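(* Let $\Omega\subset\mathbb{R}^N$, $N\ge2$, be a bounded domain, let $p>1$ and $1\le q\le p$. Let $u_0\in L^q(\Omega)\setminus\{0\}$ be nonnegative, and for $n\ge0$ let $u_{n+1}\in W_0^{1,p}(\Omega)$ be the weak solution of $$-\Delta_p u_{n+1}=\|u_n\|_q^{p-q}|u_n|^{q-2}u_n\ \text{ in }\Omega,\qquad u_{n+1}=0\ \text{ on }\partial\Omega .$$ Set $w_n:=u_n/\|u_n\|_q$ and $\lambda_n:=\left(\|u_n\|_q/\|u_{n+1}\|_q\right)^{p-1}$. Then $$\lambda_n\to\lambda_q\qquad\text{and}\qquad w_n\to e_q\ \text{ in } W_0^{1,p}(\Omega)\qquad (n\to\infty),$$ where $$\lambda_q:=\min\{\|\nabla u\|_p^p : u\in W_0^{1,p}(\Omega),\ \|u\|_q=1\}$$ and $e_q$ is the positive function in $W_0^{1,p}(\Omega)$ with $\|e_q\|_q=1$ and $\|\nabla e_q\|_p^p=\lambda_q$.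
   Context: $\|\cdot\|_r$ is the norm of $L^r(\Omega)$, $\Delta_p u:=\operatorname{div}(|\nabla u|^{p-2}\nabla u)$, and $W_0^{1,p}(\Omega)$ carries the norm $\|\nabla u\|_p$. The equation for $u_{n+1}$ is understood weakly: $\int_\Omega|\nabla u_{n+1}|^{p-2}\nabla u_{n+1}\cdot\nabla v\,dx=\|u_n\|_q^{p-q}\int_\Omega|u_n|^{q-2}u_n v\,dx$ for all $v\in W_0^{1,p}(\Omega)$, where $|t|^{q-2}t:=0$ at $t=0$. It is known (for $1\le q\le p$) that $\lambda_q$ is the first eigenvalue of the problem $-\Delta_pu=\lambda\|u\|_q^{p-q}|u|^{q-2}u$ in $\Omega$, $u=0$ on $\partial\Omega$; that it is simple (its eigenfunctions are scalar multiples of one another); and that its eigenfunctions are the only eigenfunctions of the problem that do not change sign in $\Omega$. In particular $e_q$ is well defined and unique. *)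

theory Defs
  imports "HOL-Analysis.Analysis"
begin

(* Elements of L^r and of Sobolev spaces are represented by functions on the whole space, of which
   only the restriction to Omega, up to null sets, is ever used. *)

definition Lp_space :: "real \<Rightarrow> 'a::euclidean_space set \<Rightarrow> ('a \<Rightarrow> 'b::euclidean_space) set" where
  "Lp_space r \<Omega> = {f. f \<in> borel_measurable (lebesgue_on \<Omega>) \<and>
                      integrable (lebesgue_on \<Omega>) (\<lambda>x. norm (f x) powr r)}"

(* The Bochner integral is 0 for non-integrable functions, so this is the norm only on Lp_space. *)
definition Lp_norm :: "real \<Rightarrow> 'a::euclidean_space set \<Rightarrow> ('a \<Rightarrow> 'b::euclidean_space) \<Rightarrow> real" where
  "Lp_norm r \<Omega> f = (\<integral>x. norm (f x) powr r \<partial>(lebesgue_on \<Omega>)) powr (1 / r)"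

primrec Ck :: "nat \<Rightarrow> ('a::euclidean_space \<Rightarrow> real) \<Rightarrow> bool" where
  "Ck 0 f \<longleftrightarrow> continuous_on UNIV f"
| "Ck (Suc k) f \<longleftrightarrow> f differentiable_on UNIV \<and>
                   (\<forall>b\<in>Basis. Ck k (\<lambda>x. frechet_derivative f (at x) b))"

definition test_functions :: "'a::euclidean_space set \<Rightarrow> ('a \<Rightarrow> real) set" where
  "test_functions \<Omega> = {\<phi>. (\<forall>k. Ck k \<phi>) \<and> compact (closure {x. \<phi> x \<noteq> 0}) \<and>
                            closure {x. \<phi> x \<noteq> 0} \<subseteq> \<Omega>}"

definition grad :: "('a::euclidean_space \<Rightarrow> real) \<Rightarrow> 'a \<Rightarrow> 'a" where
  "grad \<phi> x = (\<Sum>b\<in>Basis. frechet_derivative \<phi> (at x) b *\<^sub>R b)"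

definition locally_integrable :: "'a::euclidean_space set \<Rightarrow> ('a \<Rightarrow> 'b::euclidean_space) \<Rightarrow> bool" where
  "locally_integrable \<Omega> f \<longleftrightarrow> (\<forall>K. compact K \<and> K \<subseteq> \<Omega> \<longrightarrow> integrable (lebesgue_on K) f)"

definition is_weak_grad ::
    "'a::euclidean_space set \<Rightarrow> ('a \<Rightarrow> real) \<Rightarrow> ('a \<Rightarrow> 'a) \<Rightarrow> bool" where
  "is_weak_grad \<Omega> u G \<longleftrightarrow> locally_integrable \<Omega> u \<and> locally_integrable \<Omega> G \<and>
     (\<forall>\<phi>\<in>test_functions \<Omega>.
        (\<integral>x. u x *\<^sub>R grad \<phi> x \<partial>(lebesgue_on \<Omega>)) = - (\<integral>x. \<phi> x *\<^sub>R G x \<partial>(lebesgue_on \<Omega>)))"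

(* Weak gradients are unique almost everywhere; this picks a representative. *)
definition weak_grad :: "'a::euclidean_space set \<Rightarrow> ('a \<Rightarrow> real) \<Rightarrow> 'a \<Rightarrow> 'a" where
  "weak_grad \<Omega> u = (SOME G. is_weak_grad \<Omega> u G)"

definition W1p :: "'a::euclidean_space set \<Rightarrow> real \<Rightarrow> ('a \<Rightarrow> real) set" where
  "W1p \<Omega> p = {u \<in> Lp_space p \<Omega>. \<exists>G\<in>Lp_space p \<Omega>. is_weak_grad \<Omega> u G}"

(* The closure of the test functions with respect to the norm of W1p. *)
definition W01p :: "'a::euclidean_space set \<Rightarrow> real \<Rightarrow> ('a \<Rightarrow> real) set" where
  "W01p \<Omega> p = {u \<in> W1p \<Omega> p. \<exists>\<phi> :: nat \<Rightarrow> 'a \<Rightarrow> real. (\<forall>k. \<phi> k \<in> test_functions \<Omega>) \<and>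
     (\<lambda>k. Lp_norm p \<Omega> (\<lambda>x. u x - \<phi> k x)
           + Lp_norm p \<Omega> (weak_grad \<Omega> (\<lambda>x. u x - \<phi> k x))) \<longlonglongrightarrow> 0}"

definition W01p_norm :: "'a::euclidean_space set \<Rightarrow> real \<Rightarrow> ('a \<Rightarrow> real) \<Rightarrow> real" where
  "W01p_norm \<Omega> p u = Lp_norm p \<Omega> (weak_grad \<Omega> u)"

(* Finitely many terms are allowed to lie outside the space: the normalised initial datum
   of the iteration is only in L^q. *)
definition tendsto_W01p ::
    "'a::euclidean_space set \<Rightarrow> real \<Rightarrow> (nat \<Rightarrow> 'a \<Rightarrow> real) \<Rightarrow> ('a \<Rightarrow> real) \<Rightarrow> bool" where
  "tendsto_W01p \<Omega> p w e \<longleftrightarrow> e \<in> W01p \<Omega> p \<and> (\<forall>\<^sub>F n in sequentially. w n \<in> W01p \<Omega> p) \<and>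
     (\<lambda>n. W01p_norm \<Omega> p (\<lambda>x. w n x - e x)) \<longlonglongrightarrow> 0"

(* v is a weak solution of - Delta_p v = ||u||_q^(p-q) |u|^(q-2) u in Omega, v = 0 on its boundary.
   Both |G|^(p-2) G and |t|^(q-2) t evaluate to 0 at 0, as they should. *)
definition weak_solution ::
    "'a::euclidean_space set \<Rightarrow> real \<Rightarrow> real \<Rightarrow> ('a \<Rightarrow> real) \<Rightarrow> ('a \<Rightarrow> real) \<Rightarrow> bool" where
  "weak_solution \<Omega> p q u v \<longleftrightarrow> v \<in> W01p \<Omega> p \<and>
     (\<forall>\<phi>\<in>W01p \<Omega> p.
        (\<integral>x. (norm (weak_grad \<Omega> v x) powr (p - 2) *\<^sub>R weak_grad \<Omega> v x) \<bullet> weak_grad \<Omega> \<phi> x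
           \<partial>(lebesgue_on \<Omega>))
        = Lp_norm q \<Omega> u powr (p - q) *
          (\<integral>x. \<bar>u x\<bar> powr (q - 2) * u x * \<phi> x \<partial>(lebesgue_on \<Omega>)))"

(* LEAST on the reals is the minimum; it is unspecified if no minimum is attained. *)
definition lambda_q :: "'a::euclidean_space set \<Rightarrow> real \<Rightarrow> real \<Rightarrow> real" where
  "lambda_q \<Omega> p q =
     (LEAST l. l \<in> {W01p_norm \<Omega> p u powr p |u. u \<in> W01p \<Omega> p \<and> Lp_norm q \<Omega> u = 1})"

(* Unique up to null sets, so the choice only concerns the representative. *)
definition e_q :: "'a::euclidean_space set \<Rightarrow> real \<Rightarrow> real \<Rightarrow> 'a \<Rightarrow> real" where
  "e_q \<Omega> p q = (SOME e. e \<in> W01p \<Omega> p \<and> (AE x in lebesgue_on \<Omega>. e x > 0) \<and>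
                         Lp_norm q \<Omega> e = 1 \<and> W01p_norm \<Omega> p e powr p = lambda_q \<Omega> p q)"

end

(* The numbers lam n are nonincreasing and dominate the energies of w (n+1), and lam n - lam (n+1) controls
   the convexity gap of the p-energy between the gradients of w (n+1) and w (n+2), so consecutive
   iterates merge. By compactness every subsequence of w has a further one converging in W_0^{1,p} to
   some v >= 0 with norm 1 and energy at most L = lim lam.

   That v minimizes the Rayleigh quotient is not deduced from an equation for v: testing the equation of w (n+1)
   with |phi|^p / (w (n+1) + eps)^(p-1) and letting n tend to infinity gives a Picone inequality, which bounds
   L by the energy of every normalized function. Keeping the convexity gap in this inequality shows that a positive minimizer e satisfies
   grad e / e = grad v / v, so that ln e - ln v is locally constant and the sets where e > v and e <= v are
   both open up to null sets; as Omega is connected, one of them is null, and the normalization gives e = v.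
   Positivity of v comes from the same test function through a local bound for grad ln (v + eps).
   Hence all subsequential limits agree with e_q. *)
theory Submission
  imports Defs "HOL-Complex_Analysis.Great_Picard"
begin

section \<open>Spaces of functions with integrable powers\<close>

text \<open>The obstacle is the right-hand side \<open>\<bar>w n x\<bar> powr (q - 1)\<close>: for q
  = 1 it jumps where the limit vanishes, so it can be passed to the limit only once v > 0 is known.
  Hence positivity is derived with the right-hand side thrown away, using only its sign; it enters
  again when the minimality of L is proved. Little is known about the limit beyond a Sobolev
  gradient of finite energy; in particular neither e / v nor ln v is known to lie in a Sobolev
  space. Therefore integral bounds are carried in the extended nonnegative reals and passed on by
  Fatou's lemma, and constancy is read off from a double integral of |h x - h z| over a ball. The
  convexity gap replaces separate inequalities for p < 2 and p >= 2: it is homogeneous of degree p,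
  so compactness of the unit sphere serves all p > 1, and the same quantity occurs in Picone's
  identity. The minimum behind \<open>lambda_q\<close> and the function \<open>e_q\<close> also get
  their existence from the iteration: a subsequential limit is the witness for both.\<close>

definition in_Lp :: "real \<Rightarrow> 'm measure \<Rightarrow> ('m \<Rightarrow> 'b::euclidean_space) \<Rightarrow> bool" where
  "in_Lp r M f \<longleftrightarrow> f \<in> borel_measurable M \<and> integrable M (\<lambda>x. norm (f x) powr r)"

text \<open>Leaving out the r-th root keeps integrals of powers easy to add and to pass to limits.
  The price is a triangle inequality with the factor \<open>2 powr r\<close>, harmless because only
  boundedness and convergence to 0 are derived from it.\<close>

definition Lpi :: "real \<Rightarrow> 'm measure \<Rightarrow> ('m \<Rightarrow> 'b::euclidean_space) \<Rightarrow> real" where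
  "Lpi r M f = (\<integral>x. norm (f x) powr r \<partial>M)"

lemma powr_add_le:
  fixes s t r :: real
  assumes "0 \<le> s" "0 \<le> t" "0 \<le> r"
  shows "(s + t) powr r \<le> 2 powr r * (s powr r + t powr r)"
proof -
  have "(s + t) powr r \<le> (2 * max s t) powr r"
    using assms by (intro powr_mono2) auto
  also have "\<dots> = 2 powr r * max s t powr r"
    using assms by (simp add: powr_mult)
  also have "\<dots> \<le> 2 powr r * (s powr r + t powr r)"
    by (intro mult_left_mono) (auto simp: max_def)
  finally show ?thesis .
qed

lemma norm_add_powr_le:
  fixes a b :: "'b::real_normed_vector"
  assumes "0 \<le> r"
  shows "norm (a + b) powr r \<le> 2 powr r * (norm a powr r + norm b powr r)"
    and "norm (a - b) powr r \<le> 2 powr r * (norm a powr r + norm b powr r)"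
proof -
  have "norm (a + b) powr r \<le> (norm a + norm b) powr r"
    using assms by (intro powr_mono2) (auto simp: norm_triangle_ineq)
  then show "norm (a + b) powr r \<le> 2 powr r * (norm a powr r + norm b powr r)"
    using powr_add_le[of "norm a" "norm b" r] assms by simp
  have "norm (a - b) powr r \<le> (norm a + norm b) powr r"
    using assms by (intro powr_mono2) (auto simp: norm_triangle_ineq4)
  then show "norm (a - b) powr r \<le> 2 powr r * (norm a powr r + norm b powr r)"
    using powr_add_le[of "norm a" "norm b" r] assms by simp
qed

lemma powr_minus_one_mult:
  fixes s r :: real
  assumes "0 \<le> s"
  shows "s powr (r - 1) * s = s powr r"
  using assms by (cases "s = 0") (auto simp: powr_diff)

text \<open>Read as \<open>t powr r \<ge> s powr r + r * s powr (r - 1) * (t - s)\<close>: the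
  convex power lies above its tangent at s. For r > 1 it is Young's inequality with the exponents r
  / (r - 1) and r; at r = 1 the first exponent degenerates, hence the separate case.\<close>

lemma young_powr:
  fixes s t r :: real
  assumes "0 \<le> s" "0 \<le> t" "1 \<le> r"
  shows "r * s powr (r - 1) * t \<le> (r - 1) * s powr r + t powr r"
proof (cases "r = 1")
  case True
  then show ?thesis using assms by (cases "s = 0") auto
next
  case False
  with assms have r: "1 < r" by simp
  have "s powr (r - 1) * t \<le> (s powr (r - 1)) powr (r / (r - 1)) / (r / (r - 1)) + t powr r / r"
    using assms r by (intro Youngs_inequality) (auto simp: field_simps)
  also have "(s powr (r - 1)) powr (r / (r - 1)) = s powr r"
    using r by (simp add: powr_powr)
  finally have "r * (s powr (r - 1) * t) \<le> r * (s powr r / (r / (r - 1)) + t powr r / r)"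
    using r by (intro mult_left_mono) auto
  also have "\<dots> = (r - 1) * s powr r + t powr r"
    using r by (simp add: field_simps)
  finally show ?thesis by (simp add: mult.assoc)
qed

text \<open>The tangent inequality at s bounds one sign of the difference, the tangent inequality at
  t the other; the sum of the two slopes covers both.\<close>

lemma abs_powr_diff_le:
  fixes s t r :: real
  assumes "0 \<le> s" "0 \<le> t" "1 \<le> r"
  shows "\<bar>s powr r - t powr r\<bar> \<le> r * (s powr (r - 1) + t powr (r - 1)) * \<bar>s - t\<bar>"
proof -
  have *: "s powr r - t powr r \<le> r * (s powr (r - 1) + t powr (r - 1)) * \<bar>s - t\<bar>"
    if "0 \<le> s" "0 \<le> t" for s t :: real
  proof -
    have "s powr r - t powr r \<le> r * (s powr r) - r * s powr (r - 1) * t"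
      using young_powr[OF that assms(3)] by (simp add: algebra_simps)
    also have "\<dots> = r * s powr (r - 1) * (s - t)"
      using that by (subst powr_minus_one_mult[symmetric]) (auto simp: algebra_simps)
    also have "\<dots> \<le> r * s powr (r - 1) * \<bar>s - t\<bar>"
      using assms(3) by (intro mult_left_mono) auto
    also have "\<dots> \<le> r * (s powr (r - 1) + t powr (r - 1)) * \<bar>s - t\<bar>"
      using assms(3) by (intro mult_right_mono mult_left_mono) auto
    finally show ?thesis .
  qed
  show ?thesis
    using *[OF assms(1,2)] *[OF assms(2,1)] by (intro abs_leI) (simp_all add: add.commute abs_minus_commute)
qed

lemma in_Lp_measurable: "in_Lp r M f \<Longrightarrow> f \<in> borel_measurable M"
  and in_Lp_integrable: "in_Lp r M f \<Longrightarrow> integrable M (\<lambda>x. norm (f x) powr r)"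
  by (auto simp: in_Lp_def)

lemma Lpi_nonneg: "0 \<le> Lpi r M f"
  by (simp add: Lpi_def)

lemma Lpi_cong_AE:
  assumes "AE x in M. f x = g x" "f \<in> borel_measurable M" "g \<in> borel_measurable M"
  shows "Lpi r M f = Lpi r M g"
  unfolding Lpi_def using assms by (intro integral_cong_AE) auto

lemma in_Lp_cong_AE:
  assumes "AE x in M. f x = g x" "in_Lp r M f" "g \<in> borel_measurable M"
  shows "in_Lp r M g"
  unfolding in_Lp_def
proof (intro conjI)
  show "integrable M (\<lambda>x. norm (g x) powr r)"
    by (rule integrable_cong_AE_imp[OF in_Lp_integrable[OF assms(2)]]) (use assms in auto)
qed (fact assms)

lemma in_Lp_bound:
  assumes "in_Lp r M g" "f \<in> borel_measurable M" "AE x in M. norm (f x) \<le> norm (g x)" "0 \<le> r"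
  shows "in_Lp r M f"
  unfolding in_Lp_def
proof (intro conjI)
  show "integrable M (\<lambda>x. norm (f x) powr r)"
    by (rule Bochner_Integration.integrable_bound[OF in_Lp_integrable[OF assms(1)]])
       (use assms in \<open>auto intro!: powr_mono2 elim!: eventually_mono\<close>)
qed (fact assms)

lemma in_Lp_const: "finite_measure M \<Longrightarrow> in_Lp r M (\<lambda>_. c)"
  by (auto simp: in_Lp_def finite_measure.integrable_const)

lemma in_Lp_bounded:
  assumes "finite_measure M" "f \<in> borel_measurable M" "AE x in M. norm (f x) \<le> K" "0 \<le> r"
  shows "in_Lp r M f"
  by (rule in_Lp_bound[OF in_Lp_const[OF assms(1), where c = K]]) (use assms in auto)

lemma in_Lp_add:
  assumes "in_Lp r M f" "in_Lp r M g" "0 \<le> r"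
  shows "in_Lp r M (\<lambda>x. f x + g x)"
    and "Lpi r M (\<lambda>x. f x + g x) \<le> 2 powr r * (Lpi r M f + Lpi r M g)"
proof -
  note [measurable] = in_Lp_measurable[OF assms(1)] in_Lp_measurable[OF assms(2)]
  have i: "integrable M (\<lambda>x. 2 powr r * (norm (f x) powr r + norm (g x) powr r))"
    using assms by (auto simp: in_Lp_def)
  show *: "in_Lp r M (\<lambda>x. f x + g x)"
    unfolding in_Lp_def
    by (auto intro!: Bochner_Integration.integrable_bound[OF i] AE_I2 norm_add_powr_le assms)
  have "Lpi r M (\<lambda>x. f x + g x) \<le> (\<integral>x. 2 powr r * (norm (f x) powr r + norm (g x) powr r) \<partial>M)"
    unfolding Lpi_def
    by (intro integral_mono i in_Lp_integrable[OF *] norm_add_powr_le assms)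
  then show "Lpi r M (\<lambda>x. f x + g x) \<le> 2 powr r * (Lpi r M f + Lpi r M g)"
    using assms by (simp add: Lpi_def in_Lp_def)
qed

lemma in_Lp_scaleR:
  assumes "in_Lp r M f"
  shows "in_Lp r M (\<lambda>x. c *\<^sub>R f x)" and "Lpi r M (\<lambda>x. c *\<^sub>R f x) = \<bar>c\<bar> powr r * Lpi r M f"
  using assms by (auto simp: in_Lp_def Lpi_def powr_mult)

lemma in_Lp_minus:
  "in_Lp r M f \<Longrightarrow> in_Lp r M (\<lambda>x. - f x)" "Lpi r M (\<lambda>x. - f x) = Lpi r M f"
  by (auto simp: in_Lp_def Lpi_def)

lemma in_Lp_diff:
  assumes "in_Lp r M f" "in_Lp r M g" "0 \<le> r"
  shows "in_Lp r M (\<lambda>x. f x - g x)"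
    and "Lpi r M (\<lambda>x. f x - g x) \<le> 2 powr r * (Lpi r M f + Lpi r M g)"
  using in_Lp_add[OF assms(1) in_Lp_minus(1)[OF assms(2)] assms(3)] by (auto simp: in_Lp_minus(2))

lemma Lpi_diff_commute: "Lpi r M (\<lambda>x. f x - g x) = Lpi r M (\<lambda>x. g x - f x)"
  by (simp add: Lpi_def norm_minus_commute)

lemma Lpi_triangle:
  assumes "in_Lp r M f" "in_Lp r M g" "in_Lp r M h" "0 \<le> r"
  shows "Lpi r M (\<lambda>x. f x - h x) \<le> 2 powr r * (Lpi r M (\<lambda>x. f x - g x) + Lpi r M (\<lambda>x. g x - h x))"
  using in_Lp_add(2)[OF in_Lp_diff(1)[OF assms(1,2,4)] in_Lp_diff(1)[OF assms(2,3,4)] assms(4)] by simp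

lemma Lpi_eq_0_iff:
  assumes "in_Lp r M f"
  shows "Lpi r M f = 0 \<longleftrightarrow> (AE x in M. f x = 0)"
  unfolding Lpi_def
  by (subst integral_nonneg_eq_0_iff_AE[OF in_Lp_integrable[OF assms]]) auto

text \<open>Young's inequality after dividing f and g by their norms. Putting the power r - 1 on f,
  rather than using a conjugate exponent, includes r = 1 and matches the products of a flux with a
  gradient in the weak equation.\<close>

lemma Holder_integral:
  fixes f :: "'m \<Rightarrow> 'b::euclidean_space" and g :: "'m \<Rightarrow> 'c::euclidean_space"
  assumes "in_Lp r M f" "in_Lp r M g" "1 \<le> r"
  shows "integrable M (\<lambda>x. norm (f x) powr (r - 1) * norm (g x))"
    and "(\<integral>x. norm (f x) powr (r - 1) * norm (g x) \<partial>M) \<le> Lpi r M f powr (1 - 1 / r) * Lpi r M g powr (1 / r)"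
proof -
  note [measurable] = in_Lp_measurable[OF assms(1)] in_Lp_measurable[OF assms(2)]
  have i: "integrable M (\<lambda>x. ((r - 1) * norm (f x) powr r + norm (g x) powr r) / r)"
    using assms by (auto simp: in_Lp_def)
  have le: "norm (f x) powr (r - 1) * norm (g x) \<le> ((r - 1) * norm (f x) powr r + norm (g x) powr r) / r" for x
    using young_powr[of "norm (f x)" "norm (g x)" r] assms(3) by (simp add: field_simps)
  show int: "integrable M (\<lambda>x. norm (f x) powr (r - 1) * norm (g x))"
    by (rule Bochner_Integration.integrable_bound[OF i]) (use le assms(3) in auto)
  define a b where "a = Lpi r M f" and "b = Lpi r M g"
  show "(\<integral>x. norm (f x) powr (r - 1) * norm (g x) \<partial>M) \<le> Lpi r M f powr (1 - 1 / r) * Lpi r M g powr (1 / r)"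
  proof (cases "a = 0 \<or> b = 0")
    case True
    then have "AE x in M. norm (f x) powr (r - 1) * norm (g x) = 0"
      using Lpi_eq_0_iff[OF assms(1)] Lpi_eq_0_iff[OF assms(2)] by (auto simp: a_def b_def)
    then have "(\<integral>x. norm (f x) powr (r - 1) * norm (g x) \<partial>M) = 0"
      by (intro integral_eq_zero_AE)
    then show ?thesis by simp
  next
    case False
    then have ab: "0 < a" "0 < b"
      using Lpi_nonneg[of r M f] Lpi_nonneg[of r M g] by (auto simp: a_def b_def)
    define \<alpha> \<beta> where "\<alpha> = a powr (1 / r)" and "\<beta> = b powr (1 / r)"
    have pos: "0 < \<alpha>" "0 < \<beta>" and \<alpha>: "\<alpha> powr r = a" and \<beta>: "\<beta> powr r = b"
      using ab assms(3) by (auto simp: \<alpha>_def \<beta>_def powr_powr)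
    have eq: "norm (f x) powr (r - 1) * norm (g x)
        = \<alpha> powr (r - 1) * \<beta> * ((norm (f x) / \<alpha>) powr (r - 1) * (norm (g x) / \<beta>))" for x
      using pos by (simp add: powr_divide)
    have "(norm (f x) / \<alpha>) powr (r - 1) * (norm (g x) / \<beta>)
        \<le> ((r - 1) * (norm (f x) powr r / a) + norm (g x) powr r / b) / r" for x
    proof -
      have "r * (norm (f x) / \<alpha>) powr (r - 1) * (norm (g x) / \<beta>)
          \<le> (r - 1) * (norm (f x) / \<alpha>) powr r + (norm (g x) / \<beta>) powr r"
        using pos assms(3) by (intro young_powr) auto
      moreover have "(norm (f x) / \<alpha>) powr r = norm (f x) powr r / a" "(norm (g x) / \<beta>) powr r = norm (g x) powr r / b"
        using \<alpha> \<beta> pos by (auto simp: powr_divide)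
      ultimately show ?thesis
        using assms(3) by (simp add: field_simps)
    qed
    then have le2: "norm (f x) powr (r - 1) * norm (g x)
        \<le> \<alpha> powr (r - 1) * \<beta> * (((r - 1) * (norm (f x) powr r / a) + norm (g x) powr r / b) / r)" for x
      unfolding eq using pos by (intro mult_left_mono) auto
    have "(\<integral>x. norm (f x) powr (r - 1) * norm (g x) \<partial>M)
        \<le> (\<integral>x. \<alpha> powr (r - 1) * \<beta> * (((r - 1) * (norm (f x) powr r / a) + norm (g x) powr r / b) / r) \<partial>M)"
      by (intro integral_mono int le2) (use assms in \<open>auto simp: in_Lp_def\<close>)
    also have "\<dots> = \<alpha> powr (r - 1) * \<beta> * (((r - 1) * (Lpi r M f / a) + Lpi r M g / b) / r)"
      using assms by (simp add: in_Lp_def Lpi_def)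
    also have "\<dots> = \<alpha> powr (r - 1) * \<beta>"
      using ab assms(3) by (simp add: a_def[symmetric] b_def[symmetric])
    also have "\<alpha> powr (r - 1) = a powr (1 - 1 / r)"
      using assms(3) by (simp add: \<alpha>_def powr_powr field_simps)
    finally show ?thesis by (simp add: \<beta>_def a_def b_def)
  qed
qed

lemma integrable_of_in_Lp:
  assumes "finite_measure M" "in_Lp r M f" "1 \<le> r"
  shows "integrable M f"
    and "(\<integral>x. norm (f x) \<partial>M) \<le> measure M (space M) powr (1 - 1 / r) * Lpi r M f powr (1 / r)"
proof -
  note H = Holder_integral[OF in_Lp_const[OF assms(1), where c = "1::real"] assms(2,3)]
  show "integrable M f"
    using H(1) in_Lp_measurable[OF assms(2)] by (auto simp: integrable_norm_iff)
  show "(\<integral>x. norm (f x) \<partial>M) \<le> measure M (space M) powr (1 - 1 / r) * Lpi r M f powr (1 / r)"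
    using H(2) by (simp add: Lpi_def)
qed

text \<open>Jensen's inequality, obtained from Holder's inequality against the constant 1.\<close>

lemma integral_powr_le:
  assumes "finite_measure M" "in_Lp r M f" "1 \<le> r"
  shows "(\<integral>x. norm (f x) \<partial>M) powr r \<le> measure M (space M) powr (r - 1) * Lpi r M f"
proof -
  have "(\<integral>x. norm (f x) \<partial>M) powr r \<le> (measure M (space M) powr (1 - 1 / r) * Lpi r M f powr (1 / r)) powr r"
    using integrable_of_in_Lp[OF assms] assms(3) by (intro powr_mono2) auto
  also have "\<dots> = measure M (space M) powr (r - 1) * Lpi r M f"
    using assms(3) Lpi_nonneg[of r M f] by (simp add: powr_mult powr_powr left_diff_distrib)
  finally show ?thesis .
qed

text \<open>The difference of the powers is estimated pointwise by \<open>abs_powr_diff_le\<close>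
  and then by Holder's inequality, which leaves the factor \<open>d n powr (1 / r)\<close>; the
  other factors stay bounded because \<open>Lpi r M (f n)\<close> is controlled by g and
  \<open>d n\<close>.\<close>

lemma Lpi_tendsto:
  assumes "\<And>n. in_Lp r M (f n)" "in_Lp r M g" "1 \<le> r" "(\<lambda>n. Lpi r M (\<lambda>x. f n x - g x)) \<longlonglongrightarrow> 0"
  shows "(\<lambda>n. Lpi r M (f n)) \<longlonglongrightarrow> Lpi r M g"
proof -
  define d where "d n = Lpi r M (\<lambda>x. f n x - g x)" for n
  have d0: "d \<longlonglongrightarrow> 0" using assms(4) by (simp add: d_def[abs_def])
  have dn: "0 \<le> d n" for n by (simp add: d_def Lpi_nonneg)
  have D: "in_Lp r M (\<lambda>x. f n x - g x)" for n
    using assms by (intro in_Lp_diff) auto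
  define K where "K n = r * ((2 powr r * (d n + Lpi r M g)) powr (1 - 1 / r) + Lpi r M g powr (1 - 1 / r)) * d n powr (1 / r)" for n
  have K0: "K \<longlonglongrightarrow> r * ((2 powr r * (0 + Lpi r M g)) powr (1 - 1 / r) + Lpi r M g powr (1 - 1 / r)) * 0"
  proof -
    have 1: "(\<lambda>n. d n powr (1 / r)) \<longlonglongrightarrow> 0"
      using tendsto_powr2[OF d0, of "\<lambda>_. 1 / r" "1 / r"] assms(3) dn by auto
    have 2: "(\<lambda>n. (2 powr r * (d n + Lpi r M g)) powr (1 - 1 / r)) \<longlonglongrightarrow> (2 powr r * (0 + Lpi r M g)) powr (1 - 1 / r)"
      if "r \<noteq> 1"
      using assms(3) dn that Lpi_nonneg[of r M g]
      by (intro tendsto_powr2 tendsto_intros d0) (auto intro!: always_eventually)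
    show ?thesis
    \<comment> \<open>At r = 1 the exponent 1 - 1 / r is 0, and \<open>0 powr 0 = 0\<close> makes
      the power discontinuous at 0; there the factor is at most 2 and is bounded directly.\<close>
    proof (cases "r = 1")
      case True
      have "\<bar>K n\<bar> \<le> 2 * d n" for n
        using dn[of n] True by (auto simp: K_def abs_if mult_right_mono)
      moreover have "(\<lambda>n. 2 * d n) \<longlonglongrightarrow> 0" using tendsto_mult_right_zero[OF d0] by simp
      ultimately have "K \<longlonglongrightarrow> 0"
        by (intro Lim_null_comparison[of K "\<lambda>n. 2 * d n"]) (auto intro!: always_eventually)
      then show ?thesis by simp
    next
      case False
      show ?thesis unfolding K_def by (intro tendsto_intros 1 2 False)
    qed
  qed
  have "\<bar>Lpi r M (f n) - Lpi r M g\<bar> \<le> K n" for n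
  proof -
    note Hf = Holder_integral[OF assms(1)[of n] D[of n] assms(3)]
    note Hg = Holder_integral[OF assms(2) D[of n] assms(3)]
    have fb: "Lpi r M (f n) \<le> 2 powr r * (d n + Lpi r M g)"
      using in_Lp_add(2)[OF D[of n] assms(2)] assms(3) by (simp add: d_def)
    have "\<bar>Lpi r M (f n) - Lpi r M g\<bar> = \<bar>\<integral>x. norm (f n x) powr r - norm (g x) powr r \<partial>M\<bar>"
      using assms(1)[of n] assms(2) by (simp add: Lpi_def in_Lp_def)
    also have "\<dots> \<le> (\<integral>x. \<bar>norm (f n x) powr r - norm (g x) powr r\<bar> \<partial>M)"
      by (rule integral_abs_bound)
    also have "\<dots> \<le> (\<integral>x. r * (norm (f n x) powr (r - 1) * norm (f n x - g x) + norm (g x) powr (r - 1) * norm (f n x - g x)) \<partial>M)"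
    proof (intro integral_mono)
      fix x
      have "\<bar>norm (f n x) powr r - norm (g x) powr r\<bar> \<le> r * (norm (f n x) powr (r - 1) + norm (g x) powr (r - 1)) * \<bar>norm (f n x) - norm (g x)\<bar>"
        by (intro abs_powr_diff_le assms) auto
      also have "\<dots> \<le> r * (norm (f n x) powr (r - 1) + norm (g x) powr (r - 1)) * norm (f n x - g x)"
        using assms(3) by (intro mult_left_mono norm_triangle_ineq3) auto
      finally show "\<bar>norm (f n x) powr r - norm (g x) powr r\<bar> \<le> r * (norm (f n x) powr (r - 1) * norm (f n x - g x) + norm (g x) powr (r - 1) * norm (f n x - g x))"
        by (simp add: algebra_simps)
    qed (use assms(1)[of n] assms(2) Hf(1) Hg(1) in \<open>auto simp: in_Lp_def\<close>)
    also have "\<dots> = r * ((\<integral>x. norm (f n x) powr (r - 1) * norm (f n x - g x) \<partial>M) + (\<integral>x. norm (g x) powr (r - 1) * norm (f n x - g x) \<partial>M))"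
      using Hf(1) Hg(1) by simp
    also have "\<dots> \<le> r * ((2 powr r * (d n + Lpi r M g)) powr (1 - 1 / r) * d n powr (1 / r) + Lpi r M g powr (1 - 1 / r) * d n powr (1 / r))"
    proof (intro mult_left_mono add_mono)
      have "Lpi r M (f n) powr (1 - 1 / r) * d n powr (1 / r) \<le> (2 powr r * (d n + Lpi r M g)) powr (1 - 1 / r) * d n powr (1 / r)"
        using fb assms(3) Lpi_nonneg[of r M "f n"] by (intro mult_right_mono powr_mono2) auto
      then show "(\<integral>x. norm (f n x) powr (r - 1) * norm (f n x - g x) \<partial>M) \<le> (2 powr r * (d n + Lpi r M g)) powr (1 - 1 / r) * d n powr (1 / r)"
        using Hf(2) by (simp add: d_def)
    qed (use Hg(2) assms(3) in \<open>auto simp: d_def\<close>)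
    finally show ?thesis by (simp add: K_def algebra_simps)
  qed
  then have "(\<lambda>n. Lpi r M (f n) - Lpi r M g) \<longlonglongrightarrow> 0"
    using K0 by - (rule Lim_null_comparison[where f = "\<lambda>n. Lpi r M (f n) - Lpi r M g" and g = K], auto)
  then show ?thesis by (simp add: LIM_zero_iff)
qed

lemma Lp_AE_subseq:
  assumes "\<And>n. in_Lp r M (f n)" "in_Lp r M g" "0 < r" "(\<lambda>n. Lpi r M (\<lambda>x. f n x - g x)) \<longlonglongrightarrow> 0"
  obtains s :: "nat \<Rightarrow> nat" where "strict_mono s" "AE x in M. (\<lambda>n. f (s n) x) \<longlonglongrightarrow> g x"
proof -
  have D: "in_Lp r M (\<lambda>x. f n x - g x)" for n
    using assms by (intro in_Lp_diff) auto
  obtain s :: "nat \<Rightarrow> nat" where s: "strict_mono s" "AE x in M. (\<lambda>n. norm (f (s n) x - g x) powr r) \<longlonglongrightarrow> 0"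
    using tendsto_L1_AE_subseq[of M "\<lambda>n x. norm (f n x - g x) powr r"] D assms(4)
    by (auto simp: in_Lp_def Lpi_def)
  have "AE x in M. (\<lambda>n. f (s n) x) \<longlonglongrightarrow> g x"
    using s(2)
  proof eventually_elim
    fix x assume "(\<lambda>n. norm (f (s n) x - g x) powr r) \<longlonglongrightarrow> 0"
    then have "(\<lambda>n. (norm (f (s n) x - g x) powr r) powr (1 / r)) \<longlonglongrightarrow> 0"
      using tendsto_powr2[of "\<lambda>n. norm (f (s n) x - g x) powr r" 0 sequentially "\<lambda>_. 1 / r" "1 / r"] assms(3) by auto
    then have "(\<lambda>n. norm (f (s n) x - g x)) \<longlonglongrightarrow> 0"
      using assms(3) by (simp add: powr_powr)
    then show "(\<lambda>n. f (s n) x) \<longlonglongrightarrow> g x"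
      by (simp add: tendsto_norm_zero_iff LIM_zero_iff)
  qed
  with s(1) show ?thesis by (rule that)
qed

lemma Lp_dominated_convergence:
  assumes "\<And>n. f n \<in> borel_measurable M" "g \<in> borel_measurable M" "in_Lp r M h" "0 < r"
    and "AE x in M. (\<lambda>n. f n x) \<longlonglongrightarrow> g x" "\<And>n. AE x in M. norm (f n x) \<le> norm (h x)"
  shows "in_Lp r M g" and "(\<lambda>n. Lpi r M (\<lambda>x. f n x - g x)) \<longlonglongrightarrow> 0"
proof -
  note [measurable] = assms(1,2) in_Lp_measurable[OF assms(3)]
  have gb: "AE x in M. norm (g x) \<le> norm (h x)"
  proof -
    have "AE x in M. \<forall>n. norm (f n x) \<le> norm (h x)"
      using assms(6) by (simp add: AE_all_countable)
    with assms(5) show ?thesis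
      by eventually_elim (rule LIMSEQ_le_const2[OF tendsto_norm], auto)
  qed
  show "in_Lp r M g"
    using assms(4) by (intro in_Lp_bound[OF assms(3) assms(2) gb]) auto
  have "(\<lambda>n. \<integral>x. norm (f n x - g x) powr r \<partial>M) \<longlonglongrightarrow> (\<integral>x. 0 \<partial>M)"
  proof (rule integral_dominated_convergence[where w = "\<lambda>x. 2 powr r * (norm (h x) powr r + norm (h x) powr r)"])
    show "AE x in M. (\<lambda>n. norm (f n x - g x) powr r) \<longlonglongrightarrow> 0"
      using assms(5)
    proof eventually_elim
      fix x assume "(\<lambda>n. f n x) \<longlonglongrightarrow> g x"
      then have "(\<lambda>n. norm (f n x - g x)) \<longlonglongrightarrow> 0"
        by (simp add: tendsto_norm_zero_iff LIM_zero_iff)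
      then show "(\<lambda>n. norm (f n x - g x) powr r) \<longlonglongrightarrow> 0"
        using tendsto_powr2[of "\<lambda>n. norm (f n x - g x)" 0 sequentially "\<lambda>_. r" r] assms(4) by auto
    qed
    show "AE x in M. norm (norm (f n x - g x) powr r) \<le> 2 powr r * (norm (h x) powr r + norm (h x) powr r)" for n
      using assms(6)[of n] gb
    proof eventually_elim
      fix x assume *: "norm (f n x) \<le> norm (h x)" "norm (g x) \<le> norm (h x)"
      have "norm (f n x - g x) powr r \<le> 2 powr r * (norm (f n x) powr r + norm (g x) powr r)"
        using assms(4) by (intro norm_add_powr_le) auto
      also have "\<dots> \<le> 2 powr r * (norm (h x) powr r + norm (h x) powr r)"
        using * assms(4) by (intro mult_left_mono add_mono powr_mono2) auto
      finally show "norm (norm (f n x - g x) powr r) \<le> 2 powr r * (norm (h x) powr r + norm (h x) powr r)" by simp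
    qed
  qed (use in_Lp_integrable[OF assms(3)] in auto)
  then show "(\<lambda>n. Lpi r M (\<lambda>x. f n x - g x)) \<longlonglongrightarrow> 0" by (simp add: Lpi_def)
qed

lemma in_Lp_exponent_mono:
  assumes "finite_measure M" "in_Lp r M f" "0 \<le> q" "q \<le> r"
  shows "in_Lp q M f"
  unfolding in_Lp_def
proof (intro conjI)
  interpret finite_measure M by fact
  note [measurable] = in_Lp_measurable[OF assms(2)]
  show "f \<in> borel_measurable M" by measurable
  have i: "integrable M (\<lambda>x. 1 + norm (f x) powr r)"
    using assms(2) by (auto simp: in_Lp_def)
  have "norm (f x) powr q \<le> 1 + norm (f x) powr r" for x
  proof (cases "norm (f x) \<le> 1")
    case True
    then have "norm (f x) powr q \<le> 1" using assms(3) by (simp add: powr_le1)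
    then show ?thesis using powr_ge_zero[of "norm (f x)" r] by linarith
  next
    case False
    then have "norm (f x) powr q \<le> norm (f x) powr r" using assms(4) by (intro powr_mono) auto
    then show ?thesis by simp
  qed
  then show "integrable M (\<lambda>x. norm (f x) powr q)"
    by (intro Bochner_Integration.integrable_bound[OF i]) (auto intro!: AE_I2)
qed

text \<open>Holder's inequality with exponent r / q for the functions |f n|^q on a space of finite
  measure.\<close>

lemma Lpi_tendsto_0_exponent_mono:
  assumes "finite_measure M" "\<And>n. in_Lp r M (f n)" "0 < q" "q \<le> r" "(\<lambda>n. Lpi r M (f n)) \<longlonglongrightarrow> 0"
  shows "(\<lambda>n. Lpi q M (f n)) \<longlonglongrightarrow> 0"
proof -
  interpret finite_measure M by fact
  have rq: "1 \<le> r / q" using assms by (simp add: field_simps)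
  have iq: "in_Lp q M (f n)" for n
    using assms by (intro in_Lp_exponent_mono[OF assms(1,2)]) auto
  have L: "in_Lp (r / q) M (\<lambda>x. norm (f n x) powr q)"
    and E: "Lpi (r / q) M (\<lambda>x. norm (f n x) powr q) = Lpi r M (f n)" for n
    using assms(2)[of n] iq[of n] assms(3) by (auto simp: in_Lp_def Lpi_def powr_powr)
  have b: "Lpi q M (f n) \<le> measure M (space M) powr (1 - 1 / (r / q)) * Lpi r M (f n) powr (1 / (r / q))" for n
    using integrable_of_in_Lp(2)[OF assms(1) L rq, of n] unfolding E by (simp add: Lpi_def)
  have "(\<lambda>n. measure M (space M) powr (1 - 1 / (r / q)) * Lpi r M (f n) powr (1 / (r / q))) \<longlonglongrightarrow> measure M (space M) powr (1 - 1 / (r / q)) * 0 powr (1 / (r / q))"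
    using assms by (intro tendsto_mult_left tendsto_powr2[OF assms(5) tendsto_const]) (simp_all add: Lpi_nonneg)
  then have "(\<lambda>n. measure M (space M) powr (1 - 1 / (r / q)) * Lpi r M (f n) powr (1 / (r / q))) \<longlonglongrightarrow> 0"
    by simp
  then show ?thesis
    by (rule Lim_null_comparison[rotated]) (simp add: Lpi_nonneg b always_eventually del: divide_divide_eq_right)
qed

section \<open>Test functions\<close>

lemma Ck_SucD: "Ck (Suc k) f \<Longrightarrow> Ck k f"
proof (induction k arbitrary: f)
  case 0
  then show ?case by (auto intro: differentiable_imp_continuous_on)
next
  case (Suc k)
  then show ?case by (metis Ck.simps(2))
qed

lemma Ck_const: "Ck k (\<lambda>x. c)"
  by (induction k arbitrary: c) auto

lemma Ck_has_derivative:
  "Ck (Suc k) f \<Longrightarrow> (f has_derivative frechet_derivative f (at x)) (at x)"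
  by (auto simp: differentiable_on_def frechet_derivative_works[symmetric])

lemma Ck_SucI:
  assumes "\<And>x. (f has_derivative D x) (at x)" "\<And>b. b \<in> Basis \<Longrightarrow> Ck k (\<lambda>x. D x b)"
  shows "Ck (Suc k) f"
proof -
  have "frechet_derivative f (at x) = D x" for x
    using frechet_derivative_at[OF assms(1)] by simp
  moreover have "f differentiable_on UNIV"
    using differentiableI[OF assms(1)] by (simp add: differentiable_on_def)
  ultimately show ?thesis
    using assms(2) by simp
qed

lemma Ck_bounded_linear:
  assumes "bounded_linear f"
  shows "Ck k f"
proof (cases k)
  case 0
  then show ?thesis using assms by (auto intro: linear_continuous_on)
next
  case (Suc m)
  have d: "(f has_derivative f) (at x)" for x
    using assms by (rule bounded_linear.has_derivative) (rule has_derivative_ident)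
  show ?thesis
    unfolding Suc by (rule Ck_SucI[OF d]) (rule Ck_const)
qed

lemma Ck_add: "Ck k f \<Longrightarrow> Ck k g \<Longrightarrow> Ck k (\<lambda>x. f x + g x)"
proof (induction k arbitrary: f g)
  case 0
  then show ?case by (auto intro: continuous_on_add)
next
  case (Suc k)
  show ?case
    by (rule Ck_SucI[OF has_derivative_add[OF Ck_has_derivative[OF Suc.prems(1)] Ck_has_derivative[OF Suc.prems(2)]]])
       (use Suc in auto)
qed

lemma Ck_mult: "Ck k f \<Longrightarrow> Ck k g \<Longrightarrow> Ck k (\<lambda>x. f x * g x)"
proof (induction k arbitrary: f g)
  case 0
  then show ?case by (auto intro: continuous_on_mult)
next
  case (Suc k)
  show ?case
    by (rule Ck_SucI[OF has_derivative_mult[OF Ck_has_derivative[OF Suc.prems(1)] Ck_has_derivative[OF Suc.prems(2)]]])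
       (use Suc Ck_SucD[OF Suc.prems(1)] Ck_SucD[OF Suc.prems(2)] in \<open>auto intro!: Ck_add\<close>)
qed

lemma Ck_real_polynomial_function: "real_polynomial_function P \<Longrightarrow> Ck k P"
  by (induction rule: real_polynomial_function.induct) (auto intro: Ck_bounded_linear Ck_const Ck_add Ck_mult)

text \<open>Polynomial outer functions keep test functions smooth;
  \<open>sobolev0_test_product\<close> reaches \<open>C\<^sup>1\<close> outer functions by
  approximating them with polynomials. A bounded linear g on the reals is multiplication by
  \<open>g 1\<close>.\<close>

lemma Ck_real_polynomial_comp: "real_polynomial_function P \<Longrightarrow> Ck k f \<Longrightarrow> Ck k (\<lambda>x. P (f x))"
proof (induction rule: real_polynomial_function.induct)
  case (linear g)
  then interpret bounded_linear g by simp
  have "g (f x) = f x * g 1" for x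
    using scaleR[of "f x" 1] by simp
  then have "(\<lambda>x. g (f x)) = (\<lambda>x. f x * g 1)" by (rule ext)
  then show ?case by (metis Ck_mult[OF linear.prems Ck_const])
qed (auto intro: Ck_const Ck_add Ck_mult)

text \<open>By the recursion \<open>flat_exp_deriv\<close> this family is closed under differentiation up to linear combinations.\<close>

definition flat_exp :: "nat \<Rightarrow> real \<Rightarrow> real" where
  "flat_exp m t = (if 0 < t then exp (- 1 / t) / t ^ m else 0)"

lemma flat_exp_tendsto_0: "(flat_exp m \<longlongrightarrow> 0) (at 0)"
proof -
  have "((\<lambda>x::real. x ^ m / exp x) \<longlongrightarrow> 0) at_top"
    by (rule tendsto_power_div_exp_0)
  then have "((\<lambda>t::real. inverse t ^ m / exp (inverse t)) \<longlongrightarrow> 0) (at_right 0)"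
    by (rule filterlim_compose[OF _ filterlim_inverse_at_top_right])
  moreover have "\<forall>\<^sub>F t in at_right 0. inverse t ^ m / exp (inverse t) = flat_exp m t"
    by (rule eventually_at_right_less[THEN eventually_mono])
       (auto simp: flat_exp_def exp_minus field_simps)
  ultimately have r: "(flat_exp m \<longlongrightarrow> 0) (at_right 0)"
    by (rule Lim_transform_eventually)
  have "\<forall>\<^sub>F t in at_left 0. 0 = flat_exp m t"
    by (auto simp: eventually_at_left_field flat_exp_def intro!: exI[of _ "-1"])
  then have "(flat_exp m \<longlongrightarrow> 0) (at_left 0)"
    by (rule Lim_transform_eventually[OF tendsto_const])
  with r show ?thesis by (simp add: filterlim_split_at)
qed

lemma flat_exp_deriv:
  "(flat_exp m has_real_derivative flat_exp (m + 2) t - real m * flat_exp (m + 1) t) (at t)"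
proof -
  consider "0 < t" | "t < 0" | "t = 0" by linarith
  then show ?thesis
  proof cases
    case 1
    have "((\<lambda>t. exp (- 1 / t) / t ^ m) has_real_derivative flat_exp (m + 2) t - real m * flat_exp (m + 1) t) (at t)"
    proof (cases m)
      case 0
      then show ?thesis using 1
        by (auto simp: flat_exp_def intro!: derivative_eq_intros simp: power2_eq_square)
    next
      case (Suc k)
      then show ?thesis using 1
        by (auto simp: flat_exp_def intro!: derivative_eq_intros) (cases k; simp add: field_simps power2_eq_square)
    qed
    then show ?thesis
      by (rule has_field_derivative_transform_within_open[of _ _ _ "{0<..}"]) (use 1 in \<open>auto simp: flat_exp_def\<close>)
  next
    case 2
    have "((\<lambda>t. 0) has_real_derivative 0) (at t)" by simp
    then have "(flat_exp m has_real_derivative 0) (at t)"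
      by (rule has_field_derivative_transform_within_open[of _ _ _ "{..<0}"]) (use 2 in \<open>auto simp: flat_exp_def\<close>)
    then show ?thesis using 2 by (simp add: flat_exp_def)
  next
    case 3
    \<comment> \<open>The difference quotient at 0 stays in the family, so its limit is already
      known.\<close>
    have "flat_exp m h / h = flat_exp (m + 1) h" if "h \<noteq> 0" for h
      using that by (simp add: flat_exp_def)
    then have "((\<lambda>h. (flat_exp m (0 + h) - flat_exp m 0) / h) \<longlongrightarrow> 0) (at 0)"
      using flat_exp_tendsto_0[of "m + 1"]
      by (subst tendsto_cong[where g = "flat_exp (m + 1)"]) (auto simp: eventually_at_filter flat_exp_def)
    then show ?thesis
      using 3 by (simp add: DERIV_def flat_exp_def)
  qed
qed

lemma Ck_flat_exp_comp:
  assumes s: "\<And>k. Ck k s"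
  shows "Ck k (\<lambda>x. flat_exp m (s x))"
proof (induction k arbitrary: m)
  case 0
  have "continuous_on UNIV (flat_exp m)"
    using flat_exp_deriv by (intro DERIV_continuous_on) (auto intro: has_field_derivative_at_within)
  then show ?case
    using s[of 0] by (auto intro: continuous_on_compose2)
next
  case (Suc k)
  have d: "((\<lambda>x. flat_exp m (s x)) has_derivative
      (\<lambda>h. (flat_exp (m + 2) (s x) + (- real m) * flat_exp (m + 1) (s x)) * frechet_derivative s (at x) h)) (at x)" for x
    using has_derivative_compose[OF Ck_has_derivative[OF s] flat_exp_deriv[of m "s x", unfolded has_field_derivative_def]]
    by simp
  show ?case
    by (rule Ck_SucI[OF d]) (intro Ck_mult Ck_add Ck_const Suc, use s[of "Suc k"] in auto)
qed

section \<open>Bump functions and the space of test functions\<close>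

text \<open>The squared distance is subtracted from the squared radius because this keeps the inner
  function a polynomial in x; the profile \<open>flat_exp 0\<close> supplies the smooth transition
  to 0 at the boundary of the ball.\<close>

definition bump :: "'a::euclidean_space \<Rightarrow> real \<Rightarrow> 'a \<Rightarrow> real" where
  "bump c r x = flat_exp 0 (r\<^sup>2 - (x - c) \<bullet> (x - c))"

lemma Ck_bump: "Ck k (bump c r)"
proof -
  have l: "real_polynomial_function (\<lambda>x::'a. (x - c) \<bullet> b)" for b
    unfolding inner_diff_left
    by (intro real_polynomial_function_diff real_polynomial_function.intros(1,2) bounded_linear_inner_left)
  have "real_polynomial_function (\<lambda>x::'a. r\<^sup>2 - (\<Sum>b\<in>Basis. ((x - c) \<bullet> b) * ((x - c) \<bullet> b)))"
    by (intro real_polynomial_function_diff real_polynomial_function_sum real_polynomial_function.intros(2,4) l finite_Basis)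
  then have "real_polynomial_function (\<lambda>x::'a. r\<^sup>2 - (x - c) \<bullet> (x - c))"
    by (simp only: euclidean_inner[symmetric])
  then show ?thesis
    unfolding bump_def[abs_def] by (intro Ck_flat_exp_comp Ck_real_polynomial_function)
qed

lemma bump_eq: "bump c r x = (if dist c x < \<bar>r\<bar> then exp (- 1 / (r\<^sup>2 - (dist c x)\<^sup>2)) else 0)"
proof -
  have "(x - c) \<bullet> (x - c) = (dist c x)\<^sup>2"
    by (simp only: dist_norm norm_minus_commute[of c x] power2_norm_eq_inner)
  moreover have "0 < r\<^sup>2 - (dist c x)\<^sup>2 \<longleftrightarrow> dist c x < \<bar>r\<bar>"
    using abs_le_square_iff[of r "dist c x"] by (auto simp: abs_if not_le[symmetric])
  ultimately show ?thesis by (simp add: bump_def flat_exp_def)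
qed

lemma bump_pos: "dist c x < r \<Longrightarrow> 0 < bump c r x"
  and bump_zero: "0 \<le> r \<Longrightarrow> r \<le> dist c x \<Longrightarrow> bump c r x = 0"
  and bump_nonneg: "0 \<le> bump c r x"
  and bump_le_1: "bump c r x \<le> 1"
proof -
  show "bump c r x \<le> 1"
  proof -
    have "- 1 / (r\<^sup>2 - (dist c x)\<^sup>2) \<le> 0" if "dist c x < \<bar>r\<bar>"
    proof -
      have "(dist c x)\<^sup>2 \<le> \<bar>r\<bar>\<^sup>2" using that by (intro power_mono) auto
      then show ?thesis by simp
    qed
    then show ?thesis by (simp add: bump_eq)
  qed
qed (auto simp: bump_eq)

lemma test_functionI:
  assumes "\<And>k. Ck k \<phi>" "compact K" "K \<subseteq> \<Omega>" "\<And>x. x \<notin> K \<Longrightarrow> \<phi> x = 0"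
  shows "\<phi> \<in> test_functions \<Omega>"
proof -
  have "closure {x. \<phi> x \<noteq> 0} \<subseteq> K"
    using assms by (intro closure_minimal) (auto simp: compact_imp_closed)
  moreover then have "compact (closure {x. \<phi> x \<noteq> 0})"
    using assms(2) by (metis closed_closure compact_Int_closed inf.absorb2)
  ultimately show ?thesis
    using assms by (auto simp: test_functions_def)
qed

lemma test_functionE:
  assumes "\<phi> \<in> test_functions \<Omega>"
  obtains K where "compact K" "K \<subseteq> \<Omega>" "\<And>x. x \<notin> K \<Longrightarrow> \<phi> x = 0"
proof (rule that[of "closure {x. \<phi> x \<noteq> 0}"])
  show "\<phi> x = 0" if "x \<notin> closure {x. \<phi> x \<noteq> 0}" for x
    using that closure_subset[of "{x. \<phi> x \<noteq> 0}"] by auto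
qed (use assms in \<open>simp_all add: test_functions_def\<close>)

lemma test_function_Ck: "\<phi> \<in> test_functions \<Omega> \<Longrightarrow> Ck k \<phi>"
  by (simp add: test_functions_def)

lemma test_function_zero_outside: "\<phi> \<in> test_functions \<Omega> \<Longrightarrow> x \<notin> \<Omega> \<Longrightarrow> \<phi> x = 0"
  by (metis subsetD test_functionE)

lemma bump_test_function: "cball c r \<subseteq> \<Omega> \<Longrightarrow> 0 \<le> r \<Longrightarrow> bump c r \<in> test_functions \<Omega>"
  by (rule test_functionI[OF Ck_bump compact_cball]) (auto intro: bump_zero)

lemma test_function_0: "(\<lambda>x. 0) \<in> test_functions \<Omega>"
  by (rule test_functionI[of _ "{}"]) (auto intro: Ck_const)

lemma test_function_add:
  assumes "\<phi> \<in> test_functions \<Omega>" "\<psi> \<in> test_functions \<Omega>"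
  shows "(\<lambda>x. \<phi> x + \<psi> x) \<in> test_functions \<Omega>"
proof -
  obtain K where "compact K" "K \<subseteq> \<Omega>" "\<And>x. x \<notin> K \<Longrightarrow> \<phi> x = 0"
    by (rule test_functionE[OF assms(1)]) blast
  moreover obtain L where "compact L" "L \<subseteq> \<Omega>" "\<And>x. x \<notin> L \<Longrightarrow> \<psi> x = 0"
    by (rule test_functionE[OF assms(2)]) blast
  ultimately show ?thesis
    by (intro test_functionI[of _ "K \<union> L"]) (auto intro!: Ck_add test_function_Ck[OF assms(1)] test_function_Ck[OF assms(2)])
qed

lemma test_function_mult_Ck:
  assumes "\<phi> \<in> test_functions \<Omega>" "\<And>k. Ck k f"
  shows "(\<lambda>x. \<phi> x * f x) \<in> test_functions \<Omega>"
proof -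
  obtain K where "compact K" "K \<subseteq> \<Omega>" "\<And>x. x \<notin> K \<Longrightarrow> \<phi> x = 0"
    by (rule test_functionE[OF assms(1)]) blast
  then show ?thesis
    by (intro test_functionI[of _ K]) (auto intro!: Ck_mult assms(2) test_function_Ck[OF assms(1)])
qed

lemma test_function_scale: "\<phi> \<in> test_functions \<Omega> \<Longrightarrow> (\<lambda>x. c * \<phi> x) \<in> test_functions \<Omega>"
  using test_function_mult_Ck[of \<phi> \<Omega> "\<lambda>_. c"] by (simp add: Ck_const mult.commute)

section \<open>Functions with continuous gradient, and integration by parts\<close>

text \<open>The gradient is a parameter, so that the sum, product and chain rules produce explicit
  vector fields; \<open>C1_grad_eq\<close> identifies it with \<open>grad\<close>.\<close>

definition C1 :: "('a::euclidean_space \<Rightarrow> real) \<Rightarrow> ('a \<Rightarrow> 'a) \<Rightarrow> bool" where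
  "C1 f g \<longleftrightarrow> continuous_on UNIV g \<and> (\<forall>x. (f has_derivative (\<lambda>h. g x \<bullet> h)) (at x))"

lemma C1_D: "C1 f g \<Longrightarrow> (f has_derivative (\<lambda>h. g x \<bullet> h)) (at x)"
  and C1_continuous_grad: "C1 f g \<Longrightarrow> continuous_on UNIV g"
  by (auto simp: C1_def)

lemma C1_continuous: "C1 f g \<Longrightarrow> continuous_on UNIV f"
  by (meson C1_D continuous_at_imp_continuous_on has_derivative_continuous)

lemma C1_grad_eq: "C1 f g \<Longrightarrow> grad f x = g x"
  unfolding grad_def frechet_derivative_at[OF C1_D, symmetric] by (rule euclidean_representation)

lemma Ck_C1:
  assumes "Ck (Suc 0) f"
  shows "C1 f (grad f)"
  unfolding C1_def
proof (intro conjI allI)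
  show "continuous_on UNIV (grad f)"
    unfolding grad_def[abs_def] using assms by (intro continuous_intros) auto
  fix x
  have d: "(f has_derivative frechet_derivative f (at x)) (at x)"
    using assms by (rule Ck_has_derivative)
  interpret bounded_linear "frechet_derivative f (at x)"
    using d by (rule has_derivative_bounded_linear)
  have "frechet_derivative f (at x) h = grad f x \<bullet> h" for h
  proof -
    have "frechet_derivative f (at x) h = frechet_derivative f (at x) (\<Sum>b\<in>Basis. (h \<bullet> b) *\<^sub>R b)"
      by (simp add: euclidean_representation)
    also have "\<dots> = grad f x \<bullet> h"
      by (simp add: sum scaleR grad_def inner_sum_left inner_commute[of h] mult.commute)
    finally show ?thesis .
  qed
  with d show "(f has_derivative (\<lambda>h. grad f x \<bullet> h)) (at x)"
    by (metis (no_types, lifting) ext)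
qed

lemma test_function_C1: "\<phi> \<in> test_functions \<Omega> \<Longrightarrow> C1 \<phi> (grad \<phi>)"
  by (intro Ck_C1 test_function_Ck)

lemma C1_add: "C1 f f' \<Longrightarrow> C1 g g' \<Longrightarrow> C1 (\<lambda>x. f x + g x) (\<lambda>x. f' x + g' x)"
  and C1_diff: "C1 f f' \<Longrightarrow> C1 g g' \<Longrightarrow> C1 (\<lambda>x. f x - g x) (\<lambda>x. f' x - g' x)"
  unfolding C1_def inner_add_left inner_diff_left
  by (simp_all add: continuous_on_add continuous_on_diff has_derivative_add has_derivative_diff)

lemma C1_mult:
  assumes "C1 f f'" "C1 g g'"
  shows "C1 (\<lambda>x. f x * g x) (\<lambda>x. f x *\<^sub>R g' x + g x *\<^sub>R f' x)"
  unfolding C1_def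
proof (intro conjI allI)
  show "continuous_on UNIV (\<lambda>x. f x *\<^sub>R g' x + g x *\<^sub>R f' x)"
    using assms by (intro continuous_intros C1_continuous C1_continuous_grad)
  show "((\<lambda>x. f x * g x) has_derivative (\<lambda>h. (f x *\<^sub>R g' x + g x *\<^sub>R f' x) \<bullet> h)) (at x)" for x
    using has_derivative_mult[OF C1_D[OF assms(1)] C1_D[OF assms(2)], of x]
    by (simp add: inner_add_left mult.commute)
qed

lemma C1_scale: "C1 f f' \<Longrightarrow> C1 (\<lambda>x. c * f x) (\<lambda>x. c *\<^sub>R f' x)"
  using C1_mult[of "\<lambda>_. c" "\<lambda>_. 0" f f'] by (auto simp: C1_def)

lemma C1_comp:
  assumes "C1 f f'" "\<And>t. (F has_real_derivative F' t) (at t)" "continuous_on UNIV F'"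
  shows "C1 (\<lambda>x. F (f x)) (\<lambda>x. F' (f x) *\<^sub>R f' x)"
  unfolding C1_def
proof (intro conjI allI)
  show "continuous_on UNIV (\<lambda>x. F' (f x) *\<^sub>R f' x)"
    using assms C1_continuous[OF assms(1)]
    by (intro continuous_intros C1_continuous_grad continuous_on_compose2[OF assms(3)]) auto
  show "((\<lambda>x. F (f x)) has_derivative (\<lambda>h. (F' (f x) *\<^sub>R f' x) \<bullet> h)) (at x)" for x
    using has_derivative_compose[OF C1_D[OF assms(1), of x] assms(2)[of "f x", unfolded has_field_derivative_def]]
    by simp
qed

lemma C1_zero_grad:
  assumes "C1 f g" "closed K" "\<And>x. x \<notin> K \<Longrightarrow> f x = 0" "x \<notin> K"
  shows "g x = 0"
proof -
  have "((\<lambda>x. 0) has_derivative (\<lambda>h. 0)) (at x)" by simp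
  then have "(f has_derivative (\<lambda>h. 0)) (at x)"
    by (rule has_derivative_transform_within_open[of _ _ _ _ "- K"]) (use assms in auto)
  then have "(\<lambda>h. g x \<bullet> h) = (\<lambda>h. 0)"
    using C1_D[OF assms(1)] by (intro has_derivative_unique)
  then show ?thesis by (metis inner_eq_zero_iff)
qed

lemma test_function_grad_zero_outside:
  assumes "\<phi> \<in> test_functions \<Omega>" "x \<notin> \<Omega>"
  shows "grad \<phi> x = 0"
proof -
  obtain K where "compact K" "K \<subseteq> \<Omega>" "\<And>x. x \<notin> K \<Longrightarrow> \<phi> x = 0"
    by (rule test_functionE[OF assms(1)]) blast
  then show ?thesis
    using C1_zero_grad[OF test_function_C1[OF assms(1)], of K x] assms(2) by (auto simp: compact_imp_closed)
qed

lemma integrable_compact_support: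
  fixes f :: "'a::euclidean_space \<Rightarrow> 'b::euclidean_space"
  assumes "continuous_on UNIV f" "compact K" "\<And>x. x \<notin> K \<Longrightarrow> f x = 0"
  shows "integrable lborel f"
proof -
  have "integrable lborel (\<lambda>x. indicator K x *\<^sub>R f x)"
    by (rule borel_integrable_compact) (use assms in \<open>auto intro: continuous_on_subset\<close>)
  also have "(\<lambda>x. indicator K x *\<^sub>R f x) = f"
    using assms(3) by (auto simp: indicator_def)
  finally show ?thesis .
qed

lemma lborel_integral_translate:
  fixes f :: "'a::euclidean_space \<Rightarrow> 'b::euclidean_space"
  assumes "f \<in> borel_measurable borel"
  shows "(\<integral>x. f (x + y) \<partial>lborel) = (\<integral>x. f x \<partial>lborel)"
    and "integrable lborel f \<Longrightarrow> integrable lborel (\<lambda>x. f (x + y))"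
proof -
  show "(\<integral>x. f (x + y) \<partial>lborel) = (\<integral>x. f x \<partial>lborel)"
    by (subst (2) lborel_distr_plus[symmetric, of y], subst integral_distr) (use assms in \<open>auto simp: add.commute\<close>)
  assume "integrable lborel f"
  then have "integrable (distr lborel borel ((+) y)) f" by (simp add: lborel_distr_plus)
  then show "integrable lborel (\<lambda>x. f (x + y))"
    by (subst (asm) integrable_distr_eq) (use assms in \<open>auto simp: add.commute\<close>)
qed

lemma C1_compact_support_bounds:
  assumes "C1 f g" "compact K" "\<And>x. x \<notin> K \<Longrightarrow> f x = 0"
  obtains B where "0 \<le> B" "\<And>x. norm (g x) \<le> B" "\<And>x y. \<bar>f x - f y\<bar> \<le> B * norm (x - y)" "\<And>x. \<bar>f x\<bar> \<le> B"
proof -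
  have g0: "x \<notin> K \<Longrightarrow> g x = 0" for x
    using C1_zero_grad[OF assms(1) compact_imp_closed[OF assms(2)] assms(3)] by blast
  have "bounded (g ` K)" "bounded (f ` K)"
    using assms(2) continuous_on_subset[OF C1_continuous_grad[OF assms(1)], of K] continuous_on_subset[OF C1_continuous[OF assms(1)], of K]
    by (auto intro!: compact_imp_bounded compact_continuous_image)
  then obtain B1 B2 where B: "\<And>x. x \<in> K \<Longrightarrow> norm (g x) \<le> B1" "\<And>x. x \<in> K \<Longrightarrow> norm (f x) \<le> B2"
    unfolding bounded_iff by blast
  define B where "B = max 0 (max B1 B2)"
  have gB: "norm (g x) \<le> B" and fB: "\<bar>f x\<bar> \<le> B" for x
    using B[of x] g0[of x] assms(3)[of x] by (cases "x \<in> K"; auto simp: B_def)+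
  have "\<bar>f x - f y\<bar> \<le> B * norm (x - y)" for x y
  proof -
    have "norm (f x - f y) \<le> B * norm (x - y)"
    proof (rule differentiable_bound[of UNIV f "\<lambda>x h. g x \<bullet> h"])
      show "onorm (\<lambda>h. g x \<bullet> h) \<le> B" for x
      proof (rule onorm_bound)
        show "0 \<le> B" by (simp add: B_def)
        show "norm (g x \<bullet> h) \<le> B * norm h" for h
          using Cauchy_Schwarz_ineq2[of "g x" h] mult_right_mono[OF gB[of x], of "norm h"] by simp
      qed
    qed (use assms(1) in \<open>auto intro: C1_D\<close>)
    then show ?thesis by simp
  qed
  with gB fB show ?thesis by (intro that[of B]) (auto simp: B_def)
qed

text \<open>Translation invariance of Lebesgue measure makes every difference quotient in a
  direction y integrate to 0, and dominated convergence carries this over to the directional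
  derivative.\<close>

lemma integral_grad_compact_support:
  fixes f :: "'a::euclidean_space \<Rightarrow> real"
  assumes f: "C1 f g" and K: "compact K" "\<And>x. x \<notin> K \<Longrightarrow> f x = 0"
  shows "integrable lborel g" "(\<integral>x. g x \<partial>lborel) = 0"
proof -
  have g0: "x \<notin> K \<Longrightarrow> g x = 0" for x
    using C1_zero_grad[OF f compact_imp_closed[OF K(1)] K(2)] by blast
  show int: "integrable lborel g"
    by (rule integrable_compact_support[OF C1_continuous_grad[OF f] K(1) g0])
  obtain B where B: "0 \<le> B" "\<And>x. norm (g x) \<le> B" "\<And>x y. \<bar>f x - f y\<bar> \<le> B * norm (x - y)" "\<And>x. \<bar>f x\<bar> \<le> B"
    by (rule C1_compact_support_bounds[OF f K]) blast+
  have intf: "integrable lborel f"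
    by (rule integrable_compact_support[OF C1_continuous[OF f] K])
  have fm[measurable]: "f \<in> borel_measurable borel"
    by (rule borel_measurable_continuous_onI[OF C1_continuous[OF f]])
  have gm[measurable]: "g \<in> borel_measurable borel"
    by (rule borel_measurable_continuous_onI[OF C1_continuous_grad[OF f]])
  obtain R where R: "\<And>x. x \<in> K \<Longrightarrow> norm x \<le> R"
    using compact_imp_bounded[OF K(1)] by (auto simp: bounded_iff)
  have "(\<integral>x. g x \<partial>lborel) \<bullet> y = 0" for y
  proof -
    define t :: "nat \<Rightarrow> real" where "t n = inverse (real (Suc n))" for n
    have t: "0 < t n" "t n \<le> 1" for n by (auto simp: t_def field_simps)
    have t0: "t \<longlonglongrightarrow> 0" unfolding t_def[abs_def] by (rule LIMSEQ_inverse_real_of_nat)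
    define q where "q n x = (f (x + t n *\<^sub>R y) - f x) / t n" for n x
    have "(\<lambda>n. \<integral>x. q n x \<partial>lborel) \<longlonglongrightarrow> (\<integral>x. g x \<bullet> y \<partial>lborel)"
    \<comment> \<open>K lies in the ball of radius R and the steps \<open>t n\<close> are at most 1,
      so all shifted supports lie in the ball of radius R + |y|; the Lipschitz constant B bounds the
      quotients by B |y|.\<close>
    proof (rule integral_dominated_convergence[where w = "\<lambda>x. indicator (cball 0 (R + norm y)) x *\<^sub>R (B * norm y)"])
      show "integrable lborel (\<lambda>x::'a. indicator (cball 0 (R + norm y)) x *\<^sub>R (B * norm y))"
        by (rule borel_integrable_compact) auto
      show "AE x in lborel. (\<lambda>n. q n x) \<longlonglongrightarrow> g x \<bullet> y"
      proof (rule AE_I2)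
        fix x
        have "((\<lambda>s. f (x + s *\<^sub>R y)) has_derivative (\<lambda>s. g (x + 0 *\<^sub>R y) \<bullet> (s *\<^sub>R y))) (at 0)"
          by (rule has_derivative_compose[where f = "\<lambda>s. x + s *\<^sub>R y" and f' = "\<lambda>s. s *\<^sub>R y", OF _ C1_D[OF f]])
             (auto intro!: derivative_eq_intros)
        then have "((\<lambda>s. f (x + s *\<^sub>R y)) has_real_derivative g x \<bullet> y) (at 0)"
          by (simp add: has_field_derivative_def mult.commute[of _ "g x \<bullet> y"] mult_commute_abs)
        then have "((\<lambda>h. (f (x + h *\<^sub>R y) - f x) / h) \<longlongrightarrow> g x \<bullet> y) (at 0)"
          by (simp add: DERIV_def)
        then show "(\<lambda>n. q n x) \<longlonglongrightarrow> g x \<bullet> y"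
          unfolding q_def
          by (rule filterlim_compose) (use t t0 in \<open>auto simp: filterlim_at less_imp_neq[THEN not_sym] eventually_sequentially\<close>)
      qed
      show "AE x in lborel. norm (q n x) \<le> indicator (cball 0 (R + norm y)) x *\<^sub>R (B * norm y)" for n
      proof (rule AE_I2)
        fix x
        have "\<bar>f (x + t n *\<^sub>R y) - f x\<bar> \<le> B * norm y * t n"
          using B(3)[of "x + t n *\<^sub>R y" x] t(1)[of n] by (simp add: algebra_simps)
        then have 1: "\<bar>q n x\<bar> \<le> B * norm y"
          using t(1)[of n] by (simp add: q_def field_simps)
        have 2: "q n x = 0" if "x \<notin> cball 0 (R + norm y)"
        proof -
          have n: "R + norm y < norm x" using that by simp
          then have "x \<notin> K" using R[of x] norm_ge_zero[of y] by linarith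
          moreover have "x + t n *\<^sub>R y \<notin> K"
          proof
            assume "x + t n *\<^sub>R y \<in> K"
            then have "norm (x + t n *\<^sub>R y) \<le> R" by (rule R)
            moreover have "norm x \<le> norm (x + t n *\<^sub>R y) + norm (t n *\<^sub>R y)"
              using norm_triangle_ineq4[of "x + t n *\<^sub>R y" "t n *\<^sub>R y"] by simp
            moreover have "norm (t n *\<^sub>R y) \<le> norm y"
              using t[of n] by (simp add: mult_left_le_one_le)
            ultimately show False using n by linarith
          qed
          ultimately show ?thesis by (simp add: q_def K(2))
        qed
        from 1 2 show "norm (q n x) \<le> indicator (cball 0 (R + norm y)) x *\<^sub>R (B * norm y)"
          by (cases "x \<in> cball 0 (R + norm y)") (simp_all del: mem_cball)
      qed
    qed (auto simp: q_def)
    moreover have "(\<integral>x. q n x \<partial>lborel) = 0" for n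
    proof -
      have "(\<integral>x. q n x \<partial>lborel) = ((\<integral>x. f (x + t n *\<^sub>R y) \<partial>lborel) - (\<integral>x. f x \<partial>lborel)) / t n"
        unfolding q_def using lborel_integral_translate(2)[OF fm intf] intf by simp
      also have "\<dots> = 0" using lborel_integral_translate(1)[OF fm] by simp
      finally show ?thesis .
    qed
    ultimately have "(\<integral>x. g x \<bullet> y \<partial>lborel) = 0"
      by (simp add: LIMSEQ_const_iff)
    then show ?thesis using int by simp
  qed
  then show "(\<integral>x. g x \<partial>lborel) = 0" by (metis inner_eq_zero_iff)
qed

lemma integral_lebesgue_on_eq_lborel:
  fixes f :: "'a::euclidean_space \<Rightarrow> 'b::euclidean_space"
  assumes "f \<in> borel_measurable borel" "\<Omega> \<in> sets lebesgue" "\<And>x. x \<notin> \<Omega> \<Longrightarrow> f x = 0"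
  shows "(\<integral>x. f x \<partial>lebesgue_on \<Omega>) = (\<integral>x. f x \<partial>lborel)"
    and "integrable (lebesgue_on \<Omega>) f \<longleftrightarrow> integrable lborel f"
proof -
  have e: "(\<lambda>x. indicator \<Omega> x *\<^sub>R f x) = f"
    using assms(3) by (auto simp: indicator_def)
  show "(\<integral>x. f x \<partial>lebesgue_on \<Omega>) = (\<integral>x. f x \<partial>lborel)"
    using assms by (simp add: integral_restrict_space e integral_completion)
  show "integrable (lebesgue_on \<Omega>) f \<longleftrightarrow> integrable lborel f"
    using assms by (simp add: integrable_restrict_space e integrable_completion)
qed

text \<open>The product of \<phi> and \<psi> inherits the compact support of \<phi>, so its gradient
  integrates to 0; the two summands of the product rule are the two sides.\<close>

lemma test_function_parts:
  fixes \<phi> \<psi> :: "'a::euclidean_space \<Rightarrow> real"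
  assumes "\<phi> \<in> test_functions \<Omega>" "C1 \<psi> \<psi>'" "\<Omega> \<in> sets lebesgue"
  shows "(\<integral>x. \<psi> x *\<^sub>R grad \<phi> x \<partial>lebesgue_on \<Omega>) = - (\<integral>x. \<phi> x *\<^sub>R \<psi>' x \<partial>lebesgue_on \<Omega>)"
proof -
  obtain K where K: "compact K" "K \<subseteq> \<Omega>" "\<And>x. x \<notin> K \<Longrightarrow> \<phi> x = 0"
    by (rule test_functionE[OF assms(1)]) blast
  note C = test_function_C1[OF assms(1)]
  have g0: "x \<notin> K \<Longrightarrow> grad \<phi> x = 0" for x
    using C1_zero_grad[OF C compact_imp_closed[OF K(1)] K(3)] by blast
  have i1: "continuous_on UNIV (\<lambda>x. \<psi> x *\<^sub>R grad \<phi> x)" and i2: "continuous_on UNIV (\<lambda>x. \<phi> x *\<^sub>R \<psi>' x)"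
    using C1_continuous[OF C] C1_continuous_grad[OF C] C1_continuous[OF assms(2)] C1_continuous_grad[OF assms(2)]
    by (auto intro!: continuous_intros)
  have "(\<integral>x. \<phi> x *\<^sub>R \<psi>' x + \<psi> x *\<^sub>R grad \<phi> x \<partial>lborel) = 0"
    by (rule integral_grad_compact_support(2)[OF C1_mult[OF C assms(2)] K(1)]) (use K(3) in auto)
  moreover have "integrable lborel (\<lambda>x. \<phi> x *\<^sub>R \<psi>' x)" "integrable lborel (\<lambda>x. \<psi> x *\<^sub>R grad \<phi> x)"
    by (rule integrable_compact_support[OF i2 K(1)], use K(3) in auto)
       (rule integrable_compact_support[OF i1 K(1)], use g0 in auto)
  ultimately have "(\<integral>x. \<psi> x *\<^sub>R grad \<phi> x \<partial>lborel) = - (\<integral>x. \<phi> x *\<^sub>R \<psi>' x \<partial>lborel)"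
    by (simp add: eq_neg_iff_add_eq_0 add.commute)
  moreover have "(\<integral>x. \<psi> x *\<^sub>R grad \<phi> x \<partial>lebesgue_on \<Omega>) = (\<integral>x. \<psi> x *\<^sub>R grad \<phi> x \<partial>lborel)"
    by (rule integral_lebesgue_on_eq_lborel(1)[OF borel_measurable_continuous_onI[OF i1] assms(3)])
       (use g0 K(2) in auto)
  moreover have "(\<integral>x. \<phi> x *\<^sub>R \<psi>' x \<partial>lebesgue_on \<Omega>) = (\<integral>x. \<phi> x *\<^sub>R \<psi>' x \<partial>lborel)"
    by (rule integral_lebesgue_on_eq_lborel(1)[OF borel_measurable_continuous_onI[OF i2] assms(3)])
       (use K in auto)
  ultimately show ?thesis by simp
qed

section \<open>Weak gradients\<close>

lemma integrable_lebesgue_on_subset: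
  fixes f :: "'a::euclidean_space \<Rightarrow> 'b::euclidean_space"
  assumes "integrable (lebesgue_on A) f" "A \<in> sets lebesgue" "B \<in> sets lebesgue" "B \<subseteq> A"
  shows "integrable (lebesgue_on B) f"
proof -
  have "integrable lebesgue (\<lambda>x. indicator A x *\<^sub>R f x)"
    using assms by (simp add: integrable_restrict_space)
  then have "integrable lebesgue (\<lambda>x. indicator B x *\<^sub>R (indicator A x *\<^sub>R f x))"
    by (rule integrable_mult_indicator[OF assms(3)])
  also have "(\<lambda>x. indicator B x *\<^sub>R (indicator A x *\<^sub>R f x)) = (\<lambda>x. indicator B x *\<^sub>R f x)"
    using assms(4) by (auto simp: fun_eq_iff split: split_indicator)
  finally show ?thesis
    using assms by (simp add: integrable_restrict_space)
qed

lemma lebesgue_on_support: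
  fixes f :: "'a::euclidean_space \<Rightarrow> 'b::euclidean_space"
  assumes "A \<in> sets lebesgue" "B \<in> sets lebesgue" "B \<subseteq> A" "\<And>x. x \<notin> B \<Longrightarrow> f x = 0"
  shows "(\<integral>x. f x \<partial>lebesgue_on A) = (\<integral>x. f x \<partial>lebesgue_on B)"
    and "integrable (lebesgue_on A) f \<longleftrightarrow> integrable (lebesgue_on B) f"
proof -
  have e: "(\<lambda>x. indicator A x *\<^sub>R f x) = (\<lambda>x. indicator B x *\<^sub>R f x)"
    using assms(3,4) by (auto simp: fun_eq_iff split: split_indicator)
  show "(\<integral>x. f x \<partial>lebesgue_on A) = (\<integral>x. f x \<partial>lebesgue_on B)"
    using assms(1,2) by (simp add: integral_restrict_space e)
  show "integrable (lebesgue_on A) f \<longleftrightarrow> integrable (lebesgue_on B) f"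
    using assms(1,2) by (simp add: integrable_restrict_space e)
qed

lemma borel_measurable_lebesgue_onI:
  fixes f :: "'a::euclidean_space \<Rightarrow> 'b::euclidean_space"
  shows "f \<in> borel_measurable borel \<Longrightarrow> f \<in> borel_measurable (lebesgue_on A)"
  by (intro measurable_restrict_space1 measurable_completion) simp

lemma continuous_borel_measurable_lebesgue_on:
  fixes f :: "'a::euclidean_space \<Rightarrow> 'b::euclidean_space"
  shows "continuous_on UNIV f \<Longrightarrow> f \<in> borel_measurable (lebesgue_on A)"
  by (intro borel_measurable_lebesgue_onI borel_measurable_continuous_onI)

lemma AE_lebesgue_on_iff:
  fixes A :: "'a::euclidean_space set"
  assumes "A \<in> sets lebesgue"
  shows "(AE x in lebesgue_on A. P x) \<longleftrightarrow> negligible {x\<in>A. \<not> P x}"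
proof -
  have "(AE x in lebesgue_on A. P x) \<longleftrightarrow> (AE x in lebesgue. x \<in> A \<longrightarrow> P x)"
    using assms by (simp add: AE_restrict_space_iff)
  also have "\<dots> \<longleftrightarrow> {x \<in> space lebesgue. \<not> (x \<in> A \<longrightarrow> P x)} \<in> null_sets lebesgue"
    by (rule completion.AE_iff_null_sets)
  also have "{x \<in> space lebesgue. \<not> (x \<in> A \<longrightarrow> P x)} = {x\<in>A. \<not> P x}" by auto
  finally show ?thesis by (simp add: negligible_iff_null_sets)
qed

lemma AE_lebesgue_on_mono:
  fixes A :: "'a::euclidean_space set"
  assumes "AE x in lebesgue_on A. P x" "B \<subseteq> A" "A \<in> sets lebesgue" "B \<in> sets lebesgue"
  shows "AE x in lebesgue_on B. P x"
  using assms by (auto simp: AE_lebesgue_on_iff intro: negligible_subset)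

text \<open>Null sets can be recognised locally, by the Lindelof property behind
  \<open>locally_negligible_alt\<close>. This is what allows almost everywhere statements to be
  proved on balls.\<close>

lemma AE_lebesgue_on_local:
  fixes A :: "'a::euclidean_space set"
  assumes "A \<in> sets lebesgue"
    and "\<And>c. c \<in> A \<Longrightarrow> \<exists>r>0. AE x in lebesgue_on (A \<inter> ball c r). P x"
  shows "AE x in lebesgue_on A. P x"
  unfolding AE_lebesgue_on_iff[OF assms(1)]
proof (subst locally_negligible_alt, rule ballI)
  fix c assume c: "c \<in> {x\<in>A. \<not> P x}"
  then obtain r where r: "0 < r" "AE x in lebesgue_on (A \<inter> ball c r). P x"
    using assms(2)[of c] by blast
  have "negligible {x \<in> A \<inter> ball c r. \<not> P x}"
    using r(2) assms(1) by (subst AE_lebesgue_on_iff[symmetric]) auto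
  moreover have "{x \<in> A \<inter> ball c r. \<not> P x} = {x\<in>A. \<not> P x} \<inter> ball c r" by auto
  ultimately show "\<exists>U. openin (top_of_set {x\<in>A. \<not> P x}) U \<and> c \<in> U \<and> negligible U"
    using c r(1) by (intro exI[of _ "{x\<in>A. \<not> P x} \<inter> ball c r"]) (auto simp: openin_open_Int)
qed

lemma locally_integrable_times_test:
  fixes G :: "'a::euclidean_space \<Rightarrow> 'b::euclidean_space"
  assumes "locally_integrable \<Omega> G" "\<Omega> \<in> sets lebesgue" "compact K" "K \<subseteq> \<Omega>"
    and "continuous_on UNIV \<phi>" "\<And>x. x \<notin> K \<Longrightarrow> \<phi> x = 0"
  shows "integrable (lebesgue_on \<Omega>) (\<lambda>x. \<phi> x *\<^sub>R G x)"
proof -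
  have K: "K \<in> sets lebesgue" using assms(3) by (simp add: lmeasurable_compact fmeasurableD)
  have G: "integrable (lebesgue_on K) G"
    using assms by (auto simp: locally_integrable_def)
  have "bounded (\<phi> ` K)"
    using assms by (intro compact_imp_bounded compact_continuous_image) (auto intro: continuous_on_subset)
  then obtain B where B: "\<And>x. x \<in> K \<Longrightarrow> \<bar>\<phi> x\<bar> \<le> B"
    by (auto simp: bounded_iff)
  have "integrable (lebesgue_on K) (\<lambda>x. \<phi> x *\<^sub>R G x)"
  proof (rule Bochner_Integration.integrable_bound)
    show "integrable (lebesgue_on K) (\<lambda>x. B *\<^sub>R G x)" using G by simp
    show "(\<lambda>x. \<phi> x *\<^sub>R G x) \<in> borel_measurable (lebesgue_on K)"
      using continuous_borel_measurable_lebesgue_on[OF assms(5)] G by (intro borel_measurable_scaleR) auto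
    show "AE x in lebesgue_on K. norm (\<phi> x *\<^sub>R G x) \<le> norm (B *\<^sub>R G x)"
      using B by (intro AE_I2) (auto intro!: mult_right_mono order_trans[OF B])
  qed
  then show ?thesis
    by (subst lebesgue_on_support(2)[OF assms(2) K assms(4)]) (use assms in auto)
qed

text \<open>The fundamental lemma of the calculus of variations. A bump times a polynomial is a test
  function; Stone-Weierstrass extends the vanishing to a bump times any continuous h on the ball;
  finally h runs through continuous approximations of the sign of g, which leaves the integral of
  the bump times |g|.\<close>

lemma integral_test_functions_zero_imp_AE_zero:
  fixes g :: "'a::euclidean_space \<Rightarrow> real"
  assumes "open \<Omega>" and g: "locally_integrable \<Omega> g"
    and zero: "\<And>\<phi>. \<phi> \<in> test_functions \<Omega> \<Longrightarrow> (\<integral>x. \<phi> x * g x \<partial>lebesgue_on \<Omega>) = 0"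
  shows "AE x in lebesgue_on \<Omega>. g x = 0"
proof (rule AE_lebesgue_on_local)
  show \<Omega>: "\<Omega> \<in> sets lebesgue" using assms(1) by (simp add: borel_open)
  fix c assume "c \<in> \<Omega>"
  then obtain r where r: "0 < r" "cball c r \<subseteq> \<Omega>"
    using \<open>open \<Omega>\<close> open_contains_cball by blast
  define K where "K = cball c r"
  have K: "compact K" "K \<subseteq> \<Omega>" "K \<in> sets lebesgue"
    using r by (auto simp: K_def lmeasurable_compact fmeasurableD)
  have gK: "integrable (lebesgue_on K) g"
    using g K by (auto simp: locally_integrable_def)
  have b0: "x \<notin> K \<Longrightarrow> bump c r x = 0" for x
    using r by (auto simp: K_def intro: bump_zero)
  have bm: "bump c r \<in> borel_measurable (lebesgue_on K)"
    by (rule continuous_borel_measurable_lebesgue_on) (metis Ck.simps(1) Ck_bump)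
  have int: "integrable (lebesgue_on K) (\<lambda>x. h x * (bump c r x * g x))"
    if "h \<in> borel_measurable (lebesgue_on K)" "\<And>x. x \<in> K \<Longrightarrow> \<bar>h x\<bar> \<le> B" for h B
  proof (rule Bochner_Integration.integrable_bound)
    show "integrable (lebesgue_on K) (\<lambda>x. B *\<^sub>R g x)" using gK by simp
    show "AE x in lebesgue_on K. norm (h x * (bump c r x * g x)) \<le> norm (B *\<^sub>R g x)"
    proof (rule AE_I2)
      fix x assume "x \<in> space (lebesgue_on K)"
      then have "\<bar>h x\<bar> * (bump c r x * \<bar>g x\<bar>) \<le> \<bar>B\<bar> * (1 * \<bar>g x\<bar>)"
        using that(2)[of x] bump_nonneg[of c r x] bump_le_1[of c r x]
        by (intro mult_mono mult_right_mono) auto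
      then show "norm (h x * (bump c r x * g x)) \<le> norm (B *\<^sub>R g x)"
        using bump_nonneg[of c r x] by (simp add: abs_mult)
    qed
  qed (use that(1) bm gK in auto)
  have cont_zero: "(\<integral>x. h x * (bump c r x * g x) \<partial>lebesgue_on K) = 0" if h: "continuous_on UNIV h" for h
  proof -
    have hm: "h \<in> borel_measurable (lebesgue_on K)"
      by (rule continuous_borel_measurable_lebesgue_on[OF h])
    have "bounded (h ` K)"
      using K(1) h by (intro compact_imp_bounded compact_continuous_image) (auto intro: continuous_on_subset)
    then obtain B where B: "\<And>x. x \<in> K \<Longrightarrow> \<bar>h x\<bar> \<le> B" by (auto simp: bounded_iff)
    have "\<bar>\<integral>x. h x * (bump c r x * g x) \<partial>lebesgue_on K\<bar> \<le> e * (\<integral>x. \<bar>g x\<bar> \<partial>lebesgue_on K)" if "0 < e" for e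
    proof -
      obtain P where P: "real_polynomial_function P" "\<And>x. x \<in> K \<Longrightarrow> \<bar>h x - P x\<bar> < e"
        using Stone_Weierstrass_real_polynomial_function[OF K(1) _ \<open>0 < e\<close>, of h] h continuous_on_subset by blast
      have Pc: "continuous_on UNIV P" using Ck_real_polynomial_function[OF P(1), of 0] by simp
      have Pm: "P \<in> borel_measurable (lebesgue_on K)"
        by (rule continuous_borel_measurable_lebesgue_on[OF Pc])
      have PB: "\<bar>P x\<bar> \<le> B + e" if "x \<in> K" for x using P(2)[OF that] B[OF that] by linarith
      have "(\<lambda>x. bump c r x * P x) \<in> test_functions \<Omega>"
        using r by (intro test_function_mult_Ck bump_test_function Ck_real_polynomial_function P(1)) auto
      then have "(\<integral>x. (bump c r x * P x) * g x \<partial>lebesgue_on \<Omega>) = 0" by (rule zero)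
      also have "(\<integral>x. (bump c r x * P x) * g x \<partial>lebesgue_on \<Omega>) = (\<integral>x. (bump c r x * P x) * g x \<partial>lebesgue_on K)"
        by (rule lebesgue_on_support(1)[OF \<Omega> K(3,2)]) (simp add: b0)
      finally have "(\<integral>x. P x * (bump c r x * g x) \<partial>lebesgue_on K) = 0" by (simp add: ac_simps)
      then have "\<bar>\<integral>x. h x * (bump c r x * g x) \<partial>lebesgue_on K\<bar> = \<bar>\<integral>x. h x * (bump c r x * g x) - P x * (bump c r x * g x) \<partial>lebesgue_on K\<bar>"
        using int[OF hm B] int[OF Pm PB] by simp
      also have "\<dots> \<le> (\<integral>x. \<bar>h x * (bump c r x * g x) - P x * (bump c r x * g x)\<bar> \<partial>lebesgue_on K)"
        by (rule integral_abs_bound)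
      also have "\<dots> \<le> (\<integral>x. e * \<bar>g x\<bar> \<partial>lebesgue_on K)"
      proof (rule integral_mono)
        fix x assume "x \<in> space (lebesgue_on K)"
        then have "\<bar>h x - P x\<bar> * (bump c r x * \<bar>g x\<bar>) \<le> e * (1 * \<bar>g x\<bar>)"
          using P(2)[of x] bump_nonneg[of c r x] bump_le_1[of c r x] \<open>0 < e\<close>
          by (intro mult_mono mult_right_mono) auto
        moreover have "\<bar>h x * (bump c r x * g x) - P x * (bump c r x * g x)\<bar> = \<bar>h x - P x\<bar> * (bump c r x * \<bar>g x\<bar>)"
          using bump_nonneg[of c r x] by (simp add: left_diff_distrib[symmetric] abs_mult)
        ultimately show "\<bar>h x * (bump c r x * g x) - P x * (bump c r x * g x)\<bar> \<le> e * \<bar>g x\<bar>" by simp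
      qed (use gK int[OF hm B] int[OF Pm PB] in auto)
      finally show ?thesis using gK by simp
    qed
    note le = this
    have "\<bar>\<integral>x. h x * (bump c r x * g x) \<partial>lebesgue_on K\<bar> \<le> 0"
    proof (rule field_le_epsilon)
      fix d :: real assume d: "0 < d"
      define I where "I = (\<integral>x. \<bar>g x\<bar> \<partial>lebesgue_on K)"
      have I: "0 \<le> I" by (simp add: I_def)
      have "0 < d / (I + 1)" using d I by simp
      from le[OF this] have "\<bar>\<integral>x. h x * (bump c r x * g x) \<partial>lebesgue_on K\<bar> \<le> (d / (I + 1)) * I"
        by (simp only: I_def)
      also have "\<dots> \<le> d" using d I by (simp add: field_simps)
      finally show "\<bar>\<integral>x. h x * (bump c r x * g x) \<partial>lebesgue_on K\<bar> \<le> 0 + d" by simp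
    qed
    then show ?thesis by simp
  qed
  have gm: "g \<in> borel_measurable (lebesgue_on K)" using gK by auto
  have "(\<lambda>x. sgn (g x)) \<in> borel_measurable (lebesgue_on K)" using gm by measurable
  then have "(\<lambda>x. sgn (g x)) measurable_on K"
    by (simp add: measurable_on_iff_borel_measurable[OF K(3)])
  then obtain N s where N: "negligible N" and s: "\<And>n. continuous_on UNIV (s n)"
    and lim: "\<And>x. x \<notin> N \<Longrightarrow> (\<lambda>n. s n x) \<longlonglongrightarrow> (if x \<in> K then sgn (g x) else 0)"
    unfolding measurable_on_def by blast
  \<comment> \<open>Clipping to [-1, 1] leaves the limit \<open>sgn (g x)\<close> unchanged and
    makes |g| a dominating function.\<close>
  define t where "t n x = max (-1) (min 1 (s n x))" for n :: nat and x
  have tc: "continuous_on UNIV (t n)" for n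
    unfolding t_def[abs_def] using s by (intro continuous_intros)
  have tb: "\<bar>t n x\<bar> \<le> 1" for n x by (auto simp: t_def)
  have tm: "t n \<in> borel_measurable (lebesgue_on K)" for n
    by (rule continuous_borel_measurable_lebesgue_on[OF tc])
  have aeN: "AE x in lebesgue_on K. x \<notin> N"
    unfolding AE_lebesgue_on_iff[OF K(3)] by (rule negligible_subset[OF N]) auto
  have "(\<lambda>n. \<integral>x. t n x * (bump c r x * g x) \<partial>lebesgue_on K) \<longlonglongrightarrow> (\<integral>x. bump c r x * \<bar>g x\<bar> \<partial>lebesgue_on K)"
  proof (rule integral_dominated_convergence[where w = "\<lambda>x. \<bar>g x\<bar>"])
    show "AE x in lebesgue_on K. (\<lambda>n. t n x * (bump c r x * g x)) \<longlonglongrightarrow> bump c r x * \<bar>g x\<bar>"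
      using aeN AE_space
    proof eventually_elim
      fix x assume x: "x \<notin> N" "x \<in> space (lebesgue_on K)"
      then have "(\<lambda>n. s n x) \<longlonglongrightarrow> sgn (g x)" using lim[of x] by simp
      then have "(\<lambda>n. t n x) \<longlonglongrightarrow> max (-1) (min 1 (sgn (g x)))"
        unfolding t_def by (intro tendsto_max tendsto_min tendsto_const)
      also have "max (-1) (min 1 (sgn (g x))) = sgn (g x)" by (auto simp: sgn_if)
      finally have "(\<lambda>n. t n x * (bump c r x * g x)) \<longlonglongrightarrow> sgn (g x) * (bump c r x * g x)"
        by (rule tendsto_mult_right)
      then show "(\<lambda>n. t n x * (bump c r x * g x)) \<longlonglongrightarrow> bump c r x * \<bar>g x\<bar>"
        by (simp add: abs_sgn mult_ac)
    qed
    show "AE x in lebesgue_on K. norm (t n x * (bump c r x * g x)) \<le> \<bar>g x\<bar>" for n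
    proof (rule AE_I2)
      fix x
      have "\<bar>t n x\<bar> * (bump c r x * \<bar>g x\<bar>) \<le> 1 * (1 * \<bar>g x\<bar>)"
        using tb bump_nonneg[of c r x] bump_le_1[of c r x] by (intro mult_mono mult_right_mono) auto
      then show "norm (t n x * (bump c r x * g x)) \<le> \<bar>g x\<bar>"
        using bump_nonneg[of c r x] by (simp add: abs_mult)
    qed
  qed (use gK gm bm tm in auto)
  then have "(\<integral>x. bump c r x * \<bar>g x\<bar> \<partial>lebesgue_on K) = 0"
    using cont_zero[OF tc] by (simp add: LIMSEQ_const_iff)
  moreover have "integrable (lebesgue_on K) (\<lambda>x. bump c r x * \<bar>g x\<bar>)"
  proof (rule Bochner_Integration.integrable_bound[OF gK])
    show "AE x in lebesgue_on K. norm (bump c r x * \<bar>g x\<bar>) \<le> norm (g x)"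
      using bump_nonneg[of c r] bump_le_1[of c r] by (intro AE_I2) (simp add: abs_mult mult_left_le_one_le)
  qed (use gm bm in auto)
  ultimately have "AE x in lebesgue_on K. bump c r x * \<bar>g x\<bar> = 0"
    using bump_nonneg[of c r] by (subst (asm) integral_nonneg_eq_0_iff_AE) auto
  then have "AE x in lebesgue_on (\<Omega> \<inter> ball c r). bump c r x * \<bar>g x\<bar> = 0"
    by (rule AE_lebesgue_on_mono) (use \<Omega> K(3) in \<open>auto simp: K_def\<close>)
  moreover have "AE x in lebesgue_on (\<Omega> \<inter> ball c r). x \<in> ball c r"
    using AE_space by eventually_elim simp
  ultimately have "AE x in lebesgue_on (\<Omega> \<inter> ball c r). g x = 0"
  proof eventually_elim
    fix x assume "bump c r x * \<bar>g x\<bar> = 0" "x \<in> ball c r"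
    then show "g x = 0" using bump_pos[of c x r] by auto
  qed
  with r(1) show "\<exists>r>0. AE x in lebesgue_on (\<Omega> \<inter> ball c r). g x = 0" by blast
qed

lemma weak_grad_unique:
  fixes \<Omega> :: "'a::euclidean_space set"
  assumes "open \<Omega>" "is_weak_grad \<Omega> u G" "is_weak_grad \<Omega> u H"
  shows "AE x in lebesgue_on \<Omega>. G x = H x"
proof -
  have \<Omega>: "\<Omega> \<in> sets lebesgue" using assms(1) by (simp add: borel_open)
  have "AE x in lebesgue_on \<Omega>. (G x - H x) \<bullet> b = 0" for b :: 'a
  proof (rule integral_test_functions_zero_imp_AE_zero[OF assms(1)])
    show "locally_integrable \<Omega> (\<lambda>x. (G x - H x) \<bullet> b)"
      using assms(2,3) unfolding is_weak_grad_def locally_integrable_def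
      by (auto intro!: integrable_inner_left Bochner_Integration.integrable_diff)
    fix \<phi> assume \<phi>: "\<phi> \<in> test_functions \<Omega>"
    obtain K where K: "compact K" "K \<subseteq> \<Omega>" "\<And>x. x \<notin> K \<Longrightarrow> \<phi> x = 0"
      by (rule test_functionE[OF \<phi>]) blast
    have c: "continuous_on UNIV \<phi>" by (rule C1_continuous[OF test_function_C1[OF \<phi>]])
    have i: "integrable (lebesgue_on \<Omega>) (\<lambda>x. \<phi> x *\<^sub>R G x)" "integrable (lebesgue_on \<Omega>) (\<lambda>x. \<phi> x *\<^sub>R H x)"
      by (rule locally_integrable_times_test[OF _ \<Omega> K(1,2) c K(3)], use assms in \<open>auto simp: is_weak_grad_def\<close>)+
    have "(\<integral>x. \<phi> x *\<^sub>R G x \<partial>lebesgue_on \<Omega>) = (\<integral>x. \<phi> x *\<^sub>R H x \<partial>lebesgue_on \<Omega>)"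
      using assms(2,3) \<phi> unfolding is_weak_grad_def by (metis neg_equal_iff_equal)
    then have "((\<integral>x. \<phi> x *\<^sub>R G x \<partial>lebesgue_on \<Omega>) - (\<integral>x. \<phi> x *\<^sub>R H x \<partial>lebesgue_on \<Omega>)) \<bullet> b = 0" by simp
    also have "((\<integral>x. \<phi> x *\<^sub>R G x \<partial>lebesgue_on \<Omega>) - (\<integral>x. \<phi> x *\<^sub>R H x \<partial>lebesgue_on \<Omega>)) \<bullet> b
      = (\<integral>x. (\<phi> x *\<^sub>R G x - \<phi> x *\<^sub>R H x) \<bullet> b \<partial>lebesgue_on \<Omega>)"
      using i by simp
    also have "\<dots> = (\<integral>x. \<phi> x * ((G x - H x) \<bullet> b) \<partial>lebesgue_on \<Omega>)"
      by (simp add: scaleR_diff_right[symmetric])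
    finally show "(\<integral>x. \<phi> x * ((G x - H x) \<bullet> b) \<partial>lebesgue_on \<Omega>) = 0" .
  qed
  then have ae: "AE x in lebesgue_on \<Omega>. \<forall>b\<in>Basis. (G x - H x) \<bullet> b = 0"
    by (simp only: AE_ball_countable[OF countable_finite[OF finite_Basis]]) simp
  have "G x = H x" if "\<forall>b\<in>Basis. (G x - H x) \<bullet> b = 0" for x
  proof (rule euclidean_eqI)
    fix b :: 'a assume "b \<in> Basis"
    with that have "(G x - H x) \<bullet> b = 0" by blast
    then show "G x \<bullet> b = H x \<bullet> b" by (simp only: inner_diff_left right_minus_eq)
  qed
  then show ?thesis by (rule eventually_mono[OF ae])
qed

text \<open>The gradient is an argument here, so that limits and compositions need not speak about the representative
  that \<^const>\<open>weak_grad\<close> happens to choose.\<close>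

definition sobolev0 :: "'a::euclidean_space set \<Rightarrow> real \<Rightarrow> ('a \<Rightarrow> real) \<Rightarrow> ('a \<Rightarrow> 'a) \<Rightarrow> bool" where
  "sobolev0 \<Omega> p u G \<longleftrightarrow> in_Lp p (lebesgue_on \<Omega>) u \<and> in_Lp p (lebesgue_on \<Omega>) G \<and>
     (\<exists>\<phi>. (\<forall>k::nat. \<phi> k \<in> test_functions \<Omega>) \<and>
       (\<lambda>k. Lpi p (lebesgue_on \<Omega>) (\<lambda>x. u x - \<phi> k x)) \<longlonglongrightarrow> 0 \<and>
       (\<lambda>k. Lpi p (lebesgue_on \<Omega>) (\<lambda>x. G x - grad (\<phi> k) x)) \<longlonglongrightarrow> 0)"

locale bounded_open =
  fixes \<Omega> :: "'a::euclidean_space set" and p :: real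
  assumes open_\<Omega>: "open \<Omega>" and bounded_\<Omega>: "bounded \<Omega>" and p_gt_1: "1 < p"
begin

abbreviation "M \<equiv> lebesgue_on \<Omega>"

lemma sets_\<Omega>: "\<Omega> \<in> sets lebesgue"
  using open_\<Omega> by (simp add: borel_open)

lemma finite_M: "finite_measure M"
  using open_\<Omega> bounded_\<Omega> by (intro finite_measure_lebesgue_on lmeasurable_open)

lemma test_in_Lp:
  assumes "\<phi> \<in> test_functions \<Omega>" "0 \<le> r"
  shows "in_Lp r M \<phi>" "in_Lp r M (grad \<phi>)"
proof -
  obtain K where K: "compact K" "K \<subseteq> \<Omega>" "\<And>x. x \<notin> K \<Longrightarrow> \<phi> x = 0"
    by (rule test_functionE[OF assms(1)]) blast
  note C = test_function_C1[OF assms(1)]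
  obtain B where B: "\<And>x. norm (grad \<phi> x) \<le> B" "\<And>x. \<bar>\<phi> x\<bar> \<le> B"
    by (rule C1_compact_support_bounds[OF C K(1,3)]) blast+
  show "in_Lp r M \<phi>"
    using B(2) by (intro in_Lp_bounded[OF finite_M continuous_borel_measurable_lebesgue_on[OF C1_continuous[OF C]]] assms) auto
  show "in_Lp r M (grad \<phi>)"
    using B(1) by (intro in_Lp_bounded[OF finite_M continuous_borel_measurable_lebesgue_on[OF C1_continuous_grad[OF C]]] assms) auto
qed

text \<open>Stated for a bounded bilinear pairing because the converging factor is once the scalar
  one, a function, and once the vector one, a gradient. On the bounded domain convergence in L^p
  implies convergence in L^1, which suffices against a bounded h.\<close>

lemma Lp_limit_integral_bilinear:
  fixes f :: "nat \<Rightarrow> 'a \<Rightarrow> 'b::euclidean_space" and h :: "'a \<Rightarrow> 'c::euclidean_space"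
    and prd :: "'b \<Rightarrow> 'c \<Rightarrow> 'd::euclidean_space"
  assumes "bounded_bilinear prd" "\<And>n. in_Lp p M (f n)" "in_Lp p M g" "(\<lambda>n. Lpi p M (\<lambda>x. g x - f n x)) \<longlonglongrightarrow> 0"
    and "h \<in> borel_measurable M" "\<And>x. norm (h x) \<le> B"
  shows "(\<lambda>n. \<integral>x. prd (f n x) (h x) \<partial>M) \<longlonglongrightarrow> (\<integral>x. prd (g x) (h x) \<partial>M)"
proof -
  interpret bounded_bilinear prd by fact
  obtain K where K: "0 \<le> K" "\<And>a b. norm (prd a b) \<le> norm a * norm b * K"
    using nonneg_bounded by blast
  have B: "0 \<le> B" using assms(6)[of undefined] norm_ge_zero[of "h undefined"] by linarith
  have le: "norm (prd a (h x)) \<le> (K * B) * norm a" for a x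
  proof -
    have "norm (prd a (h x)) \<le> norm a * norm (h x) * K" by (rule K)
    also have "\<dots> \<le> norm a * B * K" using assms(6) K(1) by (intro mult_right_mono mult_left_mono) auto
    finally show ?thesis by (simp add: ac_simps)
  qed
  have pm: "(\<lambda>x. prd (k x) (h x)) \<in> borel_measurable M" if "k \<in> borel_measurable M" for k
    by (rule borel_measurable_continuous_Pair[OF that assms(5)]) (intro continuous_on continuous_intros)
  have int: "integrable M (\<lambda>x. prd (k x) (h x))" if "in_Lp p M k" for k
  proof (rule Bochner_Integration.integrable_bound)
    show "integrable M (\<lambda>x. (K * B) *\<^sub>R k x)"
      using integrable_of_in_Lp(1)[OF finite_M that] p_gt_1 by simp
    show "AE x in M. norm (prd (k x) (h x)) \<le> norm ((K * B) *\<^sub>R k x)"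
      using le K(1) B by (intro AE_I2) simp
  qed (rule pm[OF in_Lp_measurable[OF that]])
  have D: "in_Lp p M (\<lambda>x. g x - f n x)" for n
    using assms p_gt_1 by (intro in_Lp_diff) auto
  have lim: "(\<lambda>n. (K * B) * Lpi 1 M (\<lambda>x. g x - f n x)) \<longlonglongrightarrow> 0"
    using p_gt_1 by (intro tendsto_mult_right_zero Lpi_tendsto_0_exponent_mono[OF finite_M D _ _ assms(4)]) auto
  have "(\<lambda>n. (\<integral>x. prd (f n x) (h x) \<partial>M) - (\<integral>x. prd (g x) (h x) \<partial>M)) \<longlonglongrightarrow> 0"
  proof (rule Lim_null_comparison[OF always_eventually lim], rule allI)
    fix n
    have "norm ((\<integral>x. prd (f n x) (h x) \<partial>M) - (\<integral>x. prd (g x) (h x) \<partial>M)) = norm (\<integral>x. prd (g x) (h x) - prd (f n x) (h x) \<partial>M)"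
      using int[OF assms(2)[of n]] int[OF assms(3)] by (simp add: norm_minus_commute)
    also have "\<dots> = norm (\<integral>x. prd (g x - f n x) (h x) \<partial>M)" by (simp add: diff_left)
    also have "\<dots> \<le> (\<integral>x. norm (prd (g x - f n x) (h x)) \<partial>M)" by (rule integral_norm_bound)
    also have "\<dots> \<le> (\<integral>x. (K * B) * norm (g x - f n x) \<partial>M)"
      using int[OF D] integrable_of_in_Lp(1)[OF finite_M D] p_gt_1
      by (intro integral_mono le) auto
    also have "\<dots> = (K * B) * Lpi 1 M (\<lambda>x. g x - f n x)" by (simp add: Lpi_def)
    finally show "norm ((\<integral>x. prd (f n x) (h x) \<partial>M) - (\<integral>x. prd (g x) (h x) \<partial>M)) \<le> (K * B) * Lpi 1 M (\<lambda>x. g x - f n x)" .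
  qed
  then show ?thesis by (simp add: LIM_zero_iff)
qed

lemma in_Lp_locally_integrable:
  fixes f :: "'a \<Rightarrow> 'b::euclidean_space"
  shows "in_Lp p M f \<Longrightarrow> locally_integrable \<Omega> f"
  unfolding locally_integrable_def
  using integrable_lebesgue_on_subset[OF integrable_of_in_Lp(1)[OF finite_M] sets_\<Omega>, of p f] p_gt_1
  by (auto simp: lmeasurable_compact fmeasurableD)

lemma sobolev0_is_weak_grad:
  assumes "sobolev0 \<Omega> p u G"
  shows "is_weak_grad \<Omega> u G"
proof -
  obtain \<phi> where u: "in_Lp p M u" "in_Lp p M G" and \<phi>: "\<And>k. \<phi> k \<in> test_functions \<Omega>"
    and lim: "(\<lambda>k. Lpi p M (\<lambda>x. u x - \<phi> k x)) \<longlonglongrightarrow> 0" "(\<lambda>k. Lpi p M (\<lambda>x. G x - grad (\<phi> k) x)) \<longlonglongrightarrow> 0"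
    using assms unfolding sobolev0_def by blast
  have p0: "0 \<le> p" using p_gt_1 by simp
  have "(\<integral>x. u x *\<^sub>R grad \<psi> x \<partial>M) = - (\<integral>x. \<psi> x *\<^sub>R G x \<partial>M)" if \<psi>: "\<psi> \<in> test_functions \<Omega>" for \<psi>
  proof -
    obtain K where K: "compact K" "K \<subseteq> \<Omega>" "\<And>x. x \<notin> K \<Longrightarrow> \<psi> x = 0"
      by (rule test_functionE[OF \<psi>]) blast
    note C = test_function_C1[OF \<psi>]
    obtain B where B: "\<And>x. norm (grad \<psi> x) \<le> B" "\<And>x. \<bar>\<psi> x\<bar> \<le> B"
      by (rule C1_compact_support_bounds[OF C K(1,3)]) blast+
    have 1: "(\<lambda>k. \<integral>x. \<phi> k x *\<^sub>R grad \<psi> x \<partial>M) \<longlonglongrightarrow> (\<integral>x. u x *\<^sub>R grad \<psi> x \<partial>M)"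
      by (rule Lp_limit_integral_bilinear[OF bounded_bilinear_scaleR test_in_Lp(1)[OF \<phi> p0] u(1) lim(1)
            in_Lp_measurable[OF test_in_Lp(2)[OF \<psi> p0]] B(1)])
    have 2: "(\<integral>x. \<phi> k x *\<^sub>R grad \<psi> x \<partial>M) = - (\<integral>x. \<psi> x *\<^sub>R grad (\<phi> k) x \<partial>M)" for k
      by (rule test_function_parts[OF \<psi> test_function_C1[OF \<phi>] sets_\<Omega>])
    have 3: "(\<lambda>k. \<integral>x. \<psi> x *\<^sub>R grad (\<phi> k) x \<partial>M) \<longlonglongrightarrow> (\<integral>x. \<psi> x *\<^sub>R G x \<partial>M)"
      by (rule Lp_limit_integral_bilinear[OF bounded_bilinear.flip[OF bounded_bilinear_scaleR] test_in_Lp(2)[OF \<phi> p0] u(2) lim(2)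
            in_Lp_measurable[OF test_in_Lp(1)[OF \<psi> p0]], of B]) (use B(2) in auto)
    show ?thesis
      using LIMSEQ_unique[OF 1[unfolded 2] tendsto_minus[OF 3]] .
  qed
  then show ?thesis
    unfolding is_weak_grad_def using in_Lp_locally_integrable[OF u(1)] in_Lp_locally_integrable[OF u(2)] by blast
qed

lemma is_weak_grad_diff:
  assumes "is_weak_grad \<Omega> u G" "is_weak_grad \<Omega> v H"
  shows "is_weak_grad \<Omega> (\<lambda>x. u x - v x) (\<lambda>x. G x - H x)"
  unfolding is_weak_grad_def
proof (intro conjI ballI)
  show "locally_integrable \<Omega> (\<lambda>x. u x - v x)" "locally_integrable \<Omega> (\<lambda>x. G x - H x)"
    using assms by (auto simp: is_weak_grad_def locally_integrable_def)
  fix \<phi> assume \<phi>: "\<phi> \<in> test_functions \<Omega>"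
  obtain K where K: "compact K" "K \<subseteq> \<Omega>" "\<And>x. x \<notin> K \<Longrightarrow> \<phi> x = 0"
    by (rule test_functionE[OF \<phi>]) blast
  note C = test_function_C1[OF \<phi>]
  have g0: "x \<notin> K \<Longrightarrow> grad \<phi> x = 0" for x
    using C1_zero_grad[OF C compact_imp_closed[OF K(1)] K(3)] by blast
  have i: "integrable M (\<lambda>x. \<phi> x *\<^sub>R G x)" "integrable M (\<lambda>x. \<phi> x *\<^sub>R H x)"
    by (rule locally_integrable_times_test[OF _ sets_\<Omega> K(1,2) C1_continuous[OF C] K(3)],
        use assms in \<open>auto simp: is_weak_grad_def\<close>)+
  have j: "integrable M (\<lambda>x. w x *\<^sub>R grad \<phi> x)" if w: "locally_integrable \<Omega> w" for w :: "'a \<Rightarrow> real"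
  proof -
    \<comment> \<open>The compactly supported factor has to be the scalar one, so the vector is
      split into coordinates and reassembled.\<close>
    have "integrable M (\<lambda>x. (grad \<phi> x \<bullet> b) *\<^sub>R w x)" for b
      by (rule locally_integrable_times_test[OF w sets_\<Omega> K(1,2)])
         (use g0 C1_continuous_grad[OF C] in \<open>auto intro!: continuous_intros\<close>)
    then have "integrable M (\<lambda>x. \<Sum>b\<in>Basis. ((grad \<phi> x \<bullet> b) *\<^sub>R w x) *\<^sub>R b)"
      by (intro Bochner_Integration.integrable_sum integrable_scaleR_left)
    also have "(\<lambda>x. \<Sum>b\<in>Basis. ((grad \<phi> x \<bullet> b) *\<^sub>R w x) *\<^sub>R b) = (\<lambda>x. w x *\<^sub>R grad \<phi> x)"
    proof
      fix x
      have "(\<Sum>b\<in>Basis. ((grad \<phi> x \<bullet> b) *\<^sub>R w x) *\<^sub>R b) = w x *\<^sub>R (\<Sum>b\<in>Basis. (grad \<phi> x \<bullet> b) *\<^sub>R b)"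
        by (simp add: scaleR_sum_right mult.commute)
      then show "(\<Sum>b\<in>Basis. ((grad \<phi> x \<bullet> b) *\<^sub>R w x) *\<^sub>R b) = w x *\<^sub>R grad \<phi> x"
        by (simp add: euclidean_representation)
    qed
    finally show ?thesis .
  qed
  have "integrable M (\<lambda>x. u x *\<^sub>R grad \<phi> x)" "integrable M (\<lambda>x. v x *\<^sub>R grad \<phi> x)"
    using assms by (auto simp: is_weak_grad_def intro: j)
  then show "(\<integral>x. (u x - v x) *\<^sub>R grad \<phi> x \<partial>M) = - (\<integral>x. \<phi> x *\<^sub>R (G x - H x) \<partial>M)"
    using i assms \<phi> by (simp add: scaleR_diff_left scaleR_diff_right is_weak_grad_def)
qed

lemma is_weak_grad_weak_grad: "is_weak_grad \<Omega> u G \<Longrightarrow> is_weak_grad \<Omega> u (weak_grad \<Omega> u)"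
  unfolding weak_grad_def by (rule someI[of "is_weak_grad \<Omega> u"])

text \<open>The representative chosen by \<open>weak_grad\<close> is compared with an explicit
  gradient only almost everywhere; completeness of Lebesgue measure transfers measurability to
  it.\<close>

lemma borel_measurable_AE_lebesgue_on:
  fixes f g :: "'a \<Rightarrow> 'b::euclidean_space"
  assumes "f \<in> borel_measurable M" "AE x in M. f x = g x"
  shows "g \<in> borel_measurable M"
proof -
  have "(\<lambda>x. if x \<in> \<Omega> then f x else 0) \<in> borel_measurable lebesgue"
    using assms(1) by (simp add: borel_measurable_if sets_\<Omega>)
  moreover have "AE x in lebesgue. (if x \<in> \<Omega> then f x else 0) = (if x \<in> \<Omega> then g x else 0)"
    using assms(2) sets_\<Omega> unfolding AE_restrict_space_iff[of \<Omega> lebesgue, simplified, OF sets_\<Omega>] by (auto elim: eventually_mono)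
  ultimately have "(\<lambda>x. if x \<in> \<Omega> then g x else 0) \<in> borel_measurable lebesgue"
    by (rule borel_measurable_AE)
  then show ?thesis by (rule borel_measurable_if_D)
qed

lemma weak_grad_eq:
  assumes "is_weak_grad \<Omega> u G"
  shows "AE x in M. weak_grad \<Omega> u x = G x"
  by (rule weak_grad_unique[OF open_\<Omega> is_weak_grad_weak_grad[OF assms] assms])

lemma Lp_norm_eq: "Lp_norm r \<Omega> f = Lpi r M f powr (1 / r)"
  by (simp add: Lp_norm_def Lpi_def)

lemma Lp_space_iff: "f \<in> Lp_space r \<Omega> \<longleftrightarrow> in_Lp r M f"
  by (simp add: Lp_space_def in_Lp_def)

lemma test_is_weak_grad: "\<phi> \<in> test_functions \<Omega> \<Longrightarrow> is_weak_grad \<Omega> \<phi> (grad \<phi>)"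
  using p_gt_1
  by (intro sobolev0_is_weak_grad)
     (auto simp: sobolev0_def test_in_Lp Lpi_def intro!: exI[of _ "\<lambda>_. \<phi>"])

lemma tendsto_powr_inverse_iff:
  assumes "\<And>n. 0 \<le> a n" "0 < r"
  shows "(\<lambda>n. a n powr (1 / r)) \<longlonglongrightarrow> 0 \<longleftrightarrow> a \<longlonglongrightarrow> (0::real)"
proof
  assume "(\<lambda>n. a n powr (1 / r)) \<longlonglongrightarrow> 0"
  then have "(\<lambda>n. (a n powr (1 / r)) powr r) \<longlonglongrightarrow> 0 powr r"
    using assms by (intro tendsto_powr2[OF _ tendsto_const]) auto
  then show "a \<longlonglongrightarrow> 0" using assms by (simp add: powr_powr)
next
  assume "a \<longlonglongrightarrow> 0"
  then have "(\<lambda>n. a n powr (1 / r)) \<longlonglongrightarrow> 0 powr (1 / r)"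
    using assms by (intro tendsto_powr2[OF _ tendsto_const]) auto
  then show "(\<lambda>n. a n powr (1 / r)) \<longlonglongrightarrow> 0" by simp
qed

text \<open>With its converse \<open>sobolev0_imp_W01p\<close> this replaces the gradients of u -
  \<phi> k, chosen anew for every k, by differences of explicit gradients; uniqueness of weak
  gradients makes the two agree almost everywhere.\<close>

lemma W01p_imp_sobolev0:
  assumes "u \<in> W01p \<Omega> p"
  shows "sobolev0 \<Omega> p u (weak_grad \<Omega> u)"
proof -
  obtain G \<phi> where u: "in_Lp p M u" and G: "in_Lp p M G" "is_weak_grad \<Omega> u G" and \<phi>: "\<And>k. \<phi> k \<in> test_functions \<Omega>"
    and lim: "(\<lambda>k. Lp_norm p \<Omega> (\<lambda>x. u x - \<phi> k x) + Lp_norm p \<Omega> (weak_grad \<Omega> (\<lambda>x. u x - \<phi> k x))) \<longlonglongrightarrow> 0"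
    using assms unfolding W01p_def W1p_def mem_Collect_eq Bex_def Lp_space_iff by blast
  have p0: "0 \<le> p" using p_gt_1 by simp
  have nn: "0 \<le> Lp_norm p \<Omega> f" for f :: "'a \<Rightarrow> 'c::euclidean_space" by (simp add: Lp_norm_def)
  have "(\<lambda>k. Lp_norm p \<Omega> (\<lambda>x. u x - \<phi> k x)) \<longlonglongrightarrow> 0"
    by (rule Lim_null_comparison[OF always_eventually lim]) (simp add: nn)
  then have l1: "(\<lambda>k. Lpi p M (\<lambda>x. u x - \<phi> k x)) \<longlonglongrightarrow> 0"
    unfolding Lp_norm_eq using p_gt_1 by (subst (asm) tendsto_powr_inverse_iff) (auto simp: Lpi_nonneg)
  have "(\<lambda>k. Lp_norm p \<Omega> (weak_grad \<Omega> (\<lambda>x. u x - \<phi> k x))) \<longlonglongrightarrow> 0"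
    by (rule Lim_null_comparison[OF always_eventually lim]) (simp add: nn)
  then have l2: "(\<lambda>k. Lpi p M (weak_grad \<Omega> (\<lambda>x. u x - \<phi> k x))) \<longlonglongrightarrow> 0"
    unfolding Lp_norm_eq using p_gt_1 by (subst (asm) tendsto_powr_inverse_iff) (auto simp: Lpi_nonneg)
  have GW: "AE x in M. G x = weak_grad \<Omega> u x"
    using weak_grad_eq[OF G(2)] by eventually_elim simp
  then have wm: "weak_grad \<Omega> u \<in> borel_measurable M"
    by (rule borel_measurable_AE_lebesgue_on[OF in_Lp_measurable[OF G(1)]])
  have W: "in_Lp p M (weak_grad \<Omega> u)"
    by (rule in_Lp_cong_AE[OF GW G(1) wm])
  have "Lpi p M (weak_grad \<Omega> (\<lambda>x. u x - \<phi> k x)) = Lpi p M (\<lambda>x. weak_grad \<Omega> u x - grad (\<phi> k) x)" for k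
  proof (rule Lpi_cong_AE)
    have "is_weak_grad \<Omega> (\<lambda>x. u x - \<phi> k x) (\<lambda>x. weak_grad \<Omega> u x - grad (\<phi> k) x)"
      by (rule is_weak_grad_diff[OF is_weak_grad_weak_grad[OF G(2)] test_is_weak_grad[OF \<phi>]])
    then show *: "AE x in M. weak_grad \<Omega> (\<lambda>x. u x - \<phi> k x) x = weak_grad \<Omega> u x - grad (\<phi> k) x"
      by (rule weak_grad_eq)
    show m: "(\<lambda>x. weak_grad \<Omega> u x - grad (\<phi> k) x) \<in> borel_measurable M"
      using wm in_Lp_measurable[OF test_in_Lp(2)[OF \<phi> p0]] by (rule borel_measurable_diff)
    show "weak_grad \<Omega> (\<lambda>x. u x - \<phi> k x) \<in> borel_measurable M"
      by (rule borel_measurable_AE_lebesgue_on[OF m]) (use * in eventually_elim, simp)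
  qed
  then have "(\<lambda>k. Lpi p M (\<lambda>x. weak_grad \<Omega> u x - grad (\<phi> k) x)) \<longlonglongrightarrow> 0" using l2 by simp
  then show ?thesis
    unfolding sobolev0_def using u W \<phi> l1 by blast
qed

lemma sobolev0_imp_W01p:
  assumes "sobolev0 \<Omega> p u G"
  shows "u \<in> W01p \<Omega> p" "AE x in M. weak_grad \<Omega> u x = G x"
proof -
  obtain \<phi> where u: "in_Lp p M u" "in_Lp p M G" and \<phi>: "\<And>k. \<phi> k \<in> test_functions \<Omega>"
    and lim: "(\<lambda>k. Lpi p M (\<lambda>x. u x - \<phi> k x)) \<longlonglongrightarrow> 0" "(\<lambda>k. Lpi p M (\<lambda>x. G x - grad (\<phi> k) x)) \<longlonglongrightarrow> 0"
    using assms unfolding sobolev0_def by blast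
  have p0: "0 \<le> p" using p_gt_1 by simp
  have w: "is_weak_grad \<Omega> u G" by (rule sobolev0_is_weak_grad[OF assms])
  show "AE x in M. weak_grad \<Omega> u x = G x" by (rule weak_grad_eq[OF w])
  have eq: "Lpi p M (weak_grad \<Omega> (\<lambda>x. u x - \<phi> k x)) = Lpi p M (\<lambda>x. G x - grad (\<phi> k) x)" for k
  proof (rule Lpi_cong_AE)
    show *: "AE x in M. weak_grad \<Omega> (\<lambda>x. u x - \<phi> k x) x = G x - grad (\<phi> k) x"
      by (rule weak_grad_eq[OF is_weak_grad_diff[OF w test_is_weak_grad[OF \<phi>]]])
    show m: "(\<lambda>x. G x - grad (\<phi> k) x) \<in> borel_measurable M"
      using in_Lp_measurable[OF u(2)] in_Lp_measurable[OF test_in_Lp(2)[OF \<phi> p0]] by (rule borel_measurable_diff)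
    show "weak_grad \<Omega> (\<lambda>x. u x - \<phi> k x) \<in> borel_measurable M"
      by (rule borel_measurable_AE_lebesgue_on[OF m]) (use * in eventually_elim, simp)
  qed
  have "(\<lambda>k. Lp_norm p \<Omega> (\<lambda>x. u x - \<phi> k x)) \<longlonglongrightarrow> 0"
    unfolding Lp_norm_eq using p_gt_1 lim(1) by (subst tendsto_powr_inverse_iff) (auto simp: Lpi_nonneg)
  moreover have "(\<lambda>k. Lp_norm p \<Omega> (weak_grad \<Omega> (\<lambda>x. u x - \<phi> k x))) \<longlonglongrightarrow> 0"
    unfolding Lp_norm_eq using p_gt_1 lim(2) eq by (subst tendsto_powr_inverse_iff) (auto simp: Lpi_nonneg)
  ultimately have "(\<lambda>k. Lp_norm p \<Omega> (\<lambda>x. u x - \<phi> k x) + Lp_norm p \<Omega> (weak_grad \<Omega> (\<lambda>x. u x - \<phi> k x))) \<longlonglongrightarrow> 0"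
    using tendsto_add by fastforce
  then show "u \<in> W01p \<Omega> p"
    unfolding W01p_def W1p_def mem_Collect_eq Bex_def Lp_space_iff using u w \<phi> by blast
qed

end

section \<open>The Poincare inequality and Rellich compactness\<close>

text \<open>Fatou's lemma with a convergent sequence of bounds. Working in the extended nonnegative
  reals makes the conclusion meaningful before the limit is known to be integrable.\<close>

lemma nn_integral_Fatou_le:
  fixes f :: "nat \<Rightarrow> 'm \<Rightarrow> ennreal"
  assumes "\<And>k. f k \<in> borel_measurable M" "AE x in M. (\<lambda>k. f k x) \<longlonglongrightarrow> g x"
    and "\<And>k. (\<integral>\<^sup>+x. f k x \<partial>M) \<le> c k" "c \<longlonglongrightarrow> d"
  shows "(\<integral>\<^sup>+x. g x \<partial>M) \<le> d"
proof -
  have "(\<integral>\<^sup>+x. g x \<partial>M) = (\<integral>\<^sup>+x. liminf (\<lambda>k. f k x) \<partial>M)"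
    by (rule nn_integral_cong_AE) (use assms(2) in eventually_elim, simp add: lim_imp_Liminf)
  also have "\<dots> \<le> liminf (\<lambda>k. \<integral>\<^sup>+x. f k x \<partial>M)"
    by (rule nn_integral_liminf[OF assms(1)])
  also have "\<dots> \<le> liminf c"
    by (rule Liminf_mono) (simp add: assms(3))
  also have "\<dots> = d"
    using assms(4) by (simp add: lim_imp_Liminf)
  finally show ?thesis .
qed

lemma in_Lp_nn_integral:
  assumes "in_Lp r M f"
  shows "(\<integral>\<^sup>+x. ennreal (norm (f x) powr r) \<partial>M) = ennreal (Lpi r M f)"
  unfolding Lpi_def by (rule nn_integral_eq_integral[OF in_Lp_integrable[OF assms]]) simp

lemma in_Lp_nn_integralI:
  assumes "f \<in> borel_measurable M" "(\<integral>\<^sup>+x. ennreal (norm (f x) powr r) \<partial>M) \<le> ennreal c" "0 \<le> c"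
  shows "in_Lp r M f" "Lpi r M f \<le> c"
proof -
  note [measurable] = assms(1)
  have "(\<integral>\<^sup>+x. ennreal (norm (f x) powr r) \<partial>M) < \<infinity>"
    using assms(2) by (rule le_less_trans) simp
  then show L: "in_Lp r M f"
    unfolding in_Lp_def by (auto intro!: integrableI_bounded)
  show "Lpi r M f \<le> c"
    using assms(2,3) unfolding in_Lp_nn_integral[OF L] by simp
qed

lemma Lp_complete:
  fixes f :: "nat \<Rightarrow> 'm \<Rightarrow> 'b::euclidean_space"
  assumes f: "\<And>n. in_Lp r M (f n)" and r: "1 \<le> r"
    and Cauchy: "\<And>e. 0 < e \<Longrightarrow> \<exists>N. \<forall>m\<ge>N. \<forall>n\<ge>N. Lpi r M (\<lambda>x. f m x - f n x) \<le> e"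
  obtains g where "in_Lp r M g" "(\<lambda>n. Lpi r M (\<lambda>x. f n x - g x)) \<longlonglongrightarrow> 0"
proof -
  note [measurable] = in_Lp_measurable[OF f]
  have r0: "0 \<le> r" using r by simp
  \<comment> \<open>Chosen so that after division by \<open>((1/2) ^ k) powr r\<close> the integrals
    of the increments still sum like a geometric series; then almost everywhere the increments are
    eventually at most \<open>(1/2) ^ k\<close> and the subsequence converges.\<close>
  define e where "e k = (1/2 :: real) ^ k * ((1/2) ^ k) powr r" for k :: nat
  have e: "0 < e k" for k by (simp add: e_def)
  have "\<exists>s. \<forall>k. (\<forall>m\<ge>s k. \<forall>n\<ge>s k. Lpi r M (\<lambda>x. f m x - f n x) \<le> e k) \<and> s k < s (Suc k)"
  proof (rule dependent_nat_choice)
    show "\<exists>N. \<forall>m\<ge>N. \<forall>n\<ge>N. Lpi r M (\<lambda>x. f m x - f n x) \<le> e 0"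
      by (rule Cauchy[OF e])
    fix N k
    obtain N' where "\<forall>m\<ge>N'. \<forall>n\<ge>N'. Lpi r M (\<lambda>x. f m x - f n x) \<le> e (Suc k)"
      using Cauchy[OF e] by blast
    then show "\<exists>N'. (\<forall>m\<ge>N'. \<forall>n\<ge>N'. Lpi r M (\<lambda>x. f m x - f n x) \<le> e (Suc k)) \<and> N < N'"
      by (intro exI[of _ "max N' (Suc N)"]) auto
  qed
  then obtain s where s: "\<And>k m n. s k \<le> m \<Longrightarrow> s k \<le> n \<Longrightarrow> Lpi r M (\<lambda>x. f m x - f n x) \<le> e k" "\<And>k. s k < s (Suc k)"
    by blast
  have sm: "strict_mono s" using s(2) by (simp add: strict_mono_Suc_iff)
  have D: "in_Lp r M (\<lambda>x. f m x - f n x)" for m n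
    by (rule in_Lp_diff(1)[OF f f r0])
  define a where "a k x = norm (f (s (Suc k)) x - f (s k) x) powr r / ((1/2) ^ k) powr r" for k x
  have am[measurable]: "a k \<in> borel_measurable M" for k unfolding a_def by measurable
  have a_le: "(\<integral>\<^sup>+x. ennreal (a k x) \<partial>M) \<le> ennreal ((1/2) ^ k)" for k
  proof -
    have "(\<integral>\<^sup>+x. ennreal (a k x) \<partial>M) = ennreal (\<integral>x. a k x \<partial>M)"
      by (rule nn_integral_eq_integral) (use D[of "s (Suc k)" "s k"] in \<open>auto simp: a_def in_Lp_def\<close>)
    also have "(\<integral>x. a k x \<partial>M) = Lpi r M (\<lambda>x. f (s (Suc k)) x - f (s k) x) / ((1/2) ^ k) powr r"
      by (simp add: a_def Lpi_def)
    also have "\<dots> \<le> e k / ((1/2) ^ k) powr r"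
      using s(2)[of k] by (intro divide_right_mono s(1)) auto
    also have "\<dots> = (1/2) ^ k" by (simp add: e_def)
    finally show ?thesis by (simp add: ennreal_leI)
  qed
  have "(\<integral>\<^sup>+x. (\<Sum>k. ennreal (a k x)) \<partial>M) = (\<Sum>k. \<integral>\<^sup>+x. ennreal (a k x) \<partial>M)"
    by (rule nn_integral_suminf) measurable
  also have "\<dots> \<le> (\<Sum>k. ennreal ((1/2) ^ k))"
    by (intro suminf_le a_le) auto
  also have "\<dots> = ennreal (\<Sum>k. (1/2) ^ k)"
    by (intro suminf_ennreal2) (auto intro: summable_geometric)
  also have "\<dots> < \<infinity>" by simp
  finally have "AE x in M. (\<Sum>k. ennreal (a k x)) \<noteq> \<infinity>"
    by (intro nn_integral_PInf_AE) auto
  then have conv: "AE x in M. (\<lambda>k. f (s k) x) \<longlonglongrightarrow> lim (\<lambda>k. f (s k) x)"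
  proof eventually_elim
    fix x assume "(\<Sum>k. ennreal (a k x)) \<noteq> \<infinity>"
    then have "summable (\<lambda>k. a k x)"
      by (intro summable_suminf_not_top) (auto simp: a_def)
    then have "(\<lambda>k. a k x) \<longlonglongrightarrow> 0" by (rule summable_LIMSEQ_zero)
    then have "\<forall>\<^sub>F k in sequentially. a k x < 1"
      by (rule order_tendstoD) simp
    then have "\<forall>\<^sub>F k in sequentially. norm (f (s (Suc k)) x - f (s k) x) \<le> (1/2) ^ k"
    proof eventually_elim
      fix k assume "a k x < 1"
      then have "norm (f (s (Suc k)) x - f (s k) x) powr r < ((1/2) ^ k) powr r"
        by (simp add: a_def)
      then show "norm (f (s (Suc k)) x - f (s k) x) \<le> (1/2) ^ k"
        using r0 by (meson linorder_not_le norm_ge_zero order_less_imp_le powr_mono2 zero_le_power zero_le_divide_1_iff zero_le_numeral)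
    qed
    then have "summable (\<lambda>k. f (s (Suc k)) x - f (s k) x)"
      by (rule summable_comparison_test_ev) (simp add: summable_geometric)
    then have "convergent (\<lambda>n. \<Sum>k<n. f (s (Suc k)) x - f (s k) x)"
      by (simp add: summable_iff_convergent)
    then have "convergent (\<lambda>n. f (s n) x - f (s 0) x)"
      by (simp only: sum_lessThan_telescope[of "\<lambda>k. f (s k) x"])
    then have "convergent (\<lambda>n. f (s n) x)"
      using convergent_diff_const_right_iff[of "\<lambda>n. f (s n) x" "f (s 0) x"] by simp
    then show "(\<lambda>k. f (s k) x) \<longlonglongrightarrow> lim (\<lambda>k. f (s k) x)"
      by (simp add: convergent_LIMSEQ_iff)
  qed
  define g where "g x = lim (\<lambda>k. f (s k) x)" for x
  have gm[measurable]: "g \<in> borel_measurable M"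
    unfolding g_def by measurable
  \<comment> \<open>Fatou along the subsequence: a bound between \<open>f n\<close> and all late
    terms passes to \<open>f n\<close> and the limit. The index k + N guarantees that the terms used
    are late enough.\<close>
  have gle: "(\<integral>\<^sup>+x. ennreal (norm (f n x - g x) powr r) \<partial>M) \<le> ennreal c"
    if N: "\<And>m. N \<le> m \<Longrightarrow> Lpi r M (\<lambda>x. f n x - f m x) \<le> c" for n N c
  proof (rule nn_integral_Fatou_le)
    show "(\<lambda>x. ennreal (norm (f n x - f (s (k + N)) x) powr r)) \<in> borel_measurable M" for k by measurable
    show "AE x in M. (\<lambda>k. ennreal (norm (f n x - f (s (k + N)) x) powr r)) \<longlonglongrightarrow> ennreal (norm (f n x - g x) powr r)"
      using conv
    proof eventually_elim
      fix x assume "(\<lambda>k. f (s k) x) \<longlonglongrightarrow> lim (\<lambda>k. f (s k) x)"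
      then have "(\<lambda>k. f (s (k + N)) x) \<longlonglongrightarrow> g x"
        unfolding g_def by (rule LIMSEQ_ignore_initial_segment)
      then have "(\<lambda>k. norm (f n x - f (s (k + N)) x)) \<longlonglongrightarrow> norm (f n x - g x)"
        by (intro tendsto_intros)
      then show "(\<lambda>k. ennreal (norm (f n x - f (s (k + N)) x) powr r)) \<longlonglongrightarrow> ennreal (norm (f n x - g x) powr r)"
        using r by (intro tendsto_ennrealI tendsto_powr2[OF _ tendsto_const]) auto
    qed
    show "(\<integral>\<^sup>+x. ennreal (norm (f n x - f (s (k + N)) x) powr r) \<partial>M) \<le> ennreal c" for k
    proof -
      have "N \<le> s (k + N)" using strict_mono_imp_increasing[OF sm, of "k + N"] by simp
      then show ?thesis unfolding in_Lp_nn_integral[OF D] by (intro ennreal_leI N)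
    qed
    show "(\<lambda>k. ennreal c) \<longlonglongrightarrow> ennreal c" by simp
  qed
  have Lg: "in_Lp r M (\<lambda>x. f n x - g x) \<and> Lpi r M (\<lambda>x. f n x - g x) \<le> c"
    if N: "\<And>m. N \<le> m \<Longrightarrow> Lpi r M (\<lambda>x. f n x - f m x) \<le> c" for n N c
  proof -
    have "0 \<le> c" using N[of N] Lpi_nonneg[of r M "\<lambda>x. f n x - f N x"] by simp
    then show ?thesis using in_Lp_nn_integralI[OF _ gle[OF N]] by auto
  qed
  have "in_Lp r M g"
  proof -
    obtain N where N: "\<forall>m\<ge>N. \<forall>n\<ge>N. Lpi r M (\<lambda>x. f m x - f n x) \<le> 1" using Cauchy[of 1] by auto
    have "in_Lp r M (\<lambda>x. f N x - g x)"
      using Lg[of N N 1] N by blast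
    then have "in_Lp r M (\<lambda>x. f N x - (f N x - g x))"
      by (rule in_Lp_diff(1)[OF f _ r0])
    then show ?thesis by simp
  qed
  moreover have "(\<lambda>n. Lpi r M (\<lambda>x. f n x - g x)) \<longlonglongrightarrow> 0"
  proof (rule LIMSEQ_I)
    fix d :: real assume d: "0 < d"
    then obtain N where N: "\<forall>m\<ge>N. \<forall>n\<ge>N. Lpi r M (\<lambda>x. f m x - f n x) \<le> d / 2" using Cauchy[of "d / 2"] by auto
    have "Lpi r M (\<lambda>x. f n x - g x) \<le> d / 2" if "N \<le> n" for n
      using Lg[of N n "d / 2"] N that by blast
    then show "\<exists>N. \<forall>n\<ge>N. norm (Lpi r M (\<lambda>x. f n x - g x) - 0) < d"
      using d by (intro exI[of _ N]) (fastforce simp: Lpi_nonneg)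
  qed
  ultimately show ?thesis by (rule that)
qed

section \<open>Translates of a function estimated by its gradient\<close>

lemma nn_integral_lborel_translate:
  fixes f :: "'a::euclidean_space \<Rightarrow> ennreal"
  assumes "f \<in> borel_measurable borel"
  shows "(\<integral>\<^sup>+x. f (x + y) \<partial>lborel) = (\<integral>\<^sup>+x. f x \<partial>lborel)"
  by (subst (2) lborel_distr_plus[symmetric, of y], subst nn_integral_distr) (use assms in \<open>auto simp: add.commute\<close>)

text \<open>The fundamental theorem of calculus along the segment from x to x + y, followed by
  Jensen's inequality on the unit interval, whose total mass is 1.\<close>

lemma C1_increment_powr_le:
  fixes f :: "'a::euclidean_space \<Rightarrow> real"
  assumes f: "C1 f g" and r: "1 \<le> r"
  shows "ennreal (\<bar>f (x + y) - f x\<bar> powr r)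
    \<le> (\<integral>\<^sup>+t. ennreal (norm y powr r) * ennreal (norm (g (x + t *\<^sub>R y)) powr r) * indicator {0..1} t \<partial>lborel)"
proof -
  define h where "h t = g (x + t *\<^sub>R y) \<bullet> y" for t :: real
  define N where "N = restrict_space lborel {0..1::real}"
  have hc: "continuous_on UNIV h"
    unfolding h_def by (intro continuous_intros continuous_on_compose2[OF C1_continuous_grad[OF f]]) auto
  have hm[measurable]: "h \<in> borel_measurable borel" by (rule borel_measurable_continuous_onI[OF hc])
  have hN: "h \<in> borel_measurable N" unfolding N_def by (intro measurable_restrict_space1) simp
  have N: "finite_measure N" "measure N (space N) = 1"
    by (auto simp: N_def space_restrict_space emeasure_restrict_space measure_restrict_space intro!: finite_measureI)
  have "has_bochner_integral lborel (\<lambda>t. h t * indicator {0..1} t) (f (x + 1 *\<^sub>R y) - f (x + 0 *\<^sub>R y))"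
  proof (rule has_bochner_integral_FTC_Icc_real)
    fix t :: real
    have "((\<lambda>s. x + s *\<^sub>R y) has_derivative (\<lambda>s. s *\<^sub>R y)) (at t)"
      by (auto intro!: derivative_eq_intros)
    from has_derivative_compose[OF this C1_D[OF f]]
    show "((\<lambda>t. f (x + t *\<^sub>R y)) has_real_derivative h t) (at t)"
      by (simp add: has_field_derivative_def h_def mult_commute_abs)
    show "isCont h t" using hc by (simp add: continuous_on_eq_continuous_at)
  qed simp
  then have "f (x + y) - f x = (\<integral>t. indicator {0..1} t *\<^sub>R h t \<partial>lborel)"
    by (simp add: has_bochner_integral_iff mult.commute)
  also have "\<dots> = (\<integral>t. h t \<partial>N)"
    unfolding N_def by (rule integral_restrict_space[symmetric]) simp
  finally have eq: "f (x + y) - f x = (\<integral>t. h t \<partial>N)" .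
  have "bounded (h ` {0..1})"
    by (intro compact_imp_bounded compact_continuous_image continuous_on_subset[OF hc]) auto
  then obtain B where "\<And>t. t \<in> {0..1} \<Longrightarrow> norm (h t) \<le> B" unfolding bounded_iff by blast
  then have L: "in_Lp r N h"
    using r by (intro in_Lp_bounded[OF N(1) hN, of B] AE_I2) (auto simp: N_def space_restrict_space)
  have "\<bar>f (x + y) - f x\<bar> \<le> (\<integral>t. norm (h t) \<partial>N)" unfolding eq by simp
  then have "\<bar>f (x + y) - f x\<bar> powr r \<le> (\<integral>t. norm (h t) \<partial>N) powr r" using r by (intro powr_mono2) auto
  also have "\<dots> \<le> Lpi r N h" using integral_powr_le[OF N(1) L r] N(2) by simp
  finally have "ennreal (\<bar>f (x + y) - f x\<bar> powr r) \<le> ennreal (Lpi r N h)" by (rule ennreal_leI)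
  also have "\<dots> = (\<integral>\<^sup>+t. ennreal (norm (h t) powr r) \<partial>N)" by (rule in_Lp_nn_integral[OF L, symmetric])
  also have "\<dots> = (\<integral>\<^sup>+t. ennreal (norm (h t) powr r) * indicator {0..1} t \<partial>lborel)"
    unfolding N_def by (rule nn_integral_restrict_space) simp
  also have "\<dots> \<le> (\<integral>\<^sup>+t. ennreal (norm y powr r) * ennreal (norm (g (x + t *\<^sub>R y)) powr r) * indicator {0..1} t \<partial>lborel)"
  proof (intro nn_integral_mono mult_right_mono)
    fix t
    have "norm (h t) \<le> norm y * norm (g (x + t *\<^sub>R y))"
      unfolding h_def using Cauchy_Schwarz_ineq2[of "g (x + t *\<^sub>R y)" y] by (simp add: mult.commute)
    then have "norm (h t) powr r \<le> norm y powr r * norm (g (x + t *\<^sub>R y)) powr r"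
      using powr_mono2[of r "norm (h t)" "norm y * norm (g (x + t *\<^sub>R y))"] r by (simp add: powr_mult)
    then show "ennreal (norm (h t) powr r) \<le> ennreal (norm y powr r) * ennreal (norm (g (x + t *\<^sub>R y)) powr r)"
      by (simp add: ennreal_mult[symmetric] ennreal_leI)
  qed simp
  finally show ?thesis .
qed

text \<open>The increment bound is integrated over x; Fubini and translation invariance remove the
  parameter t. The sets A and A' are there for \<open>mean_oscillation_ball\<close>, where only the
  gradient inside the ball may be used.\<close>

lemma translation_inequality:
  fixes f :: "'a::euclidean_space \<Rightarrow> real"
  assumes f: "C1 f g" and r: "1 \<le> r" and [measurable]: "A \<in> sets borel" "A' \<in> sets borel"
    and A: "\<And>x t. x \<in> A \<Longrightarrow> 0 \<le> t \<Longrightarrow> t \<le> 1 \<Longrightarrow> x + t *\<^sub>R y \<in> A'"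
  shows "(\<integral>\<^sup>+x. ennreal (\<bar>f (x + y) - f x\<bar> powr r) * indicator A x \<partial>lborel)
    \<le> ennreal (norm y powr r) * (\<integral>\<^sup>+x. ennreal (norm (g x) powr r) * indicator A' x \<partial>lborel)"
proof -
  define c where "c = ennreal (norm y powr r)"
  define F where "F x = ennreal (norm (g x) powr r) * indicator A' x" for x
  have gm[measurable]: "g \<in> borel_measurable borel"
    by (rule borel_measurable_continuous_onI[OF C1_continuous_grad[OF f]])
  have Fm[measurable]: "F \<in> borel_measurable borel" unfolding F_def by measurable
  have "(\<integral>\<^sup>+x. ennreal (\<bar>f (x + y) - f x\<bar> powr r) * indicator A x \<partial>lborel)
      \<le> (\<integral>\<^sup>+x. (\<integral>\<^sup>+t. c * F (x + t *\<^sub>R y) * indicator {0..1::real} t \<partial>lborel) \<partial>lborel)"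
  proof (rule nn_integral_mono)
    fix x
    show "ennreal (\<bar>f (x + y) - f x\<bar> powr r) * indicator A x \<le> (\<integral>\<^sup>+t. c * F (x + t *\<^sub>R y) * indicator {0..1::real} t \<partial>lborel)"
    proof (cases "x \<in> A")
      case True
      then have "ennreal (\<bar>f (x + y) - f x\<bar> powr r) * indicator A x
        \<le> (\<integral>\<^sup>+t. c * ennreal (norm (g (x + t *\<^sub>R y)) powr r) * indicator {0..1::real} t \<partial>lborel)"
        using C1_increment_powr_le[OF f r, of x y] by (simp add: c_def)
      also have "\<dots> = (\<integral>\<^sup>+t. c * F (x + t *\<^sub>R y) * indicator {0..1::real} t \<partial>lborel)"
        by (intro nn_integral_cong) (use A[OF True] in \<open>auto simp: F_def split: split_indicator\<close>)
      finally show ?thesis .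
    qed simp
  qed
  also have "\<dots> = (\<integral>\<^sup>+t. (\<integral>\<^sup>+x. c * F (x + t *\<^sub>R y) * indicator {0..1::real} t \<partial>lborel) \<partial>lborel)"
    by (rule lborel_pair.Fubini'[symmetric]) measurable
  also have "\<dots> = (\<integral>\<^sup>+t. c * (\<integral>\<^sup>+x. F x \<partial>lborel) * indicator {0..1::real} t \<partial>lborel)"
  proof (rule nn_integral_cong)
    fix t :: real
    have "(\<integral>\<^sup>+x. c * F (x + t *\<^sub>R y) * indicator {0..1::real} t \<partial>lborel) = c * (\<integral>\<^sup>+x. F (x + t *\<^sub>R y) \<partial>lborel) * indicator {0..1::real} t"
      by (simp add: nn_integral_multc nn_integral_cmult)
    also have "(\<integral>\<^sup>+x. F (x + t *\<^sub>R y) \<partial>lborel) = (\<integral>\<^sup>+x. F x \<partial>lborel)"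
      by (rule nn_integral_lborel_translate) measurable
    finally show "(\<integral>\<^sup>+x. c * F (x + t *\<^sub>R y) * indicator {0..1::real} t \<partial>lborel) = c * (\<integral>\<^sup>+x. F x \<partial>lborel) * indicator {0..1::real} t" .
  qed
  also have "\<dots> = c * (\<integral>\<^sup>+x. F x \<partial>lborel)"
    by (simp add: nn_integral_cmult)
  finally show ?thesis by (simp add: c_def F_def)
qed

text \<open>With z = x + y only |y| < 2 r matters, and for each such y the translation inequality
  costs a factor |y| < 2 r, the segment from x to x + y staying in the ball by convexity. So the
  constant is 2 r times the volume of the ball of possible y.\<close>

lemma mean_oscillation_ball:
  fixes f :: "'a::euclidean_space \<Rightarrow> real"
  assumes f: "C1 f g"
  shows "(\<integral>\<^sup>+x. (\<integral>\<^sup>+z. ennreal \<bar>f x - f z\<bar> * indicator (ball c r) z \<partial>lborel) * indicator (ball c r) x \<partial>lborel)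
    \<le> ennreal (2 * r) * emeasure lborel (ball (0::'a) (2 * r)) * (\<integral>\<^sup>+x. ennreal (norm (g x)) * indicator (ball c r) x \<partial>lborel)"
proof -
  define B where "B = ball c r"
  define I where "I = (\<integral>\<^sup>+x. ennreal (norm (g x)) * indicator B x \<partial>lborel)"
  have [measurable]: "B \<in> sets borel" by (simp add: B_def)
  have fm[measurable]: "f \<in> borel_measurable borel"
    by (rule borel_measurable_continuous_onI[OF C1_continuous[OF f]])
  define T where "T x y = ennreal \<bar>f (x + y) - f x\<bar> * indicator B (x + y) * indicator B x" for x y
  have Tm[measurable]: "case_prod T \<in> borel_measurable (borel \<Otimes>\<^sub>M borel)"
    unfolding T_def[abs_def] by measurable
  have "(\<integral>\<^sup>+x. (\<integral>\<^sup>+z. ennreal \<bar>f x - f z\<bar> * indicator B z \<partial>lborel) * indicator B x \<partial>lborel)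
      = (\<integral>\<^sup>+x. (\<integral>\<^sup>+y. T x y \<partial>lborel) \<partial>lborel)"
  proof (rule nn_integral_cong)
    fix x
    have "(\<integral>\<^sup>+z. ennreal \<bar>f x - f z\<bar> * indicator B z \<partial>lborel) * indicator B x = (\<integral>\<^sup>+z. ennreal \<bar>f z - f x\<bar> * indicator B z * indicator B x \<partial>lborel)"
      by (simp add: nn_integral_multc abs_minus_commute)
    also have "\<dots> = (\<integral>\<^sup>+y. ennreal \<bar>f (y + x) - f x\<bar> * indicator B (y + x) * indicator B x \<partial>lborel)"
      by (rule nn_integral_lborel_translate[symmetric]) measurable
    also have "\<dots> = (\<integral>\<^sup>+y. T x y \<partial>lborel)" by (simp add: T_def add.commute)
    finally show "(\<integral>\<^sup>+z. ennreal \<bar>f x - f z\<bar> * indicator B z \<partial>lborel) * indicator B x = (\<integral>\<^sup>+y. T x y \<partial>lborel)" .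
  qed
  also have "\<dots> = (\<integral>\<^sup>+y. (\<integral>\<^sup>+x. T x y \<partial>lborel) \<partial>lborel)"
    by (rule lborel_pair.Fubini'[symmetric]) simp
  also have "\<dots> \<le> (\<integral>\<^sup>+y. ennreal (2 * r) * I * indicator (ball (0::'a) (2 * r)) y \<partial>lborel)"
  proof (rule nn_integral_mono)
    fix y :: 'a
    show "(\<integral>\<^sup>+x. T x y \<partial>lborel) \<le> ennreal (2 * r) * I * indicator (ball (0::'a) (2 * r)) y"
    proof (cases "norm y < 2 * r")
      case True
      define A where "A = {x. x \<in> B \<and> x + y \<in> B}"
      have [measurable]: "A \<in> sets borel" unfolding A_def by measurable
      have seg: "x + t *\<^sub>R y \<in> B" if "x \<in> A" "0 \<le> t" "t \<le> 1" for x t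
      proof -
        have "(1 - t) *\<^sub>R x + t *\<^sub>R (x + y) \<in> B"
          using that by (intro convexD_alt) (auto simp: A_def B_def)
        then show ?thesis by (simp add: algebra_simps)
      qed
      have "(\<integral>\<^sup>+x. T x y \<partial>lborel) = (\<integral>\<^sup>+x. ennreal (\<bar>f (x + y) - f x\<bar> powr 1) * indicator A x \<partial>lborel)"
        by (intro nn_integral_cong) (auto simp: T_def A_def split: split_indicator)
      also have "\<dots> \<le> ennreal (norm y powr 1) * (\<integral>\<^sup>+x. ennreal (norm (g x) powr 1) * indicator B x \<partial>lborel)"
        by (rule translation_inequality[OF f]) (use seg in auto)
      also have "\<dots> \<le> ennreal (2 * r) * I"
        using True by (auto simp: I_def intro!: mult_right_mono ennreal_leI)
      finally show ?thesis using True by simp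
    next
      case False
      have "T x y = 0" for x
      proof -
        have "\<not> (x \<in> B \<and> x + y \<in> B)"
        proof
          assume "x \<in> B \<and> x + y \<in> B"
          then have "dist x (x + y) < 2 * r"
            unfolding B_def mem_ball using dist_triangle3[of x "x + y" c] by (auto simp: dist_commute)
          then show False using False by (simp add: dist_norm)
        qed
        then show ?thesis by (auto simp: T_def split: split_indicator)
      qed
      then show ?thesis by simp
    qed
  qed
  also have "\<dots> = ennreal (2 * r) * emeasure lborel (ball (0::'a) (2 * r)) * I"
    by (subst nn_integral_cmult_indicator) (auto simp: ac_simps)
  finally show ?thesis by (simp add: B_def I_def)
qed

section \<open>Means over small balls\<close>

text \<open>Applied to \<open>\<lambda>y. f (x + y)\<close> it is the mean of f over the ball of
  radius h around x, which plays the part of a mollifier in the compactness proof: Lipschitz and sup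
  bounds are all that Arzela-Ascoli asks for.\<close>

definition avg :: "real \<Rightarrow> ('a::euclidean_space \<Rightarrow> real) \<Rightarrow> real" where
  "avg h k = (\<integral>y. k y \<partial>restrict_space lborel (ball 0 h)) / measure lborel (ball (0::'a) h)"

lemma avg_ball_measure:
  assumes "0 < h"
  shows "finite_measure (restrict_space lborel (ball (0::'a::euclidean_space) h))"
    and "measure (restrict_space lborel (ball (0::'a) h)) (space (restrict_space lborel (ball (0::'a) h))) = measure lborel (ball (0::'a) h)"
    and "0 < measure lborel (ball (0::'a) h)"
proof -
  have e: "emeasure lborel (ball (0::'a) h) < \<infinity>"
    by (intro emeasure_bounded_finite) auto
  then show "finite_measure (restrict_space lborel (ball (0::'a) h))"
    by (intro finite_measureI) (auto simp: space_restrict_space emeasure_restrict_space)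
  show "measure (restrict_space lborel (ball (0::'a) h)) (space (restrict_space lborel (ball (0::'a) h))) = measure lborel (ball (0::'a) h)"
    by (simp add: space_restrict_space measure_restrict_space)
  show "0 < measure lborel (ball (0::'a) h)"
    using assms content_ball_pos[of h "0::'a"] by (simp add: measure_completion)
qed

lemma continuous_in_Lp_ball:
  fixes k :: "'a::euclidean_space \<Rightarrow> real"
  assumes "continuous_on UNIV k" "0 < h" "0 \<le> r"
  shows "in_Lp r (restrict_space lborel (ball 0 h)) k"
proof -
  have "bounded (k ` cball 0 h)"
    by (intro compact_imp_bounded compact_continuous_image continuous_on_subset[OF assms(1)]) auto
  then obtain B where B: "\<And>y. y \<in> cball 0 h \<Longrightarrow> norm (k y) \<le> B" unfolding bounded_iff by blast
  show ?thesis
  proof (rule in_Lp_bounded[OF avg_ball_measure(1)[OF assms(2)] _ _ assms(3)])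
    show "k \<in> borel_measurable (restrict_space lborel (ball 0 h))"
      using borel_measurable_continuous_onI[OF assms(1)] by (intro measurable_restrict_space1) simp
    show "AE x in restrict_space lborel (ball 0 h). norm (k x) \<le> B"
      using B by (intro AE_I2) (auto simp: space_restrict_space)
  qed
qed

lemma avg_powr_le:
  fixes k :: "'a::euclidean_space \<Rightarrow> real"
  assumes k: "continuous_on UNIV k" and h: "0 < h" and r: "1 \<le> r"
  shows "ennreal (\<bar>avg h k\<bar> powr r) \<le> ennreal (1 / measure lborel (ball (0::'a) h)) *
    (\<integral>\<^sup>+y. ennreal (\<bar>k y\<bar> powr r) * indicator (ball 0 h) y \<partial>lborel)"
proof -
  define V where "V = measure lborel (ball (0::'a) h)"
  define N where "N = restrict_space lborel (ball (0::'a) h)"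
  have V: "0 < V" unfolding V_def by (rule avg_ball_measure(3)[OF h])
  have L: "in_Lp r N k" unfolding N_def using r by (intro continuous_in_Lp_ball[OF k h]) simp
  have N: "finite_measure N" "measure N (space N) = V"
    unfolding N_def V_def by (rule avg_ball_measure[OF h])+
  have "\<bar>avg h k\<bar> powr r = \<bar>\<integral>y. k y \<partial>N\<bar> powr r / V powr r"
    using V by (simp add: avg_def N_def V_def powr_divide)
  also have "\<dots> \<le> (\<integral>y. norm (k y) \<partial>N) powr r / V powr r"
    using r V by (intro divide_right_mono powr_mono2) auto
  also have "\<dots> \<le> V powr (r - 1) * Lpi r N k / V powr r"
    using integral_powr_le[OF N(1) L r] N(2) V by (intro divide_right_mono) auto
  also have "\<dots> = 1 / V * Lpi r N k"
    using V by (simp add: powr_diff)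
  finally have "ennreal (\<bar>avg h k\<bar> powr r) \<le> ennreal (1 / V) * ennreal (Lpi r N k)"
    using V by (subst ennreal_mult[symmetric]) (auto simp: Lpi_nonneg intro: ennreal_leI)
  also have "ennreal (Lpi r N k) = (\<integral>\<^sup>+y. ennreal (\<bar>k y\<bar> powr r) \<partial>N)"
    using in_Lp_nn_integral[OF L] by simp
  also have "\<dots> = (\<integral>\<^sup>+y. ennreal (\<bar>k y\<bar> powr r) * indicator (ball 0 h) y \<partial>lborel)"
    unfolding N_def by (rule nn_integral_restrict_space) simp
  finally show ?thesis by (simp add: V_def)
qed

lemma avg_diff:
  fixes k l :: "'a::euclidean_space \<Rightarrow> real"
  assumes "continuous_on UNIV k" "continuous_on UNIV l" "0 < h"
  shows "avg h k - avg h l = avg h (\<lambda>y. k y - l y)"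
proof -
  have "integrable (restrict_space lborel (ball 0 h)) k" "integrable (restrict_space lborel (ball 0 h)) l"
    using assms by (auto intro!: integrable_of_in_Lp(1)[OF avg_ball_measure(1) continuous_in_Lp_ball[of _ _ 1]])
  then show ?thesis by (simp add: avg_def diff_divide_distrib)
qed

lemma avg_const: "0 < h \<Longrightarrow> avg h (\<lambda>y::'a::euclidean_space. c) = c"
  using avg_ball_measure(2,3)[of h, where 'a = 'a] by (simp add: avg_def)

context
  fixes f :: "'a::euclidean_space \<Rightarrow> real" and g :: "'a \<Rightarrow> 'a" and r h :: real and E :: ennreal
  assumes f: "C1 f g" and r: "1 \<le> r" and h: "0 < h"
    and E: "(\<integral>\<^sup>+x. ennreal (norm (g x) powr r) \<partial>lborel) \<le> E"
begin

lemma shifted_continuous: "continuous_on UNIV (\<lambda>y. f (x + y))"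
  by (intro continuous_on_compose2[OF C1_continuous[OF f]] continuous_intros) auto

lemma translation_inequality_UNIV:
  "(\<integral>\<^sup>+x. ennreal (\<bar>f (x + y) - f x\<bar> powr r) \<partial>lborel) \<le> ennreal (norm y powr r) * E"
proof -
  have "(\<integral>\<^sup>+x. ennreal (\<bar>f (x + y) - f x\<bar> powr r) * indicator UNIV x \<partial>lborel)
      \<le> ennreal (norm y powr r) * (\<integral>\<^sup>+x. ennreal (norm (g x) powr r) * indicator UNIV x \<partial>lborel)"
    by (rule translation_inequality[OF f r]) auto
  also have "\<dots> \<le> ennreal (norm y powr r) * E" using E by (intro mult_left_mono) auto
  finally show ?thesis by simp
qed

text \<open>The difference of two means is the mean of the increment by x - x', which the
  translation inequality bounds by the energy. The constant depends on h but not on f, so functions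
  of bounded energy have equicontinuous means.\<close>

lemma avg_Lipschitz_powr:
  "ennreal (\<bar>avg h (\<lambda>y. f (x + y)) - avg h (\<lambda>y. f (x' + y))\<bar> powr r)
    \<le> ennreal (1 / measure lborel (ball (0::'a) h)) * (ennreal (norm (x - x') powr r) * E)"
proof -
  have [measurable]: "f \<in> borel_measurable borel"
    by (rule borel_measurable_continuous_onI[OF C1_continuous[OF f]])
  have "ennreal (\<bar>avg h (\<lambda>y. f (x + y)) - avg h (\<lambda>y. f (x' + y))\<bar> powr r)
    \<le> ennreal (1 / measure lborel (ball (0::'a) h)) *
      (\<integral>\<^sup>+y. ennreal (\<bar>f (x + y) - f (x' + y)\<bar> powr r) * indicator (ball 0 h) y \<partial>lborel)"
    unfolding avg_diff[OF shifted_continuous shifted_continuous h]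
    by (intro avg_powr_le h r continuous_intros shifted_continuous)
  also have "\<dots> \<le> ennreal (1 / measure lborel (ball (0::'a) h)) *
      (\<integral>\<^sup>+y. ennreal (\<bar>f ((y + x') + (x - x')) - f (y + x')\<bar> powr r) \<partial>lborel)"
    by (intro mult_left_mono nn_integral_mono) (auto simp: add.commute split: split_indicator)
  also have "(\<integral>\<^sup>+y. ennreal (\<bar>f ((y + x') + (x - x')) - f (y + x')\<bar> powr r) \<partial>lborel)
     = (\<integral>\<^sup>+y. ennreal (\<bar>f (y + (x - x')) - f y\<bar> powr r) \<partial>lborel)"
    by (rule nn_integral_lborel_translate) measurable
  also have "ennreal (1 / measure lborel (ball (0::'a) h)) * \<dots>
      \<le> ennreal (1 / measure lborel (ball (0::'a) h)) * (ennreal (norm (x - x') powr r) * E)"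
    by (intro mult_left_mono translation_inequality_UNIV) auto
  finally show ?thesis .
qed

lemma avg_powr_bound:
  "ennreal (\<bar>avg h (\<lambda>y. f (x + y))\<bar> powr r)
    \<le> ennreal (1 / measure lborel (ball (0::'a) h)) * (\<integral>\<^sup>+y. ennreal (\<bar>f y\<bar> powr r) \<partial>lborel)"
proof -
  have [measurable]: "f \<in> borel_measurable borel"
    by (rule borel_measurable_continuous_onI[OF C1_continuous[OF f]])
  have "ennreal (\<bar>avg h (\<lambda>y. f (x + y))\<bar> powr r)
    \<le> ennreal (1 / measure lborel (ball (0::'a) h)) *
      (\<integral>\<^sup>+y. ennreal (\<bar>f (x + y)\<bar> powr r) * indicator (ball 0 h) y \<partial>lborel)"
    by (intro avg_powr_le h r shifted_continuous)
  also have "\<dots> \<le> ennreal (1 / measure lborel (ball (0::'a) h)) *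
      (\<integral>\<^sup>+y. ennreal (\<bar>f (y + x)\<bar> powr r) \<partial>lborel)"
    by (intro mult_left_mono nn_integral_mono) (auto simp: add.commute split: split_indicator)
  also have "(\<integral>\<^sup>+y. ennreal (\<bar>f (y + x)\<bar> powr r) \<partial>lborel) = (\<integral>\<^sup>+y. ennreal (\<bar>f y\<bar> powr r) \<partial>lborel)"
    by (rule nn_integral_lborel_translate) measurable
  finally show ?thesis .
qed

text \<open>Jensen's inequality inside and Fubini outside reduce the claim to the translation
  inequality for each single y with |y| < h.\<close>

lemma avg_approx:
  "(\<integral>\<^sup>+x. ennreal (\<bar>avg h (\<lambda>y. f (x + y)) - f x\<bar> powr r) \<partial>lborel) \<le> ennreal (h powr r) * E"
proof -
  define V where "V = measure lborel (ball (0::'a) h)"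
  have V: "0 < V" unfolding V_def by (rule avg_ball_measure(3)[OF h])
  have [measurable]: "ball (0::'a) h \<in> sets borel" by simp
  have [measurable]: "f \<in> borel_measurable borel"
    by (rule borel_measurable_continuous_onI[OF C1_continuous[OF f]])
  have "(\<integral>\<^sup>+x. (\<integral>\<^sup>+y. ennreal (\<bar>f (x + y) - f x\<bar> powr r) * indicator (ball 0 h) y \<partial>lborel) \<partial>lborel)
     = (\<integral>\<^sup>+y. (\<integral>\<^sup>+x. ennreal (\<bar>f (x + y) - f x\<bar> powr r) * indicator (ball 0 h) y \<partial>lborel) \<partial>lborel)"
    by (rule lborel_pair.Fubini'[symmetric]) measurable
  also have "\<dots> \<le> (\<integral>\<^sup>+y. ennreal (h powr r) * E * indicator (ball (0::'a) h) y \<partial>lborel)"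
  proof (rule nn_integral_mono)
    fix y :: 'a
    show "(\<integral>\<^sup>+x. ennreal (\<bar>f (x + y) - f x\<bar> powr r) * indicator (ball 0 h) y \<partial>lborel) \<le> ennreal (h powr r) * E * indicator (ball (0::'a) h) y"
    proof (cases "y \<in> ball 0 h")
      case True
      then have "ennreal (norm y powr r) \<le> ennreal (h powr r)" using r by (intro ennreal_leI powr_mono2) auto
      then have "ennreal (norm y powr r) * E \<le> ennreal (h powr r) * E" by (intro mult_right_mono) auto
      with True translation_inequality_UNIV[of y] show ?thesis by (auto intro: order_trans)
    qed simp
  qed
  also have "\<dots> = ennreal (h powr r) * E * ennreal V"
    unfolding V_def using emeasure_bounded_finite[of "ball (0::'a) h"]
    by (subst nn_integral_cmult_indicator) (auto simp: emeasure_eq_ennreal_measure)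
  finally have swap: "(\<integral>\<^sup>+x. (\<integral>\<^sup>+y. ennreal (\<bar>f (x + y) - f x\<bar> powr r) * indicator (ball 0 h) y \<partial>lborel) \<partial>lborel)
     \<le> ennreal (h powr r) * E * ennreal V" .
  have "(\<integral>\<^sup>+x. ennreal (\<bar>avg h (\<lambda>y. f (x + y)) - f x\<bar> powr r) \<partial>lborel)
    \<le> (\<integral>\<^sup>+x. ennreal (1 / V) * (\<integral>\<^sup>+y. ennreal (\<bar>f (x + y) - f x\<bar> powr r) * indicator (ball 0 h) y \<partial>lborel) \<partial>lborel)"
  proof (rule nn_integral_mono)
    fix x
    have "avg h (\<lambda>y. f (x + y)) - f x = avg h (\<lambda>y. f (x + y) - f x)"
      using avg_diff[OF shifted_continuous continuous_on_const h, of x "f x"] avg_const[OF h, of "f x", where 'a = 'a] by simp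
    then show "ennreal (\<bar>avg h (\<lambda>y. f (x + y)) - f x\<bar> powr r) \<le> ennreal (1 / V) * (\<integral>\<^sup>+y. ennreal (\<bar>f (x + y) - f x\<bar> powr r) * indicator (ball 0 h) y \<partial>lborel)"
      unfolding V_def by (simp only:) (intro avg_powr_le h r continuous_intros shifted_continuous)
  qed
  also have "\<dots> = ennreal (1 / V) * (\<integral>\<^sup>+x. (\<integral>\<^sup>+y. ennreal (\<bar>f (x + y) - f x\<bar> powr r) * indicator (ball 0 h) y \<partial>lborel) \<partial>lborel)"
    by (rule nn_integral_cmult) measurable
  also have "\<dots> \<le> ennreal (1 / V) * (ennreal (h powr r) * E * ennreal V)"
    by (intro mult_left_mono swap) simp
  also have "\<dots> = (ennreal (1 / V) * ennreal V) * (ennreal (h powr r) * E)"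
    by (simp only: ac_simps)
  also have "ennreal (1 / V) * ennreal V = 1" using V by (subst ennreal_mult[symmetric]) auto
  finally show ?thesis by simp
qed

end

section \<open>Passage to the bounded domain\<close>

context bounded_open
begin

lemma Lpi_eq_nn_integral_lborel:
  fixes k :: "'a \<Rightarrow> 'b::euclidean_space"
  assumes "in_Lp r M k" "\<And>x. x \<notin> \<Omega> \<Longrightarrow> k x = 0"
  shows "(\<integral>\<^sup>+x. ennreal (norm (k x) powr r) \<partial>lborel) = ennreal (Lpi r M k)"
proof -
  have "ennreal (Lpi r M k) = (\<integral>\<^sup>+x. ennreal (norm (k x) powr r) \<partial>M)"
    by (rule in_Lp_nn_integral[OF assms(1), symmetric])
  also have "\<dots> = (\<integral>\<^sup>+x. ennreal (norm (k x) powr r) * indicator \<Omega> x \<partial>lebesgue)"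
    by (rule nn_integral_restrict_space) (simp add: sets_\<Omega>)
  also have "\<dots> = (\<integral>\<^sup>+x. ennreal (norm (k x) powr r) \<partial>lebesgue)"
    by (intro nn_integral_cong) (use assms(2) in \<open>auto split: split_indicator\<close>)
  finally show ?thesis by (simp add: nn_integral_completion)
qed

lemma Lpi_le_nn_integral_lborel:
  fixes k :: "'a \<Rightarrow> 'b::euclidean_space"
  assumes "in_Lp r M k" "(\<integral>\<^sup>+x. ennreal (norm (k x) powr r) \<partial>lborel) \<le> ennreal c" "0 \<le> c"
  shows "Lpi r M k \<le> c"
proof -
  have "ennreal (Lpi r M k) = (\<integral>\<^sup>+x. ennreal (norm (k x) powr r) \<partial>M)"
    by (rule in_Lp_nn_integral[OF assms(1), symmetric])
  also have "\<dots> = (\<integral>\<^sup>+x. ennreal (norm (k x) powr r) * indicator \<Omega> x \<partial>lebesgue)"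
    by (rule nn_integral_restrict_space) (simp add: sets_\<Omega>)
  also have "\<dots> \<le> (\<integral>\<^sup>+x. ennreal (norm (k x) powr r) \<partial>lebesgue)"
    by (intro nn_integral_mono) (auto split: split_indicator)
  also have "\<dots> \<le> ennreal c" using assms(2) by (simp add: nn_integral_completion)
  finally show ?thesis using assms(3) by simp
qed

lemma sobolev0_in_Lp: "sobolev0 \<Omega> p u G \<Longrightarrow> in_Lp p M u" "sobolev0 \<Omega> p u G \<Longrightarrow> in_Lp p M G"
  by (auto simp: sobolev0_def)

text \<open>A shift y of length 2 R moves the domain off itself, so on the domain \<phi> is minus
  its own increment along y, and the translation inequality yields the constant
  \<open>(2 * R) powr p\<close>.\<close>

lemma poincare_test:
  obtains D where "0 < D" "\<And>\<phi>. \<phi> \<in> test_functions \<Omega> \<Longrightarrow> Lpi p M \<phi> \<le> D * Lpi p M (grad \<phi>)"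
proof -
  have p: "0 \<le> p" "1 \<le> p" using p_gt_1 by auto
  obtain R where R: "0 < R" "\<And>x. x \<in> \<Omega> \<Longrightarrow> norm x < R"
    using bounded_\<Omega> unfolding bounded_pos_less by blast
  obtain b :: 'a where b: "b \<in> Basis" using nonempty_Basis by blast
  define y where "y = (2 * R) *\<^sub>R b"
  have y: "norm y = 2 * R" using R b by (simp add: y_def)
  show ?thesis
  proof (rule that[of "(2 * R) powr p"])
    show "0 < (2 * R) powr p" using R by simp
    fix \<phi> assume \<phi>: "\<phi> \<in> test_functions \<Omega>"
    note C = test_function_C1[OF \<phi>]
    have E: "(\<integral>\<^sup>+x. ennreal (norm (grad \<phi> x) powr p) \<partial>lborel) = ennreal (Lpi p M (grad \<phi>))"
      by (rule Lpi_eq_nn_integral_lborel[OF test_in_Lp(2)[OF \<phi> p(1)] test_function_grad_zero_outside[OF \<phi>]])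
    have "(\<integral>\<^sup>+x. ennreal (norm (\<phi> x) powr p) \<partial>lborel) \<le> (\<integral>\<^sup>+x. ennreal (\<bar>\<phi> (x + y) - \<phi> x\<bar> powr p) \<partial>lborel)"
    proof (intro nn_integral_mono ennreal_leI)
      fix x
      show "norm (\<phi> x) powr p \<le> \<bar>\<phi> (x + y) - \<phi> x\<bar> powr p"
      proof (cases "x \<in> \<Omega>")
        case True
        have "x + y \<notin> \<Omega>"
        proof
          assume "x + y \<in> \<Omega>"
          then have "norm (x + y) < R" by (rule R)
          moreover have "norm y \<le> norm (x + y) + norm x" using norm_triangle_ineq4[of "x + y" x] by simp
          ultimately show False using R(2)[OF True] y by simp
        qed
        then show ?thesis using test_function_zero_outside[OF \<phi>] by simp
      qed (simp add: test_function_zero_outside[OF \<phi>])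
    qed
    also have "\<dots> \<le> ennreal (norm y powr p) * ennreal (Lpi p M (grad \<phi>))"
      using E by (intro translation_inequality_UNIV[OF C p(2) zero_less_one]) auto
    also have "\<dots> = ennreal ((2 * R) powr p * Lpi p M (grad \<phi>))"
      by (simp add: y ennreal_mult Lpi_nonneg)
    finally show "Lpi p M \<phi> \<le> (2 * R) powr p * Lpi p M (grad \<phi>)"
      by (rule Lpi_le_nn_integral_lborel[OF test_in_Lp(1)[OF \<phi> p(1)]]) (simp add: Lpi_nonneg)
  qed
qed

lemma poincare:
  obtains D where "0 < D" "\<And>u G. sobolev0 \<Omega> p u G \<Longrightarrow> Lpi p M u \<le> D * Lpi p M G"
proof -
  have p: "0 \<le> p" "1 \<le> p" using p_gt_1 by auto
  obtain D where D: "0 < D" "\<And>\<phi>. \<phi> \<in> test_functions \<Omega> \<Longrightarrow> Lpi p M \<phi> \<le> D * Lpi p M (grad \<phi>)"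
    using poincare_test by blast
  show ?thesis
  proof (rule that[OF D(1)])
    fix u G assume "sobolev0 \<Omega> p u G"
    then obtain \<phi> where u: "in_Lp p M u" "in_Lp p M G" and \<phi>: "\<And>k. \<phi> k \<in> test_functions \<Omega>"
      and lim: "(\<lambda>k. Lpi p M (\<lambda>x. u x - \<phi> k x)) \<longlonglongrightarrow> 0" "(\<lambda>k. Lpi p M (\<lambda>x. G x - grad (\<phi> k) x)) \<longlonglongrightarrow> 0"
      unfolding sobolev0_def by blast
    have "(\<lambda>k. Lpi p M (\<phi> k)) \<longlonglongrightarrow> Lpi p M u"
      using lim(1) by (intro Lpi_tendsto[OF test_in_Lp(1)[OF \<phi> p(1)] u(1) p(2)]) (simp add: Lpi_diff_commute)
    moreover have "(\<lambda>k. D * Lpi p M (grad (\<phi> k))) \<longlonglongrightarrow> D * Lpi p M G"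
      using lim(2) by (intro tendsto_mult_left Lpi_tendsto[OF test_in_Lp(2)[OF \<phi> p(1)] u(2) p(2)]) (simp add: Lpi_diff_commute)
    ultimately show "Lpi p M u \<le> D * Lpi p M G"
      by (rule LIMSEQ_le) (use D(2)[OF \<phi>] in auto)
  qed
qed

lemma powr_le_imp_le:
  fixes a b r :: real
  assumes "a powr r \<le> b powr r" "0 \<le> a" "0 \<le> b" "0 < r"
  shows "a \<le> b"
  using assms powr_less_mono2[of r b a] by (meson linorder_not_le)

text \<open>The means over balls of a fixed radius h are bounded and Lipschitz uniformly in n, so
  Arzela-Ascoli applies to them, and they differ from the functions by at most
  \<open>h powr p * K\<close>. One radius reaches only one tolerance e.\<close>

lemma rellich_eps:
  assumes \<phi>: "\<And>n::nat. \<phi> n \<in> test_functions \<Omega>" and K: "\<And>n. Lpi p M (grad (\<phi> n)) \<le> K" and e: "0 < e"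
  obtains s :: "nat \<Rightarrow> nat" and N where "strict_mono s"
    "\<And>i j. N \<le> i \<Longrightarrow> N \<le> j \<Longrightarrow> Lpi p M (\<lambda>x. \<phi> (s i) x - \<phi> (s j) x) \<le> e"
proof -
  have p: "0 \<le> p" "1 \<le> p" "0 < p" using p_gt_1 by auto
  have K0: "0 \<le> K" using K[of 0] Lpi_nonneg[of p M "grad (\<phi> 0)"] by simp
  obtain D where D: "0 < D" "\<And>\<phi>. \<phi> \<in> test_functions \<Omega> \<Longrightarrow> Lpi p M \<phi> \<le> D * Lpi p M (grad \<phi>)"
    using poincare_test by blast
  define c where "c = 2 powr p"
  have c: "0 < c" by (simp add: c_def)
  define \<mu> where "\<mu> = measure M (space M)"
  \<comment> \<open>Two triangle inequalities with factor c give the total error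
    \<open>(c + c * c) * X + c * c * (\<delta> powr p * \<mu>)\<close> with
    \<open>X = h powr p * K\<close>; h and \<delta> are chosen so that each summand is at most e /
    2. The 1 added to K and to \<mu> in the denominators covers the case that one of them is
    0.\<close>
  define y where "y = e / (2 * (c + c * c) * (K + 1))"
  have "0 < c * c" using c by simp
  then have "0 < c + c * c" "0 < K + 1" using c K0 by linarith+
  then have y: "0 < y" unfolding y_def using e by (intro divide_pos_pos mult_pos_pos) auto
  define h where "h = y powr (1 / p)"
  have h: "0 < h" using y by (simp add: h_def)
  have hp: "h powr p = e / (2 * (c + c * c) * (K + 1))"
    unfolding y_def[symmetric] using y p by (simp add: h_def powr_powr)
  define X where "X = h powr p * K"
  have X: "0 \<le> X" "(c + c * c) * X \<le> e / 2"
  proof -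
    show "0 \<le> X" using K0 by (simp add: X_def)
    have "0 < c * c" using c by simp
    then have "0 < c + c * c" using c by linarith
    moreover have "d * (e / (2 * d * t) * K) = e / 2 * (K / t)" if "0 < d" for d t :: real
      using that by (simp add: field_simps)
    ultimately have "(c + c * c) * X = e / 2 * (K / (K + 1))"
      unfolding X_def hp by blast
    also have "\<dots> \<le> e / 2 * 1" using e K0 by (intro mult_left_mono) auto
    finally show "(c + c * c) * X \<le> e / 2" by simp
  qed
  define \<delta> where "\<delta> = (e / (2 * (c * c) * (\<mu> + 1))) powr (1 / p)"
  have \<mu>: "0 \<le> \<mu>" by (simp add: \<mu>_def)
  have \<delta>: "0 < \<delta>" using e c \<mu> by (simp add: \<delta>_def)
  have \<delta>p: "\<delta> powr p = e / (2 * (c * c) * (\<mu> + 1))" using e c \<mu> p by (simp add: \<delta>_def powr_powr)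
  have \<delta>\<mu>: "c * c * (\<delta> powr p * \<mu>) \<le> e / 2"
  proof -
    have "d * (e / (2 * d * t) * \<mu>) = e / 2 * (\<mu> / t)" if "0 < d" for d t :: real
      using that by (simp add: field_simps)
    moreover have "0 < c * c" using c by simp
    ultimately have "c * c * (\<delta> powr p * \<mu>) = e / 2 * (\<mu> / (\<mu> + 1))"
      unfolding \<delta>p by blast
    also have "\<dots> \<le> e / 2 * 1" using e \<mu> by (intro mult_left_mono) auto
    finally show ?thesis by simp
  qed
  define V where "V = measure lborel (ball (0::'a) h)"
  have V: "0 < V" unfolding V_def by (rule avg_ball_measure(3)[OF h])
  define m where "m n x = avg h (\<lambda>y. \<phi> n (x + y))" for n x
  note C = test_function_C1[OF \<phi>]
  have E: "(\<integral>\<^sup>+x. ennreal (norm (grad (\<phi> n) x) powr p) \<partial>lborel) \<le> ennreal K" for n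
    using Lpi_eq_nn_integral_lborel[OF test_in_Lp(2)[OF \<phi> p(1)] test_function_grad_zero_outside[OF \<phi>], of n] K[of n]
    by (simp add: ennreal_leI)
  have E0: "(\<integral>\<^sup>+x. ennreal (norm (\<phi> n x) powr p) \<partial>lborel) \<le> ennreal (D * K)" for n
  proof -
    have "Lpi p M (\<phi> n) \<le> D * K" using D(2)[OF \<phi>, of n] mult_left_mono[OF K[of n] less_imp_le[OF D(1)]] by linarith
    then show ?thesis
      using Lpi_eq_nn_integral_lborel[OF test_in_Lp(1)[OF \<phi> p(1)] test_function_zero_outside[OF \<phi>], of n]
      by (simp add: ennreal_leI)
  qed
  define L where "L = (K / V) powr (1 / p)"
  have lip: "\<bar>m n x - m n x'\<bar> \<le> L * norm (x - x')" for n x x'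
  proof (rule powr_le_imp_le[OF _ _ _ p(3)])
    have "ennreal (\<bar>m n x - m n x'\<bar> powr p) \<le> ennreal (1 / V) * (ennreal (norm (x - x') powr p) * ennreal K)"
      unfolding m_def V_def by (rule avg_Lipschitz_powr[OF C p(2) h E])
    also have "\<dots> = ennreal (1 / V * (norm (x - x') powr p * K))"
      using V K0 by (simp add: ennreal_mult[symmetric])
    finally have "\<bar>m n x - m n x'\<bar> powr p \<le> 1 / V * (norm (x - x') powr p * K)"
      using V K0 by (subst (asm) ennreal_le_iff) auto
    also have "\<dots> = (L * norm (x - x')) powr p"
      using V K0 p by (simp add: L_def powr_mult powr_powr)
    finally show "\<bar>m n x - m n x'\<bar> powr p \<le> (L * norm (x - x')) powr p" .
  qed (auto simp: L_def)
  define B where "B = (D * K / V) powr (1 / p)"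
  have bd: "\<bar>m n x\<bar> \<le> B" for n x
  proof (rule powr_le_imp_le[OF _ _ _ p(3)])
    have "ennreal (\<bar>m n x\<bar> powr p) \<le> ennreal (1 / V) * (\<integral>\<^sup>+y. ennreal (\<bar>\<phi> n y\<bar> powr p) \<partial>lborel)"
      unfolding m_def V_def by (rule avg_powr_bound[OF C p(2) h E])
    also have "\<dots> \<le> ennreal (1 / V) * ennreal (D * K)"
      using E0[of n] by (intro mult_left_mono) auto
    also have "\<dots> = ennreal (1 / V * (D * K))"
      using V K0 D(1) by (simp add: ennreal_mult[symmetric])
    finally have "\<bar>m n x\<bar> powr p \<le> 1 / V * (D * K)"
      using V K0 D(1) by (subst (asm) ennreal_le_iff) auto
    also have "\<dots> = B powr p" using V K0 D(1) p by (simp add: B_def powr_powr)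
    finally show "\<bar>m n x\<bar> powr p \<le> B powr p" .
  qed (auto simp: B_def)
  have mc: "continuous_on UNIV (m n)" for n
  proof (rule lipschitz_on_continuous_on)
    show "L-lipschitz_on UNIV (m n)"
      using lip by (intro lipschitz_onI) (auto simp: dist_norm L_def)
  qed
  have mm: "m n \<in> borel_measurable M" for n by (rule continuous_borel_measurable_lebesgue_on[OF mc])
  have mL: "in_Lp p M (m n)" for n
    using bd by (intro in_Lp_bounded[OF finite_M mm _ p(1)] AE_I2) auto
  have \<phi>L: "in_Lp p M (\<phi> n)" for n by (rule test_in_Lp(1)[OF \<phi> p(1)])
  have approx: "Lpi p M (\<lambda>x. m n x - \<phi> n x) \<le> X" for n
  proof (rule Lpi_le_nn_integral_lborel[OF in_Lp_diff(1)[OF mL \<phi>L p(1)] _ X(1)])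
    have "(\<integral>\<^sup>+x. ennreal (\<bar>m n x - \<phi> n x\<bar> powr p) \<partial>lborel) \<le> ennreal (h powr p) * ennreal K"
      unfolding m_def by (rule avg_approx[OF C p(2) h E])
    then show "(\<integral>\<^sup>+x. ennreal (norm (m n x - \<phi> n x) powr p) \<partial>lborel) \<le> ennreal X"
      using K0 by (simp add: X_def ennreal_mult[symmetric])
  qed
  \<comment> \<open>Arzela-Ascoli asks for a compact set; the means are defined on the whole space,
    so the closure of the domain can be used.\<close>
  have "compact (closure \<Omega>)" using bounded_\<Omega> by simp
  then obtain g s where s: "strict_mono (s :: nat \<Rightarrow> nat)"
    and g: "\<And>e. 0 < e \<Longrightarrow> \<exists>N. \<forall>n x. n \<ge> N \<and> x \<in> closure \<Omega> \<longrightarrow> norm (m (s n) x - g x) < e"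
  proof (rule Arzela_Ascoli[of "closure \<Omega>" m B])
    show "norm (m n x) \<le> B" for n x using bd by simp
    show "\<exists>d>0. \<forall>n y. y \<in> closure \<Omega> \<and> norm (x - y) < d \<longrightarrow> norm (m n x - m n y) < e" if "0 < e" for x e
    proof (intro exI[of _ "e / (L + 1)"] conjI allI impI)
      have L: "0 \<le> L" by (simp add: L_def)
      then show "0 < e / (L + 1)" using that by simp
      fix n y assume "y \<in> closure \<Omega> \<and> norm (x - y) < e / (L + 1)"
      then have "norm (x - y) * (L + 1) < e" using L by (simp add: field_simps)
      moreover have "L * norm (x - y) \<le> norm (x - y) * (L + 1)" using L by (simp add: algebra_simps)
      ultimately show "norm (m n x - m n y) < e" using lip[of n x y] by simp
    qed
  qed blast
  obtain N where N: "\<And>n x. N \<le> n \<Longrightarrow> x \<in> closure \<Omega> \<Longrightarrow> norm (m (s n) x - g x) < \<delta> / 2"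
    using g[of "\<delta> / 2"] \<delta> by auto
  show ?thesis
  proof (rule that[OF s])
    fix i j assume ij: "N \<le> i" "N \<le> j"
    have mid: "Lpi p M (\<lambda>x. m (s i) x - m (s j) x) \<le> \<delta> powr p * \<mu>"
    proof -
      have "Lpi p M (\<lambda>x. m (s i) x - m (s j) x) \<le> (\<integral>x. \<delta> powr p \<partial>M)"
        unfolding Lpi_def
      proof (rule integral_mono)
        show "integrable M (\<lambda>x. norm (m (s i) x - m (s j) x) powr p)"
          by (rule in_Lp_integrable[OF in_Lp_diff(1)[OF mL mL p(1)]])
        show "integrable M (\<lambda>x. \<delta> powr p)" using finite_M by (simp add: finite_measure.integrable_const)
        fix x assume "x \<in> space M"
        then have "x \<in> closure \<Omega>" using closure_subset by auto
        then have "norm (m (s i) x - g x) < \<delta> / 2" "norm (m (s j) x - g x) < \<delta> / 2"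
          using N ij by auto
        then have "norm (m (s i) x - m (s j) x) \<le> \<delta>" by (simp add: abs_if split: if_splits)
        then show "norm (m (s i) x - m (s j) x) powr p \<le> \<delta> powr p" using p by (intro powr_mono2) auto
      qed
      then show ?thesis by (simp add: \<mu>_def mult.commute)
    qed
    have "Lpi p M (\<lambda>x. \<phi> (s i) x - \<phi> (s j) x)
        \<le> c * (Lpi p M (\<lambda>x. \<phi> (s i) x - m (s i) x) + Lpi p M (\<lambda>x. m (s i) x - \<phi> (s j) x))"
      unfolding c_def by (rule Lpi_triangle[OF \<phi>L mL \<phi>L p(1)])
    also have "\<dots> \<le> c * (X + c * (\<delta> powr p * \<mu> + X))"
    proof (intro mult_left_mono add_mono)
      show "Lpi p M (\<lambda>x. \<phi> (s i) x - m (s i) x) \<le> X"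
        using approx[of "s i"] Lpi_diff_commute[of p M "\<phi> (s i)" "m (s i)"] by simp
      have "Lpi p M (\<lambda>x. m (s i) x - \<phi> (s j) x)
        \<le> c * (Lpi p M (\<lambda>x. m (s i) x - m (s j) x) + Lpi p M (\<lambda>x. m (s j) x - \<phi> (s j) x))"
        unfolding c_def by (rule Lpi_triangle[OF mL mL \<phi>L p(1)])
      also have "\<dots> \<le> c * (\<delta> powr p * \<mu> + X)"
        using c mid approx[of "s j"] by (intro mult_left_mono add_mono) auto
      finally show "Lpi p M (\<lambda>x. m (s i) x - \<phi> (s j) x) \<le> c * (\<delta> powr p * \<mu> + X)" .
    qed (use c in auto)
    also have "\<dots> = (c + c * c) * X + c * c * (\<delta> powr p * \<mu>)" by (simp add: algebra_simps)
    also have "\<dots> \<le> e" using X(2) \<delta>\<mu> by simp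
    finally show "Lpi p M (\<lambda>x. \<phi> (s i) x - \<phi> (s j) x) \<le> e" .
  qed
qed

text \<open>The subsequence from \<open>rellich_eps\<close> depends on the tolerance, so the
  tolerances 1 / (i + 1) are reached by successive subsequences, and a diagonal sequence is Cauchy
  in L^p.\<close>

lemma rellich_test:
  assumes \<phi>: "\<And>n::nat. \<phi> n \<in> test_functions \<Omega>" and K: "\<And>n. Lpi p M (grad (\<phi> n)) \<le> K"
  obtains s :: "nat \<Rightarrow> nat" and u where "strict_mono s" "in_Lp p M u" "(\<lambda>n. Lpi p M (\<lambda>x. \<phi> (s n) x - u x)) \<longlonglongrightarrow> 0"
proof -
  have p: "0 \<le> p" "1 \<le> p" "0 < p" using p_gt_1 by auto
  define P where "P i r \<longleftrightarrow>
      (\<exists>N. \<forall>m\<ge>N. \<forall>n\<ge>N. Lpi p M (\<lambda>x. \<phi> (r m) x - \<phi> (r n) x) \<le> inverse (real (Suc i)))" for i and r :: "nat \<Rightarrow> nat"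
  obtain s where s: "strict_mono (s :: nat \<Rightarrow> nat)" "\<And>i. P i (id \<circ> s)"
  proof (rule subsequence_diagonalization_lemma[of P id])
    fix i and r :: "nat \<Rightarrow> nat"
    obtain k N where k: "strict_mono (k :: nat \<Rightarrow> nat)"
        "\<And>i' j. N \<le> i' \<Longrightarrow> N \<le> j \<Longrightarrow> Lpi p M (\<lambda>x. \<phi> (r (k i')) x - \<phi> (r (k j)) x) \<le> inverse (real (Suc i))"
      by (rule rellich_eps[of "\<lambda>n. \<phi> (r n)" K "inverse (real (Suc i))", OF \<phi> K]) auto
    then show "\<exists>k. strict_mono (k :: nat \<Rightarrow> nat) \<and> P i (r \<circ> k)"
      unfolding P_def o_def by blast
  next
    fix i N and r :: "nat \<Rightarrow> nat" and k1 k2 :: "nat \<Rightarrow> nat"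
    assume 1: "P i (r \<circ> k1)" and 2: "\<And>j. N \<le> j \<Longrightarrow> \<exists>j'. j \<le> j' \<and> k2 j = k1 j'"
    obtain N1 where N1: "\<And>m n. N1 \<le> m \<Longrightarrow> N1 \<le> n \<Longrightarrow> Lpi p M (\<lambda>x. \<phi> (r (k1 m)) x - \<phi> (r (k1 n)) x) \<le> inverse (real (Suc i))"
      using 1 unfolding P_def o_def by blast
    have "Lpi p M (\<lambda>x. \<phi> (r (k2 m)) x - \<phi> (r (k2 n)) x) \<le> inverse (real (Suc i))"
      if mn: "max N N1 \<le> m" "max N N1 \<le> n" for m n
    proof -
      obtain m' n' where "m \<le> m'" "k2 m = k1 m'" "n \<le> n'" "k2 n = k1 n'"
        using 2[of m] 2[of n] mn by auto
      then show ?thesis using N1[of m' n'] mn by simp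
    qed
    then show "P i (r \<circ> k2)" unfolding P_def o_def by blast
  qed blast
  have L: "in_Lp p M (\<phi> (s n))" for n by (rule test_in_Lp(1)[OF \<phi> p(1)])
  obtain u where "in_Lp p M u" "(\<lambda>n. Lpi p M (\<lambda>x. \<phi> (s n) x - u x)) \<longlonglongrightarrow> 0"
  proof (rule Lp_complete[of p M "\<lambda>n. \<phi> (s n)", OF L p(2)])
    fix e :: real assume "0 < e"
    then obtain i where i: "inverse (real (Suc i)) < e" using reals_Archimedean by blast
    obtain N where "\<And>m n. N \<le> m \<Longrightarrow> N \<le> n \<Longrightarrow> Lpi p M (\<lambda>x. \<phi> (s m) x - \<phi> (s n) x) \<le> inverse (real (Suc i))"
      using s(2)[of i] unfolding P_def o_def by auto
    then show "\<exists>N. \<forall>m\<ge>N. \<forall>n\<ge>N. Lpi p M (\<lambda>x. \<phi> (s m) x - \<phi> (s n) x) \<le> e"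
      using i by (intro exI[of _ N]) (meson less_imp_le order_trans)
  qed blast
  with s(1) show ?thesis by (rule that)
qed

lemma sobolev0_approx:
  assumes "sobolev0 \<Omega> p u G" "0 < e"
  obtains \<phi> where "\<phi> \<in> test_functions \<Omega>" "Lpi p M (\<lambda>x. u x - \<phi> x) < e" "Lpi p M (\<lambda>x. G x - grad \<phi> x) < e"
proof -
  obtain \<phi> where \<phi>: "\<And>k::nat. \<phi> k \<in> test_functions \<Omega>"
    and lim: "(\<lambda>k. Lpi p M (\<lambda>x. u x - \<phi> k x)) \<longlonglongrightarrow> 0" "(\<lambda>k. Lpi p M (\<lambda>x. G x - grad (\<phi> k) x)) \<longlonglongrightarrow> 0"
    using assms(1) unfolding sobolev0_def by blast
  have "\<forall>\<^sub>F k in sequentially. Lpi p M (\<lambda>x. u x - \<phi> k x) < e \<and> Lpi p M (\<lambda>x. G x - grad (\<phi> k) x) < e"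
    using order_tendstoD(2)[OF lim(1) assms(2)] order_tendstoD(2)[OF lim(2) assms(2)] by (rule eventually_conj)
  then obtain k where "Lpi p M (\<lambda>x. u x - \<phi> k x) < e" "Lpi p M (\<lambda>x. G x - grad (\<phi> k) x) < e"
    using eventually_happens by force
  with \<phi> show ?thesis by (rule that)
qed

text \<open>Each \<open>v n\<close> is replaced by a test function that is within 1 / (n + 1) in
  value and in gradient; the energies stay bounded and the limits of the two sequences
  agree.\<close>

lemma rellich:
  assumes S: "\<And>n::nat. sobolev0 \<Omega> p (v n) (G n)" and K: "\<And>n. Lpi p M (G n) \<le> K"
  obtains s :: "nat \<Rightarrow> nat" and u where "strict_mono s" "in_Lp p M u" "(\<lambda>n. Lpi p M (\<lambda>x. v (s n) x - u x)) \<longlonglongrightarrow> 0"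
proof -
  have p: "0 \<le> p" "1 \<le> p" "0 < p" using p_gt_1 by auto
  have "\<exists>\<phi>. \<phi> \<in> test_functions \<Omega> \<and> Lpi p M (\<lambda>x. v n x - \<phi> x) < inverse (real (Suc n)) \<and> Lpi p M (\<lambda>x. G n x - grad \<phi> x) < inverse (real (Suc n))" for n
    by (rule sobolev0_approx[OF S[of n], of "inverse (real (Suc n))"]) auto
  then obtain \<phi> where \<phi>: "\<And>n. \<phi> n \<in> test_functions \<Omega>"
    and 1: "\<And>n. Lpi p M (\<lambda>x. v n x - \<phi> n x) < inverse (real (Suc n))"
    and 2: "\<And>n. Lpi p M (\<lambda>x. G n x - grad (\<phi> n) x) < inverse (real (Suc n))"
    by metis
  have \<phi>L: "in_Lp p M (\<phi> n)" "in_Lp p M (grad (\<phi> n))" for n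
    by (rule test_in_Lp[OF \<phi> p(1)])+
  have "Lpi p M (grad (\<phi> n)) \<le> 2 powr p * (K + 1)" for n
  proof -
    have "Lpi p M (\<lambda>x. G n x - (G n x - grad (\<phi> n) x)) \<le> 2 powr p * (Lpi p M (G n) + Lpi p M (\<lambda>x. G n x - grad (\<phi> n) x))"
      by (intro in_Lp_diff sobolev0_in_Lp[OF S] \<phi>L p(1))
    also have "\<dots> \<le> 2 powr p * (K + 1)"
    proof (intro mult_left_mono add_mono K)
      have "inverse (real (Suc n)) \<le> 1" by (simp add: field_simps)
      with 2[of n] show "Lpi p M (\<lambda>x. G n x - grad (\<phi> n) x) \<le> 1" by linarith
    qed simp
    finally show ?thesis by simp
  qed
  note bound = this
  obtain s u where s: "strict_mono (s :: nat \<Rightarrow> nat)" and u: "in_Lp p M u" "(\<lambda>n. Lpi p M (\<lambda>x. \<phi> (s n) x - u x)) \<longlonglongrightarrow> 0"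
    by (rule rellich_test[OF \<phi> bound])
  have z: "(\<lambda>n. Lpi p M (\<lambda>x. v n x - \<phi> n x)) \<longlonglongrightarrow> 0"
    by (rule tendsto_sandwich[OF _ _ tendsto_const LIMSEQ_inverse_real_of_nat]) (use 1 in \<open>auto simp: Lpi_nonneg less_imp_le\<close>)
  have "(\<lambda>n. 2 powr p * (Lpi p M (\<lambda>x. v (s n) x - \<phi> (s n) x) + Lpi p M (\<lambda>x. \<phi> (s n) x - u x))) \<longlonglongrightarrow> 2 powr p * (0 + 0)"
    using LIMSEQ_subseq_LIMSEQ[OF z s] u(2) by (intro tendsto_intros) (simp_all add: o_def)
  then have "(\<lambda>n. 2 powr p * (Lpi p M (\<lambda>x. v (s n) x - \<phi> (s n) x) + Lpi p M (\<lambda>x. \<phi> (s n) x - u x))) \<longlonglongrightarrow> 0" by simp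
  then have "(\<lambda>n. Lpi p M (\<lambda>x. v (s n) x - u x)) \<longlonglongrightarrow> 0"
    by (rule tendsto_sandwich[OF _ _ tendsto_const, rotated 2])
       (use Lpi_triangle[OF sobolev0_in_Lp(1)[OF S] \<phi>L(1) u(1) p(1)] in \<open>auto simp: Lpi_nonneg\<close>)
  with s u(1) show ?thesis by (rule that)
qed

end

section \<open>The convexity gap of the p-energy and the chain rule\<close>

text \<open>The flux of the p-Laplacian, that is, the gradient of |a|^p / p. The exponent p - 2 may
  be negative; the factor a makes the value 0 at the origin.\<close>

definition pflow :: "real \<Rightarrow> 'b::euclidean_space \<Rightarrow> 'b" where
  "pflow p a = norm a powr (p - 2) *\<^sub>R a"

text \<open>Up to regrouping, \<open>\<bar>b\<bar>\<^sup>p - \<bar>a\<bar>\<^sup>p - p \<bar>a\<bar>\<^bsup>p-2\<^esup> a \<bullet> (b - a)\<close>: the distance of the convex function \<open>\<bar>\<cdot>\<bar>\<^sup>p\<close> at \<open>b\<close>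
  from its tangent at \<open>a\<close>.\<close>

definition pgap :: "real \<Rightarrow> 'b::euclidean_space \<Rightarrow> 'b \<Rightarrow> real" where
  "pgap p a b = norm b powr p + (p - 1) * norm a powr p - p * (pflow p a \<bullet> b)"

lemma norm_pflow: "norm (pflow p a) = norm a powr (p - 1)"
proof (cases "a = 0")
  case False
  then have "norm a powr (p - 2) * norm a = norm a powr (p - 2) * norm a powr 1" by simp
  also have "\<dots> = norm a powr (p - 1)" by (subst powr_add[symmetric]) simp
  finally show ?thesis by (simp add: pflow_def)
qed (simp add: pflow_def)

lemma pflow_inner_self: "pflow p a \<bullet> a = norm a powr p"
proof (cases "a = 0")
  case False
  have "pflow p a \<bullet> a = norm a powr (p - 2) * (norm a powr 1 * norm a powr 1)"
    using False by (simp add: pflow_def power2_norm_eq_inner[symmetric] power2_eq_square)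
  also have "\<dots> = norm a powr p" by (subst powr_add[symmetric])+ simp
  finally show ?thesis .
qed (simp add: pflow_def)

lemma pflow_inner_le: "\<bar>pflow p a \<bullet> b\<bar> \<le> norm a powr (p - 1) * norm b"
  using Cauchy_Schwarz_ineq2[of "pflow p a" b] by (simp add: norm_pflow)

lemma pflow_scale:
  assumes "0 \<le> c"
  shows "pflow p (c *\<^sub>R a) = c powr (p - 1) *\<^sub>R pflow p a"
proof (cases "c = 0")
  case False
  with assms have "c powr (p - 2) * c = c powr (p - 2) * c powr 1" by simp
  also have "\<dots> = c powr (p - 1)" by (subst powr_add[symmetric]) simp
  finally have "c powr (p - 2) * c = c powr (p - 1)" .
  then have "(c powr (p - 2) * norm a powr (p - 2) * c) = c powr (p - 1) * norm a powr (p - 2)"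
    by (simp add: ac_simps)
  then show ?thesis using assms by (simp add: pflow_def powr_mult)
qed (simp add: pflow_def)

text \<open>The case of equality in Young's inequality. With x = t / s, the inequality
  \<open>ln y \<le> y - 1\<close> is taken once at \<open>y = x powr p / x\<close> and p - 1 times
  at \<open>y = 1 / x\<close>; the logarithms cancel, and by hypothesis the right-hand sides cancel
  as well. So equality holds at 1 / x, which forces 1 / x = 1.\<close>

lemma young_powr_strict:
  fixes s t p :: real
  assumes "0 \<le> s" "0 \<le> t" "1 < p" and eq: "t powr p + (p - 1) * s powr p = p * s powr (p - 1) * t"
  shows "s = t"
proof (cases "s = 0 \<or> t = 0")
  case True
  then show ?thesis using assms by auto
next
  case False
  then have pos: "0 < s" "0 < t" using assms by auto
  define x where "x = t / s"
  have x: "0 < x" using pos by (simp add: x_def)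
  have S: "0 < s powr p" "s powr (p - 1) = s powr p / s" using pos by (simp_all add: powr_diff)
  have "x powr p + (p - 1) = (t powr p + (p - 1) * s powr p) / s powr p"
    using pos S(1) by (simp add: x_def powr_divide add_divide_distrib)
  also have "\<dots> = p * x"
    unfolding eq S(2) using S(1) by (simp add: x_def)
  finally have xp: "x powr p + (p - 1) = p * x" .
  have 1: "ln (x powr p / x) \<le> x powr p / x - 1" using x by (intro ln_le_minus_one) auto
  have 2: "ln (1 / x) \<le> 1 / x - 1" using x by (intro ln_le_minus_one) auto
  have "ln (x powr p / x) + (p - 1) * ln (1 / x) = 0"
    using x by (simp add: ln_div ln_powr algebra_simps)
  moreover have "(x powr p / x - 1) + (p - 1) * (1 / x - 1) = (x powr p + (p - 1)) / x - p"
    by (simp add: add_divide_distrib algebra_simps diff_divide_distrib)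
  moreover have "(x powr p + (p - 1)) / x - p = 0" using xp x by simp
  moreover have "(p - 1) * ln (1 / x) \<le> (p - 1) * (1 / x - 1)" using 2 assms(3) by (intro mult_left_mono) auto
  ultimately have "(p - 1) * ln (1 / x) = (p - 1) * (1 / x - 1)" using 1 by linarith
  then have "ln (1 / x) = 1 / x - 1" using assms(3) by simp
  then have "1 / x = 1" using x by (intro ln_eq_minus_one) auto
  then show ?thesis using pos by (simp add: x_def)
qed

lemma pgap_ge:
  assumes "1 < p"
  shows "norm b powr p + (p - 1) * norm a powr p - p * norm a powr (p - 1) * norm b \<le> pgap p a b"
  using pflow_inner_le[of p a b] assms by (simp add: pgap_def mult.assoc abs_le_iff)

lemma pgap_nonneg:
  assumes "1 < p"
  shows "0 \<le> pgap p a b"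
  using pgap_ge[OF assms, of b a] young_powr[of "norm a" "norm b" p] assms by simp

text \<open>The gap consists of a defect in Young's inequality for the norms and a defect in the
  Cauchy-Schwarz inequality. The first gives equal norms, the second then equal directions.\<close>

lemma pgap_eq_0_imp:
  assumes p: "1 < p" and z: "pgap p a b = 0"
  shows "a = b"
proof -
  have "norm b powr p + (p - 1) * norm a powr p - p * norm a powr (p - 1) * norm b = 0"
    using pgap_ge[OF p, of b a] young_powr[of "norm a" "norm b" p] p z by simp
  then have "norm b powr p + (p - 1) * norm a powr p = p * norm a powr (p - 1) * norm b" by simp
  then have n: "norm a = norm b"
    by (rule young_powr_strict[OF norm_ge_zero norm_ge_zero p])
  have "p * (pflow p a \<bullet> b) = norm b powr p + (p - 1) * norm a powr p"
    using z by (simp add: pgap_def)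
  also have "\<dots> = p * (norm a powr p)" by (simp add: n left_diff_distrib)
  finally have eq: "pflow p a \<bullet> b = norm a powr p" using p by simp
  show ?thesis
  proof (cases "a = 0")
    case False
    then have "norm a powr (p - 2) * (a \<bullet> b) = norm a powr (p - 2) * (a \<bullet> a)"
      using eq pflow_inner_self[of p a] by (simp add: pflow_def)
    then have "a \<bullet> b = a \<bullet> a" using False by simp
    moreover have "b \<bullet> b = a \<bullet> a" using n by (metis power2_norm_eq_inner)
    ultimately have "(a - b) \<bullet> (a - b) = 0" by (simp add: inner_diff_left inner_diff_right inner_commute)
    then show ?thesis by simp
  qed (use n in simp)
qed

lemma pgap_scale:
  assumes "0 \<le> c"
  shows "pgap p (c *\<^sub>R a) (c *\<^sub>R b) = c powr p * pgap p a b"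
proof -
  have "c * c powr (p - 1) = c powr p" using powr_minus_one_mult[OF assms, of p] by (simp add: mult.commute)
  then show ?thesis
    using assms by (simp add: pgap_def pflow_scale powr_mult algebra_simps)
qed

text \<open>The right-hand side is the monotonicity pairing of the p-Laplacian, which is what
  appears when two equations are tested with the difference of their solutions.\<close>

lemma pgap_sym_sum: "pgap p a b + pgap p b a = p * ((pflow p a - pflow p b) \<bullet> (a - b))"
  by (simp add: pgap_def pflow_inner_self inner_diff_left inner_diff_right algebra_simps)

text \<open>Young's inequality is applied with 2 |b| in place of |b|, so that the mixed term absorbs
  only half of (p - 1) |a|^p; this is the origin of the constants 1 / 2 and
  \<open>2 powr (p - 1)\<close>.\<close>

lemma pgap_coercive:
  assumes p: "1 < p"
  shows "(p - 1) / 2 * norm a powr p \<le> pgap p a b + 2 powr (p - 1) * norm b powr p"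
proof -
  have "p * norm a powr (p - 1) * (2 * norm b) \<le> (p - 1) * norm a powr p + (2 * norm b) powr p"
    using p by (intro young_powr) auto
  moreover have "(2 * norm b) powr p = 2 * (2 powr (p - 1)) * norm b powr p"
    using powr_minus_one_mult[of 2 p] by (simp add: powr_mult)
  moreover have "p * norm a powr (p - 1) * (2 * norm b) = 2 * (p * norm a powr (p - 1) * norm b)" by simp
  moreover have "(p - 1) / 2 * norm a powr p = (p - 1) * norm a powr p / 2" by simp
  moreover have "0 \<le> norm b powr p" by simp
  ultimately show ?thesis using pgap_ge[OF p, of b a] by linarith
qed

lemma continuous_pflow:
  fixes a :: "'b::euclidean_space"
  assumes p: "1 < p"
  shows "isCont (pflow p) a"
proof (cases "a = 0")
  case False
  then have "((\<lambda>x. norm x powr (p - 2) *\<^sub>R x) \<longlongrightarrow> norm a powr (p - 2) *\<^sub>R a) (at a)"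
    by (intro tendsto_scaleR tendsto_powr tendsto_norm tendsto_ident_at tendsto_const) auto
  then show ?thesis by (simp add: isCont_def pflow_def[abs_def])
next
  case True
  have "((\<lambda>x::'b. norm x powr (p - 1)) \<longlongrightarrow> norm (0::'b) powr (p - 1)) (at 0)"
    using p by (intro tendsto_powr2 tendsto_norm tendsto_ident_at tendsto_const) auto
  then have "((\<lambda>x::'b. norm (pflow p x)) \<longlongrightarrow> 0) (at 0)" by (simp add: norm_pflow)
  then have "(pflow p \<longlongrightarrow> 0) (at (0::'b))" by (rule tendsto_norm_zero_cancel)
  then show ?thesis using True by (simp add: isCont_def) (simp add: pflow_def)
qed

lemma continuous_on_pflow: "1 < p \<Longrightarrow> continuous_on S (pflow p)"
  by (intro continuous_at_imp_continuous_on ballI continuous_pflow)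

lemma continuous_on_pgap:
  assumes p: "1 < p"
  shows "continuous_on UNIV (\<lambda>z :: 'b::euclidean_space \<times> 'b. pgap p (fst z) (snd z))"
  unfolding pgap_def
  using p by (intro continuous_on_add continuous_on_diff continuous_on_mult continuous_on_inner continuous_on_const
      continuous_on_powr' continuous_on_norm continuous_on_fst continuous_on_snd continuous_on_id
      continuous_on_compose2[OF continuous_on_pflow[OF p, of UNIV]]) auto

text \<open>For p < 2 and |a| = 1 the gap is of second order in a - b, hence much smaller than |a -
  b|^p for b close to a; the term with e makes up for this, and since e is arbitrary the estimate
  still yields Cauchy sequences when energies are bounded. By homogeneity only the unit sphere of
  pairs matters, and that is compact.\<close>

lemma pgap_controls_norm_diff:
  assumes p: "1 < p" and e: "0 < e"
  obtains C where "0 < C"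
    "\<And>a b :: 'b::euclidean_space. norm (a - b) powr p \<le> e * (norm a powr p + norm b powr p) + C * pgap p a b"
proof -
  define N where "N z = norm (fst z) powr p + norm (snd z) powr p" for z :: "'b \<times> 'b"
  define d where "d z = norm (fst z - snd z) powr p" for z :: "'b \<times> 'b"
  define G where "G z = pgap p (fst z) (snd z)" for z :: "'b \<times> 'b"
  \<comment> \<open>The pairs at which the term with e does not suffice by itself, together with the
    boundary case. The gap is positive on this compact set, because a vanishing gap means a = b and
    then |a - b|^p = 0.\<close>
  define K where "K = sphere (0 :: 'b \<times> 'b) 1 \<inter> {z. e * N z \<le> d z}"
  have cN: "continuous_on UNIV N" and cd: "continuous_on UNIV d"
    unfolding N_def[abs_def] d_def[abs_def]
    using p by (auto intro!: continuous_on_add continuous_on_powr' continuous_on_norm continuous_on_fst continuous_on_snd continuous_on_id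
      continuous_on_diff continuous_on_const)
  have "closed {z. e * N z \<le> d z}"
    by (intro closed_Collect_le continuous_on_mult continuous_on_const cN cd)
  then have cK: "compact K" unfolding K_def by (intro compact_Int_closed) auto
  have "\<exists>m>0. \<forall>z\<in>K. m \<le> G z"
  proof (cases "K = {}")
    case False
    have "continuous_on K G" unfolding G_def[abs_def] using continuous_on_pgap[OF p] by (rule continuous_on_subset) simp
    then obtain z where z: "z \<in> K" "\<And>y. y \<in> K \<Longrightarrow> G z \<le> G y"
      using continuous_attains_inf[OF cK False] by blast
    have "G z \<noteq> 0"
    proof
      assume "G z = 0"
      then have "fst z = snd z" unfolding G_def by (rule pgap_eq_0_imp[OF p])
      then have "d z = 0" by (simp add: d_def)
      then have "e * N z \<le> 0" using z(1) by (simp add: K_def)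
      moreover have "0 \<le> N z" by (simp add: N_def)
      ultimately have "N z = 0" using e by (simp add: mult_le_0_iff)
      then have "z = 0" by (auto simp: N_def prod_eq_iff add_nonneg_eq_0_iff)
      then show False using z(1) by (simp add: K_def)
    qed
    then have "0 < G z" using pgap_nonneg[OF p] by (simp add: G_def order_less_le)
    then show ?thesis using z(2) by blast
  qed (auto intro: exI[of _ 1])
  then obtain m where m: "0 < m" "\<And>z. z \<in> K \<Longrightarrow> m \<le> G z" by blast
  have d_le: "d z \<le> 2 powr p * 2" if "norm z = 1" for z
  proof -
    have "d z \<le> 2 powr p * (norm (fst z) powr p + norm (snd z) powr p)"
      unfolding d_def using p by (intro norm_add_powr_le) auto
    also have "\<dots> \<le> 2 powr p * (1 + 1)"
      using norm_fst_le[of "fst z" "snd z"] norm_snd_le[of "snd z" "fst z"] that p by (intro mult_left_mono add_mono powr_le1) auto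
    finally show ?thesis by simp
  qed
  define C where "C = 2 powr p * 2 / m"
  have C: "0 < C" using m by (simp add: C_def)
  have unit: "d z \<le> e * N z + C * G z" if "norm z = 1" for z
  proof (cases "z \<in> K")
    case True
    have "d z \<le> C * m" using d_le[OF that] m by (simp add: C_def)
    also have "\<dots> \<le> C * G z" using C m(2)[OF True] by (intro mult_left_mono) auto
    also have "\<dots> \<le> e * N z + C * G z" using e by (simp add: N_def)
    finally show ?thesis .
  next
    case False
    then have "d z \<le> e * N z" using that by (auto simp: K_def)
    moreover have "0 \<le> C * G z" unfolding G_def using C by (intro mult_nonneg_nonneg pgap_nonneg[OF p]) simp
    ultimately show ?thesis by linarith
  qed
  show ?thesis
  proof (rule that[OF C])
    fix a b :: 'b
    show "norm (a - b) powr p \<le> e * (norm a powr p + norm b powr p) + C * pgap p a b"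
    proof (cases "(a, b) = 0")
      case True
      then show ?thesis using p by (simp add: zero_prod_def pgap_def)
    next
      case False
      define c where "c = norm (a, b)"
      have c: "0 < c" using False by (simp add: c_def)
      define z where "z = (1 / c) *\<^sub>R (a, b)"
      have "norm z = 1" unfolding z_def norm_scaleR using c by (simp add: c_def[symmetric])
      then have "d z \<le> e * N z + C * G z" by (rule unit)
      then have "c powr p * d z \<le> c powr p * (e * N z + C * G z)" by (intro mult_left_mono) auto
      moreover have a: "a = c *\<^sub>R fst z" "b = c *\<^sub>R snd z" using c by (auto simp: z_def)
      have "norm (a - b) powr p = c powr p * d z" "norm a powr p = c powr p * norm (fst z) powr p"
        "norm b powr p = c powr p * norm (snd z) powr p"
        using c unfolding a d_def scaleR_diff_right[symmetric] by (simp_all add: powr_mult)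
      moreover have "pgap p a b = c powr p * G z"
        using c unfolding a G_def by (intro pgap_scale) simp
      ultimately show ?thesis by (simp add: N_def algebra_simps)
    qed
  qed
qed

text \<open>The difference splits into a k times (f k - g), small because the factors a k are
  bounded, and (a k - b) times g, which tends to 0 by dominated convergence.\<close>

lemma Lp_scaleR_tendsto:
  fixes a :: "nat \<Rightarrow> 'm \<Rightarrow> real" and f :: "nat \<Rightarrow> 'm \<Rightarrow> 'b::euclidean_space"
  assumes a: "\<And>k. a k \<in> borel_measurable M" "b \<in> borel_measurable M" "\<And>k x. \<bar>a k x\<bar> \<le> K" "AE x in M. (\<lambda>k. a k x) \<longlonglongrightarrow> b x"
    and f: "\<And>k. in_Lp r M (f k)" "in_Lp r M g" "(\<lambda>k. Lpi r M (\<lambda>x. f k x - g x)) \<longlonglongrightarrow> 0" and r: "0 < r"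
  shows "\<And>k. in_Lp r M (\<lambda>x. a k x *\<^sub>R f k x)" "in_Lp r M (\<lambda>x. b x *\<^sub>R g x)"
    "(\<lambda>k. Lpi r M (\<lambda>x. a k x *\<^sub>R f k x - b x *\<^sub>R g x)) \<longlonglongrightarrow> 0"
proof -
  note [measurable] = a(1,2) in_Lp_measurable[OF f(1)] in_Lp_measurable[OF f(2)]
  have r0: "0 \<le> r" using r by simp
  have K: "0 \<le> K" using a(3)[of 0 undefined] by linarith
  have scaled: "in_Lp r M (\<lambda>x. a k x *\<^sub>R h x)" "Lpi r M (\<lambda>x. a k x *\<^sub>R h x) \<le> K powr r * Lpi r M h"
    if h: "in_Lp r M h" for k and h :: "'m \<Rightarrow> 'b"
  proof -
    note [measurable] = in_Lp_measurable[OF h]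
    have le: "norm (a k x *\<^sub>R h x) \<le> norm (K *\<^sub>R h x)" for x using a(3)[of k x] K by (simp add: mult_right_mono)
    show 1: "in_Lp r M (\<lambda>x. a k x *\<^sub>R h x)"
      by (rule in_Lp_bound[OF in_Lp_scaleR(1)[OF h, of K] _ AE_I2[OF le] r0]) measurable
    have "Lpi r M (\<lambda>x. a k x *\<^sub>R h x) \<le> Lpi r M (\<lambda>x. K *\<^sub>R h x)"
      unfolding Lpi_def using le r0
      by (intro integral_mono in_Lp_integrable[OF 1] in_Lp_integrable[OF in_Lp_scaleR(1)[OF h]] powr_mono2) auto
    then show "Lpi r M (\<lambda>x. a k x *\<^sub>R h x) \<le> K powr r * Lpi r M h"
      using in_Lp_scaleR(2)[OF h, of K] K by simp
  qed
  show af: "in_Lp r M (\<lambda>x. a k x *\<^sub>R f k x)" for k by (rule scaled(1)[OF f(1)])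
  have agm: "(\<lambda>x. a k x *\<^sub>R g x) \<in> borel_measurable M" for k by measurable
  have bgm: "(\<lambda>x. b x *\<^sub>R g x) \<in> borel_measurable M" by measurable
  have "AE x in M. (\<lambda>k. a k x *\<^sub>R g x) \<longlonglongrightarrow> b x *\<^sub>R g x"
    using a(4) by eventually_elim (rule tendsto_scaleR[OF _ tendsto_const])
  note dc = Lp_dominated_convergence[OF agm bgm in_Lp_scaleR(1)[OF f(2), of K] r this AE_I2]
  have le: "norm (a k x *\<^sub>R g x) \<le> norm (K *\<^sub>R g x)" for k x using a(3)[of k x] K by (simp add: mult_right_mono)
  show bg: "in_Lp r M (\<lambda>x. b x *\<^sub>R g x)" by (rule dc(1)[OF le])
  have 2: "(\<lambda>k. Lpi r M (\<lambda>x. a k x *\<^sub>R g x - b x *\<^sub>R g x)) \<longlonglongrightarrow> 0" by (rule dc(2)[OF le])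
  have D: "in_Lp r M (\<lambda>x. f k x - g x)" for k by (rule in_Lp_diff(1)[OF f(1,2) r0])
  have "(\<lambda>k. 2 powr r * (K powr r * Lpi r M (\<lambda>x. f k x - g x) + Lpi r M (\<lambda>x. a k x *\<^sub>R g x - b x *\<^sub>R g x))) \<longlonglongrightarrow> 2 powr r * (K powr r * 0 + 0)"
    by (intro tendsto_mult_left tendsto_add f(3) 2)
  then have lim: "(\<lambda>k. 2 powr r * (K powr r * Lpi r M (\<lambda>x. f k x - g x) + Lpi r M (\<lambda>x. a k x *\<^sub>R g x - b x *\<^sub>R g x))) \<longlonglongrightarrow> 0" by simp
  have "Lpi r M (\<lambda>x. a k x *\<^sub>R f k x - b x *\<^sub>R g x) \<le> 2 powr r * (K powr r * Lpi r M (\<lambda>x. f k x - g x) + Lpi r M (\<lambda>x. a k x *\<^sub>R g x - b x *\<^sub>R g x))" for k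
  proof -
    have "Lpi r M (\<lambda>x. a k x *\<^sub>R f k x - b x *\<^sub>R g x) \<le> 2 powr r * (Lpi r M (\<lambda>x. a k x *\<^sub>R f k x - a k x *\<^sub>R g x) + Lpi r M (\<lambda>x. a k x *\<^sub>R g x - b x *\<^sub>R g x))"
      by (rule Lpi_triangle[OF af scaled(1)[OF f(2)] bg r0])
    also have "\<dots> \<le> 2 powr r * (K powr r * Lpi r M (\<lambda>x. f k x - g x) + Lpi r M (\<lambda>x. a k x *\<^sub>R g x - b x *\<^sub>R g x))"
      using scaled(2)[OF D, of k k] by (intro mult_left_mono add_mono) (simp_all add: scaleR_diff_right)
    finally show ?thesis .
  qed
  then show "(\<lambda>k. Lpi r M (\<lambda>x. a k x *\<^sub>R f k x - b x *\<^sub>R g x)) \<longlonglongrightarrow> 0"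
    by (intro tendsto_sandwich[OF _ _ tendsto_const lim] always_eventually allI Lpi_nonneg) auto
qed

section \<open>Chain and product rules by polynomial approximation\<close>

text \<open>Weierstrass is applied to the derivative and the polynomial is integrated; this controls
  function and derivative at once. The value at 0 is kept exactly, which later preserves vanishing
  outside a compact support.\<close>

lemma polynomial_C1_approx:
  fixes R R' :: "real \<Rightarrow> real"
  assumes R: "\<And>t. (R has_real_derivative R' t) (at t)" "continuous_on UNIV R'" and e: "0 < e" and m: "0 < m"
  obtains P P' where "real_polynomial_function P" "\<And>t. (P has_real_derivative P' t) (at t)" "continuous_on UNIV P'"
    "P 0 = R 0" "\<And>t. \<bar>t\<bar> \<le> m \<Longrightarrow> \<bar>P t - R t\<bar> \<le> e" "\<And>t. \<bar>t\<bar> \<le> m \<Longrightarrow> \<bar>P' t - R' t\<bar> \<le> e"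
proof -
  \<comment> \<open>Integrating from 0 to a point at distance at most m multiplies the error of the
    derivative by at most m.\<close>
  define d where "d = min e (e / m)"
  have d: "0 < d" "d \<le> e" "d * m \<le> e" using e m by (auto simp: d_def min_def field_simps)
  obtain g where g: "real_polynomial_function g" "\<And>t. t \<in> {-m..m} \<Longrightarrow> \<bar>R' t - g t\<bar> < d"
    by (rule Stone_Weierstrass_real_polynomial_function[of "{-m..m}" R' d]) (use d R(2) in \<open>auto intro: continuous_on_subset\<close>)
  obtain a n where an: "g = (\<lambda>t. \<Sum>i\<le>n. a i * t ^ i)"
    using g(1) real_polynomial_function_iff_sum by blast
  define P where "P t = R 0 + (\<Sum>i\<le>n. a i / real (Suc i) * t ^ Suc i)" for t
  have P: "(P has_real_derivative g t) (at t)" for t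
  proof -
    have "((\<lambda>t. a i / real (Suc i) * t ^ Suc i) has_real_derivative a i * t ^ i) (at t)" for i
      using DERIV_cmult[OF DERIV_pow[of "Suc i" t], of "a i / real (Suc i)"] by simp
    then have "((\<lambda>t. R 0 + (\<Sum>i\<le>n. a i / real (Suc i) * t ^ Suc i)) has_real_derivative 0 + (\<Sum>i\<le>n. a i * t ^ i)) (at t)"
      by (intro DERIV_add DERIV_const DERIV_sum)
    then show ?thesis by (simp add: P_def[abs_def] an)
  qed
  show ?thesis
  proof (rule that[of P g])
    show "real_polynomial_function P"
      unfolding P_def[abs_def]
      by (intro real_polynomial_function.intros(2,3,4) real_polynomial_function_sum real_polynomial_function_power
          real_polynomial_function.intros(1)[OF bounded_linear_ident]) auto
    show "(P has_real_derivative g t) (at t)" for t by (rule P)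
    show "continuous_on UNIV g" unfolding an by (intro continuous_intros)
    show "P 0 = R 0" by (simp add: P_def)
    show "\<bar>g t - R' t\<bar> \<le> e" if "\<bar>t\<bar> \<le> m" for t
      using g(2)[of t] that d(2) by (simp add: abs_le_iff abs_less_iff)
    show "\<bar>P t - R t\<bar> \<le> e" if "\<bar>t\<bar> \<le> m" for t
    proof -
      have "norm ((P t - R t) - (P 0 - R 0)) \<le> d * norm (t - 0)"
      proof (rule field_differentiable_bound[of "{-m..m}" "\<lambda>t. P t - R t" "\<lambda>t. g t - R' t"])
        show "((\<lambda>t. P t - R t) has_field_derivative g s - R' s) (at s within {-m..m})" for s
          by (intro DERIV_diff has_field_derivative_at_within[OF P] has_field_derivative_at_within[OF R(1)])
        show "norm (g s - R' s) \<le> d" if "s \<in> {-m..m}" for s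
          using g(2)[OF that] by (simp add: abs_le_iff abs_less_iff)
      qed (use that m in auto)
      also have "\<dots> \<le> d * m" using that d by (intro mult_left_mono) auto
      finally show ?thesis using d(3) by (simp add: P_def)
    qed
  qed
qed

lemma polynomial_C1_approx_sequence:
  fixes R R' :: "real \<Rightarrow> real"
  assumes R: "\<And>t. (R has_real_derivative R' t) (at t)" "continuous_on UNIV R'" and m: "0 < m"
  shows "\<exists>P P'. \<forall>n::nat. real_polynomial_function (P n) \<and> (\<forall>t. (P n has_real_derivative P' n t) (at t)) \<and>
    continuous_on UNIV (P' n) \<and> P n 0 = R 0 \<and> (\<forall>t. \<bar>t\<bar> \<le> m \<longrightarrow> \<bar>P n t - R t\<bar> \<le> inverse (real (Suc n))) \<and>
    (\<forall>t. \<bar>t\<bar> \<le> m \<longrightarrow> \<bar>P' n t - R' t\<bar> \<le> inverse (real (Suc n)))"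
proof -
  define \<Phi> where "\<Phi> n P P' \<longleftrightarrow> real_polynomial_function P \<and> (\<forall>t. (P has_real_derivative P' t) (at t)) \<and>
    continuous_on UNIV P' \<and> P 0 = R 0 \<and> (\<forall>t. \<bar>t\<bar> \<le> m \<longrightarrow> \<bar>P t - R t\<bar> \<le> inverse (real (Suc n))) \<and>
    (\<forall>t. \<bar>t\<bar> \<le> m \<longrightarrow> \<bar>P' t - R' t\<bar> \<le> inverse (real (Suc n)))" for n :: nat and P P' :: "real \<Rightarrow> real"
  have "\<exists>P P'. \<Phi> n P P'" for n
  proof (rule polynomial_C1_approx[OF R _ m])
    show "0 < inverse (real (Suc n))" by simp
    fix P P' assume "real_polynomial_function P" "\<And>t. (P has_real_derivative P' t) (at t)" "continuous_on UNIV P'"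
      "P 0 = R 0" "\<And>t. \<bar>t\<bar> \<le> m \<Longrightarrow> \<bar>P t - R t\<bar> \<le> inverse (real (Suc n))" "\<And>t. \<bar>t\<bar> \<le> m \<Longrightarrow> \<bar>P' t - R' t\<bar> \<le> inverse (real (Suc n))"
    then show "\<exists>P P'. \<Phi> n P P'" unfolding \<Phi>_def by blast
  qed
  then have "\<exists>P P'. \<forall>n. \<Phi> n (P n) (P' n)" by metis
  then show ?thesis unfolding \<Phi>_def .
qed

context bounded_open
begin

lemma p_bounds: "0 \<le> p" "1 \<le> p" "0 < p"
  using p_gt_1 by auto

lemma test_Lp: "\<phi> \<in> test_functions \<Omega> \<Longrightarrow> in_Lp p M \<phi>" "\<phi> \<in> test_functions \<Omega> \<Longrightarrow> in_Lp p M (grad \<phi>)"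
  using test_in_Lp p_bounds(1) by blast+

lemma sobolev0_test: "\<phi> \<in> test_functions \<Omega> \<Longrightarrow> sobolev0 \<Omega> p \<phi> (grad \<phi>)"
  using p_bounds by (auto simp: sobolev0_def test_Lp Lpi_def intro!: exI[of _ "\<lambda>_. \<phi>"])

lemma sobolev0_closed:
  assumes u: "in_Lp p M u" "in_Lp p M G"
    and approx: "\<And>e. 0 < e \<Longrightarrow> \<exists>v H. sobolev0 \<Omega> p v H \<and> Lpi p M (\<lambda>x. u x - v x) < e \<and> Lpi p M (\<lambda>x. G x - H x) < e"
  shows "sobolev0 \<Omega> p u G"
proof -
  define e where "e n = inverse (real (Suc n))" for n
  have e: "0 < e n" for n by (simp add: e_def)
  have "\<exists>\<phi>. \<phi> \<in> test_functions \<Omega> \<and> Lpi p M (\<lambda>x. u x - \<phi> x) \<le> 2 powr p * 2 * e n \<and> Lpi p M (\<lambda>x. G x - grad \<phi> x) \<le> 2 powr p * 2 * e n" for n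
  proof -
    obtain v H where v: "sobolev0 \<Omega> p v H" "Lpi p M (\<lambda>x. u x - v x) < e n" "Lpi p M (\<lambda>x. G x - H x) < e n"
      using approx[OF e] by blast
    obtain \<phi> where \<phi>: "\<phi> \<in> test_functions \<Omega>" "Lpi p M (\<lambda>x. v x - \<phi> x) < e n" "Lpi p M (\<lambda>x. H x - grad \<phi> x) < e n"
      by (rule sobolev0_approx[OF v(1) e])
    have "Lpi p M (\<lambda>x. u x - \<phi> x) \<le> 2 powr p * (Lpi p M (\<lambda>x. u x - v x) + Lpi p M (\<lambda>x. v x - \<phi> x))"
      by (rule Lpi_triangle[OF u(1) sobolev0_in_Lp(1)[OF v(1)] test_Lp(1)[OF \<phi>(1)] p_bounds(1)])
    also have "\<dots> \<le> 2 powr p * (e n + e n)" using v \<phi> by (intro mult_left_mono add_mono) auto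
    finally have 1: "Lpi p M (\<lambda>x. u x - \<phi> x) \<le> 2 powr p * 2 * e n" by simp
    have "Lpi p M (\<lambda>x. G x - grad \<phi> x) \<le> 2 powr p * (Lpi p M (\<lambda>x. G x - H x) + Lpi p M (\<lambda>x. H x - grad \<phi> x))"
      by (rule Lpi_triangle[OF u(2) sobolev0_in_Lp(2)[OF v(1)] test_Lp(2)[OF \<phi>(1)] p_bounds(1)])
    also have "\<dots> \<le> 2 powr p * (e n + e n)" using v \<phi> by (intro mult_left_mono add_mono) auto
    finally have 2: "Lpi p M (\<lambda>x. G x - grad \<phi> x) \<le> 2 powr p * 2 * e n" by simp
    from \<phi>(1) 1 2 show ?thesis by blast
  qed
  then obtain \<phi> where \<phi>: "\<And>n. \<phi> n \<in> test_functions \<Omega>"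
    and b: "\<And>n. Lpi p M (\<lambda>x. u x - \<phi> n x) \<le> 2 powr p * 2 * e n" "\<And>n. Lpi p M (\<lambda>x. G x - grad (\<phi> n) x) \<le> 2 powr p * 2 * e n"
    by metis
  have "e \<longlonglongrightarrow> 0" unfolding e_def[abs_def] by (rule LIMSEQ_inverse_real_of_nat)
  then have z: "(\<lambda>n. 2 powr p * 2 * e n) \<longlonglongrightarrow> 0" by (rule tendsto_mult_right_zero)
  have "(\<lambda>n. Lpi p M (\<lambda>x. u x - \<phi> n x)) \<longlonglongrightarrow> 0" "(\<lambda>n. Lpi p M (\<lambda>x. G x - grad (\<phi> n) x)) \<longlonglongrightarrow> 0"
    by (rule tendsto_sandwich[OF always_eventually always_eventually tendsto_const z]; simp add: b Lpi_nonneg)+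
  then show ?thesis unfolding sobolev0_def using u \<phi> by blast
qed

lemma sobolev0_limit:
  assumes v: "\<And>k::nat. sobolev0 \<Omega> p (v k) (H k)" and u: "in_Lp p M u" "in_Lp p M G"
    and lim: "(\<lambda>k. Lpi p M (\<lambda>x. v k x - u x)) \<longlonglongrightarrow> 0" "(\<lambda>k. Lpi p M (\<lambda>x. H k x - G x)) \<longlonglongrightarrow> 0"
  shows "sobolev0 \<Omega> p u G"
proof (rule sobolev0_closed[OF u])
  fix e :: real assume e: "0 < e"
  have "\<forall>\<^sub>F k in sequentially. Lpi p M (\<lambda>x. v k x - u x) < e \<and> Lpi p M (\<lambda>x. H k x - G x) < e"
    using order_tendstoD(2)[OF lim(1) e] order_tendstoD(2)[OF lim(2) e] by (rule eventually_conj)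
  then obtain k where "Lpi p M (\<lambda>x. v k x - u x) < e" "Lpi p M (\<lambda>x. H k x - G x) < e"
    using eventually_happens by force
  then show "\<exists>v H. sobolev0 \<Omega> p v H \<and> Lpi p M (\<lambda>x. u x - v x) < e \<and> Lpi p M (\<lambda>x. G x - H x) < e"
    using v Lpi_diff_commute[of p M u "v k"] Lpi_diff_commute[of p M G "H k"] by metis
qed

lemma sobolev0_scale:
  assumes "sobolev0 \<Omega> p u G"
  shows "sobolev0 \<Omega> p (\<lambda>x. c * u x) (\<lambda>x. c *\<^sub>R G x)"
proof -
  obtain \<phi> where u: "in_Lp p M u" "in_Lp p M G" and \<phi>: "\<And>k::nat. \<phi> k \<in> test_functions \<Omega>"
    and lim: "(\<lambda>k. Lpi p M (\<lambda>x. u x - \<phi> k x)) \<longlonglongrightarrow> 0" "(\<lambda>k. Lpi p M (\<lambda>x. G x - grad (\<phi> k) x)) \<longlonglongrightarrow> 0"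
    using assms unfolding sobolev0_def by blast
  note u' = in_Lp_scaleR[OF u(1), of c, unfolded real_scaleR_def] in_Lp_scaleR[OF u(2), of c]
  show ?thesis unfolding sobolev0_def
  proof (intro conjI exI[of _ "\<lambda>k x. c * \<phi> k x"] allI)
    show "(\<lambda>x. c * \<phi> k x) \<in> test_functions \<Omega>" for k by (rule test_function_scale[OF \<phi>])
    have "Lpi p M (\<lambda>x. c * u x - c * \<phi> k x) = \<bar>c\<bar> powr p * Lpi p M (\<lambda>x. u x - \<phi> k x)" for k
      using in_Lp_scaleR(2)[OF in_Lp_diff(1)[OF u(1) test_Lp(1)[OF \<phi>] p_bounds(1)], of c] by (simp add: right_diff_distrib)
    then show "(\<lambda>k. Lpi p M (\<lambda>x. c * u x - c * \<phi> k x)) \<longlonglongrightarrow> 0"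
      using tendsto_mult_right_zero[OF lim(1)] by simp
    have "Lpi p M (\<lambda>x. c *\<^sub>R G x - grad (\<lambda>x. c * \<phi> k x) x) = \<bar>c\<bar> powr p * Lpi p M (\<lambda>x. G x - grad (\<phi> k) x)" for k
      using in_Lp_scaleR(2)[OF in_Lp_diff(1)[OF u(2) test_Lp(2)[OF \<phi>] p_bounds(1)], of c]
      by (simp add: scaleR_diff_right C1_grad_eq[OF C1_scale[OF test_function_C1[OF \<phi>]]])
    then show "(\<lambda>k. Lpi p M (\<lambda>x. c *\<^sub>R G x - grad (\<lambda>x. c * \<phi> k x) x)) \<longlonglongrightarrow> 0"
      using tendsto_mult_right_zero[OF lim(2)] by simp
  qed (fact u')+
qed

lemma sobolev0_add:
  assumes "sobolev0 \<Omega> p u G" "sobolev0 \<Omega> p v H"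
  shows "sobolev0 \<Omega> p (\<lambda>x. u x + v x) (\<lambda>x. G x + H x)"
proof (rule sobolev0_closed)
  note u = sobolev0_in_Lp[OF assms(1)] and v = sobolev0_in_Lp[OF assms(2)]
  show "in_Lp p M (\<lambda>x. u x + v x)" "in_Lp p M (\<lambda>x. G x + H x)"
    by (intro in_Lp_add u v p_bounds)+
  fix e :: real assume e: "0 < e"
  define d where "d = e / (2 powr p * 2) / 2"
  have d: "0 < d" "2 powr p * (d + d) < e" using e by (auto simp: d_def)
  obtain \<phi> where \<phi>: "\<phi> \<in> test_functions \<Omega>" "Lpi p M (\<lambda>x. u x - \<phi> x) < d" "Lpi p M (\<lambda>x. G x - grad \<phi> x) < d"
    by (rule sobolev0_approx[OF assms(1) d(1)])
  obtain \<psi> where \<psi>: "\<psi> \<in> test_functions \<Omega>" "Lpi p M (\<lambda>x. v x - \<psi> x) < d" "Lpi p M (\<lambda>x. H x - grad \<psi> x) < d"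
    by (rule sobolev0_approx[OF assms(2) d(1)])
  have "Lpi p M (\<lambda>x. (u x - \<phi> x) + (v x - \<psi> x)) \<le> 2 powr p * (Lpi p M (\<lambda>x. u x - \<phi> x) + Lpi p M (\<lambda>x. v x - \<psi> x))"
    by (intro in_Lp_add in_Lp_diff u v test_Lp \<phi> \<psi> p_bounds)
  also have "\<dots> \<le> 2 powr p * (d + d)" using \<phi> \<psi> by (intro mult_left_mono add_mono) auto
  finally have 1: "Lpi p M (\<lambda>x. (u x + v x) - (\<phi> x + \<psi> x)) < e" using d(2) by (simp add: algebra_simps)
  have "Lpi p M (\<lambda>x. (G x - grad \<phi> x) + (H x - grad \<psi> x)) \<le> 2 powr p * (Lpi p M (\<lambda>x. G x - grad \<phi> x) + Lpi p M (\<lambda>x. H x - grad \<psi> x))"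
    by (intro in_Lp_add in_Lp_diff u v test_Lp \<phi> \<psi> p_bounds)
  also have "\<dots> \<le> 2 powr p * (d + d)" using \<phi> \<psi> by (intro mult_left_mono add_mono) auto
  finally have 2: "Lpi p M (\<lambda>x. (G x + H x) - grad (\<lambda>x. \<phi> x + \<psi> x) x) < e"
    using d(2) by (simp add: algebra_simps C1_grad_eq[OF C1_add[OF test_function_C1[OF \<phi>(1)] test_function_C1[OF \<psi>(1)]]])
  show "\<exists>w K. sobolev0 \<Omega> p w K \<and> Lpi p M (\<lambda>x. (u x + v x) - w x) < e \<and> Lpi p M (\<lambda>x. (G x + H x) - K x) < e"
    using sobolev0_test[OF test_function_add[OF \<phi>(1) \<psi>(1)]] 1 2 by blast
qed

lemma sobolev0_diff:
  "sobolev0 \<Omega> p u G \<Longrightarrow> sobolev0 \<Omega> p v H \<Longrightarrow> sobolev0 \<Omega> p (\<lambda>x. u x - v x) (\<lambda>x. G x - H x)"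
  using sobolev0_add[of u G "\<lambda>x. (-1) * v x" "\<lambda>x. (-1) *\<^sub>R H x"] sobolev0_scale[of v H "-1"] by simp

lemma sobolev0_AE_approx:
  assumes "sobolev0 \<Omega> p u G"
  obtains \<phi> where "\<And>k::nat. \<phi> k \<in> test_functions \<Omega>"
    "(\<lambda>k. Lpi p M (\<lambda>x. \<phi> k x - u x)) \<longlonglongrightarrow> 0" "(\<lambda>k. Lpi p M (\<lambda>x. grad (\<phi> k) x - G x)) \<longlonglongrightarrow> 0"
    "AE x in M. (\<lambda>k. \<phi> k x) \<longlonglongrightarrow> u x" "AE x in M. (\<lambda>k. grad (\<phi> k) x) \<longlonglongrightarrow> G x"
proof -
  obtain \<phi> where u: "in_Lp p M u" "in_Lp p M G" and \<phi>: "\<And>k::nat. \<phi> k \<in> test_functions \<Omega>"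
    and lim': "(\<lambda>k. Lpi p M (\<lambda>x. u x - \<phi> k x)) \<longlonglongrightarrow> 0" "(\<lambda>k. Lpi p M (\<lambda>x. G x - grad (\<phi> k) x)) \<longlonglongrightarrow> 0"
    using assms unfolding sobolev0_def by blast
  have lim: "(\<lambda>k. Lpi p M (\<lambda>x. \<phi> k x - u x)) \<longlonglongrightarrow> 0" "(\<lambda>k. Lpi p M (\<lambda>x. grad (\<phi> k) x - G x)) \<longlonglongrightarrow> 0"
    using lim'(1)[unfolded Lpi_diff_commute[of p M u]] lim'(2)[unfolded Lpi_diff_commute[of p M G]] .
  obtain s where s: "strict_mono (s :: nat \<Rightarrow> nat)" "AE x in M. (\<lambda>k. \<phi> (s k) x) \<longlonglongrightarrow> u x"
    by (rule Lp_AE_subseq[OF test_Lp(1)[OF \<phi>] u(1) p_bounds(3) lim(1)])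
  have lim2: "(\<lambda>k. Lpi p M (\<lambda>x. grad (\<phi> (s k)) x - G x)) \<longlonglongrightarrow> 0" "(\<lambda>k. Lpi p M (\<lambda>x. \<phi> (s k) x - u x)) \<longlonglongrightarrow> 0"
    using LIMSEQ_subseq_LIMSEQ[OF lim(1) s(1)] LIMSEQ_subseq_LIMSEQ[OF lim(2) s(1)] by (simp_all add: o_def)
  obtain t where t: "strict_mono (t :: nat \<Rightarrow> nat)" "AE x in M. (\<lambda>k. grad (\<phi> (s (t k))) x) \<longlonglongrightarrow> G x"
    by (rule Lp_AE_subseq[OF test_Lp(2)[OF \<phi>] u(2) p_bounds(3) lim2(1)])
  show ?thesis
  proof (rule that[of "\<lambda>k. \<phi> (s (t k))"])
    show "AE x in M. (\<lambda>k. \<phi> (s (t k)) x) \<longlonglongrightarrow> u x"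
      using s(2) by eventually_elim (use LIMSEQ_subseq_LIMSEQ[OF _ t(1)] in \<open>auto simp: o_def\<close>)
    show "(\<lambda>k. Lpi p M (\<lambda>x. \<phi> (s (t k)) x - u x)) \<longlonglongrightarrow> 0" "(\<lambda>k. Lpi p M (\<lambda>x. grad (\<phi> (s (t k))) x - G x)) \<longlonglongrightarrow> 0"
      using LIMSEQ_subseq_LIMSEQ[OF lim2(1) t(1)] LIMSEQ_subseq_LIMSEQ[OF lim2(2) t(1)] by (simp_all add: o_def)
  qed (fact \<phi> t(2))+
qed

text \<open>R and H are replaced by polynomials that are close in C1 on [-m, m], an interval
  containing all values of \<phi> and \<psi>. Polynomials of test functions are smooth, and since
  they agree with R and H at 0 the product still vanishes where \<phi> and \<psi> both do, so it is
  a test function.\<close>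

lemma sobolev0_test_product:
  assumes \<phi>: "\<phi> \<in> test_functions \<Omega>" and \<psi>: "\<psi> \<in> test_functions \<Omega>"
    and R: "\<And>t. (R has_real_derivative R' t) (at t)" "continuous_on UNIV R'"
    and H: "\<And>t. (H has_real_derivative H' t) (at t)" "continuous_on UNIV H'"
    and zero: "R 0 * H 0 = 0"
  shows "sobolev0 \<Omega> p (\<lambda>x. R (\<phi> x) * H (\<psi> x))
    (\<lambda>x. (R (\<phi> x) * H' (\<psi> x)) *\<^sub>R grad \<psi> x + (H (\<psi> x) * R' (\<phi> x)) *\<^sub>R grad \<phi> x)"
proof -
  obtain K where K: "compact K" "K \<subseteq> \<Omega>" "\<And>x. x \<notin> K \<Longrightarrow> \<phi> x = 0"
    by (rule test_functionE[OF \<phi>]) blast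
  obtain L where L: "compact L" "L \<subseteq> \<Omega>" "\<And>x. x \<notin> L \<Longrightarrow> \<psi> x = 0"
    by (rule test_functionE[OF \<psi>]) blast
  note C\<phi> = test_function_C1[OF \<phi>] and C\<psi> = test_function_C1[OF \<psi>]
  obtain B1 where B1: "0 \<le> B1" "\<And>x. norm (grad \<phi> x) \<le> B1" "\<And>x. \<bar>\<phi> x\<bar> \<le> B1"
    by (rule C1_compact_support_bounds[OF C\<phi> K(1,3)]) blast+
  obtain B2 where B2: "0 \<le> B2" "\<And>x. norm (grad \<psi> x) \<le> B2" "\<And>x. \<bar>\<psi> x\<bar> \<le> B2"
    by (rule C1_compact_support_bounds[OF C\<psi> L(1,3)]) blast+
  define m where "m = B1 + B2 + 1"
  have m: "0 < m" "\<And>x. \<bar>\<phi> x\<bar> \<le> m" "\<And>x. \<bar>\<psi> x\<bar> \<le> m" "\<And>x. norm (grad \<phi> x) \<le> m" "\<And>x. norm (grad \<psi> x) \<le> m"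
  proof -
    show "0 < m" using B1(1) B2(1) by (simp add: m_def)
    fix x
    show "\<bar>\<phi> x\<bar> \<le> m" "\<bar>\<psi> x\<bar> \<le> m" "norm (grad \<phi> x) \<le> m" "norm (grad \<psi> x) \<le> m"
      using B1(1) B2(1) B1(2)[of x] B1(3)[of x] B2(2)[of x] B2(3)[of x] unfolding m_def by linarith+
  qed
  have Rc: "continuous_on UNIV R" and Hc: "continuous_on UNIV H"
    using R(1) H(1) by (meson DERIV_continuous continuous_at_imp_continuous_on)+
  have bd: "\<exists>B. \<forall>t. \<bar>t\<bar> \<le> m \<longrightarrow> \<bar>f t\<bar> \<le> B" if "continuous_on UNIV f" for f :: "real \<Rightarrow> real"
  proof -
    have "bounded (f ` {-m..m})"
      by (intro compact_imp_bounded compact_continuous_image continuous_on_subset[OF that]) auto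
    then obtain a where "\<forall>y\<in>f ` {-m..m}. norm y \<le> a" unfolding bounded_iff by blast
    then show ?thesis by (intro exI[of _ a]) (auto simp: abs_le_iff)
  qed
  obtain b1 b2 b3 b4 where b: "\<And>t. \<bar>t\<bar> \<le> m \<Longrightarrow> \<bar>R t\<bar> \<le> b1" "\<And>t. \<bar>t\<bar> \<le> m \<Longrightarrow> \<bar>R' t\<bar> \<le> b2"
     "\<And>t. \<bar>t\<bar> \<le> m \<Longrightarrow> \<bar>H t\<bar> \<le> b3" "\<And>t. \<bar>t\<bar> \<le> m \<Longrightarrow> \<bar>H' t\<bar> \<le> b4"
    using bd[OF Rc] bd[OF R(2)] bd[OF Hc] bd[OF H(2)] by blast
  \<comment> \<open>The extra 1 leaves room for the polynomial approximations, whose error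
    \<open>e n\<close> is at most 1.\<close>
  define B where "B = \<bar>b1\<bar> + \<bar>b2\<bar> + \<bar>b3\<bar> + \<bar>b4\<bar> + 1"
  have B: "0 \<le> B" "\<And>t. \<bar>t\<bar> \<le> m \<Longrightarrow> \<bar>R t\<bar> + 1 \<le> B" "\<And>t. \<bar>t\<bar> \<le> m \<Longrightarrow> \<bar>R' t\<bar> + 1 \<le> B"
     "\<And>t. \<bar>t\<bar> \<le> m \<Longrightarrow> \<bar>H t\<bar> + 1 \<le> B" "\<And>t. \<bar>t\<bar> \<le> m \<Longrightarrow> \<bar>H' t\<bar> + 1 \<le> B"
  proof -
    show "0 \<le> B" by (simp add: B_def)
    fix t :: real assume t: "\<bar>t\<bar> \<le> m"
    show "\<bar>R t\<bar> + 1 \<le> B" "\<bar>R' t\<bar> + 1 \<le> B" "\<bar>H t\<bar> + 1 \<le> B" "\<bar>H' t\<bar> + 1 \<le> B"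
      using b(1)[OF t] b(2)[OF t] b(3)[OF t] b(4)[OF t] unfolding B_def by linarith+
  qed
  define e where "e n = inverse (real (Suc n))" for n
  have e: "0 < e n" "e n \<le> 1" for n by (auto simp: e_def field_simps)
  have e0: "e \<longlonglongrightarrow> 0" unfolding e_def[abs_def] by (rule LIMSEQ_inverse_real_of_nat)
  obtain P P' where P0: "\<forall>n::nat. real_polynomial_function (P n) \<and> (\<forall>t. (P n has_real_derivative P' n t) (at t)) \<and>
    continuous_on UNIV (P' n) \<and> P n 0 = R 0 \<and> (\<forall>t. \<bar>t\<bar> \<le> m \<longrightarrow> \<bar>P n t - R t\<bar> \<le> inverse (real (Suc n))) \<and>
    (\<forall>t. \<bar>t\<bar> \<le> m \<longrightarrow> \<bar>P' n t - R' t\<bar> \<le> inverse (real (Suc n)))"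
    using polynomial_C1_approx_sequence[OF R m(1)] by (elim exE) (erule that)
  note P = P0[THEN spec, THEN conjunct1]
    P0[THEN spec, THEN conjunct2, THEN conjunct1, THEN spec]
    P0[THEN spec, THEN conjunct2, THEN conjunct2, THEN conjunct1]
    P0[THEN spec, THEN conjunct2, THEN conjunct2, THEN conjunct2, THEN conjunct1]
    P0[THEN spec, THEN conjunct2, THEN conjunct2, THEN conjunct2, THEN conjunct2, THEN conjunct1, THEN spec, THEN mp, folded e_def]
    P0[THEN spec, THEN conjunct2, THEN conjunct2, THEN conjunct2, THEN conjunct2, THEN conjunct2, THEN spec, THEN mp, folded e_def]
  obtain Q Q' where Q0: "\<forall>n::nat. real_polynomial_function (Q n) \<and> (\<forall>t. (Q n has_real_derivative Q' n t) (at t)) \<and>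
    continuous_on UNIV (Q' n) \<and> Q n 0 = H 0 \<and> (\<forall>t. \<bar>t\<bar> \<le> m \<longrightarrow> \<bar>Q n t - H t\<bar> \<le> inverse (real (Suc n))) \<and>
    (\<forall>t. \<bar>t\<bar> \<le> m \<longrightarrow> \<bar>Q' n t - H' t\<bar> \<le> inverse (real (Suc n)))"
    using polynomial_C1_approx_sequence[OF H m(1)] by (elim exE) (erule that)
  note Q = Q0[THEN spec, THEN conjunct1]
    Q0[THEN spec, THEN conjunct2, THEN conjunct1, THEN spec]
    Q0[THEN spec, THEN conjunct2, THEN conjunct2, THEN conjunct1]
    Q0[THEN spec, THEN conjunct2, THEN conjunct2, THEN conjunct2, THEN conjunct1]
    Q0[THEN spec, THEN conjunct2, THEN conjunct2, THEN conjunct2, THEN conjunct2, THEN conjunct1, THEN spec, THEN mp, folded e_def]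
    Q0[THEN spec, THEN conjunct2, THEN conjunct2, THEN conjunct2, THEN conjunct2, THEN conjunct2, THEN spec, THEN mp, folded e_def]
  define \<theta> where "\<theta> n x = P n (\<phi> x) * Q n (\<psi> x)" for n x
  define \<Theta> where "\<Theta> n x = (P n (\<phi> x) * Q' n (\<psi> x)) *\<^sub>R grad \<psi> x + (Q n (\<psi> x) * P' n (\<phi> x)) *\<^sub>R grad \<phi> x" for n x
  have \<theta>: "\<theta> n \<in> test_functions \<Omega>" for n
  proof (rule test_functionI[of _ "K \<union> L"])
    show "Ck k (\<theta> n)" for k
      unfolding \<theta>_def[abs_def]
      by (rule Ck_mult[OF Ck_real_polynomial_comp[OF P(1) test_function_Ck[OF \<phi>]] Ck_real_polynomial_comp[OF Q(1) test_function_Ck[OF \<psi>]]])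
    show "\<theta> n x = 0" if "x \<notin> K \<union> L" for x
      using that K(3)[of x] L(3)[of x] zero by (simp add: \<theta>_def P(4) Q(4))
  qed (use K L in auto)
  have "C1 (\<theta> n) (\<Theta> n)" for n
    unfolding \<theta>_def[abs_def] \<Theta>_def[abs_def]
    using C1_mult[OF C1_comp[OF C\<phi> P(2,3)] C1_comp[OF C\<psi> Q(2,3)], of n n] by (simp add: ac_simps)
  then have g: "grad (\<theta> n) x = \<Theta> n x" for n x by (rule C1_grad_eq)
  have S: "sobolev0 \<Omega> p (\<theta> n) (\<Theta> n)" for n
    using sobolev0_test[OF \<theta>, of n] unfolding ext[of "grad (\<theta> n)" "\<Theta> n", OF g] .
  have conv: "(\<lambda>n. f n (\<phi> x)) \<longlonglongrightarrow> F (\<phi> x)" "(\<lambda>n. f n (\<psi> x)) \<longlonglongrightarrow> F (\<psi> x)"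
    if "\<And>n t. \<bar>t\<bar> \<le> m \<Longrightarrow> \<bar>f n t - F t\<bar> \<le> e n" for f F and x
    using that m(2)[of x] m(3)[of x]
    by (auto intro!: LIM_zero_cancel[OF Lim_null_comparison[OF always_eventually e0]])
  have aux: "\<bar>c\<bar> \<le> B" if "\<bar>c - d\<bar> \<le> e n" "\<bar>d\<bar> + 1 \<le> B" for c d n
    using that e(2)[of n] by linarith
  have bP: "\<bar>P n (\<phi> x)\<bar> \<le> B" "\<bar>P' n (\<phi> x)\<bar> \<le> B" "\<bar>Q n (\<psi> x)\<bar> \<le> B" "\<bar>Q' n (\<psi> x)\<bar> \<le> B" for n x
    by (rule aux[OF P(5)[OF m(2)] B(2)[OF m(2)]] aux[OF P(6)[OF m(2)] B(3)[OF m(2)]]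
        aux[OF Q(5)[OF m(3)] B(4)[OF m(3)]] aux[OF Q(6)[OF m(3)] B(5)[OF m(3)]])+
  have b1: "norm (\<theta> n x) \<le> norm (B * B)" for n x
    using mult_mono[OF bP(1)[of n x] bP(3)[of n x]] B(1) by (simp add: \<theta>_def abs_mult)
  have b2: "norm (\<Theta> n x) \<le> norm (B * B * m + B * B * m)" for n x
  proof -
    have "norm (\<Theta> n x) \<le> norm ((P n (\<phi> x) * Q' n (\<psi> x)) *\<^sub>R grad \<psi> x) + norm ((Q n (\<psi> x) * P' n (\<phi> x)) *\<^sub>R grad \<phi> x)"
      unfolding \<Theta>_def by (rule norm_triangle_ineq)
    also have "\<dots> \<le> B * B * m + B * B * m"
      unfolding norm_scaleR abs_mult using bP[of n x] m(4,5)[of x] B(1) m(1) by (intro add_mono mult_mono) auto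
    finally show ?thesis using B(1) m(1) by simp
  qed
  have meas: "f \<in> borel_measurable M" if "continuous_on UNIV f" for f :: "'a \<Rightarrow> 'c::euclidean_space"
    by (rule continuous_borel_measurable_lebesgue_on[OF that])
  have cc: "continuous_on UNIV (\<lambda>x. R (\<phi> x))" "continuous_on UNIV (\<lambda>x. R' (\<phi> x))" "continuous_on UNIV (\<lambda>x. H (\<psi> x))" "continuous_on UNIV (\<lambda>x. H' (\<psi> x))"
    by (rule continuous_on_compose2[OF Rc C1_continuous[OF C\<phi>] subset_UNIV] continuous_on_compose2[OF R(2) C1_continuous[OF C\<phi>] subset_UNIV]
          continuous_on_compose2[OF Hc C1_continuous[OF C\<psi>] subset_UNIV] continuous_on_compose2[OF H(2) C1_continuous[OF C\<psi>] subset_UNIV])+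
  note d1 = Lp_dominated_convergence[OF in_Lp_measurable[OF sobolev0_in_Lp(1)[OF S]] _ in_Lp_const[OF finite_M, of _ "B * B"] p_bounds(3) _ AE_I2[OF b1],
      of "\<lambda>x. R (\<phi> x) * H (\<psi> x)"]
  note d2 = Lp_dominated_convergence[OF in_Lp_measurable[OF sobolev0_in_Lp(2)[OF S]] _ in_Lp_const[OF finite_M, of _ "B * B * m + B * B * m"] p_bounds(3) _ AE_I2[OF b2],
      of "\<lambda>x. (R (\<phi> x) * H' (\<psi> x)) *\<^sub>R grad \<psi> x + (H (\<psi> x) * R' (\<phi> x)) *\<^sub>R grad \<phi> x"]
  have m1: "(\<lambda>x. R (\<phi> x) * H (\<psi> x)) \<in> borel_measurable M"
    by (intro meas continuous_on_mult cc)
  have m2: "(\<lambda>x. (R (\<phi> x) * H' (\<psi> x)) *\<^sub>R grad \<psi> x + (H (\<psi> x) * R' (\<phi> x)) *\<^sub>R grad \<phi> x) \<in> borel_measurable M"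
    by (intro meas continuous_on_mult continuous_on_add continuous_on_scaleR cc C1_continuous_grad[OF C\<phi>] C1_continuous_grad[OF C\<psi>])
  have l1: "AE x in M. (\<lambda>n. \<theta> n x) \<longlonglongrightarrow> R (\<phi> x) * H (\<psi> x)"
    unfolding \<theta>_def by (intro AE_I2 tendsto_mult conv(1)[OF P(5)] conv(2)[OF Q(5)])
  have l2: "AE x in M. (\<lambda>n. \<Theta> n x) \<longlonglongrightarrow> (R (\<phi> x) * H' (\<psi> x)) *\<^sub>R grad \<psi> x + (H (\<psi> x) * R' (\<phi> x)) *\<^sub>R grad \<phi> x"
    unfolding \<Theta>_def
    by (intro AE_I2 tendsto_add tendsto_scaleR tendsto_mult tendsto_const conv(1)[OF P(5)] conv(2)[OF Q(5)] conv(1)[OF P(6)] conv(2)[OF Q(6)])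
  show ?thesis
    by (rule sobolev0_limit[OF S d1(1)[OF m1 l1] d2(1)[OF m2 l2] d1(2)[OF m1 l1] d2(2)[OF m2 l2]])
qed

text \<open>Only u is approximated by test functions; the factors with H and H' are then bounded and
  converge almost everywhere, while the gradients converge in L^p. The shape of the product is that
  of the test function in Picone's inequality: a power of |\<phi>| times a function of the
  solution.\<close>

lemma sobolev0_product:
  assumes \<phi>: "\<phi> \<in> test_functions \<Omega>" and u: "sobolev0 \<Omega> p u G"
    and R: "\<And>t. (R has_real_derivative R' t) (at t)" "continuous_on UNIV R'"
    and H: "\<And>t. (H has_real_derivative H' t) (at t)" "continuous_on UNIV H'"
    and bd: "\<And>t. \<bar>H t\<bar> \<le> b" "\<And>t. \<bar>H' t\<bar> \<le> b"
    and zero: "R 0 * H 0 = 0"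
  shows "sobolev0 \<Omega> p (\<lambda>x. R (\<phi> x) * H (u x))
    (\<lambda>x. (R (\<phi> x) * H' (u x)) *\<^sub>R G x + (H (u x) * R' (\<phi> x)) *\<^sub>R grad \<phi> x)"
proof -
  obtain K where K: "compact K" "K \<subseteq> \<Omega>" "\<And>x. x \<notin> K \<Longrightarrow> \<phi> x = 0"
    by (rule test_functionE[OF \<phi>]) blast
  note C = test_function_C1[OF \<phi>]
  obtain B where B: "0 \<le> B" "\<And>x. norm (grad \<phi> x) \<le> B" "\<And>x. \<bar>\<phi> x\<bar> \<le> B"
    by (rule C1_compact_support_bounds[OF C K(1,3)]) blast+
  have Rc: "continuous_on UNIV R" and Hc: "continuous_on UNIV H"
    using R(1) H(1) by (meson DERIV_continuous continuous_at_imp_continuous_on)+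
  have bd': "\<exists>m. \<forall>t. \<bar>t\<bar> \<le> B \<longrightarrow> \<bar>f t\<bar> \<le> m" if "continuous_on UNIV f" for f :: "real \<Rightarrow> real"
  proof -
    have "bounded (f ` {-B..B})"
      by (intro compact_imp_bounded compact_continuous_image continuous_on_subset[OF that]) auto
    then obtain a where "\<forall>y\<in>f ` {-B..B}. norm y \<le> a" unfolding bounded_iff by blast
    then show ?thesis by (intro exI[of _ a]) (auto simp: abs_le_iff)
  qed
  obtain m1 m2 where m: "\<And>x. \<bar>R (\<phi> x)\<bar> \<le> m1" "\<And>x. \<bar>R' (\<phi> x)\<bar> \<le> m2"
    using bd'[OF Rc] bd'[OF R(2)] B(3) by blast
  have m0: "0 \<le> m1" "0 \<le> m2" "0 \<le> b" using m(1)[of undefined] m(2)[of undefined] bd(1)[of 0] by linarith+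
  obtain \<psi> where \<psi>: "\<And>k::nat. \<psi> k \<in> test_functions \<Omega>"
    and lim: "(\<lambda>k. Lpi p M (\<lambda>x. grad (\<psi> k) x - G x)) \<longlonglongrightarrow> 0" "AE x in M. (\<lambda>k. \<psi> k x) \<longlonglongrightarrow> u x"
    by (rule sobolev0_AE_approx[OF u]) blast
  note S = sobolev0_test_product[OF \<phi> \<psi> R H zero]
  have um: "u \<in> borel_measurable M" "G \<in> borel_measurable M" "\<phi> \<in> borel_measurable M" "grad \<phi> \<in> borel_measurable M"
    using sobolev0_in_Lp[OF u] test_Lp[OF \<phi>] by (auto dest: in_Lp_measurable)
  have \<psi>m: "\<psi> k \<in> borel_measurable M" for k using test_Lp[OF \<psi>] by (auto dest: in_Lp_measurable)
  have comp: "(\<lambda>x. f (v x)) \<in> borel_measurable M" if "continuous_on UNIV f" "v \<in> borel_measurable M" for f :: "real \<Rightarrow> real" and v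
    using measurable_compose[OF that(2) borel_measurable_continuous_onI[OF that(1)]] .
  have Hlim: "AE x in M. (\<lambda>k. f (\<psi> k x)) \<longlonglongrightarrow> f (u x)" if "continuous_on UNIV f" for f :: "real \<Rightarrow> real"
    using lim(2) by eventually_elim (use that in \<open>auto intro: isCont_tendsto_compose simp: continuous_on_eq_continuous_at\<close>)
  have le1: "\<bar>R (\<phi> x) * H' (v x)\<bar> \<le> m1 * b" "\<bar>R (\<phi> x) * H (v x)\<bar> \<le> m1 * b" "\<bar>H (v x) * R' (\<phi> x)\<bar> \<le> b * m2" for v x
    unfolding abs_mult using m bd m0 by (auto intro!: mult_mono)
  have cm: "(\<lambda>x. R (\<phi> x)) \<in> borel_measurable M" "(\<lambda>x. R' (\<phi> x)) \<in> borel_measurable M"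
     "(\<lambda>x. H (u x)) \<in> borel_measurable M" "(\<lambda>x. H' (u x)) \<in> borel_measurable M"
     "\<And>k. (\<lambda>x. H (\<psi> k x)) \<in> borel_measurable M" "\<And>k. (\<lambda>x. H' (\<psi> k x)) \<in> borel_measurable M"
    by (rule comp[OF Rc um(3)] comp[OF R(2) um(3)] comp[OF Hc um(1)] comp[OF H(2) um(1)] comp[OF Hc \<psi>m] comp[OF H(2) \<psi>m])+
  have al1: "AE x in M. (\<lambda>k. R (\<phi> x) * H' (\<psi> k x)) \<longlonglongrightarrow> R (\<phi> x) * H' (u x)"
    using Hlim[OF H(2)] by eventually_elim (rule tendsto_mult_left)
  have al2: "AE x in M. (\<lambda>k. H (\<psi> k x) * R' (\<phi> x)) \<longlonglongrightarrow> H (u x) * R' (\<phi> x)"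
    using Hlim[OF Hc] by eventually_elim (rule tendsto_mult_right)
  have al3: "AE x in M. (\<lambda>k. R (\<phi> x) * H (\<psi> k x)) \<longlonglongrightarrow> R (\<phi> x) * H (u x)"
    using Hlim[OF Hc] by eventually_elim (rule tendsto_mult_left)
  have le2: "\<bar>R (\<phi> x) * H' (\<psi> k x)\<bar> \<le> m1 * b" "\<bar>R (\<phi> x) * H (\<psi> k x)\<bar> \<le> m1 * b" "\<bar>H (\<psi> k x) * R' (\<phi> x)\<bar> \<le> b * m2" for k x
    by (rule le1)+
  have triv: "(\<lambda>k::nat. Lpi p M (\<lambda>x. grad \<phi> x - grad \<phi> x)) \<longlonglongrightarrow> 0" "(\<lambda>k::nat. Lpi p M (\<lambda>x. (1::real) - 1)) \<longlonglongrightarrow> 0"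
    by (simp_all add: Lpi_def)
  note s1' = Lp_scaleR_tendsto[where a = "\<lambda>k x. R (\<phi> x) * H' (\<psi> k x)" and f = "\<lambda>k. grad (\<psi> k)", OF borel_measurable_times[OF cm(1,6)] borel_measurable_times[OF cm(1,4)] le2(1) al1
      test_Lp(2)[OF \<psi>] sobolev0_in_Lp(2)[OF u] lim(1) p_bounds(3)]
  note s1 = s1'(2,3,1)
  note s2' = Lp_scaleR_tendsto[where a = "\<lambda>k x. H (\<psi> k x) * R' (\<phi> x)" and f = "\<lambda>k. grad \<phi>", OF borel_measurable_times[OF cm(5,2)] borel_measurable_times[OF cm(3,2)] le2(3) al2
      test_Lp(2)[OF \<phi>] test_Lp(2)[OF \<phi>] triv(1) p_bounds(3)]
  note s2 = s2'(2,3,1)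
  note s3' = Lp_scaleR_tendsto(2,3)[where a = "\<lambda>k x. R (\<phi> x) * H (\<psi> k x)" and f = "\<lambda>k x. 1::real",
      OF borel_measurable_times[OF cm(1,5)] borel_measurable_times[OF cm(1,3)] le2(2) al3
      in_Lp_const[OF finite_M] in_Lp_const[OF finite_M] triv(2) p_bounds(3)]
  have s3: "in_Lp p M (\<lambda>x. R (\<phi> x) * H (u x))" "(\<lambda>k. Lpi p M (\<lambda>x. R (\<phi> x) * H (\<psi> k x) - R (\<phi> x) * H (u x))) \<longlonglongrightarrow> 0"
    using s3' by simp_all
  show ?thesis
  proof (rule sobolev0_limit[OF S s3(1) in_Lp_add(1)[OF s1(1) s2(1) p_bounds(1)] s3(2)])
    have "(\<lambda>k. 2 powr p * (Lpi p M (\<lambda>x. (R (\<phi> x) * H' (\<psi> k x)) *\<^sub>R grad (\<psi> k) x - (R (\<phi> x) * H' (u x)) *\<^sub>R G x)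
       + Lpi p M (\<lambda>x. (H (\<psi> k x) * R' (\<phi> x)) *\<^sub>R grad \<phi> x - (H (u x) * R' (\<phi> x)) *\<^sub>R grad \<phi> x))) \<longlonglongrightarrow> 2 powr p * (0 + 0)"
      by (intro tendsto_mult_left tendsto_add s1(2) s2(2))
    then have z: "(\<lambda>k. 2 powr p * (Lpi p M (\<lambda>x. (R (\<phi> x) * H' (\<psi> k x)) *\<^sub>R grad (\<psi> k) x - (R (\<phi> x) * H' (u x)) *\<^sub>R G x)
       + Lpi p M (\<lambda>x. (H (\<psi> k x) * R' (\<phi> x)) *\<^sub>R grad \<phi> x - (H (u x) * R' (\<phi> x)) *\<^sub>R grad \<phi> x))) \<longlonglongrightarrow> 0" by simp
    show "(\<lambda>k. Lpi p M (\<lambda>x. (R (\<phi> x) * H' (\<psi> k x)) *\<^sub>R grad (\<psi> k) x + (H (\<psi> k x) * R' (\<phi> x)) *\<^sub>R grad \<phi> x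
        - ((R (\<phi> x) * H' (u x)) *\<^sub>R G x + (H (u x) * R' (\<phi> x)) *\<^sub>R grad \<phi> x))) \<longlonglongrightarrow> 0"
    proof (rule tendsto_sandwich[OF always_eventually always_eventually tendsto_const z]; intro allI)
      fix k
      show "Lpi p M (\<lambda>x. (R (\<phi> x) * H' (\<psi> k x)) *\<^sub>R grad (\<psi> k) x + (H (\<psi> k x) * R' (\<phi> x)) *\<^sub>R grad \<phi> x
        - ((R (\<phi> x) * H' (u x)) *\<^sub>R G x + (H (u x) * R' (\<phi> x)) *\<^sub>R grad \<phi> x))
        \<le> 2 powr p * (Lpi p M (\<lambda>x. (R (\<phi> x) * H' (\<psi> k x)) *\<^sub>R grad (\<psi> k) x - (R (\<phi> x) * H' (u x)) *\<^sub>R G x)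
       + Lpi p M (\<lambda>x. (H (\<psi> k x) * R' (\<phi> x)) *\<^sub>R grad \<phi> x - (H (u x) * R' (\<phi> x)) *\<^sub>R grad \<phi> x))"
        using in_Lp_add(2)[OF in_Lp_diff(1)[OF s1(3)[of k] s1(1) p_bounds(1)] in_Lp_diff(1)[OF s2(3)[of k] s2(1) p_bounds(1)] p_bounds(1)]
        by (simp add: add_diff_add)
    qed (rule Lpi_nonneg)
  qed
qed

lemma sobolev0_comp:
  assumes u: "sobolev0 \<Omega> p u G"
    and H: "\<And>t. (H has_real_derivative H' t) (at t)" "continuous_on UNIV H'"
    and bd: "\<And>t. \<bar>H t\<bar> \<le> b" "\<And>t. \<bar>H' t\<bar> \<le> b" and zero: "H 0 = 0"
  shows "sobolev0 \<Omega> p (\<lambda>x. H (u x)) (\<lambda>x. H' (u x) *\<^sub>R G x)"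
proof -
  \<comment> \<open>The product rule for the zero test function and the constant outer function 1;
    the condition at 0 becomes H 0 = 0.\<close>
  have "sobolev0 \<Omega> p (\<lambda>x. 1 * H (u x)) (\<lambda>x. (1 * H' (u x)) *\<^sub>R G x + (H (u x) * 0) *\<^sub>R grad (\<lambda>x. 0) x)"
    by (rule sobolev0_product[OF test_function_0 u, where R = "\<lambda>_. 1" and R' = "\<lambda>_. 0"]) (use H bd zero in auto)
  then show ?thesis by simp
qed

end

section \<open>Oscillation on balls\<close>

text \<open>Functions such as \<open>ln (t + \<epsilon>)\<close> are needed only for \<open>t \<ge> 0\<close>; the sine continues them to a \<open>C\<^sup>1\<close> function with bounded
  derivative.\<close>

definition ext_neg :: "(real \<Rightarrow> real) \<Rightarrow> (real \<Rightarrow> real) \<Rightarrow> real \<Rightarrow> real" where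
  "ext_neg F F' t = (if 0 \<le> t then F t else F 0 + F' 0 * sin t)"

definition ext_neg_deriv :: "(real \<Rightarrow> real) \<Rightarrow> real \<Rightarrow> real" where
  "ext_neg_deriv F' t = (if 0 \<le> t then F' t else F' 0 * cos t)"

lemma ext_neg_has_derivative:
  assumes F: "\<And>t. 0 \<le> t \<Longrightarrow> (F has_real_derivative F' t) (at t)"
  shows "(ext_neg F F' has_real_derivative ext_neg_deriv F' t) (at t)"
proof -
  have S: "((\<lambda>t. F 0 + F' 0 * sin t) has_real_derivative F' 0 * cos t) (at t)" for t
    by (auto intro!: derivative_eq_intros)
  consider "0 < t" | "t < 0" | "t = 0" by linarith
  then show ?thesis
  proof cases
    case 1
    then have "(F has_real_derivative ext_neg_deriv F' t) (at t)" using F[of t] by (simp add: ext_neg_deriv_def)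
    then show ?thesis
      by (rule has_field_derivative_transform_within_open[of _ _ _ "{0<..}"]) (use 1 in \<open>auto simp: ext_neg_def\<close>)
  next
    case 2
    then have "((\<lambda>t. F 0 + F' 0 * sin t) has_real_derivative ext_neg_deriv F' t) (at t)" using S[of t] by (simp add: ext_neg_deriv_def)
    then show ?thesis
      by (rule has_field_derivative_transform_within_open[of _ _ _ "{..<0}"]) (use 2 in \<open>auto simp: ext_neg_def\<close>)
  next
    case 3
    have l: "((\<lambda>h. (ext_neg F F' (0 + h) - ext_neg F F' 0) / h) \<longlongrightarrow> F' 0) (at_left 0)"
    proof (rule Lim_transform_eventually)
      show "((\<lambda>h. ((F 0 + F' 0 * sin (0 + h)) - (F 0 + F' 0 * sin 0)) / h) \<longlongrightarrow> F' 0) (at_left 0)"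
        using S[of 0] unfolding DERIV_def by (simp add: filterlim_at_split)
      show "\<forall>\<^sub>F h in at_left 0. ((F 0 + F' 0 * sin (0 + h)) - (F 0 + F' 0 * sin 0)) / h = (ext_neg F F' (0 + h) - ext_neg F F' 0) / h"
        by (rule eventually_at_leftI[of "-1"]) (auto simp: ext_neg_def)
    qed
    have r: "((\<lambda>h. (ext_neg F F' (0 + h) - ext_neg F F' 0) / h) \<longlongrightarrow> F' 0) (at_right 0)"
    proof (rule Lim_transform_eventually)
      show "((\<lambda>h. (F (0 + h) - F 0) / h) \<longlongrightarrow> F' 0) (at_right 0)"
        using F[of 0] unfolding DERIV_def by (simp add: filterlim_at_split)
      show "\<forall>\<^sub>F h in at_right 0. (F (0 + h) - F 0) / h = (ext_neg F F' (0 + h) - ext_neg F F' 0) / h"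
        by (rule eventually_at_rightI[of _ 1]) (auto simp: ext_neg_def)
    qed
    show ?thesis
      unfolding 3 DERIV_def using filterlim_split_at[OF l r] by (simp add: ext_neg_deriv_def)
  qed
qed

lemma ext_neg_deriv_continuous:
  assumes "continuous_on {0..} F'"
  shows "continuous_on UNIV (ext_neg_deriv F')"
proof -
  have "continuous_on ({0..} \<union> {..0}) (\<lambda>t. if 0 \<le> t then F' t else F' 0 * cos t)"
    by (rule continuous_on_If) (use assms in \<open>auto intro!: continuous_intros\<close>)
  moreover have "{0..} \<union> {..0} = (UNIV :: real set)" by auto
  ultimately show ?thesis by (simp add: ext_neg_deriv_def[abs_def])
qed

lemma ext_neg_deriv_bound:
  assumes "\<And>t. 0 \<le> t \<Longrightarrow> \<bar>F' t\<bar> \<le> b"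
  shows "\<bar>ext_neg_deriv F' t\<bar> \<le> b"
proof (cases "0 \<le> t")
  case False
  have "\<bar>F' 0 * cos t\<bar> \<le> \<bar>F' 0\<bar> * 1" unfolding abs_mult by (intro mult_left_mono) auto
  then show ?thesis using False assms[of 0] by (simp add: ext_neg_deriv_def)
qed (use assms in \<open>auto simp: ext_neg_deriv_def\<close>)

lemma ext_neg_bound:
  assumes "\<And>t. 0 \<le> t \<Longrightarrow> \<bar>F t\<bar> \<le> b" "\<And>t. 0 \<le> t \<Longrightarrow> \<bar>F' t\<bar> \<le> b"
  shows "\<bar>ext_neg F F' t\<bar> \<le> 2 * b"
proof (cases "0 \<le> t")
  case True
  then show ?thesis using assms(1)[of t] by (simp add: ext_neg_def)
next
  case False
  have "\<bar>F' 0 * sin t\<bar> \<le> \<bar>F' 0\<bar> * 1" unfolding abs_mult by (intro mult_left_mono) auto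
  then show ?thesis using False assms[of 0] by (simp add: ext_neg_def)
qed

context bounded_open
begin

text \<open>Unlike the mean oscillation, this makes sense for functions that are not known to be integrable, such as the
  logarithm of a limit.\<close>

definition osc :: "'a set \<Rightarrow> ('a \<Rightarrow> real) \<Rightarrow> ennreal" where
  "osc B h = (\<integral>\<^sup>+x. (\<integral>\<^sup>+z. ennreal \<bar>h x - h z\<bar> * indicator B z \<partial>M) * indicator B x \<partial>M)"

text \<open>Fatou's lemma twice, for the inner integral at almost every x and then for the outer
  one.\<close>

lemma osc_Fatou:
  assumes h: "\<And>k::nat. h k \<in> borel_measurable M" and lim: "AE x in M. (\<lambda>k. h k x) \<longlonglongrightarrow> g x"
    and B: "B \<in> sets M" and le: "\<And>k. osc B (h k) \<le> ennreal (c k)" "c \<longlonglongrightarrow> d"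
  shows "osc B g \<le> ennreal d"
proof -
  interpret finite_measure M by (rule finite_M)
  note [measurable] = h B
  define I where "I k x = (\<integral>\<^sup>+z. ennreal \<bar>h k x - h k z\<bar> * indicator B z \<partial>M)" for k x
  have Im[measurable]: "I k \<in> borel_measurable M" for k
    unfolding I_def[abs_def] by measurable
  have inner: "AE x in M. (\<integral>\<^sup>+z. ennreal \<bar>g x - g z\<bar> * indicator B z \<partial>M) \<le> liminf (\<lambda>k. I k x)"
    using lim
  proof eventually_elim
    fix x assume x: "(\<lambda>k. h k x) \<longlonglongrightarrow> g x"
    have "(\<integral>\<^sup>+z. ennreal \<bar>g x - g z\<bar> * indicator B z \<partial>M) = (\<integral>\<^sup>+z. liminf (\<lambda>k. ennreal \<bar>h k x - h k z\<bar> * indicator B z) \<partial>M)"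
    proof (rule nn_integral_cong_AE)
      show "AE z in M. ennreal \<bar>g x - g z\<bar> * indicator B z = liminf (\<lambda>k. ennreal \<bar>h k x - h k z\<bar> * indicator B z)"
        using lim
      proof eventually_elim
        fix z assume "(\<lambda>k. h k z) \<longlonglongrightarrow> g z"
        then have "(\<lambda>k. ennreal \<bar>h k x - h k z\<bar>) \<longlonglongrightarrow> ennreal \<bar>g x - g z\<bar>"
          using x by (intro tendsto_ennrealI tendsto_rabs tendsto_diff)
        then have "(\<lambda>k. ennreal \<bar>h k x - h k z\<bar> * indicator B z) \<longlonglongrightarrow> ennreal \<bar>g x - g z\<bar> * indicator B z"
          by (cases "z \<in> B") auto
        then show "ennreal \<bar>g x - g z\<bar> * indicator B z = liminf (\<lambda>k. ennreal \<bar>h k x - h k z\<bar> * indicator B z)"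
          by (simp add: lim_imp_Liminf)
      qed
    qed
    also have "\<dots> \<le> liminf (\<lambda>k. I k x)"
      unfolding I_def by (rule nn_integral_liminf) measurable
    finally show "(\<integral>\<^sup>+z. ennreal \<bar>g x - g z\<bar> * indicator B z \<partial>M) \<le> liminf (\<lambda>k. I k x)" .
  qed
  have "osc B g \<le> (\<integral>\<^sup>+x. liminf (\<lambda>k. I k x * indicator B x) \<partial>M)"
    unfolding osc_def
  proof (rule nn_integral_mono_AE)
    show "AE x in M. (\<integral>\<^sup>+z. ennreal \<bar>g x - g z\<bar> * indicator B z \<partial>M) * indicator B x \<le> liminf (\<lambda>k. I k x * indicator B x)"
      using inner
    proof eventually_elim
      fix x assume "(\<integral>\<^sup>+z. ennreal \<bar>g x - g z\<bar> * indicator B z \<partial>M) \<le> liminf (\<lambda>k. I k x)"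
      then show "(\<integral>\<^sup>+z. ennreal \<bar>g x - g z\<bar> * indicator B z \<partial>M) * indicator B x \<le> liminf (\<lambda>k. I k x * indicator B x)"
        by (cases "x \<in> B") auto
    qed
  qed
  also have "\<dots> \<le> liminf (\<lambda>k. \<integral>\<^sup>+x. I k x * indicator B x \<partial>M)"
    by (rule nn_integral_liminf) measurable
  also have "\<dots> \<le> liminf (\<lambda>k. ennreal (c k))"
    using le(1) by (intro Liminf_mono) (simp add: osc_def I_def)
  also have "\<dots> = ennreal d"
    using tendsto_ennrealI[OF le(2)] by (simp add: lim_imp_Liminf)
  finally show ?thesis .
qed

text \<open>A single point x of the ball with vanishing inner integral is enough, since that
  integral compares h with its value at x. Such a point exists because a ball is not a null
  set.\<close>

lemma osc_eq_0_imp_constant: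
  assumes "osc (ball c r) h = 0" "h \<in> borel_measurable M" "ball c r \<subseteq> \<Omega>" "0 < r"
  obtains \<kappa> where "AE x in M. x \<in> ball c r \<longrightarrow> h x = \<kappa>"
proof -
  interpret finite_measure M by (rule finite_M)
  define B where "B = ball c r"
  have BM[measurable]: "B \<in> sets M" using assms(3) by (simp add: B_def sets_restrict_space_iff sets_\<Omega>)
  note [measurable] = assms(2)
  define I where "I x = (\<integral>\<^sup>+z. ennreal \<bar>h x - h z\<bar> * indicator B z \<partial>M)" for x
  have Im[measurable]: "I \<in> borel_measurable M" unfolding I_def[abs_def] by measurable
  have "(\<integral>\<^sup>+x. I x * indicator B x \<partial>M) = 0" using assms(1) by (simp add: osc_def I_def B_def)
  then have ae: "AE x in M. I x * indicator B x = 0" by (subst (asm) nn_integral_0_iff_AE) auto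
  have nz: "\<not> (AE x in M. x \<notin> B)"
  proof
    assume "AE x in M. x \<notin> B"
    then have "negligible {x \<in> \<Omega>. x \<in> B}" unfolding AE_lebesgue_on_iff[OF sets_\<Omega>] by simp
    moreover have "{x \<in> \<Omega>. x \<in> B} = ball c r" using assms(3) by (auto simp: B_def)
    ultimately show False using assms(4) open_not_negligible[of "ball c r"] by simp
  qed
  have "\<exists>x. x \<in> B \<and> I x = 0"
  proof (rule ccontr)
    assume no: "\<not> (\<exists>x. x \<in> B \<and> I x = 0)"
    have "AE x in M. x \<notin> B"
      using ae by eventually_elim (use no in auto)
    with nz show False by blast
  qed
  then obtain x where x: "x \<in> B" "I x = 0" by blast
  have "AE z in M. ennreal \<bar>h x - h z\<bar> * indicator B z = 0"
    using x(2) unfolding I_def by (subst (asm) nn_integral_0_iff_AE) auto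
  then have "AE z in M. z \<in> ball c r \<longrightarrow> h z = h x"
    by eventually_elim (auto simp: B_def)
  then show ?thesis by (rule that)
qed

text \<open>Connectedness is applied to the set of centres around which P holds almost everywhere
  and to the analogous set for the negation. Both are open, they cover the domain by hypothesis, and
  they are disjoint because no ball is a null set.\<close>

lemma connected_null_or_conull:
  assumes conn: "connected \<Omega>"
    and local: "\<And>c. c \<in> \<Omega> \<Longrightarrow> \<exists>r>0. ball c r \<subseteq> \<Omega> \<and> ((AE x in M. x \<in> ball c r \<longrightarrow> P x) \<or> (AE x in M. x \<in> ball c r \<longrightarrow> \<not> P x))"
  shows "(AE x in M. P x) \<or> (AE x in M. \<not> P x)"
proof -
  define U where "U Q = {c \<in> \<Omega>. \<exists>r>0. ball c r \<subseteq> \<Omega> \<and> (AE x in M. x \<in> ball c r \<longrightarrow> Q x)}" for Q :: "'a \<Rightarrow> bool"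
  have op: "open (U Q)" for Q
  proof (rule openI)
    fix c assume "c \<in> U Q"
    then obtain r where r: "0 < r" "ball c r \<subseteq> \<Omega>" "AE x in M. x \<in> ball c r \<longrightarrow> Q x" by (auto simp: U_def)
    have "ball c r \<subseteq> U Q"
    proof
      fix d assume d: "d \<in> ball c r"
      define s where "s = r - dist c d"
      have s: "0 < s" "ball d s \<subseteq> ball c r"
      proof -
        show "0 < s" using d by (simp add: s_def)
        show "ball d s \<subseteq> ball c r"
        proof
          fix x assume "x \<in> ball d s"
          then show "x \<in> ball c r" using dist_triangle[of c x d] by (simp add: s_def)
        qed
      qed
      have "AE x in M. x \<in> ball d s \<longrightarrow> Q x" using r(3) by eventually_elim (use s(2) in auto)
      then show "d \<in> U Q" using d s r(2) unfolding U_def by blast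
    qed
    then show "\<exists>e>0. ball c e \<subseteq> U Q" using r(1) by blast
  qed
  have full: "AE x in M. Q x" if "\<Omega> \<subseteq> U Q" for Q
  proof (rule AE_lebesgue_on_local[OF sets_\<Omega>])
    fix c assume "c \<in> \<Omega>"
    then obtain r where r: "0 < r" "ball c r \<subseteq> \<Omega>" "AE x in M. x \<in> ball c r \<longrightarrow> Q x" using \<open>\<Omega> \<subseteq> U Q\<close> by (auto simp: U_def)
    have "AE x in lebesgue_on (\<Omega> \<inter> ball c r). x \<in> ball c r \<longrightarrow> Q x"
      by (rule AE_lebesgue_on_mono[OF r(3)]) (use sets_\<Omega> in auto)
    moreover have "AE x in lebesgue_on (\<Omega> \<inter> ball c r). x \<in> ball c r" using AE_space by eventually_elim simp
    ultimately have "AE x in lebesgue_on (\<Omega> \<inter> ball c r). Q x" by eventually_elim simp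
    with r(1) show "\<exists>r>0. AE x in lebesgue_on (\<Omega> \<inter> ball c r). Q x" by blast
  qed
  have cover: "\<Omega> \<subseteq> U P \<union> U (\<lambda>x. \<not> P x)" using local unfolding U_def by blast
  have disj: "U P \<inter> U (\<lambda>x. \<not> P x) \<inter> \<Omega> = {}"
  proof (rule ccontr)
    assume "U P \<inter> U (\<lambda>x. \<not> P x) \<inter> \<Omega> \<noteq> {}"
    then obtain c r s where c: "0 < r" "ball c r \<subseteq> \<Omega>" "AE x in M. x \<in> ball c r \<longrightarrow> P x"
       "0 < s" "AE x in M. x \<in> ball c s \<longrightarrow> \<not> P x" by (auto simp: U_def)
    have "AE x in M. x \<notin> ball c (min r s)" using c(3,5) by eventually_elim auto
    then have "negligible {x \<in> \<Omega>. x \<in> ball c (min r s)}" unfolding AE_lebesgue_on_iff[OF sets_\<Omega>] by simp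
    moreover have "{x \<in> \<Omega>. x \<in> ball c (min r s)} = ball c (min r s)" using c(2) by auto
    ultimately show False using c(1,4) open_not_negligible[of "ball c (min r s)"] by simp
  qed
  have "U P \<inter> \<Omega> = {} \<or> U (\<lambda>x. \<not> P x) \<inter> \<Omega> = {}"
    by (rule connectedD[OF conn op op disj cover])
  then show ?thesis using cover full[of P] full[of "\<lambda>x. \<not> P x"] by blast
qed

definition osc_const :: "real \<Rightarrow> real" where
  "osc_const r = 2 * r * measure lborel (ball (0::'a) (2 * r))"

lemma osc_const_nonneg: "0 \<le> r \<Longrightarrow> 0 \<le> osc_const r"
  by (simp add: osc_const_def)

lemma nn_integral_M_indicator:
  assumes "B \<subseteq> \<Omega>"
  shows "(\<integral>\<^sup>+x. F x * indicator B x \<partial>M) = (\<integral>\<^sup>+x. F x * indicator B x \<partial>lborel)"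
proof -
  have "(\<integral>\<^sup>+x. F x * indicator B x \<partial>M) = (\<integral>\<^sup>+x. F x * indicator B x * indicator \<Omega> x \<partial>lebesgue)"
    by (rule nn_integral_restrict_space) (simp add: sets_\<Omega>)
  also have "\<dots> = (\<integral>\<^sup>+x. F x * indicator B x \<partial>lebesgue)"
    by (intro nn_integral_cong) (use assms in \<open>auto split: split_indicator\<close>)
  finally show ?thesis by (simp add: nn_integral_completion)
qed

lemma osc_C1:
  assumes f: "C1 f g" and B: "ball c r \<subseteq> \<Omega>" "0 < r" and g: "integrable M g"
  shows "osc (ball c r) f \<le> ennreal (osc_const r * (\<integral>x. norm (g x) * indicator (ball c r) x \<partial>M))"
proof -
  have BM: "ball c r \<in> sets M" using B(1) by (simp add: sets_restrict_space_iff sets_\<Omega>)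
  have int: "integrable M (\<lambda>x. norm (g x) * indicator (ball c r) x)"
    using integrable_mult_indicator[OF BM integrable_norm[OF g]] by (simp add: mult.commute)
  have "osc (ball c r) f = (\<integral>\<^sup>+x. (\<integral>\<^sup>+z. ennreal \<bar>f x - f z\<bar> * indicator (ball c r) z \<partial>lborel) * indicator (ball c r) x \<partial>lborel)"
    unfolding osc_def by (simp add: nn_integral_M_indicator[OF B(1)])
  also have "\<dots> \<le> ennreal (2 * r) * emeasure lborel (ball (0::'a) (2 * r)) * (\<integral>\<^sup>+x. ennreal (norm (g x)) * indicator (ball c r) x \<partial>lborel)"
    by (rule mean_oscillation_ball[OF f])
  also have "emeasure lborel (ball (0::'a) (2 * r)) = ennreal (measure lborel (ball (0::'a) (2 * r)))"
    using emeasure_bounded_finite[of "ball (0::'a) (2 * r)"] by (intro emeasure_eq_ennreal_measure) auto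
  also have "(\<integral>\<^sup>+x. ennreal (norm (g x)) * indicator (ball c r) x \<partial>lborel) = (\<integral>\<^sup>+x. ennreal (norm (g x) * indicator (ball c r) x) \<partial>M)"
    unfolding nn_integral_M_indicator[OF B(1), symmetric] by (intro nn_integral_cong) (auto split: split_indicator)
  also have "\<dots> = ennreal (\<integral>x. norm (g x) * indicator (ball c r) x \<partial>M)"
    by (rule nn_integral_eq_integral[OF int]) simp
  finally show ?thesis
    using B(2) by (simp add: osc_const_def ennreal_mult[symmetric])
qed

text \<open>The difference is treated as one function because its gradient can vanish while neither
  summand has a small one; this happens for the logarithms of two functions with the same
  logarithmic gradient. With E = 0 a single function is covered. The bound holds for test functions
  and passes to the limit by \<open>osc_Fatou\<close>.\<close>

lemma osc_sobolev0_diff: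
  assumes u: "sobolev0 \<Omega> p u G" and v: "sobolev0 \<Omega> p v H"
    and F: "\<And>t. (F has_real_derivative F' t) (at t)" "continuous_on UNIV F'" "\<And>t. \<bar>F' t\<bar> \<le> b"
    and E: "\<And>t. (E has_real_derivative E' t) (at t)" "continuous_on UNIV E'" "\<And>t. \<bar>E' t\<bar> \<le> b"
    and B: "ball c r \<subseteq> \<Omega>" "0 < r"
  shows "osc (ball c r) (\<lambda>x. F (u x) - E (v x))
    \<le> ennreal (osc_const r * (\<integral>x. norm (F' (u x) *\<^sub>R G x - E' (v x) *\<^sub>R H x) * indicator (ball c r) x \<partial>M))"
    (is "_ \<le> ennreal (osc_const r * ?I)")
proof -
  have BM[measurable]: "ball c r \<in> sets M" using B(1) by (simp add: sets_restrict_space_iff sets_\<Omega>)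
  have Fc: "continuous_on UNIV F" and Ec: "continuous_on UNIV E"
    using F(1) E(1) by (meson DERIV_continuous continuous_at_imp_continuous_on)+
  have comp: "(\<lambda>x. f (w x)) \<in> borel_measurable M" if "continuous_on UNIV f" "w \<in> borel_measurable M" for f :: "real \<Rightarrow> real" and w
    using measurable_compose[OF that(2) borel_measurable_continuous_onI[OF that(1)]] .
  obtain \<phi> where \<phi>: "\<And>k::nat. \<phi> k \<in> test_functions \<Omega>"
    and l1: "(\<lambda>k. Lpi p M (\<lambda>x. grad (\<phi> k) x - G x)) \<longlonglongrightarrow> 0" "AE x in M. (\<lambda>k. \<phi> k x) \<longlonglongrightarrow> u x"
    by (rule sobolev0_AE_approx[OF u]) blast
  obtain \<psi> where \<psi>: "\<And>k::nat. \<psi> k \<in> test_functions \<Omega>"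
    and l2: "(\<lambda>k. Lpi p M (\<lambda>x. grad (\<psi> k) x - H x)) \<longlonglongrightarrow> 0" "AE x in M. (\<lambda>k. \<psi> k x) \<longlonglongrightarrow> v x"
    by (rule sobolev0_AE_approx[OF v]) blast
  note mm = in_Lp_measurable[OF test_Lp(1)[OF \<phi>]] in_Lp_measurable[OF test_Lp(1)[OF \<psi>]]
     in_Lp_measurable[OF sobolev0_in_Lp(1)[OF u]] in_Lp_measurable[OF sobolev0_in_Lp(1)[OF v]]
  have lim: "AE x in M. (\<lambda>k. f (w k x)) \<longlonglongrightarrow> f (y x)" if "AE x in M. (\<lambda>k. w k x) \<longlonglongrightarrow> y x" "continuous_on UNIV f"
    for f :: "real \<Rightarrow> real" and w :: "nat \<Rightarrow> 'a \<Rightarrow> real" and y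
    using that(1) by eventually_elim (use that(2) in \<open>auto intro: isCont_tendsto_compose simp: continuous_on_eq_continuous_at\<close>)
  note s1 = Lp_scaleR_tendsto[where a = "\<lambda>k x. F' (\<phi> k x)" and f = "\<lambda>k. grad (\<phi> k)", OF comp[OF F(2) mm(1)] comp[OF F(2) mm(3)] F(3)
     lim[OF l1(2) F(2)] test_Lp(2)[OF \<phi>] sobolev0_in_Lp(2)[OF u] l1(1) p_bounds(3)]
  note s2 = Lp_scaleR_tendsto[where a = "\<lambda>k x. E' (\<psi> k x)" and f = "\<lambda>k. grad (\<psi> k)", OF comp[OF E(2) mm(2)] comp[OF E(2) mm(4)] E(3)
     lim[OF l2(2) E(2)] test_Lp(2)[OF \<psi>] sobolev0_in_Lp(2)[OF v] l2(1) p_bounds(3)]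
  define f where "f k x = F (\<phi> k x) - E (\<psi> k x)" for k x
  define g where "g k x = F' (\<phi> k x) *\<^sub>R grad (\<phi> k) x - E' (\<psi> k x) *\<^sub>R grad (\<psi> k) x" for k x
  define g0 where "g0 x = F' (u x) *\<^sub>R G x - E' (v x) *\<^sub>R H x" for x
  have C: "C1 (f k) (g k)" for k
    unfolding f_def[abs_def] g_def[abs_def]
    by (rule C1_diff[OF C1_comp[OF test_function_C1[OF \<phi>] F(1,2)] C1_comp[OF test_function_C1[OF \<psi>] E(1,2)]])
  have gL: "in_Lp p M (g k)" for k unfolding g_def[abs_def] by (rule in_Lp_diff(1)[OF s1(1) s2(1) p_bounds(1)])
  have g0L: "in_Lp p M g0" unfolding g0_def[abs_def] by (rule in_Lp_diff(1)[OF s1(2) s2(2) p_bounds(1)])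
  have "(\<lambda>k. 2 powr p * (Lpi p M (\<lambda>x. F' (\<phi> k x) *\<^sub>R grad (\<phi> k) x - F' (u x) *\<^sub>R G x) + Lpi p M (\<lambda>x. E' (\<psi> k x) *\<^sub>R grad (\<psi> k) x - E' (v x) *\<^sub>R H x))) \<longlonglongrightarrow> 2 powr p * (0 + 0)"
    by (intro tendsto_mult_left tendsto_add s1(3) s2(3))
  then have z: "(\<lambda>k. 2 powr p * (Lpi p M (\<lambda>x. F' (\<phi> k x) *\<^sub>R grad (\<phi> k) x - F' (u x) *\<^sub>R G x) + Lpi p M (\<lambda>x. E' (\<psi> k x) *\<^sub>R grad (\<psi> k) x - E' (v x) *\<^sub>R H x))) \<longlonglongrightarrow> 0" by simp
  have "(\<lambda>k. Lpi p M (\<lambda>x. g k x - g0 x)) \<longlonglongrightarrow> 0"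
  proof (rule tendsto_sandwich[OF always_eventually always_eventually tendsto_const z]; intro allI)
    fix k
    have "(\<lambda>x. g k x - g0 x) = (\<lambda>x. (F' (\<phi> k x) *\<^sub>R grad (\<phi> k) x - F' (u x) *\<^sub>R G x) - (E' (\<psi> k x) *\<^sub>R grad (\<psi> k) x - E' (v x) *\<^sub>R H x))"
      by (auto simp: g_def g0_def)
    then show "Lpi p M (\<lambda>x. g k x - g0 x) \<le> 2 powr p * (Lpi p M (\<lambda>x. F' (\<phi> k x) *\<^sub>R grad (\<phi> k) x - F' (u x) *\<^sub>R G x) + Lpi p M (\<lambda>x. E' (\<psi> k x) *\<^sub>R grad (\<psi> k) x - E' (v x) *\<^sub>R H x))"
      using in_Lp_diff(2)[OF in_Lp_diff(1)[OF s1(1,2) p_bounds(1)] in_Lp_diff(1)[OF s2(1,2) p_bounds(1)] p_bounds(1)] by simp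
  qed (rule Lpi_nonneg)
  then have d: "(\<lambda>k. Lpi 1 M (\<lambda>x. g k x - g0 x)) \<longlonglongrightarrow> 0"
    by (intro Lpi_tendsto_0_exponent_mono[OF finite_M in_Lp_diff(1)[OF gL g0L p_bounds(1)] zero_less_one p_bounds(2)])
  have gi: "integrable M (g k)" and g0i: "integrable M g0" for k
    using integrable_of_in_Lp(1)[OF finite_M gL p_bounds(2)] integrable_of_in_Lp(1)[OF finite_M g0L p_bounds(2)] by auto
  have ind: "integrable M (\<lambda>x. norm (k x) * indicator (ball c r) x)" if "integrable M k" for k :: "'a \<Rightarrow> 'a"
    using integrable_mult_indicator[OF BM integrable_norm[OF that]] by (simp add: mult.commute)
  have I: "?I = (\<integral>x. norm (g0 x) * indicator (ball c r) x \<partial>M)" by (simp add: g0_def)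
  show ?thesis
    unfolding I
  proof (rule osc_Fatou)
    show "f k \<in> borel_measurable M" for k
      unfolding f_def[abs_def] by (rule borel_measurable_diff[OF comp[OF Fc mm(1)] comp[OF Ec mm(2)]])
    show "AE x in M. (\<lambda>k. f k x) \<longlonglongrightarrow> F (u x) - E (v x)"
      using lim[OF l1(2) Fc] lim[OF l2(2) Ec] unfolding f_def by eventually_elim (rule tendsto_diff)
    show "osc (ball c r) (f k) \<le> ennreal (osc_const r * ((\<integral>x. norm (g0 x) * indicator (ball c r) x \<partial>M) + Lpi 1 M (\<lambda>x. g k x - g0 x)))" for k
    proof -
      have "(\<integral>x. norm (g k x) * indicator (ball c r) x \<partial>M) \<le> (\<integral>x. norm (g0 x) * indicator (ball c r) x + norm (g k x - g0 x) \<partial>M)"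
      proof (rule integral_mono[OF ind[OF gi]])
        show "integrable M (\<lambda>x. norm (g0 x) * indicator (ball c r) x + norm (g k x - g0 x))"
          using ind[OF g0i] gi g0i by simp
        show "norm (g k x) * indicator (ball c r) x \<le> norm (g0 x) * indicator (ball c r) x + norm (g k x - g0 x)" for x
          using norm_triangle_ineq[of "g0 x" "g k x - g0 x"] by (auto split: split_indicator)
      qed
      also have "\<dots> = (\<integral>x. norm (g0 x) * indicator (ball c r) x \<partial>M) + Lpi 1 M (\<lambda>x. g k x - g0 x)"
        using ind[OF g0i] gi g0i by (simp add: Lpi_def)
      finally show ?thesis
        using osc_const_nonneg[of r] B(2) by (intro order_trans[OF osc_C1[OF C B gi]] ennreal_leI mult_left_mono) auto
    qed
    have "(\<lambda>k. osc_const r * ((\<integral>x. norm (g0 x) * indicator (ball c r) x \<partial>M) + Lpi 1 M (\<lambda>x. g k x - g0 x)))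
       \<longlonglongrightarrow> osc_const r * ((\<integral>x. norm (g0 x) * indicator (ball c r) x \<partial>M) + 0)"
      by (intro tendsto_mult_left tendsto_add tendsto_const d)
    then show "(\<lambda>k. osc_const r * ((\<integral>x. norm (g0 x) * indicator (ball c r) x \<partial>M) + Lpi 1 M (\<lambda>x. g k x - g0 x)))
       \<longlonglongrightarrow> osc_const r * (\<integral>x. norm (g0 x) * indicator (ball c r) x \<partial>M)" by simp
  qed (rule BM)
qed

end

section \<open>Monotonicity and compactness of the iteration\<close>

lemma pflow_measurable:
  assumes "1 < p" "f \<in> borel_measurable M"
  shows "(\<lambda>x. pflow p (f x)) \<in> borel_measurable M"
  using measurable_compose[OF assms(2) borel_measurable_continuous_onI[OF continuous_on_pflow[OF assms(1)]]] .

lemma integrable_pflow_inner: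
  assumes p: "1 < p" and f: "in_Lp p M f" and g: "in_Lp p M g"
  shows "integrable M (\<lambda>x. pflow p (f x) \<bullet> g x)"
proof (rule Bochner_Integration.integrable_bound[OF Holder_integral(1)[OF f g]])
  show "(\<lambda>x. pflow p (f x) \<bullet> g x) \<in> borel_measurable M"
    by (intro borel_measurable_inner pflow_measurable[OF p] in_Lp_measurable[OF f] in_Lp_measurable[OF g])
  show "AE x in M. norm (pflow p (f x) \<bullet> g x) \<le> norm (norm (f x) powr (p - 1) * norm (g x))"
    using pflow_inner_le[of p "f _" "g _"] by (intro AE_I2) simp
qed (use p in simp)

lemma integral_pflow_self:
  "(\<integral>x. pflow p (f x) \<bullet> f x \<partial>M) = Lpi p M f"
  by (simp add: pflow_inner_self Lpi_def)

lemma pgap_integral: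
  assumes p: "1 < p" and f: "in_Lp p M f" and g: "in_Lp p M g"
  shows "integrable M (\<lambda>x. pgap p (f x) (g x))"
    and "(\<integral>x. pgap p (f x) (g x) \<partial>M) = Lpi p M g + (p - 1) * Lpi p M f - p * (\<integral>x. pflow p (f x) \<bullet> g x \<partial>M)"
    and "0 \<le> (\<integral>x. pgap p (f x) (g x) \<partial>M)"
proof -
  note i = integrable_pflow_inner[OF assms] in_Lp_integrable[OF f] in_Lp_integrable[OF g]
  show "integrable M (\<lambda>x. pgap p (f x) (g x))"
    and "(\<integral>x. pgap p (f x) (g x) \<partial>M) = Lpi p M g + (p - 1) * Lpi p M f - p * (\<integral>x. pflow p (f x) \<bullet> g x \<partial>M)"
    using i by (simp_all add: pgap_def Lpi_def)
  show "0 \<le> (\<integral>x. pgap p (f x) (g x) \<partial>M)"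
    by (rule integral_nonneg_AE) (intro AE_I2 pgap_nonneg[OF p])
qed

lemma Lpi_diff_le_pgap:
  assumes p: "1 < p" and e: "0 < e"
  obtains C where "0 < C" "\<And>f g :: 'm \<Rightarrow> 'b::euclidean_space. in_Lp p M f \<Longrightarrow> in_Lp p M g \<Longrightarrow>
      Lpi p M (\<lambda>x. f x - g x) \<le> e * (Lpi p M f + Lpi p M g) + C * (\<integral>x. pgap p (f x) (g x) \<partial>M)"
proof -
  obtain C where C: "0 < C" "\<And>a b :: 'b. norm (a - b) powr p \<le> e * (norm a powr p + norm b powr p) + C * pgap p a b"
    by (rule pgap_controls_norm_diff[OF p e]) blast
  show ?thesis
  proof (rule that[OF C(1)])
    fix f g :: "'m \<Rightarrow> 'b" assume f: "in_Lp p M f" and g: "in_Lp p M g"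
    note i = in_Lp_integrable[OF f] in_Lp_integrable[OF g] pgap_integral(1)[OF p f g]
    have "Lpi p M (\<lambda>x. f x - g x) \<le> (\<integral>x. e * (norm (f x) powr p + norm (g x) powr p) + C * pgap p (f x) (g x) \<partial>M)"
      unfolding Lpi_def using p i
      by (intro integral_mono C(2) in_Lp_integrable[OF in_Lp_diff(1)[OF f g]] Bochner_Integration.integrable_add integrable_mult_right) auto
    also have "\<dots> = e * (Lpi p M f + Lpi p M g) + C * (\<integral>x. pgap p (f x) (g x) \<partial>M)"
      using i by (simp add: Lpi_def)
    finally show "Lpi p M (\<lambda>x. f x - g x) \<le> e * (Lpi p M f + Lpi p M g) + C * (\<integral>x. pgap p (f x) (g x) \<partial>M)" .
  qed
qed

text \<open>The iteration after normalisation: the equation is divided by the matching power of the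
  norm of the new iterate, which produces the factor \<open>lam n\<close>. Gradients are listed from
  index \<open>Suc n\<close> on because \<open>w 0\<close> is only in L^q. The right-hand side
  carries |w|^(q-1), which equals |w|^(q-2) w for nonnegative w.\<close>

locale inverse_iteration = bounded_open \<Omega> p for \<Omega> :: "'a::euclidean_space set" and p +
  fixes q :: real and w :: "nat \<Rightarrow> 'a \<Rightarrow> real" and G :: "nat \<Rightarrow> 'a \<Rightarrow> 'a" and lam :: "nat \<Rightarrow> real"
  assumes q: "1 \<le> q" "q \<le> p"
    and w_Lq: "\<And>n. in_Lp q M (w n)"
    and w_nonneg: "\<And>n. AE x in M. 0 \<le> w n x"
    and w_norm: "\<And>n. Lpi q M (w n) = 1"
    and w_sobolev: "\<And>n. sobolev0 \<Omega> p (w (Suc n)) (G (Suc n))"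
    and lam_nonneg: "\<And>n. 0 \<le> lam n"
    and weak_eq: "\<And>n \<phi> \<Phi>. sobolev0 \<Omega> p \<phi> \<Phi> \<Longrightarrow>
      (\<integral>x. pflow p (G (Suc n) x) \<bullet> \<Phi> x \<partial>M) = lam n * (\<integral>x. \<bar>w n x\<bar> powr (q - 1) * \<phi> x \<partial>M)"
begin

lemma Lp_imp_Lq: "in_Lp p M f \<Longrightarrow> in_Lp q M f"
  using q(1) by - (erule in_Lp_exponent_mono[OF finite_M _ _ q(2)], simp)

lemma G_Lp: "in_Lp p M (G (Suc n))"
  by (rule sobolev0_in_Lp(2)[OF w_sobolev])

lemma rhs_integrable:
  assumes "in_Lp q M v"
  shows "integrable M (\<lambda>x. \<bar>w n x\<bar> powr (q - 1) * v x)"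
    and "\<bar>\<integral>x. \<bar>w n x\<bar> powr (q - 1) * v x \<partial>M\<bar> \<le> Lpi q M v powr (1 / q)"
proof -
  note H = Holder_integral[OF w_Lq[of n] assms q(1)]
  note [measurable] = in_Lp_measurable[OF w_Lq[of n]] in_Lp_measurable[OF assms]
  show i: "integrable M (\<lambda>x. \<bar>w n x\<bar> powr (q - 1) * v x)"
    by (rule Bochner_Integration.integrable_bound[OF H(1)]) (auto simp: abs_mult)
  have "\<bar>\<integral>x. \<bar>w n x\<bar> powr (q - 1) * v x \<partial>M\<bar> \<le> (\<integral>x. \<bar>\<bar>w n x\<bar> powr (q - 1) * v x\<bar> \<partial>M)"
    by (rule integral_abs_bound)
  also have "\<dots> = (\<integral>x. norm (w n x) powr (q - 1) * norm (v x) \<partial>M)"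
    by (simp add: abs_mult)
  also have "\<dots> \<le> Lpi q M v powr (1 / q)"
    using H(2) by (simp add: w_norm)
  finally show "\<bar>\<integral>x. \<bar>w n x\<bar> powr (q - 1) * v x \<partial>M\<bar> \<le> Lpi q M v powr (1 / q)" .
qed

text \<open>The equation is tested with its own solution; the right-hand integral is at most 1 by
  Holder's inequality, both functions having norm 1.\<close>

lemma energy_le: "Lpi p M (G (Suc n)) \<le> lam n"
proof -
  have "Lpi p M (G (Suc n)) = lam n * (\<integral>x. \<bar>w n x\<bar> powr (q - 1) * w (Suc n) x \<partial>M)"
    using weak_eq[OF w_sobolev[of n], of n] by (simp add: integral_pflow_self)
  also have "\<dots> \<le> lam n * 1"
    using rhs_integrable(2)[OF w_Lq[of "Suc n"], of n] lam_nonneg[of n] w_norm[of "Suc n"]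
    by (intro mult_left_mono) auto
  finally show ?thesis by simp
qed

text \<open>Here the test function is the datum \<open>w (Suc n)\<close> of the equation itself, so
  the right-hand integral is exactly the q-th power of its norm, which is 1.\<close>

lemma pflow_shift: "(\<integral>x. pflow p (G (Suc (Suc n)) x) \<bullet> G (Suc n) x \<partial>M) = lam (Suc n)"
proof -
  have "(\<integral>x. \<bar>w (Suc n) x\<bar> powr (q - 1) * w (Suc n) x \<partial>M) = Lpi q M (w (Suc n))"
    unfolding Lpi_def
  proof (rule integral_cong_AE)
    note [measurable] = in_Lp_measurable[OF w_Lq[of "Suc n"]]
    show "(\<lambda>x. \<bar>w (Suc n) x\<bar> powr (q - 1) * w (Suc n) x) \<in> borel_measurable M" "(\<lambda>x. norm (w (Suc n) x) powr q) \<in> borel_measurable M"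
      by measurable
    show "AE x in M. \<bar>w (Suc n) x\<bar> powr (q - 1) * w (Suc n) x = norm (w (Suc n) x) powr q"
      using w_nonneg[of "Suc n"] by eventually_elim (simp add: powr_minus_one_mult)
  qed
  then show ?thesis
    using weak_eq[OF w_sobolev[of n], of "Suc n"] by (simp add: w_norm)
qed

text \<open>The cross term of the gap is known exactly from \<open>pflow_shift\<close> and the two
  energies are bounded by \<open>energy_le\<close>; of the p copies of \<open>lam (Suc n)\<close>
  that are subtracted, p - 1 cancel.\<close>

lemma pgap_shift: "(\<integral>x. pgap p (G (Suc (Suc n)) x) (G (Suc n) x) \<partial>M) \<le> lam n - lam (Suc n)"
proof -
  have "(\<integral>x. pgap p (G (Suc (Suc n)) x) (G (Suc n) x) \<partial>M)
      = Lpi p M (G (Suc n)) + (p - 1) * Lpi p M (G (Suc (Suc n))) - p * lam (Suc n)"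
    unfolding pgap_integral(2)[OF p_gt_1 G_Lp G_Lp] pflow_shift ..
  also have "\<dots> \<le> lam n + (p - 1) * lam (Suc n) - p * lam (Suc n)"
    using energy_le[of n] energy_le[of "Suc n"] p_gt_1 by (intro diff_mono add_mono mult_left_mono) auto
  finally show ?thesis by (simp add: algebra_simps)
qed

lemma lam_decreasing: "lam (Suc n) \<le> lam n"
  using pgap_shift[of n] pgap_integral(3)[OF p_gt_1 G_Lp[of "Suc n"] G_Lp[of n]] by simp

lemma lam_decseq: "decseq lam"
  by (rule decseq_SucI[of lam, OF lam_decreasing])

lemma lam_le_0: "lam n \<le> lam 0"
  using lam_decseq by (simp add: decseq_def)

lemma lam_convergent: "lam \<longlonglongrightarrow> lim lam"
proof -
  have "convergent lam"
    by (rule decseq_convergent[OF lam_decseq, of 0]) (use lam_nonneg in \<open>auto simp: convergent_def\<close>)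
  then show ?thesis by (simp add: convergent_LIMSEQ_iff)
qed

lemma energy_bound: "Lpi p M (G (Suc n)) \<le> lam 0"
  using energy_le[of n] lam_le_0[of n] by linarith

lemma grad_shift_tendsto: "(\<lambda>n. Lpi p M (\<lambda>x. G (Suc (Suc n)) x - G (Suc n) x)) \<longlonglongrightarrow> 0"
proof (rule LIMSEQ_I)
  fix e :: real assume e: "0 < e"
  \<comment> \<open>This makes the part of the estimate that is proportional to the energies at most
    e / 2; the other part is a multiple of consecutive differences of the convergent sequence
    \<open>lam\<close>. The added 1 covers \<open>lam 0 = 0\<close>.\<close>
  define d where "d = e / 2 / (2 * lam 0 + 1)"
  have d: "0 < d" using e lam_nonneg[of 0] by (simp add: d_def)
  have d2: "d * (2 * lam 0) \<le> e / 2"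
  proof -
    have "d * (2 * lam 0) \<le> d * (2 * lam 0 + 1)" using d by simp
    also have "\<dots> = e / 2" unfolding d_def using lam_nonneg[of 0] by (intro nonzero_eq_divide_eq[THEN iffD1]) auto
    finally show ?thesis .
  qed
  obtain C where C: "0 < C" "\<And>f g :: 'a \<Rightarrow> 'a. in_Lp p M f \<Longrightarrow> in_Lp p M g \<Longrightarrow>
      Lpi p M (\<lambda>x. f x - g x) \<le> d * (Lpi p M f + Lpi p M g) + C * (\<integral>x. pgap p (f x) (g x) \<partial>M)"
    by (rule Lpi_diff_le_pgap[OF p_gt_1 d]) blast
  have "(\<lambda>n. C * (lam n - lam (Suc n))) \<longlonglongrightarrow> C * (lim lam - lim lam)"
    by (intro tendsto_mult_left tendsto_diff lam_convergent LIMSEQ_Suc[OF lam_convergent])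
  then have "(\<lambda>n. C * (lam n - lam (Suc n))) \<longlonglongrightarrow> 0" by simp
  then have "\<forall>\<^sub>F n in sequentially. C * (lam n - lam (Suc n)) < e / 2" using e by (intro order_tendstoD(2)) auto
  then obtain N where N: "\<And>n. N \<le> n \<Longrightarrow> C * (lam n - lam (Suc n)) < e / 2" unfolding eventually_sequentially by blast
  have "Lpi p M (\<lambda>x. G (Suc (Suc n)) x - G (Suc n) x) < e" if "N \<le> n" for n
  proof -
    have "Lpi p M (\<lambda>x. G (Suc (Suc n)) x - G (Suc n) x)
      \<le> d * (Lpi p M (G (Suc (Suc n))) + Lpi p M (G (Suc n))) + C * (\<integral>x. pgap p (G (Suc (Suc n)) x) (G (Suc n) x) \<partial>M)"
      by (rule C(2)[OF G_Lp G_Lp])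
    also have "\<dots> \<le> d * (lam 0 + lam 0) + C * (lam n - lam (Suc n))"
      using d C(1) energy_bound[of n] energy_bound[of "Suc n"] pgap_shift[of n] by (intro add_mono mult_left_mono) auto
    also have "\<dots> < e" using d2 N[OF that] by simp
    finally show ?thesis .
  qed
  then show "\<exists>N. \<forall>n\<ge>N. norm (Lpi p M (\<lambda>x. G (Suc (Suc n)) x - G (Suc n) x) - 0) < e"
    by (intro exI[of _ N]) (simp add: Lpi_nonneg)
qed

lemma w_shift_tendsto: "(\<lambda>n. Lpi p M (\<lambda>x. w (Suc (Suc n)) x - w (Suc n) x)) \<longlonglongrightarrow> 0"
proof -
  obtain D where D: "0 < D" "\<And>u G. sobolev0 \<Omega> p u G \<Longrightarrow> Lpi p M u \<le> D * Lpi p M G"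
    by (rule poincare) blast
  have z: "(\<lambda>n. D * Lpi p M (\<lambda>x. G (Suc (Suc n)) x - G (Suc n) x)) \<longlonglongrightarrow> 0"
    by (rule tendsto_mult_right_zero[OF grad_shift_tendsto])
  show ?thesis
    by (rule tendsto_sandwich[OF always_eventually always_eventually tendsto_const z]; intro allI)
       (simp_all add: Lpi_nonneg D(2) sobolev0_diff w_sobolev)
qed

text \<open>Upgrades convergence of the functions to convergence of the gradients. The nonnegative
  gap in the opposite order is added, which gives the monotonicity pairing; each of the two
  equations turns its half into an integral against the difference of the functions, bounded by
  \<open>lam 0\<close> times the norm of that difference.\<close>

lemma pgap_le_rhs:
  "(\<integral>x. pgap p (G (Suc i) x) (G (Suc j) x) \<partial>M) \<le> 2 * p * lam 0 * Lpi q M (\<lambda>x. w (Suc i) x - w (Suc j) x) powr (1 / q)"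
proof -
  define v where "v x = w (Suc i) x - w (Suc j) x" for x
  define V where "V x = G (Suc i) x - G (Suc j) x" for x
  have v: "sobolev0 \<Omega> p v V" unfolding v_def[abs_def] V_def[abs_def] by (rule sobolev0_diff[OF w_sobolev w_sobolev])
  have vq: "in_Lp q M v" by (rule Lp_imp_Lq[OF sobolev0_in_Lp(1)[OF v]])
  have Vp: "in_Lp p M V" by (rule sobolev0_in_Lp(2)[OF v])
  have bound: "\<bar>\<integral>x. pflow p (G (Suc k) x) \<bullet> V x \<partial>M\<bar> \<le> lam 0 * Lpi q M v powr (1 / q)" for k
  proof -
    have "\<bar>\<integral>x. pflow p (G (Suc k) x) \<bullet> V x \<partial>M\<bar> = lam k * \<bar>\<integral>x. \<bar>w k x\<bar> powr (q - 1) * v x \<partial>M\<bar>"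
      using weak_eq[OF v, of k] lam_nonneg[of k] by (simp add: abs_mult)
    also have "\<dots> \<le> lam 0 * Lpi q M v powr (1 / q)"
      using lam_nonneg[of 0] lam_le_0[of k] rhs_integrable(2)[OF vq] by (intro mult_mono) auto
    finally show ?thesis .
  qed
  note gi = pgap_integral[OF p_gt_1 G_Lp G_Lp]
  have "(\<integral>x. pgap p (G (Suc i) x) (G (Suc j) x) \<partial>M)
     \<le> (\<integral>x. pgap p (G (Suc i) x) (G (Suc j) x) \<partial>M) + (\<integral>x. pgap p (G (Suc j) x) (G (Suc i) x) \<partial>M)"
    using gi(3) by simp
  also have "\<dots> = (\<integral>x. pgap p (G (Suc i) x) (G (Suc j) x) + pgap p (G (Suc j) x) (G (Suc i) x) \<partial>M)"
    using gi(1) by simp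
  also have "\<dots> = (\<integral>x. p * (pflow p (G (Suc i) x) \<bullet> V x - pflow p (G (Suc j) x) \<bullet> V x) \<partial>M)"
    by (simp add: pgap_sym_sum V_def inner_diff_left)
  also have "\<dots> = p * ((\<integral>x. pflow p (G (Suc i) x) \<bullet> V x \<partial>M) - (\<integral>x. pflow p (G (Suc j) x) \<bullet> V x \<partial>M))"
    using integrable_pflow_inner[OF p_gt_1 G_Lp Vp] by simp
  also have "\<dots> \<le> p * (2 * (lam 0 * Lpi q M v powr (1 / q)))"
    using bound[of i] bound[of j] p_gt_1 by (intro mult_left_mono) auto
  finally show ?thesis by (simp add: v_def[abs_def] ac_simps)
qed

text \<open>Two consecutive iterates are recorded because they occur together in one equation, as
  datum and as solution; that they share the limit comes from the shift estimates. Rellich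
  compactness supplies v, and \<open>pgap_le_rhs\<close> then makes the gradients a Cauchy
  sequence.\<close>

lemma subsequence_limit:
  assumes r: "strict_mono (r :: nat \<Rightarrow> nat)"
  obtains s v H where "strict_mono (s :: nat \<Rightarrow> nat)" "sobolev0 \<Omega> p v H"
    "(\<lambda>k. Lpi p M (\<lambda>x. G (Suc (r (s k))) x - H x)) \<longlonglongrightarrow> 0"
    "AE x in M. (\<lambda>k. w (Suc (r (s k))) x) \<longlonglongrightarrow> v x"
    "AE x in M. (\<lambda>k. w (Suc (Suc (r (s k)))) x) \<longlonglongrightarrow> v x"
    "AE x in M. (\<lambda>k. G (Suc (Suc (r (s k)))) x) \<longlonglongrightarrow> H x"
    "AE x in M. 0 \<le> v x" "Lpi q M v = 1" "Lpi p M H \<le> lim lam"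
proof -
  have pq: "0 < q" using q by simp
  obtain s1 v where s1: "strict_mono (s1 :: nat \<Rightarrow> nat)" and v: "in_Lp p M v"
    and v_lim: "(\<lambda>n. Lpi p M (\<lambda>x. w (Suc (r (s1 n))) x - v x)) \<longlonglongrightarrow> 0"
    by (rule rellich[of "\<lambda>n. w (Suc (r n))" "\<lambda>n. G (Suc (r n))" "lam 0", OF w_sobolev energy_bound])
  define t where "t n = r (s1 n)" for n
  have t: "strict_mono t" using r s1 unfolding t_def by (simp add: strict_mono_def)
  have wL: "in_Lp p M (w (Suc n))" for n by (rule sobolev0_in_Lp(1)[OF w_sobolev])
  have v_lim: "(\<lambda>n. Lpi p M (\<lambda>x. w (Suc (t n)) x - v x)) \<longlonglongrightarrow> 0" using v_lim by (simp add: t_def)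
  have D: "in_Lp p M (\<lambda>x. w (Suc (t n)) x - v x)" for n by (rule in_Lp_diff(1)[OF wL v p_bounds(1)])
  have vq_lim: "(\<lambda>n. Lpi q M (\<lambda>x. w (Suc (t n)) x - v x)) \<longlonglongrightarrow> 0"
    by (rule Lpi_tendsto_0_exponent_mono[OF finite_M D pq q(2) v_lim])
  have vq: "in_Lp q M v" by (rule Lp_imp_Lq[OF v])
  obtain H where H: "in_Lp p M H" and H_lim: "(\<lambda>n. Lpi p M (\<lambda>x. G (Suc (t n)) x - H x)) \<longlonglongrightarrow> 0"
  proof (rule Lp_complete[of p M "\<lambda>n. G (Suc (t n))", OF G_Lp p_bounds(2)])
    fix e :: real assume e: "0 < e"
    define d where "d = e / 2 / (2 * lam 0 + 1)"
    have d: "0 < d" using e lam_nonneg[of 0] by (simp add: d_def)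
    have d2: "d * (2 * lam 0) \<le> e / 2"
    proof -
      have "d * (2 * lam 0) \<le> d * (2 * lam 0 + 1)" using d by simp
      also have "\<dots> = e / 2" unfolding d_def using lam_nonneg[of 0] by (intro nonzero_eq_divide_eq[THEN iffD1]) auto
      finally show ?thesis .
    qed
    obtain C where C: "0 < C" "\<And>f g :: 'a \<Rightarrow> 'a. in_Lp p M f \<Longrightarrow> in_Lp p M g \<Longrightarrow>
        Lpi p M (\<lambda>x. f x - g x) \<le> d * (Lpi p M f + Lpi p M g) + C * (\<integral>x. pgap p (f x) (g x) \<partial>M)"
      by (rule Lpi_diff_le_pgap[OF p_gt_1 d]) blast
    define K where "K = C * (2 * p * lam 0)"
    have K: "0 \<le> K" using C(1) p_gt_1 lam_nonneg[of 0] by (simp add: K_def)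
    \<comment> \<open>Two distances below \<delta>, joined by the triangle inequality with factor
      \<open>2 powr q\<close>, give a quantity whose q-th root is at most e / (2 (K + 1)); this is
      the precision at which K times it stays below e / 2.\<close>
    define \<delta> where "\<delta> = (e / (2 * (K + 1))) powr q / (2 powr q * 2)"
    have \<delta>: "0 < \<delta>" using e K by (simp add: \<delta>_def)
    have "\<forall>\<^sub>F n in sequentially. Lpi q M (\<lambda>x. w (Suc (t n)) x - v x) < \<delta>"
      by (rule order_tendstoD(2)[OF vq_lim \<delta>])
    then obtain N where N: "\<And>n. N \<le> n \<Longrightarrow> Lpi q M (\<lambda>x. w (Suc (t n)) x - v x) < \<delta>" unfolding eventually_sequentially by blast
    have "Lpi p M (\<lambda>x. G (Suc (t i)) x - G (Suc (t j)) x) \<le> e" if ij: "N \<le> i" "N \<le> j" for i j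
    proof -
      have "Lpi q M (\<lambda>x. w (Suc (t i)) x - w (Suc (t j)) x)
         \<le> 2 powr q * (Lpi q M (\<lambda>x. w (Suc (t i)) x - v x) + Lpi q M (\<lambda>x. v x - w (Suc (t j)) x))"
        using pq by (intro Lpi_triangle w_Lq vq) simp
      also have "\<dots> \<le> 2 powr q * (\<delta> + \<delta>)"
        using N[OF ij(1)] N[OF ij(2)] Lpi_diff_commute[of q M v "w (Suc (t j))"] by (intro mult_left_mono add_mono) auto
      also have "\<dots> = (e / (2 * (K + 1))) powr q" by (simp add: \<delta>_def)
      finally have "Lpi q M (\<lambda>x. w (Suc (t i)) x - w (Suc (t j)) x) powr (1 / q) \<le> ((e / (2 * (K + 1))) powr q) powr (1 / q)"
        using pq by (intro powr_mono2) (auto simp: Lpi_nonneg)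
      also have "\<dots> = e / (2 * (K + 1))" using pq e K by (simp add: powr_powr)
      finally have wd: "Lpi q M (\<lambda>x. w (Suc (t i)) x - w (Suc (t j)) x) powr (1 / q) \<le> e / (2 * (K + 1))" .
      have "Lpi p M (\<lambda>x. G (Suc (t i)) x - G (Suc (t j)) x)
        \<le> d * (Lpi p M (G (Suc (t i))) + Lpi p M (G (Suc (t j)))) + C * (\<integral>x. pgap p (G (Suc (t i)) x) (G (Suc (t j)) x) \<partial>M)"
        by (rule C(2)[OF G_Lp G_Lp])
      also have "\<dots> \<le> d * (lam 0 + lam 0) + C * (2 * p * lam 0 * Lpi q M (\<lambda>x. w (Suc (t i)) x - w (Suc (t j)) x) powr (1 / q))"
        using d C(1) energy_bound by (intro add_mono mult_left_mono pgap_le_rhs) auto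
      also have "\<dots> = d * (2 * lam 0) + K * Lpi q M (\<lambda>x. w (Suc (t i)) x - w (Suc (t j)) x) powr (1 / q)"
        by (simp add: K_def)
      also have "\<dots> \<le> e / 2 + K * (e / (2 * (K + 1)))"
        using d2 wd K by (intro add_mono mult_left_mono) auto
      also have "K * (e / (2 * (K + 1))) \<le> e / 2"
      proof -
        have "K * (e / (2 * (K + 1))) = e / 2 * (K / (K + 1))" by simp
        also have "\<dots> \<le> e / 2 * 1" using K e by (intro mult_left_mono) auto
        finally show ?thesis by simp
      qed
      finally show ?thesis by simp
    qed
    then show "\<exists>N. \<forall>m\<ge>N. \<forall>n\<ge>N. Lpi p M (\<lambda>x. G (Suc (t m)) x - G (Suc (t n)) x) \<le> e" by blast
  qed blast
  have S: "sobolev0 \<Omega> p v H"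
    by (rule sobolev0_limit[of "\<lambda>n. w (Suc (t n))" "\<lambda>n. G (Suc (t n))", OF w_sobolev v H v_lim H_lim])
  have w2: "(\<lambda>n. Lpi p M (\<lambda>x. w (Suc (Suc (t n))) x - v x)) \<longlonglongrightarrow> 0"
  proof -
    have "(\<lambda>n. 2 powr p * (Lpi p M (\<lambda>x. w (Suc (Suc (t n))) x - w (Suc (t n)) x) + Lpi p M (\<lambda>x. w (Suc (t n)) x - v x))) \<longlonglongrightarrow> 2 powr p * (0 + 0)"
      using LIMSEQ_subseq_LIMSEQ[OF w_shift_tendsto t] by (intro tendsto_mult_left tendsto_add v_lim) (simp add: o_def)
    then have z: "(\<lambda>n. 2 powr p * (Lpi p M (\<lambda>x. w (Suc (Suc (t n))) x - w (Suc (t n)) x) + Lpi p M (\<lambda>x. w (Suc (t n)) x - v x))) \<longlonglongrightarrow> 0" by simp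
    show ?thesis
      by (rule tendsto_sandwich[OF always_eventually always_eventually tendsto_const z]; intro allI)
         (simp_all add: Lpi_nonneg Lpi_triangle[OF wL wL v p_bounds(1)])
  qed
  have G2: "(\<lambda>n. Lpi p M (\<lambda>x. G (Suc (Suc (t n))) x - H x)) \<longlonglongrightarrow> 0"
  proof -
    have "(\<lambda>n. 2 powr p * (Lpi p M (\<lambda>x. G (Suc (Suc (t n))) x - G (Suc (t n)) x) + Lpi p M (\<lambda>x. G (Suc (t n)) x - H x))) \<longlonglongrightarrow> 2 powr p * (0 + 0)"
      using LIMSEQ_subseq_LIMSEQ[OF grad_shift_tendsto t] by (intro tendsto_mult_left tendsto_add H_lim) (simp add: o_def)
    then have z: "(\<lambda>n. 2 powr p * (Lpi p M (\<lambda>x. G (Suc (Suc (t n))) x - G (Suc (t n)) x) + Lpi p M (\<lambda>x. G (Suc (t n)) x - H x))) \<longlonglongrightarrow> 0" by simp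
    show ?thesis
      by (rule tendsto_sandwich[OF always_eventually always_eventually tendsto_const z]; intro allI)
         (simp_all add: Lpi_nonneg Lpi_triangle[OF G_Lp G_Lp H p_bounds(1)])
  qed
  \<comment> \<open>Convergence in L^p gives almost everywhere convergence only along subsequences,
    so three successive refinements are made, one for each of the three sequences.\<close>
  obtain a1 where a1: "strict_mono (a1 :: nat \<Rightarrow> nat)" "AE x in M. (\<lambda>n. w (Suc (t (a1 n))) x) \<longlonglongrightarrow> v x"
    by (rule Lp_AE_subseq[of p M "\<lambda>n. w (Suc (t n))", OF wL v p_bounds(3) v_lim])
  have w2': "(\<lambda>n. Lpi p M (\<lambda>x. w (Suc (Suc (t (a1 n)))) x - v x)) \<longlonglongrightarrow> 0"
    using LIMSEQ_subseq_LIMSEQ[OF w2 a1(1)] by (simp add: o_def)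
  obtain a2 where a2: "strict_mono (a2 :: nat \<Rightarrow> nat)" "AE x in M. (\<lambda>n. w (Suc (Suc (t (a1 (a2 n))))) x) \<longlonglongrightarrow> v x"
    by (rule Lp_AE_subseq[of p M "\<lambda>n. w (Suc (Suc (t (a1 n))))", OF wL v p_bounds(3) w2'])
  have a12: "strict_mono (\<lambda>n. a1 (a2 n))" using a1(1) a2(1) by (simp add: strict_mono_def)
  have G2': "(\<lambda>n. Lpi p M (\<lambda>x. G (Suc (Suc (t (a1 (a2 n))))) x - H x)) \<longlonglongrightarrow> 0"
    using LIMSEQ_subseq_LIMSEQ[OF G2 a12] by (simp add: o_def)
  obtain a3 where a3: "strict_mono (a3 :: nat \<Rightarrow> nat)" "AE x in M. (\<lambda>n. G (Suc (Suc (t (a1 (a2 (a3 n)))))) x) \<longlonglongrightarrow> H x"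
    by (rule Lp_AE_subseq[of p M "\<lambda>n. G (Suc (Suc (t (a1 (a2 n)))))", OF G_Lp H p_bounds(3) G2'])
  define s where "s n = s1 (a1 (a2 (a3 n)))" for n
  have s: "strict_mono s" using s1 a1(1) a2(1) a3(1) by (simp add: s_def strict_mono_def)
  have rs: "r (s n) = t (a1 (a2 (a3 n)))" for n by (simp add: s_def t_def)
  have a23: "strict_mono (\<lambda>n. a2 (a3 n))" "strict_mono (\<lambda>n. a1 (a2 (a3 n)))" using a1(1) a2(1) a3(1) by (simp_all add: strict_mono_def)
  have l1: "AE x in M. (\<lambda>k. w (Suc (r (s k))) x) \<longlonglongrightarrow> v x"
    using a1(2) unfolding rs by eventually_elim (use LIMSEQ_subseq_LIMSEQ[OF _ a23(1)] in \<open>auto simp: o_def\<close>)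
  have l2: "AE x in M. (\<lambda>k. w (Suc (Suc (r (s k)))) x) \<longlonglongrightarrow> v x"
    using a2(2) unfolding rs by eventually_elim (use LIMSEQ_subseq_LIMSEQ[OF _ a3(1)] in \<open>auto simp: o_def\<close>)
  have nn: "AE x in M. 0 \<le> v x"
  proof -
    have "AE x in M. \<forall>n. 0 \<le> w n x" using w_nonneg by (simp add: AE_all_countable)
    with l1 show ?thesis by eventually_elim (rule LIMSEQ_le_const, auto)
  qed
  have "(\<lambda>n. Lpi q M (w (Suc (t n)))) \<longlonglongrightarrow> Lpi q M v"
    by (rule Lpi_tendsto[OF w_Lq vq q(1) vq_lim])
  then have n1: "Lpi q M v = 1" by (simp add: w_norm LIMSEQ_const_iff)
  have "(\<lambda>n. Lpi p M (G (Suc (t n)))) \<longlonglongrightarrow> Lpi p M H"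
    by (rule Lpi_tendsto[OF G_Lp H p_bounds(2) H_lim])
  then have En: "Lpi p M H \<le> lim lam"
    using LIMSEQ_subseq_LIMSEQ[OF lam_convergent t] energy_le by (intro LIMSEQ_le[of _ "Lpi p M H" "\<lambda>n. lam (t n)"]) (auto simp: o_def)
  have "(\<lambda>k. Lpi p M (\<lambda>x. G (Suc (r (s k))) x - H x)) \<longlonglongrightarrow> 0"
    using LIMSEQ_subseq_LIMSEQ[OF H_lim a23(2)] by (simp add: rs o_def)
  then show ?thesis
    using a3(2) by (intro that[OF s S _ l1 l2 _ nn n1 En]) (simp_all add: rs)
qed

end

section \<open>The Picone inequality and positivity of the limit\<close>

lemma pflow_real: "pflow p (t::real) = \<bar>t\<bar> powr (p - 1) * sgn t"
proof -
  have "\<bar>t\<bar> powr (p - 2) * \<bar>t\<bar> = \<bar>t\<bar> powr (p - 1)"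
    using powr_minus_one_mult[of "\<bar>t\<bar>" "p - 1"] by simp
  then show ?thesis by (cases "0 \<le> t") (auto simp: pflow_def sgn_if)
qed

lemma abs_powr_has_derivative:
  assumes p: "1 < p"
  shows "((\<lambda>t. \<bar>t\<bar> powr p) has_real_derivative p * pflow p t) (at t)"
proof -
  consider "0 < t" | "t < 0" | "t = 0" by linarith
  then show ?thesis
  proof cases
    case 1
    then have "((\<lambda>t. t powr p) has_real_derivative p * pflow p t) (at t)"
      by (auto intro!: derivative_eq_intros simp: pflow_real)
    then show ?thesis
      by (rule has_field_derivative_transform_within_open[of _ _ _ "{0<..}"]) (use 1 in auto)
  next
    case 2
    then have "((\<lambda>t. (- t) powr p) has_real_derivative p * pflow p t) (at t)"
      by (auto intro!: derivative_eq_intros simp: pflow_real powr_diff)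
    then show ?thesis
      by (rule has_field_derivative_transform_within_open[of _ _ _ "{..<0}"]) (use 2 in auto)
  next
    case 3
    have "(pflow p \<longlongrightarrow> pflow p 0) (at (0::real))" using continuous_pflow[OF p, of "0::real"] by (simp add: isCont_def)
    then have l: "(pflow p \<longlongrightarrow> 0) (at (0::real))" by (simp add: pflow_def)
    have "((\<lambda>h. (\<bar>0 + h\<bar> powr p - \<bar>0\<bar> powr p) / h) \<longlongrightarrow> 0) (at (0::real))"
    proof (rule Lim_transform_eventually[OF l])
      have "pflow p h = (\<bar>0 + h\<bar> powr p - \<bar>0\<bar> powr p) / h" if "h \<noteq> 0" for h :: real
      proof -
        have "\<bar>h\<bar> powr p = \<bar>h\<bar> powr (p - 1) * \<bar>h\<bar>" by (rule powr_minus_one_mult[symmetric]) simp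
        then show ?thesis using that by (cases "0 < h") (auto simp: pflow_real)
      qed
      then show "\<forall>\<^sub>F h in at 0. pflow p h = (\<bar>0 + h\<bar> powr p - \<bar>0\<bar> powr p) / h"
        by (simp add: eventually_at_filter)
    qed
    then show ?thesis using 3 by (simp add: DERIV_def pflow_def)
  qed
qed

text \<open>Where g is negative, \<open>ennreal\<close> cuts it off at 0; hence an inequality. It is
  used for a lower bound that may change sign.\<close>

lemma ennreal_integral_le_nn_integral:
  fixes g :: "'m \<Rightarrow> real"
  assumes "integrable M g"
  shows "ennreal (\<integral>x. g x \<partial>M) \<le> (\<integral>\<^sup>+x. ennreal (g x) \<partial>M)"
proof -
  have i: "integrable M (\<lambda>x. max 0 (g x))" using assms by simp
  have "ennreal (\<integral>x. g x \<partial>M) \<le> ennreal (\<integral>x. max 0 (g x) \<partial>M)"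
    by (intro ennreal_leI integral_mono assms i) auto
  also have "\<dots> = (\<integral>\<^sup>+x. ennreal (max 0 (g x)) \<partial>M)"
    by (rule nn_integral_eq_integral[OF i, symmetric]) simp
  also have "\<dots> = (\<integral>\<^sup>+x. ennreal (g x) \<partial>M)"
    by (intro nn_integral_cong) (simp add: max_def ennreal_neg)
  finally show ?thesis .
qed

context inverse_iteration
begin

text \<open>The weak equation is tested with \<open>\<bar>\<phi>\<bar>\<^sup>p / (w\<^bsub>n+1\<^esub> + \<epsilon>)\<^bsup>p-1\<^esup>\<close>.\<close>

lemma picone:
  assumes \<phi>: "\<phi> \<in> test_functions \<Omega>" and \<epsilon>: "0 < \<epsilon>"
  shows "(\<integral>\<^sup>+x. ennreal (pgap p ((\<bar>\<phi> x\<bar> / (w (Suc n) x + \<epsilon>)) *\<^sub>R G (Suc n) x) (sgn (\<phi> x) *\<^sub>R grad \<phi> x))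
      + ennreal (lam n * (\<bar>w n x\<bar> powr (q - 1) * (\<bar>\<phi> x\<bar> powr p * (w (Suc n) x + \<epsilon>) powr (1 - p)))) \<partial>M)
    \<le> ennreal (Lpi p M (grad \<phi>))"
proof -
  define W where "W = w (Suc n)"
  define Gn where "Gn = G (Suc n)"
  have S: "sobolev0 \<Omega> p W Gn" unfolding W_def Gn_def by (rule w_sobolev)
  have W0: "AE x in M. 0 \<le> W x" unfolding W_def by (rule w_nonneg)
  define R where "R t = \<bar>t\<bar> powr p" for t :: real
  define R' where "R' t = p * pflow p t" for t :: real
  have R: "(R has_real_derivative R' t) (at t)" "continuous_on UNIV R'" for t
    unfolding R_def[abs_def] R'_def[abs_def]
    by (rule abs_powr_has_derivative[OF p_gt_1]) (intro continuous_on_mult continuous_on_const continuous_on_pflow p_gt_1)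
  define F where "F t = (t + \<epsilon>) powr (1 - p)" for t :: real
  define F' where "F' t = (1 - p) * (t + \<epsilon>) powr (- p)" for t :: real
  have F: "(F has_real_derivative F' t) (at t)" if "0 \<le> t" for t
    unfolding F_def[abs_def] F'_def using that \<epsilon> by (auto intro!: derivative_eq_intros)
  have F'c: "continuous_on {0..} F'"
    unfolding F'_def[abs_def] using \<epsilon> by (intro continuous_intros) auto
  \<comment> \<open>\<open>ext_neg_bound\<close> doubles the bound it is given, so it is applied
    with b0 / 2, the sum of the bounds of F and of F', both attained at t = 0.\<close>
  define b0 where "b0 = 2 * (\<epsilon> powr (1 - p) + (p - 1) * \<epsilon> powr (- p))"
  have F1: "\<bar>F t\<bar> \<le> \<epsilon> powr (1 - p)" and F2: "\<bar>F' t\<bar> \<le> (p - 1) * \<epsilon> powr (- p)" if "0 \<le> t" for t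
    using that \<epsilon> p_gt_1 powr_mono2'[of "1 - p" \<epsilon> "t + \<epsilon>"] powr_mono2'[of "- p" \<epsilon> "t + \<epsilon>"]
    by (auto simp: F_def F'_def abs_mult intro!: mult_left_mono)
  have nn: "0 \<le> \<epsilon> powr (1 - p)" "0 \<le> (p - 1) * \<epsilon> powr (- p)" using p_gt_1 by auto
  have b0: "b0 / 2 = \<epsilon> powr (1 - p) + (p - 1) * \<epsilon> powr (- p)" "0 \<le> b0" using nn by (auto simp: b0_def)
  have F3: "\<bar>F t\<bar> \<le> b0 / 2" if "0 \<le> t" for t using F1[OF that] nn(2) unfolding b0(1) by (rule add_increasing2[rotated])
  have F4: "\<bar>F' t\<bar> \<le> b0 / 2" if "0 \<le> t" for t using F2[OF that] nn(1) unfolding b0(1) by (rule add_increasing[rotated])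
  have b1: "\<bar>ext_neg F F' t\<bar> \<le> b0" for t using ext_neg_bound[of F "b0 / 2" F' t, OF F3 F4] by simp
  have b2: "\<bar>ext_neg_deriv F' t\<bar> \<le> b0" for t
    using ext_neg_deriv_bound[of F' "b0 / 2" t, OF F4] b0(2) by linarith
  define \<psi> where "\<psi> x = R (\<phi> x) * ext_neg F F' (W x)" for x
  define \<Psi> where "\<Psi> x = (R (\<phi> x) * ext_neg_deriv F' (W x)) *\<^sub>R Gn x + (ext_neg F F' (W x) * R' (\<phi> x)) *\<^sub>R grad \<phi> x" for x
  have SP: "sobolev0 \<Omega> p \<psi> \<Psi>"
    unfolding \<psi>_def[abs_def] \<Psi>_def[abs_def]
    by (rule sobolev0_product[OF \<phi> S R ext_neg_has_derivative[of F F', OF F] ext_neg_deriv_continuous[OF F'c] b1 b2])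
       (simp_all add: R_def)
  define a where "a x = (\<bar>\<phi> x\<bar> / (W x + \<epsilon>)) *\<^sub>R Gn x" for x
  define b where "b x = sgn (\<phi> x) *\<^sub>R grad \<phi> x" for x
  have G_L: "in_Lp p M Gn" by (rule sobolev0_in_Lp(2)[OF S])
  have \<phi>_L: "in_Lp p M \<phi>" "in_Lp p M (grad \<phi>)" by (rule test_Lp[OF \<phi>])+
  note [measurable] = in_Lp_measurable[OF sobolev0_in_Lp(1)[OF S]] in_Lp_measurable[OF G_L] in_Lp_measurable[OF \<phi>_L(1)] in_Lp_measurable[OF \<phi>_L(2)] in_Lp_measurable[OF w_Lq[of n]]
  obtain K where K: "compact K" "K \<subseteq> \<Omega>" "\<And>x. x \<notin> K \<Longrightarrow> \<phi> x = 0"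
    by (rule test_functionE[OF \<phi>]) blast
  obtain B where B: "0 \<le> B" "\<And>x. \<bar>\<phi> x\<bar> \<le> B"
    by (rule C1_compact_support_bounds[OF test_function_C1[OF \<phi>] K(1,3)]) blast+
  have aL: "in_Lp p M a"
  proof (rule in_Lp_bound[OF in_Lp_scaleR(1)[OF G_L, of "B / \<epsilon>"] _ _ p_bounds(1)])
    show "a \<in> borel_measurable M" unfolding a_def[abs_def] by measurable
    show "AE x in M. norm (a x) \<le> norm ((B / \<epsilon>) *\<^sub>R Gn x)"
      using W0
    proof eventually_elim
      fix x assume "0 \<le> W x"
      then have "\<bar>\<phi> x\<bar> / (W x + \<epsilon>) \<le> B / \<epsilon>" "0 \<le> \<bar>\<phi> x\<bar> / (W x + \<epsilon>)" using \<epsilon> B by (auto intro!: frac_le)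
      then have "\<bar>\<phi> x\<bar> / (W x + \<epsilon>) * norm (Gn x) \<le> B / \<epsilon> * norm (Gn x)" by (intro mult_right_mono) auto
      moreover have "norm (a x) = \<bar>\<phi> x\<bar> / (W x + \<epsilon>) * norm (Gn x)"
        unfolding a_def norm_scaleR abs_of_nonneg[OF \<open>0 \<le> \<bar>\<phi> x\<bar> / (W x + \<epsilon>)\<close>] ..
      moreover have "norm ((B / \<epsilon>) *\<^sub>R Gn x) = B / \<epsilon> * norm (Gn x)" using B(1) \<epsilon> by simp
      ultimately show "norm (a x) \<le> norm ((B / \<epsilon>) *\<^sub>R Gn x)" by simp
    qed
  qed
  have bL: "in_Lp p M b"
  proof (rule in_Lp_bound[OF \<phi>_L(2) _ _ p_bounds(1)])
    show "b \<in> borel_measurable M" unfolding b_def[abs_def] by measurable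
    show "AE x in M. norm (b x) \<le> norm (grad \<phi> x)" by (intro AE_I2) (auto simp: b_def sgn_if)
  qed
  \<comment> \<open>Only an inequality: \<open>sgn 0 = 0\<close> makes b vanish wherever \<phi>
    does, while the gradient of \<phi> may be nonzero there.\<close>
  have ble: "Lpi p M b \<le> Lpi p M (grad \<phi>)"
    unfolding Lpi_def using p_bounds
    by (intro integral_mono in_Lp_integrable[OF bL] in_Lp_integrable[OF \<phi>_L(2)] powr_mono2) (auto simp: b_def sgn_if)
  \<comment> \<open>Picone's identity: by homogeneity of the flux the power (|\<phi>| / (W +
    \<epsilon>))^(p-1) in front of grad \<phi> is absorbed into the flux of a. The right-hand side
    is |b|^p minus the gap of a and b.\<close>
  have point: "AE x in M. pflow p (Gn x) \<bullet> \<Psi> x = p * (pflow p (a x) \<bullet> b x) - (p - 1) * norm (a x) powr p"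
    using W0
  proof eventually_elim
    fix x assume x: "0 \<le> W x"
    define d where "d = W x + \<epsilon>"
    have d: "0 < d" using x \<epsilon> by (simp add: d_def)
    define c where "c = \<bar>\<phi> x\<bar> / d"
    have c: "0 \<le> c" using d by (simp add: c_def)
    have c1: "c powr (p - 1) = \<bar>\<phi> x\<bar> powr (p - 1) * d powr (1 - p)"
      using d by (simp add: c_def powr_divide powr_diff field_simps)
    have c2: "c powr p = \<bar>\<phi> x\<bar> powr p * d powr (- p)"
      using d by (simp add: c_def powr_divide powr_minus field_simps)
    have A: "pflow p (a x) \<bullet> b x = c powr (p - 1) * (sgn (\<phi> x) * (pflow p (Gn x) \<bullet> grad \<phi> x))"
      using c by (simp add: a_def b_def c_def d_def pflow_scale)
    have "norm (a x) = c * norm (Gn x)"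
      unfolding a_def c_def d_def norm_scaleR abs_of_nonneg[OF c[unfolded c_def d_def]] ..
    then have N: "norm (a x) powr p = c powr p * norm (Gn x) powr p"
      using c by (simp add: powr_mult)
    have "pflow p (Gn x) \<bullet> \<Psi> x = (R (\<phi> x) * F' (W x)) * norm (Gn x) powr p + (F (W x) * R' (\<phi> x)) * (pflow p (Gn x) \<bullet> grad \<phi> x)"
      using x by (simp add: \<Psi>_def inner_add_right pflow_inner_self ext_neg_def ext_neg_deriv_def)
    also have "(R (\<phi> x) * F' (W x)) * norm (Gn x) powr p = - (p - 1) * norm (a x) powr p"
      by (simp add: N c2 R_def F'_def d_def algebra_simps)
    also have "(F (W x) * R' (\<phi> x)) * (pflow p (Gn x) \<bullet> grad \<phi> x) = p * (pflow p (a x) \<bullet> b x)"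
      by (simp add: A c1 R'_def F_def d_def pflow_real)
    finally show "pflow p (Gn x) \<bullet> \<Psi> x = p * (pflow p (a x) \<bullet> b x) - (p - 1) * norm (a x) powr p"
      by (simp add: left_diff_distrib)
  qed
  note ia = integrable_pflow_inner[OF p_gt_1 aL bL] in_Lp_integrable[OF aL] in_Lp_integrable[OF bL]
  define T where "T x = \<bar>w n x\<bar> powr (q - 1) * (\<bar>\<phi> x\<bar> powr p * (W x + \<epsilon>) powr (1 - p))" for x
  have TAE: "AE x in M. \<bar>w n x\<bar> powr (q - 1) * \<psi> x = T x"
    using W0 by eventually_elim (simp add: T_def \<psi>_def R_def F_def ext_neg_def)
  have \<psi>q: "in_Lp q M \<psi>" by (rule Lp_imp_Lq[OF sobolev0_in_Lp(1)[OF SP]])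
  have Tm[measurable]: "T \<in> borel_measurable M" unfolding T_def[abs_def] by measurable
  have Ti: "integrable M T"
    by (rule integrable_cong_AE_imp[OF rhs_integrable(1)[OF \<psi>q, of n] Tm]) (use TAE in auto)
  have TI: "(\<integral>x. \<bar>w n x\<bar> powr (q - 1) * \<psi> x \<partial>M) = (\<integral>x. T x \<partial>M)"
    using rhs_integrable(1)[OF \<psi>q, of n] by (intro integral_cong_AE TAE Tm) auto
  have "lam n * (\<integral>x. T x \<partial>M) = (\<integral>x. pflow p (Gn x) \<bullet> \<Psi> x \<partial>M)"
    using weak_eq[OF SP, of n] by (simp add: Gn_def TI)
  also have "\<dots> = (\<integral>x. p * (pflow p (a x) \<bullet> b x) - (p - 1) * norm (a x) powr p \<partial>M)"
    using integrable_pflow_inner[OF p_gt_1 G_L sobolev0_in_Lp(2)[OF SP]] ia by (intro integral_cong_AE point) auto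
  also have "\<dots> = p * (\<integral>x. pflow p (a x) \<bullet> b x \<partial>M) - (p - 1) * Lpi p M a"
    using ia by (simp add: Lpi_def)
  finally have eq: "(\<integral>x. pgap p (a x) (b x) \<partial>M) + lam n * (\<integral>x. T x \<partial>M) = Lpi p M b"
    using pgap_integral(2)[OF p_gt_1 aL bL] by simp
  have Tn: "0 \<le> T x" for x by (simp add: T_def)
  have "(\<integral>\<^sup>+x. ennreal (pgap p (a x) (b x)) + ennreal (lam n * T x) \<partial>M) = (\<integral>\<^sup>+x. ennreal (pgap p (a x) (b x) + lam n * T x) \<partial>M)"
    by (intro nn_integral_cong ennreal_plus[symmetric] mult_nonneg_nonneg pgap_nonneg[OF p_gt_1] lam_nonneg Tn)
  also have "\<dots> = ennreal (\<integral>x. pgap p (a x) (b x) + lam n * T x \<partial>M)"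
    using lam_nonneg[of n] Tn pgap_nonneg[OF p_gt_1] pgap_integral(1)[OF p_gt_1 aL bL] Ti
    by (intro nn_integral_eq_integral AE_I2 add_nonneg_nonneg mult_nonneg_nonneg) auto
  also have "(\<integral>x. pgap p (a x) (b x) + lam n * T x \<partial>M) = Lpi p M b"
    using pgap_integral(1)[OF p_gt_1 aL bL] Ti eq by simp
  also have "ennreal (Lpi p M b) \<le> ennreal (Lpi p M (grad \<phi>))" by (rule ennreal_leI[OF ble])
  finally show ?thesis by (simp add: a_def b_def T_def W_def Gn_def)
qed

end

section \<open>Limits along a subsequence\<close>

text \<open>Along m, \<open>w (m k)\<close> is the datum and \<open>w (Suc (m k))\<close> the
  solution of one equation, and both tend to v. The energy bound \<open>H_le\<close> is an
  inequality that minimality later turns into the equality \<open>energy_limit\<close>.\<close>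

locale iteration_limit = inverse_iteration \<Omega> p q w G lam
  for \<Omega> :: "'a::euclidean_space set" and p q w G lam +
  fixes v :: "'a \<Rightarrow> real" and H :: "'a \<Rightarrow> 'a" and m :: "nat \<Rightarrow> nat"
  assumes conn: "connected \<Omega>" and m: "strict_mono m"
    and v_sobolev: "sobolev0 \<Omega> p v H"
    and v_lim: "AE x in M. (\<lambda>k. w (m k) x) \<longlonglongrightarrow> v x" "AE x in M. (\<lambda>k. w (Suc (m k)) x) \<longlonglongrightarrow> v x"
    and H_lim: "AE x in M. (\<lambda>k. G (Suc (m k)) x) \<longlonglongrightarrow> H x"
    and v_nonneg: "AE x in M. 0 \<le> v x"
    and v_norm: "Lpi q M v = 1"
    and H_le: "Lpi p M H \<le> lim lam"
begin

lemma lam_m: "(\<lambda>k. lam (m k)) \<longlonglongrightarrow> lim lam"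
  using LIMSEQ_subseq_LIMSEQ[OF lam_convergent m] by (simp add: o_def)

lemma H_Lp: "in_Lp p M H" and v_Lp: "in_Lp p M v" and v_Lq: "in_Lp q M v"
  using sobolev0_in_Lp[OF v_sobolev] Lp_imp_Lq by auto

lemmas [measurable] = in_Lp_measurable[OF H_Lp] in_Lp_measurable[OF v_Lp]

lemma pgap_tendsto:
  assumes "(f \<longlongrightarrow> a) F" "(g \<longlongrightarrow> b) F"
  shows "((\<lambda>k. pgap p (f k) (g k)) \<longlongrightarrow> pgap p a b) F"
proof -
  have "isCont (\<lambda>z. pgap p (fst z) (snd z)) (a, b)"
    using continuous_on_pgap[OF p_gt_1] by (metis UNIV_I continuous_on_eq_continuous_at open_UNIV)
  from isCont_tendsto_compose[OF this tendsto_Pair[OF assms]] show ?thesis by simp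
qed

text \<open>Picone's inequality with the term from the right-hand side of the equation discarded,
  which its sign permits; coercivity of the gap then bounds |a|^p. The bound does not contain
  \<epsilon> and does not presuppose that v is positive, so it can serve to prove
  positivity.\<close>

lemma log_estimate:
  assumes \<phi>: "\<phi> \<in> test_functions \<Omega>" and \<epsilon>: "0 < \<epsilon>"
  shows "(\<integral>\<^sup>+x. ennreal (norm ((\<bar>\<phi> x\<bar> / (v x + \<epsilon>)) *\<^sub>R H x) powr p) \<partial>M)
    \<le> ennreal (2 / (p - 1) * ((1 + 2 powr (p - 1)) * Lpi p M (grad \<phi>)))"
proof -
  have \<phi>_L: "in_Lp p M \<phi>" "in_Lp p M (grad \<phi>)" by (rule test_Lp[OF \<phi>])+
  note [measurable] = in_Lp_measurable[OF \<phi>_L(1)] in_Lp_measurable[OF \<phi>_L(2)] in_Lp_measurable[OF w_Lq] in_Lp_measurable[OF G_Lp]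
  define a where "a x = (\<bar>\<phi> x\<bar> / (v x + \<epsilon>)) *\<^sub>R H x" for x
  define b where "b x = sgn (\<phi> x) *\<^sub>R grad \<phi> x" for x
  define ak where "ak k x = (\<bar>\<phi> x\<bar> / (w (Suc (m k)) x + \<epsilon>)) *\<^sub>R G (Suc (m k)) x" for k x
  have akm[measurable]: "ak k \<in> borel_measurable M" for k unfolding ak_def[abs_def] by measurable
  have am[measurable]: "a \<in> borel_measurable M" unfolding a_def[abs_def] by measurable
  have bm[measurable]: "b \<in> borel_measurable M" unfolding b_def[abs_def] by measurable
  have gm: "(\<lambda>x. pgap p (f x) (b x)) \<in> borel_measurable M" if "f \<in> borel_measurable M" for f
    unfolding pgap_def using that pflow_measurable[OF p_gt_1 that] by measurable
  have "(\<integral>\<^sup>+x. ennreal (pgap p (a x) (b x)) \<partial>M) \<le> ennreal (Lpi p M (grad \<phi>))"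
  proof (rule nn_integral_Fatou_le)
    show "(\<lambda>x. ennreal (pgap p (ak k x) (b x))) \<in> borel_measurable M" for k
      using gm[OF akm] by measurable
    show "AE x in M. (\<lambda>k. ennreal (pgap p (ak k x) (b x))) \<longlonglongrightarrow> ennreal (pgap p (a x) (b x))"
      using v_lim(2) H_lim v_nonneg
    proof eventually_elim
      fix x assume x: "(\<lambda>k. w (Suc (m k)) x) \<longlonglongrightarrow> v x" "(\<lambda>k. G (Suc (m k)) x) \<longlonglongrightarrow> H x" "0 \<le> v x"
      then have "(\<lambda>k. ak k x) \<longlonglongrightarrow> a x"
        unfolding ak_def a_def using \<epsilon> by (intro tendsto_scaleR tendsto_divide tendsto_add tendsto_const) auto
      then show "(\<lambda>k. ennreal (pgap p (ak k x) (b x))) \<longlonglongrightarrow> ennreal (pgap p (a x) (b x))"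
        by (intro tendsto_ennrealI pgap_tendsto tendsto_const)
    qed
    show "(\<integral>\<^sup>+x. ennreal (pgap p (ak k x) (b x)) \<partial>M) \<le> ennreal (Lpi p M (grad \<phi>))" for k
      unfolding ak_def b_def by (rule order_trans[OF nn_integral_mono picone[OF \<phi> \<epsilon>, of "m k"]]) simp
  qed (rule tendsto_const)
  note gap = this
  have bL: "in_Lp p M b"
    by (rule in_Lp_bound[OF \<phi>_L(2) bm _ p_bounds(1)]) (auto intro!: AE_I2 simp: b_def sgn_if)
  have bI: "(\<integral>\<^sup>+x. ennreal (norm (b x) powr p) \<partial>M) \<le> ennreal (Lpi p M (grad \<phi>))"
    unfolding in_Lp_nn_integral[OF \<phi>_L(2), symmetric]
    using p_bounds by (intro nn_integral_mono ennreal_leI powr_mono2) (auto simp: b_def sgn_if)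
  have "(\<integral>\<^sup>+x. ennreal (norm (a x) powr p) \<partial>M)
     \<le> (\<integral>\<^sup>+x. ennreal (2 / (p - 1)) * (ennreal (pgap p (a x) (b x)) + ennreal (2 powr (p - 1)) * ennreal (norm (b x) powr p)) \<partial>M)"
  proof (rule nn_integral_mono)
    fix x
    have "norm (a x) powr p \<le> 2 / (p - 1) * (pgap p (a x) (b x) + 2 powr (p - 1) * norm (b x) powr p)"
      using pgap_coercive[OF p_gt_1, of "a x" "b x"] p_gt_1 by (simp add: field_simps)
    then have "ennreal (norm (a x) powr p) \<le> ennreal (2 / (p - 1) * (pgap p (a x) (b x) + 2 powr (p - 1) * norm (b x) powr p))" by (rule ennreal_leI)
    also have "\<dots> = ennreal (2 / (p - 1)) * ennreal (pgap p (a x) (b x) + 2 powr (p - 1) * norm (b x) powr p)"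
      using p_gt_1 pgap_nonneg[OF p_gt_1, of "a x" "b x"] by (intro ennreal_mult) auto
    also have "ennreal (pgap p (a x) (b x) + 2 powr (p - 1) * norm (b x) powr p)
       = ennreal (pgap p (a x) (b x)) + ennreal (2 powr (p - 1)) * ennreal (norm (b x) powr p)"
      using pgap_nonneg[OF p_gt_1, of "a x" "b x"] by (simp add: ennreal_plus ennreal_mult)
    finally show "ennreal (norm (a x) powr p) \<le> ennreal (2 / (p - 1)) * (ennreal (pgap p (a x) (b x)) + ennreal (2 powr (p - 1)) * ennreal (norm (b x) powr p))" .
  qed
  also have "\<dots> = ennreal (2 / (p - 1)) * ((\<integral>\<^sup>+x. ennreal (pgap p (a x) (b x)) \<partial>M) + ennreal (2 powr (p - 1)) * (\<integral>\<^sup>+x. ennreal (norm (b x) powr p) \<partial>M))"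
    using gm[OF am] by (simp add: nn_integral_cmult nn_integral_add)
  also have "\<dots> \<le> ennreal (2 / (p - 1)) * (ennreal (Lpi p M (grad \<phi>)) + ennreal (2 powr (p - 1)) * ennreal (Lpi p M (grad \<phi>)))"
    by (intro mult_left_mono add_mono gap bI) auto
  also have "ennreal (Lpi p M (grad \<phi>)) + ennreal (2 powr (p - 1)) * ennreal (Lpi p M (grad \<phi>))
     = ennreal ((1 + 2 powr (p - 1)) * Lpi p M (grad \<phi>))"
    by (simp add: ennreal_mult ennreal_plus Lpi_nonneg distrib_right)
  also have "ennreal (2 / (p - 1)) * \<dots> = ennreal (2 / (p - 1) * ((1 + 2 powr (p - 1)) * Lpi p M (grad \<phi>)))"
    using p_gt_1 by (intro ennreal_mult[symmetric]) (auto simp: Lpi_nonneg)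
  finally show ?thesis by (simp add: a_def)
qed

text \<open>A bump on the ball of radius 2 r has a positive minimum \<beta> on the ball of radius r.
  Dividing by \<beta> and passing from L^p to L^1 keeps the constant independent of
  \<epsilon>.\<close>

lemma local_log_estimate:
  assumes "cball c (2 * r) \<subseteq> \<Omega>" "0 < r"
  obtains K where "0 \<le> K" "\<And>\<epsilon>. 0 < \<epsilon> \<Longrightarrow> (\<integral>\<^sup>+x. ennreal (norm (H x) / (v x + \<epsilon>) * indicator (ball c r) x) \<partial>M) \<le> ennreal K"
proof -
  define \<phi> where "\<phi> = bump c (2 * r)"
  have \<phi>: "\<phi> \<in> test_functions \<Omega>" unfolding \<phi>_def using assms by (intro bump_test_function) auto
  have \<phi>c: "continuous_on UNIV \<phi>" by (rule C1_continuous[OF test_function_C1[OF \<phi>]])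
  note [measurable] = in_Lp_measurable[OF test_Lp(1)[OF \<phi>]]
  obtain z where z: "z \<in> cball c r" "\<And>y. y \<in> cball c r \<Longrightarrow> \<phi> z \<le> \<phi> y"
    using continuous_attains_inf[of "cball c r" \<phi>] assms(2) continuous_on_subset[OF \<phi>c, of "cball c r"] by auto
  define \<beta> where "\<beta> = \<phi> z"
  have \<beta>: "0 < \<beta>" "\<And>y. y \<in> ball c r \<Longrightarrow> \<beta> \<le> \<phi> y"
    using z assms(2) unfolding \<beta>_def \<phi>_def by (auto intro!: bump_pos)
  define K0 where "K0 = 2 / (p - 1) * ((1 + 2 powr (p - 1)) * Lpi p M (grad \<phi>))"
  have K0: "0 \<le> K0" using p_gt_1 by (simp add: K0_def Lpi_nonneg)
  define K where "K = (measure M (space M) powr (1 - 1 / p) * K0 powr (1 / p)) / \<beta>"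
  show ?thesis
  proof (rule that[of K])
    show "0 \<le> K" using \<beta>(1) by (simp add: K_def)
    fix \<epsilon> :: real assume \<epsilon>: "0 < \<epsilon>"
    define a where "a x = (\<bar>\<phi> x\<bar> / (v x + \<epsilon>)) *\<^sub>R H x" for x
    have am: "a \<in> borel_measurable M" unfolding a_def[abs_def] by measurable
    have aL: "in_Lp p M a" "Lpi p M a \<le> K0"
      using in_Lp_nn_integralI[OF am _ K0, of p] log_estimate[OF \<phi> \<epsilon>] unfolding a_def K0_def by auto
    have ai: "integrable M a" "(\<integral>x. norm (a x) \<partial>M) \<le> measure M (space M) powr (1 - 1 / p) * Lpi p M a powr (1 / p)"
      by (rule integrable_of_in_Lp[OF finite_M aL(1) p_bounds(2)])+
    have "(\<integral>\<^sup>+x. ennreal (norm (H x) / (v x + \<epsilon>) * indicator (ball c r) x) \<partial>M) \<le> (\<integral>\<^sup>+x. ennreal (norm (a x) / \<beta>) \<partial>M)"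
    proof (rule nn_integral_mono_AE)
      show "AE x in M. ennreal (norm (H x) / (v x + \<epsilon>) * indicator (ball c r) x) \<le> ennreal (norm (a x) / \<beta>)"
        using v_nonneg
      proof eventually_elim
        fix x assume x: "0 \<le> v x"
        show "ennreal (norm (H x) / (v x + \<epsilon>) * indicator (ball c r) x) \<le> ennreal (norm (a x) / \<beta>)"
        proof (cases "x \<in> ball c r")
          case True
          have "1 \<le> \<bar>\<phi> x\<bar> / \<beta>" using \<beta>(1) \<beta>(2)[OF True] by simp
          then have "norm (H x) / (v x + \<epsilon>) * 1 \<le> norm (H x) / (v x + \<epsilon>) * (\<bar>\<phi> x\<bar> / \<beta>)"
            using x \<epsilon> by (intro mult_left_mono) auto
          also have "\<dots> = norm (a x) / \<beta>" using x \<epsilon> by (simp add: a_def)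
          finally show ?thesis using True by (intro ennreal_leI) simp
        next
          case False
          then show ?thesis by simp
        qed
      qed
    qed
    also have "\<dots> = ennreal (\<integral>x. norm (a x) / \<beta> \<partial>M)"
      using ai(1) \<beta>(1) by (intro nn_integral_eq_integral) auto
    also have "\<dots> \<le> ennreal K"
    proof (rule ennreal_leI)
      have "(\<integral>x. norm (a x) \<partial>M) \<le> measure M (space M) powr (1 - 1 / p) * K0 powr (1 / p)"
        using aL(2) p_bounds Lpi_nonneg[of p M a] by (intro order_trans[OF ai(2)] mult_left_mono powr_mono2) auto
      then show "(\<integral>x. norm (a x) / \<beta> \<partial>M) \<le> K" using \<beta>(1) by (simp add: K_def divide_right_mono)
    qed
    finally show "(\<integral>\<^sup>+x. ennreal (norm (H x) / (v x + \<epsilon>) * indicator (ball c r) x) \<partial>M) \<le> ennreal K" .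
  qed
qed

text \<open>The shift by \<delta> bounds the derivative of the logarithm, as composition with a
  Sobolev function demands. The factor \<kappa> serves two purposes: it is 1 when two logarithms are
  compared and \<open>1 / L j\<close> in \<open>v_pos\<close>.\<close>

lemma ln_ext:
  fixes \<delta> \<kappa> :: real
  assumes \<delta>: "0 < \<delta>" and \<kappa>: "0 \<le> \<kappa>"
  defines "F \<equiv> (\<lambda>t. \<kappa> * (ln (t + \<delta>) - ln \<delta>))" and "F' \<equiv> (\<lambda>t. \<kappa> / (t + \<delta>))"
  shows "(ext_neg F F' has_real_derivative ext_neg_deriv F' t) (at t)"
    and "continuous_on UNIV (ext_neg_deriv F')" and "\<bar>ext_neg_deriv F' t\<bar> \<le> \<kappa> / \<delta>"
proof -
  have "(F has_real_derivative F' t) (at t)" if "0 \<le> t" for t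
    unfolding F_def F'_def using that \<delta> by (auto intro!: derivative_eq_intros)
  then show "(ext_neg F F' has_real_derivative ext_neg_deriv F' t) (at t)" by (rule ext_neg_has_derivative)
  show "continuous_on UNIV (ext_neg_deriv F')"
    unfolding F'_def using \<delta> by (intro ext_neg_deriv_continuous continuous_intros) auto
  have "\<bar>F' t\<bar> \<le> \<kappa> / \<delta>" if "0 \<le> t" for t
    unfolding F'_def using that \<delta> \<kappa> by (auto intro!: divide_left_mono)
  then show "\<bar>ext_neg_deriv F' t\<bar> \<le> \<kappa> / \<delta>" by (rule ext_neg_deriv_bound)
qed

lemma cball_in_\<Omega>:
  assumes "c \<in> \<Omega>"
  obtains r where "0 < r" "cball c (2 * r) \<subseteq> \<Omega>" "ball c r \<subseteq> \<Omega>"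
proof -
  obtain e where e: "0 < e" "cball c e \<subseteq> \<Omega>" using open_\<Omega> assms open_contains_cball by blast
  have "ball c (e / 2) \<subseteq> cball c e" using e(1) by (auto simp: dist_commute)
  with e show ?thesis by (intro that[of "e / 2"]) auto
qed

text \<open>The rescaled logarithms \<open>h j\<close> are 0 where v = 0 and tend to 1 where v > 0,
  while their oscillation on a ball is at most a constant divided by \<open>L j\<close>. In the
  limit the indicator of v > 0 has zero oscillation, hence is constant on balls; connectedness makes
  it constant on the domain, and v = 0 is excluded by the normalisation.\<close>

lemma v_pos: "AE x in M. 0 < v x"
proof -
  have "(AE x in M. 0 < v x) \<or> (AE x in M. \<not> 0 < v x)"
  proof (rule connected_null_or_conull[OF conn])
    fix c assume "c \<in> \<Omega>"
    then obtain r where r: "0 < r" "cball c (2 * r) \<subseteq> \<Omega>" "ball c r \<subseteq> \<Omega>" by (rule cball_in_\<Omega>)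
    have BM[measurable]: "ball c r \<in> sets M" using r(3) by (simp add: sets_restrict_space_iff sets_\<Omega>)
    obtain K where K: "0 \<le> K" "\<And>\<epsilon>. 0 < \<epsilon> \<Longrightarrow> (\<integral>\<^sup>+x. ennreal (norm (H x) / (v x + \<epsilon>) * indicator (ball c r) x) \<partial>M) \<le> ennreal K"
      by (rule local_log_estimate[OF r(2,1)]) blast
    define L where "L j = real (Suc j)" for j :: nat
    have Lp: "0 < L j" for j by (simp add: L_def)
    have L0: "(\<lambda>j. 1 / L j) \<longlonglongrightarrow> 0"
      using LIMSEQ_inverse_real_of_nat by (simp add: L_def inverse_eq_divide)
    \<comment> \<open>With \<open>ln (\<epsilon> j) = - L j\<close> the quotient (ln (t + \<epsilon>
      j) - ln (\<epsilon> j)) / \<open>L j\<close> equals 1 + ln (t + \<epsilon> j) /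
      \<open>L j\<close>: for fixed t > 0 the last term disappears, and at t = 0 it is exactly
      -1.\<close>
    define \<epsilon> where "\<epsilon> j = exp (- L j)" for j :: nat
    have \<epsilon>: "0 < \<epsilon> j" and ln\<epsilon>: "ln (\<epsilon> j) = - L j" for j by (simp_all add: \<epsilon>_def)
    have "\<epsilon> j \<le> 1 / L j" for j
    proof -
      have "L j \<le> exp (L j)" using exp_ge_add_one_self[of "L j"] by linarith
      then show ?thesis using Lp[of j] by (simp add: \<epsilon>_def exp_minus field_simps)
    qed
    then have \<epsilon>0: "\<epsilon> \<longlonglongrightarrow> 0"
      by (intro tendsto_sandwich[OF always_eventually always_eventually tendsto_const L0] allI) (simp_all add: less_imp_le[OF \<epsilon>])
    define F where "F j t = 1 / L j * (ln (t + \<epsilon> j) - ln (\<epsilon> j))" for j t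
    define F' where "F' j t = (1 / L j) / (t + \<epsilon> j)" for j t
    have Lj: "0 \<le> 1 / L j" for j using Lp[of j] by simp
    have E: "(ext_neg (F j) (F' j) has_real_derivative ext_neg_deriv (F' j) t) (at t)"
      "continuous_on UNIV (ext_neg_deriv (F' j))" "\<bar>ext_neg_deriv (F' j) t\<bar> \<le> 1 / L j / \<epsilon> j" for j t
      unfolding F_def[abs_def] F'_def[abs_def] by (rule ln_ext[OF \<epsilon> Lj])+
    define h where "h j x = ext_neg (F j) (F' j) (v x)" for j x
    have hm: "h j \<in> borel_measurable M" for j
    proof -
      have "continuous_on UNIV (ext_neg (F j) (F' j))"
        using E(1)[of j] by (meson DERIV_continuous continuous_at_imp_continuous_on)
      then show ?thesis unfolding h_def[abs_def]
        using measurable_compose[OF in_Lp_measurable[OF v_Lp] borel_measurable_continuous_onI] by blast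
    qed
    have le: "osc (ball c r) (h j) \<le> ennreal (osc_const r * (K * (1 / L j)))" for j
    proof -
      have "osc (ball c r) (\<lambda>x. ext_neg (F j) (F' j) (v x) - 0)
        \<le> ennreal (osc_const r * (\<integral>x. norm (ext_neg_deriv (F' j) (v x) *\<^sub>R H x - 0 *\<^sub>R H x) * indicator (ball c r) x \<partial>M))"
        by (rule osc_sobolev0_diff[OF v_sobolev v_sobolev E(1,2,3) _ _ _ r(3,1), where E = "\<lambda>_. 0" and E' = "\<lambda>_. 0"])
           (use Lj[of j] \<epsilon>[of j] in auto)
      \<comment> \<open>The crude bound of the derivative by 1 / (L j \<epsilon> j) only makes the
        composition admissible; the smallness of the integral comes from the estimate by K, which is
        uniform in \<epsilon>.\<close>
      moreover have "(\<integral>x. norm (ext_neg_deriv (F' j) (v x) *\<^sub>R H x - 0 *\<^sub>R H x) * indicator (ball c r) x \<partial>M) \<le> K * (1 / L j)"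
      proof -
        have "(\<integral>x. norm (ext_neg_deriv (F' j) (v x) *\<^sub>R H x - 0 *\<^sub>R H x) * indicator (ball c r) x \<partial>M)
          = (\<integral>x. 1 / L j * (norm (H x) / (v x + \<epsilon> j) * indicator (ball c r) x) \<partial>M)"
        proof (rule integral_cong_AE)
          have "ext_neg_deriv (F' j) \<in> borel_measurable borel" by (rule borel_measurable_continuous_onI[OF E(2)])
          then show "(\<lambda>x. norm (ext_neg_deriv (F' j) (v x) *\<^sub>R H x - 0 *\<^sub>R H x) * indicator (ball c r) x) \<in> borel_measurable M"
            by measurable
          show "AE x in M. norm (ext_neg_deriv (F' j) (v x) *\<^sub>R H x - 0 *\<^sub>R H x) * indicator (ball c r) x = 1 / L j * (norm (H x) / (v x + \<epsilon> j) * indicator (ball c r) x)"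
            using v_nonneg by eventually_elim (use Lp[of j] \<epsilon>[of j] in \<open>simp add: ext_neg_deriv_def F'_def\<close>)
        qed measurable
        also have "\<dots> = 1 / L j * (\<integral>x. norm (H x) / (v x + \<epsilon> j) * indicator (ball c r) x \<partial>M)"
          by (rule integral_mult_right_zero)
        also have "(\<integral>x. norm (H x) / (v x + \<epsilon> j) * indicator (ball c r) x \<partial>M) \<le> K"
        proof -
          have "AE x in M. 0 \<le> norm (H x) / (v x + \<epsilon> j) * indicator (ball c r) x"
            using v_nonneg by eventually_elim (use \<epsilon>[of j] in simp)
          then have "(\<integral>x. norm (H x) / (v x + \<epsilon> j) * indicator (ball c r) x \<partial>M) = enn2real (\<integral>\<^sup>+x. ennreal (norm (H x) / (v x + \<epsilon> j) * indicator (ball c r) x) \<partial>M)"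
            by (intro integral_eq_nn_integral) measurable
          also have "\<dots> \<le> K" using K(2)[OF \<epsilon>[of j]] K(1) by (intro enn2real_leI) auto
          finally show ?thesis .
        qed
        finally show ?thesis using Lj[of j] by (simp add: mult.commute mult_left_mono divide_right_mono)
      qed
      ultimately show ?thesis
        unfolding h_def[abs_def] diff_zero using osc_const_nonneg[of r] r(1)
        by (elim order_trans, intro ennreal_leI mult_left_mono) auto
    qed
    have lim: "AE x in M. (\<lambda>j. h j x) \<longlonglongrightarrow> of_bool (0 < v x)"
      using v_nonneg
    proof eventually_elim
      fix x assume x: "0 \<le> v x"
      have eq: "h j x = 1 / L j * ln (v x + \<epsilon> j) + 1" for j
        using x Lp[of j] by (simp add: h_def ext_neg_def F_def ln\<epsilon> add_divide_distrib)
      show "(\<lambda>j. h j x) \<longlonglongrightarrow> of_bool (0 < v x)"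
      proof (cases "0 < v x")
        case True
        have "(\<lambda>j. 1 / L j * ln (v x + \<epsilon> j) + 1) \<longlonglongrightarrow> 0 * ln (v x + 0) + 1"
          using True by (intro tendsto_add tendsto_mult tendsto_const L0 tendsto_ln \<epsilon>0) auto
        then show ?thesis using True by (simp add: eq)
      next
        case False
        with x have "v x = 0" by simp
        then have "h j x = 0" for j using Lp[of j] by (simp add: eq ln\<epsilon>)
        then show ?thesis using False by simp
      qed
    qed
    have "(\<lambda>j. osc_const r * (K * (1 / L j))) \<longlonglongrightarrow> osc_const r * (K * 0)"
      by (intro tendsto_mult_left L0)
    then have "(\<lambda>j. osc_const r * (K * (1 / L j))) \<longlonglongrightarrow> 0" by simp
    then have "osc (ball c r) (\<lambda>x. of_bool (0 < v x)) \<le> ennreal 0"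
      by (rule osc_Fatou[OF hm lim BM le])
    then have "osc (ball c r) (\<lambda>x. of_bool (0 < v x)) = 0" by simp
    moreover have "(\<lambda>x. of_bool (0 < v x)) \<in> borel_measurable M" by measurable
    ultimately obtain \<kappa> :: real where \<kappa>: "AE x in M. x \<in> ball c r \<longrightarrow> of_bool (0 < v x) = \<kappa>"
      by (rule osc_eq_0_imp_constant[OF _ _ r(3,1)])
    have "(AE x in M. x \<in> ball c r \<longrightarrow> 0 < v x) \<or> (AE x in M. x \<in> ball c r \<longrightarrow> \<not> 0 < v x)"
    proof (cases "\<kappa> = 1")
      case True
      have "AE x in M. x \<in> ball c r \<longrightarrow> 0 < v x" using \<kappa> by eventually_elim (use True in \<open>auto simp: of_bool_def split: if_splits\<close>)
      then show ?thesis ..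
    next
      case False
      have "AE x in M. x \<in> ball c r \<longrightarrow> \<not> 0 < v x" using \<kappa> by eventually_elim (use False in \<open>auto simp: of_bool_def split: if_splits\<close>)
      then show ?thesis ..
    qed
    with r show "\<exists>r>0. ball c r \<subseteq> \<Omega> \<and> ((AE x in M. x \<in> ball c r \<longrightarrow> 0 < v x) \<or> (AE x in M. x \<in> ball c r \<longrightarrow> \<not> 0 < v x))" by blast
  qed
  moreover have "\<not> (AE x in M. \<not> 0 < v x)"
  proof
    assume "AE x in M. \<not> 0 < v x"
    with v_nonneg have "AE x in M. v x = 0" by eventually_elim simp
    then have "Lpi q M v = 0" using Lpi_eq_0_iff[OF v_Lq] by simp
    then show False using v_norm by simp
  qed
  ultimately show ?thesis by blast
qed

text \<open>Pointwise this is the tangent at 1 to the power p / q, evaluated at s = (|e| / v)^q and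
  multiplied by v^q. Since v and e are both normalised, the lower bound integrates to (1 - p / q) +
  p / q = 1.\<close>

lemma nn_integral_weighted_powr_ge:
  assumes e: "in_Lp q M e" "Lpi q M e = 1"
  shows "1 \<le> (\<integral>\<^sup>+x. ennreal (v x powr (q - p) * \<bar>e x\<bar> powr p) \<partial>M)"
proof -
  define r where "r = p / q"
  have r: "1 \<le> r" "q * r = p" using q by (auto simp: r_def field_simps)
  have i: "integrable M (\<lambda>x. (1 - r) * norm (v x) powr q + r * norm (e x) powr q)"
    using in_Lp_integrable[OF v_Lq] in_Lp_integrable[OF e(1)] by simp
  have "(\<integral>x. (1 - r) * norm (v x) powr q + r * norm (e x) powr q \<partial>M) = (1 - r) * Lpi q M v + r * Lpi q M e"
    using in_Lp_integrable[OF v_Lq] in_Lp_integrable[OF e(1)] by (simp add: Lpi_def)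
  then have "1 = ennreal (\<integral>x. (1 - r) * norm (v x) powr q + r * norm (e x) powr q \<partial>M)"
    by (simp add: v_norm e(2))
  also have "\<dots> \<le> (\<integral>\<^sup>+x. ennreal ((1 - r) * norm (v x) powr q + r * norm (e x) powr q) \<partial>M)"
    by (rule ennreal_integral_le_nn_integral[OF i])
  also have "\<dots> \<le> (\<integral>\<^sup>+x. ennreal (v x powr (q - p) * \<bar>e x\<bar> powr p) \<partial>M)"
  proof (rule nn_integral_mono_AE)
    show "AE x in M. ennreal ((1 - r) * norm (v x) powr q + r * norm (e x) powr q) \<le> ennreal (v x powr (q - p) * \<bar>e x\<bar> powr p)"
      using v_pos
    proof eventually_elim
      fix x assume x: "0 < v x"
      define s where "s = (\<bar>e x\<bar> / v x) powr q"
      have "r * 1 powr (r - 1) * s \<le> (r - 1) * 1 powr r + s powr r"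
        using r by (intro young_powr) (auto simp: s_def)
      then have "(1 - r) + r * s \<le> s powr r" by simp
      then have "v x powr q * ((1 - r) + r * s) \<le> v x powr q * s powr r" by (intro mult_left_mono) auto
      moreover have "v x powr q * s = \<bar>e x\<bar> powr q" using x by (simp add: s_def powr_divide)
      moreover have "v x powr q * s powr r = v x powr (q - p) * \<bar>e x\<bar> powr p"
        using x r by (simp add: s_def powr_powr powr_divide powr_diff)
      ultimately have "(1 - r) * norm (v x) powr q + r * norm (e x) powr q \<le> v x powr (q - p) * \<bar>e x\<bar> powr p"
        using x by (simp add: algebra_simps)
      then show "ennreal ((1 - r) * norm (v x) powr q + r * norm (e x) powr q) \<le> ennreal (v x powr (q - p) * \<bar>e x\<bar> powr p)"
        by (rule ennreal_leI)
    qed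
  qed
  finally show ?thesis .
qed

text \<open>Fatou's lemma in Picone's inequality, with \<phi> tending to e, \<epsilon> to 0 and the
  iterates to v simultaneously. The gap is kept for positive e, because the signs of the
  approximations converge at points where e is nonzero; otherwise it is dropped, being
  nonnegative.\<close>

lemma picone_limit:
  assumes e: "sobolev0 \<Omega> p e E"
  shows "(\<integral>\<^sup>+x. ennreal (lim lam * (v x powr (q - p) * \<bar>e x\<bar> powr p)) \<partial>M) \<le> ennreal (Lpi p M E)"
    and "AE x in M. 0 < e x \<Longrightarrow> (\<integral>\<^sup>+x. ennreal (pgap p ((e x / v x) *\<^sub>R H x) (E x))
      + ennreal (lim lam * (v x powr (q - p) * \<bar>e x\<bar> powr p)) \<partial>M) \<le> ennreal (Lpi p M E)"
proof -
  obtain \<phi> where \<phi>: "\<And>k::nat. \<phi> k \<in> test_functions \<Omega>"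
    and lim: "(\<lambda>k. Lpi p M (\<lambda>x. grad (\<phi> k) x - E x)) \<longlonglongrightarrow> 0"
      "AE x in M. (\<lambda>k. \<phi> k x) \<longlonglongrightarrow> e x" "AE x in M. (\<lambda>k. grad (\<phi> k) x) \<longlonglongrightarrow> E x"
    by (rule sobolev0_AE_approx[OF e]) blast
  define \<epsilon> where "\<epsilon> k = inverse (real (Suc k))" for k
  have \<epsilon>: "0 < \<epsilon> k" for k by (simp add: \<epsilon>_def)
  have \<epsilon>0: "\<epsilon> \<longlonglongrightarrow> 0" unfolding \<epsilon>_def[abs_def] by (rule LIMSEQ_inverse_real_of_nat)
  note [measurable] = in_Lp_measurable[OF test_Lp(1)[OF \<phi>]] in_Lp_measurable[OF test_Lp(2)[OF \<phi>]] in_Lp_measurable[OF w_Lq] in_Lp_measurable[OF G_Lp]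
  define a where "a k x = (\<bar>\<phi> k x\<bar> / (w (Suc (m k)) x + \<epsilon> k)) *\<^sub>R G (Suc (m k)) x" for k x
  define b where "b k x = sgn (\<phi> k x) *\<^sub>R grad (\<phi> k) x" for k x
  define T where "T k x = lam (m k) * (\<bar>w (m k) x\<bar> powr (q - 1) * (\<bar>\<phi> k x\<bar> powr p * (w (Suc (m k)) x + \<epsilon> k) powr (1 - p)))" for k x
  have am: "a k \<in> borel_measurable M" and bm: "b k \<in> borel_measurable M" and Tm: "T k \<in> borel_measurable M" for k
    unfolding a_def[abs_def] b_def[abs_def] T_def[abs_def] by measurable
  have gm: "(\<lambda>x. pgap p (a k x) (b k x)) \<in> borel_measurable M" for k
    unfolding pgap_def using am[of k] bm[of k] pflow_measurable[OF p_gt_1 am[of k]] by measurable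
  have J: "(\<integral>\<^sup>+x. ennreal (pgap p (a k x) (b k x)) + ennreal (T k x) \<partial>M) \<le> ennreal (Lpi p M (grad (\<phi> k)))" for k
    unfolding a_def b_def T_def by (rule picone[OF \<phi> \<epsilon>])
  have rhs: "(\<lambda>k. ennreal (Lpi p M (grad (\<phi> k)))) \<longlonglongrightarrow> ennreal (Lpi p M E)"
    by (intro tendsto_ennrealI Lpi_tendsto[OF test_Lp(2)[OF \<phi>] sobolev0_in_Lp(2)[OF e] p_bounds(2) lim(1)])
  have Tlim: "AE x in M. (\<lambda>k. T k x) \<longlonglongrightarrow> lim lam * (v x powr (q - p) * \<bar>e x\<bar> powr p)"
    using v_pos v_lim lim(2)
  proof eventually_elim
    fix x assume x: "0 < v x" "(\<lambda>k. w (m k) x) \<longlonglongrightarrow> v x" "(\<lambda>k. w (Suc (m k)) x) \<longlonglongrightarrow> v x" "(\<lambda>k. \<phi> k x) \<longlonglongrightarrow> e x"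
    have "(\<lambda>k. \<bar>\<phi> k x\<bar> powr p) \<longlonglongrightarrow> \<bar>e x\<bar> powr p"
      using p_bounds by (intro tendsto_powr2[OF tendsto_rabs[OF x(4)] tendsto_const]) auto
    moreover have "(\<lambda>k. (w (Suc (m k)) x + \<epsilon> k) powr (1 - p)) \<longlonglongrightarrow> (v x + 0) powr (1 - p)"
      using x(1) by (intro tendsto_powr tendsto_add x(3) \<epsilon>0 tendsto_const) auto
    \<comment> \<open>Positivity of v enters here: for q = 1 the exponent is 0 and the power jumps
      at 0.\<close>
    moreover have "(\<lambda>k. \<bar>w (m k) x\<bar> powr (q - 1)) \<longlonglongrightarrow> \<bar>v x\<bar> powr (q - 1)"
      using x(1) by (intro tendsto_powr tendsto_rabs x(2) tendsto_const) auto
    ultimately have "(\<lambda>k. T k x) \<longlonglongrightarrow> lim lam * (\<bar>v x\<bar> powr (q - 1) * (\<bar>e x\<bar> powr p * (v x + 0) powr (1 - p)))"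
      unfolding T_def by (intro tendsto_mult lam_m)
    also have "\<bar>v x\<bar> powr (q - 1) * (\<bar>e x\<bar> powr p * (v x + 0) powr (1 - p)) = (v x powr (q - 1) * v x powr (1 - p)) * \<bar>e x\<bar> powr p"
      using x(1) by simp
    also have "v x powr (q - 1) * v x powr (1 - p) = v x powr (q - p)"
      by (subst powr_add[symmetric]) simp
    finally show "(\<lambda>k. T k x) \<longlonglongrightarrow> lim lam * (v x powr (q - p) * \<bar>e x\<bar> powr p)" .
  qed
  show "(\<integral>\<^sup>+x. ennreal (lim lam * (v x powr (q - p) * \<bar>e x\<bar> powr p)) \<partial>M) \<le> ennreal (Lpi p M E)"
  proof (rule nn_integral_Fatou_le[OF _ _ _ rhs])
    show "(\<lambda>x. ennreal (T k x)) \<in> borel_measurable M" for k using Tm[of k] by measurable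
    show "AE x in M. (\<lambda>k. ennreal (T k x)) \<longlonglongrightarrow> ennreal (lim lam * (v x powr (q - p) * \<bar>e x\<bar> powr p))"
      using Tlim by eventually_elim (rule tendsto_ennrealI)
    show "(\<integral>\<^sup>+x. ennreal (T k x) \<partial>M) \<le> ennreal (Lpi p M (grad (\<phi> k)))" for k
      by (rule order_trans[OF nn_integral_mono J]) simp
  qed
  assume epos: "AE x in M. 0 < e x"
  show "(\<integral>\<^sup>+x. ennreal (pgap p ((e x / v x) *\<^sub>R H x) (E x)) + ennreal (lim lam * (v x powr (q - p) * \<bar>e x\<bar> powr p)) \<partial>M) \<le> ennreal (Lpi p M E)"
  proof (rule nn_integral_Fatou_le[OF _ _ J rhs])
    show "(\<lambda>x. ennreal (pgap p (a k x) (b k x)) + ennreal (T k x)) \<in> borel_measurable M" for k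
      using Tm[of k] gm[of k] by measurable
    show "AE x in M. (\<lambda>k. ennreal (pgap p (a k x) (b k x)) + ennreal (T k x)) \<longlonglongrightarrow>
       ennreal (pgap p ((e x / v x) *\<^sub>R H x) (E x)) + ennreal (lim lam * (v x powr (q - p) * \<bar>e x\<bar> powr p))"
      using Tlim epos v_pos v_lim(2) H_lim lim(2,3)
    proof eventually_elim
      fix x assume x: "(\<lambda>k. T k x) \<longlonglongrightarrow> lim lam * (v x powr (q - p) * \<bar>e x\<bar> powr p)" "0 < e x" "0 < v x"
        "(\<lambda>k. w (Suc (m k)) x) \<longlonglongrightarrow> v x" "(\<lambda>k. G (Suc (m k)) x) \<longlonglongrightarrow> H x" "(\<lambda>k. \<phi> k x) \<longlonglongrightarrow> e x" "(\<lambda>k. grad (\<phi> k) x) \<longlonglongrightarrow> E x"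
      have "(\<lambda>k. a k x) \<longlonglongrightarrow> (\<bar>e x\<bar> / (v x + 0)) *\<^sub>R H x"
        unfolding a_def using x(3) by (intro tendsto_scaleR tendsto_divide tendsto_rabs tendsto_add x \<epsilon>0) auto
      moreover have "(\<lambda>k. b k x) \<longlonglongrightarrow> sgn (e x) *\<^sub>R E x"
        unfolding b_def using x(2) by (intro tendsto_scaleR tendsto_sgn x) auto
      ultimately have "(\<lambda>k. pgap p (a k x) (b k x)) \<longlonglongrightarrow> pgap p ((\<bar>e x\<bar> / (v x + 0)) *\<^sub>R H x) (sgn (e x) *\<^sub>R E x)"
        by (rule pgap_tendsto)
      then have "(\<lambda>k. pgap p (a k x) (b k x)) \<longlonglongrightarrow> pgap p ((e x / v x) *\<^sub>R H x) (E x)" using x(2) by simp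
      then show "(\<lambda>k. ennreal (pgap p (a k x) (b k x)) + ennreal (T k x)) \<longlonglongrightarrow>
         ennreal (pgap p ((e x / v x) *\<^sub>R H x) (E x)) + ennreal (lim lam * (v x powr (q - p) * \<bar>e x\<bar> powr p))"
        by (intro tendsto_add tendsto_ennrealI x(1))
    qed
  qed
qed

lemma lim_lam_nonneg: "0 \<le> lim lam"
  by (rule LIMSEQ_le_const[OF lam_convergent]) (use lam_nonneg in auto)

lemma lim_lam_weighted:
  assumes e: "in_Lp q M e" "Lpi q M e = 1"
  shows "ennreal (lim lam) \<le> (\<integral>\<^sup>+x. ennreal (lim lam * (v x powr (q - p) * \<bar>e x\<bar> powr p)) \<partial>M)"
proof -
  note [measurable] = in_Lp_measurable[OF e(1)]
  have "ennreal (lim lam) * 1 \<le> ennreal (lim lam) * (\<integral>\<^sup>+x. ennreal (v x powr (q - p) * \<bar>e x\<bar> powr p) \<partial>M)"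
    by (intro mult_left_mono nn_integral_weighted_powr_ge[OF e]) simp
  also have "\<dots> = (\<integral>\<^sup>+x. ennreal (lim lam) * ennreal (v x powr (q - p) * \<bar>e x\<bar> powr p) \<partial>M)"
    by (rule nn_integral_cmult[symmetric]) measurable
  also have "\<dots> = (\<integral>\<^sup>+x. ennreal (lim lam * (v x powr (q - p) * \<bar>e x\<bar> powr p)) \<partial>M)"
    using lim_lam_nonneg by (intro nn_integral_cong) (simp add: ennreal_mult)
  finally show ?thesis by simp
qed

theorem lim_lam_minimal:
  assumes e: "sobolev0 \<Omega> p e E" "Lpi q M e = 1"
  shows "lim lam \<le> Lpi p M E"
proof -
  have "ennreal (lim lam) \<le> ennreal (Lpi p M E)"
    by (rule order_trans[OF lim_lam_weighted[OF Lp_imp_Lq[OF sobolev0_in_Lp(1)[OF e(1)]] e(2)] picone_limit(1)[OF e(1)]])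
  then show ?thesis by (simp add: Lpi_nonneg)
qed

lemma energy_limit: "Lpi p M H = lim lam"
  using lim_lam_minimal[OF v_sobolev v_norm] H_le by simp

theorem positive_minimizer_unique:
  assumes e: "sobolev0 \<Omega> p e E" "Lpi q M e = 1" "AE x in M. 0 < e x" "Lpi p M E \<le> lim lam"
  shows "AE x in M. e x = v x" "AE x in M. E x = H x"
proof -
  note eq = Lp_imp_Lq[OF sobolev0_in_Lp(1)[OF e(1)]]
  note [measurable] = in_Lp_measurable[OF sobolev0_in_Lp(1)[OF e(1)]] in_Lp_measurable[OF sobolev0_in_Lp(2)[OF e(1)]]
  define a where "a x = (e x / v x) *\<^sub>R H x" for x
  have am[measurable]: "a \<in> borel_measurable M" unfolding a_def[abs_def] by measurable
  have gm[measurable]: "(\<lambda>x. pgap p (a x) (E x)) \<in> borel_measurable M"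
    unfolding pgap_def using pflow_measurable[OF p_gt_1 am] by measurable
  define I where "I = (\<integral>\<^sup>+x. ennreal (pgap p (a x) (E x)) \<partial>M)"
  \<comment> \<open>The weighted term alone already accounts for \<open>lim lam\<close>, and the
    energy of e is no larger, so nothing is left for the integral I of the gap.\<close>
  have "I + ennreal (lim lam) \<le> I + (\<integral>\<^sup>+x. ennreal (lim lam * (v x powr (q - p) * \<bar>e x\<bar> powr p)) \<partial>M)"
    by (intro add_left_mono lim_lam_weighted[OF eq e(2)])
  also have "\<dots> = (\<integral>\<^sup>+x. ennreal (pgap p (a x) (E x)) + ennreal (lim lam * (v x powr (q - p) * \<bar>e x\<bar> powr p)) \<partial>M)"
    unfolding I_def by (rule nn_integral_add[symmetric]) measurable
  also have "\<dots> \<le> ennreal (Lpi p M E)" unfolding a_def by (rule picone_limit(2)[OF e(1,3)])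
  also have "\<dots> \<le> ennreal (lim lam)" by (rule ennreal_leI[OF e(4)])
  finally have le: "I + ennreal (lim lam) \<le> ennreal (lim lam)" .
  have "I = 0"
  proof -
    have "ennreal (lim lam) + I \<le> ennreal (lim lam) + 0" using le by (simp add: add.commute)
    then have "I \<le> 0" by (subst (asm) ennreal_add_left_cancel_le) auto
    then show ?thesis by simp
  qed
  then have "AE x in M. ennreal (pgap p (a x) (E x)) = 0"
    unfolding I_def by (subst (asm) nn_integral_0_iff_AE) measurable
  then have ratio: "AE x in M. a x = E x"
  proof eventually_elim
    fix x assume "ennreal (pgap p (a x) (E x)) = 0"
    then have "pgap p (a x) (E x) = 0" using pgap_nonneg[OF p_gt_1, of "a x" "E x"] by (simp add: ennreal_eq_0_iff)
    then show "a x = E x" by (rule pgap_eq_0_imp[OF p_gt_1])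
  qed
  have "(AE x in M. v x < e x) \<or> (AE x in M. \<not> v x < e x)"
  proof (rule connected_null_or_conull[OF conn])
    fix c assume "c \<in> \<Omega>"
    then obtain r where r: "0 < r" "cball c (2 * r) \<subseteq> \<Omega>" "ball c r \<subseteq> \<Omega>" by (rule cball_in_\<Omega>)
    have BM[measurable]: "ball c r \<in> sets M" using r(3) by (simp add: sets_restrict_space_iff sets_\<Omega>)
    obtain K where K: "0 \<le> K" "\<And>\<epsilon>. 0 < \<epsilon> \<Longrightarrow> (\<integral>\<^sup>+x. ennreal (norm (H x) / (v x + \<epsilon>) * indicator (ball c r) x) \<partial>M) \<le> ennreal K"
      by (rule local_log_estimate[OF r(2,1)]) blast
    define \<delta> where "\<delta> j = inverse (real (Suc j))" for j
    have \<delta>: "0 < \<delta> j" for j by (simp add: \<delta>_def)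
    have \<delta>0: "\<delta> \<longlonglongrightarrow> 0" unfolding \<delta>_def[abs_def] by (rule LIMSEQ_inverse_real_of_nat)
    \<comment> \<open>The future dominating function, the norm of the logarithmic gradient of v. It
      is integrable on the ball because the local estimates are uniform in \<epsilon>.\<close>
    define g where "g x = norm (H x) / v x * indicator (ball c r) x" for x
    have gmeas[measurable]: "g \<in> borel_measurable M" unfolding g_def[abs_def] by measurable
    have "(\<integral>\<^sup>+x. ennreal (g x) \<partial>M) \<le> ennreal K"
    proof (rule nn_integral_Fatou_le)
      show "(\<lambda>x. ennreal (norm (H x) / (v x + \<delta> j) * indicator (ball c r) x)) \<in> borel_measurable M" for j by measurable
      show "AE x in M. (\<lambda>j. ennreal (norm (H x) / (v x + \<delta> j) * indicator (ball c r) x)) \<longlonglongrightarrow> ennreal (g x)"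
        using v_pos
      proof eventually_elim
        fix x assume x: "0 < v x"
        have "(\<lambda>j. norm (H x) / (v x + \<delta> j) * indicator (ball c r) x) \<longlonglongrightarrow> norm (H x) / (v x + 0) * indicator (ball c r) x"
          using x by (intro tendsto_mult tendsto_divide tendsto_add tendsto_const \<delta>0) auto
        then show "(\<lambda>j. ennreal (norm (H x) / (v x + \<delta> j) * indicator (ball c r) x)) \<longlonglongrightarrow> ennreal (g x)"
          by (intro tendsto_ennrealI) (simp add: g_def)
      qed
      show "(\<integral>\<^sup>+x. ennreal (norm (H x) / (v x + \<delta> j) * indicator (ball c r) x) \<partial>M) \<le> ennreal K" for j
        by (rule K(2)[OF \<delta>])
    qed (rule tendsto_const)
    moreover have "AE x in M. 0 \<le> g x" using v_pos by eventually_elim (simp add: g_def)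
    ultimately have gi: "integrable M g"
      by (intro integrableI_nonneg gmeas) (auto intro: le_less_trans)
    define F where "F j t = 1 * (ln (t + \<delta> j) - ln (\<delta> j))" for j t
    define F' where "F' j t = 1 / (t + \<delta> j)" for j t
    have E: "(ext_neg (F j) (F' j) has_real_derivative ext_neg_deriv (F' j) t) (at t)"
      "continuous_on UNIV (ext_neg_deriv (F' j))" "\<bar>ext_neg_deriv (F' j) t\<bar> \<le> 1 / \<delta> j" for j t
      unfolding F_def[abs_def] F'_def[abs_def] by (rule ln_ext[OF \<delta> zero_le_one])+
    define h where "h j x = ext_neg (F j) (F' j) (e x) - ext_neg (F j) (F' j) (v x)" for j x
    define D where "D j x = norm (ext_neg_deriv (F' j) (e x) *\<^sub>R E x - ext_neg_deriv (F' j) (v x) *\<^sub>R H x) * indicator (ball c r) x" for j x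
    have [measurable]: "ext_neg (F j) (F' j) \<in> borel_measurable borel" "ext_neg_deriv (F' j) \<in> borel_measurable borel" for j
    proof -
      have "continuous_on UNIV (ext_neg (F j) (F' j))"
        using E(1)[of j] by (meson DERIV_continuous continuous_at_imp_continuous_on)
      then show "ext_neg (F j) (F' j) \<in> borel_measurable borel" by (rule borel_measurable_continuous_onI)
      show "ext_neg_deriv (F' j) \<in> borel_measurable borel" by (rule borel_measurable_continuous_onI[OF E(2)])
    qed
    have hm: "h j \<in> borel_measurable M" and Dm: "D j \<in> borel_measurable M" for j
      unfolding h_def[abs_def] D_def[abs_def] by measurable
    have le: "osc (ball c r) (h j) \<le> ennreal (osc_const r * (\<integral>x. D j x \<partial>M))" for j
      unfolding h_def[abs_def] D_def
      by (rule osc_sobolev0_diff[OF e(1) v_sobolev E(1,2,3) E(1,2,3) r(3,1)])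
    \<comment> \<open>By \<open>ratio\<close> the gradient E equals (e / v) H, so both regularised
      logarithmic gradients are multiples of H, and their coefficients differ only through
      \<open>\<delta> j\<close>.\<close>
    have form: "AE x in M. \<forall>j. D j x = norm (((e x / v x) / (e x + \<delta> j) - 1 / (v x + \<delta> j)) *\<^sub>R H x) * indicator (ball c r) x"
      using ratio e(3) v_pos
    proof eventually_elim
      fix x assume x: "a x = E x" "0 < e x" "0 < v x"
      show "\<forall>j. D j x = norm (((e x / v x) / (e x + \<delta> j) - 1 / (v x + \<delta> j)) *\<^sub>R H x) * indicator (ball c r) x"
        using x(2,3) by (simp add: D_def x(1)[symmetric] a_def ext_neg_deriv_def F'_def scaleR_diff_left mult.commute[of "v x"])
    qed
    have "(\<lambda>j. \<integral>x. D j x \<partial>M) \<longlonglongrightarrow> (\<integral>x. 0 \<partial>M)"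
    proof (rule integral_dominated_convergence[where w = "\<lambda>x. 2 * g x"])
      show "integrable M (\<lambda>x. 2 * g x)" using gi by simp
      show "AE x in M. (\<lambda>j. D j x) \<longlonglongrightarrow> 0"
        using form e(3) v_pos
      proof eventually_elim
        fix x assume x: "\<forall>j. D j x = norm (((e x / v x) / (e x + \<delta> j) - 1 / (v x + \<delta> j)) *\<^sub>R H x) * indicator (ball c r) x" "0 < e x" "0 < v x"
        have "(\<lambda>j. norm (((e x / v x) / (e x + \<delta> j) - 1 / (v x + \<delta> j)) *\<^sub>R H x) * indicator (ball c r) x)
          \<longlonglongrightarrow> norm (((e x / v x) / (e x + 0) - 1 / (v x + 0)) *\<^sub>R H x) * indicator (ball c r) x"
          using x(2,3) by (intro tendsto_mult tendsto_norm tendsto_scaleR tendsto_diff tendsto_divide tendsto_add tendsto_const \<delta>0) auto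
        then show "(\<lambda>j. D j x) \<longlonglongrightarrow> 0" using x by simp
      qed
      show "AE x in M. norm (D j x) \<le> 2 * g x" for j
        using form e(3) v_pos
      proof eventually_elim
        fix x assume x: "\<forall>j. D j x = norm (((e x / v x) / (e x + \<delta> j) - 1 / (v x + \<delta> j)) *\<^sub>R H x) * indicator (ball c r) x" "0 < e x" "0 < v x"
        have "1 / v x * (e x / (e x + \<delta> j)) \<le> 1 / v x * 1"
          using x(2,3) \<delta>[of j] by (intro mult_left_mono) auto
        then have 1: "0 \<le> (e x / v x) / (e x + \<delta> j)" "(e x / v x) / (e x + \<delta> j) \<le> 1 / v x"
          using x(2,3) \<delta>[of j] by simp_all
        have 2: "0 \<le> 1 / (v x + \<delta> j)" "1 / (v x + \<delta> j) \<le> 1 / v x"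
          using x(3) \<delta>[of j] by (simp_all add: field_simps)
        have "\<bar>(e x / v x) / (e x + \<delta> j) - 1 / (v x + \<delta> j)\<bar> \<le> 1 / v x" using 1 2 by linarith
        also have "\<dots> \<le> 2 * (1 / v x)" using x(3) by (simp add: divide_right_mono)
        finally have "\<bar>(e x / v x) / (e x + \<delta> j) - 1 / (v x + \<delta> j)\<bar> * norm (H x) \<le> 2 * (1 / v x) * norm (H x)" by (intro mult_right_mono) auto
        then show "norm (D j x) \<le> 2 * g x" using x by (simp add: g_def split: split_indicator)
      qed
    qed (use Dm in simp_all)
    then have "(\<lambda>j. osc_const r * (\<integral>x. D j x \<partial>M)) \<longlonglongrightarrow> osc_const r * 0" by (intro tendsto_mult_left) simp
    then have D0: "(\<lambda>j. osc_const r * (\<integral>x. D j x \<partial>M)) \<longlonglongrightarrow> 0" by simp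
    have hlim: "AE x in M. (\<lambda>j. h j x) \<longlonglongrightarrow> ln (e x) - ln (v x)"
      using e(3) v_pos
    proof eventually_elim
      fix x assume x: "0 < e x" "0 < v x"
      have "h j x = ln (e x + \<delta> j) - ln (v x + \<delta> j)" for j using x by (simp add: h_def ext_neg_def F_def)
      moreover have "(\<lambda>j. ln (e x + \<delta> j) - ln (v x + \<delta> j)) \<longlonglongrightarrow> ln (e x + 0) - ln (v x + 0)"
        using x by (intro tendsto_diff tendsto_ln tendsto_add tendsto_const \<delta>0) auto
      ultimately show "(\<lambda>j. h j x) \<longlonglongrightarrow> ln (e x) - ln (v x)" by simp
    qed
    have "osc (ball c r) (\<lambda>x. ln (e x) - ln (v x)) \<le> ennreal 0"
      by (rule osc_Fatou[OF hm hlim BM le D0])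
    then have "osc (ball c r) (\<lambda>x. ln (e x) - ln (v x)) = 0" by simp
    moreover have "(\<lambda>x. ln (e x) - ln (v x)) \<in> borel_measurable M" by measurable
    ultimately obtain \<kappa> where \<kappa>: "AE x in M. x \<in> ball c r \<longrightarrow> ln (e x) - ln (v x) = \<kappa>"
      by (rule osc_eq_0_imp_constant[OF _ _ r(3,1)])
    \<comment> \<open>The ratio e / v is constant on the ball, so comparing e with v there depends
      on the sign of \<kappa> only; this is the local alternative that connectedness turns into a
      global one.\<close>
    have "AE x in M. x \<in> ball c r \<longrightarrow> (v x < e x \<longleftrightarrow> 0 < \<kappa>)"
      using \<kappa> e(3) v_pos by eventually_elim (use ln_less_cancel_iff in fastforce)
    then have "(AE x in M. x \<in> ball c r \<longrightarrow> v x < e x) \<or> (AE x in M. x \<in> ball c r \<longrightarrow> \<not> v x < e x)"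
      by (cases "0 < \<kappa>") auto
    with r show "\<exists>r>0. ball c r \<subseteq> \<Omega> \<and> ((AE x in M. x \<in> ball c r \<longrightarrow> v x < e x) \<or> (AE x in M. x \<in> ball c r \<longrightarrow> \<not> v x < e x))" by blast
  qed
  \<comment> \<open>Ordered functions with the same norm coincide if the smaller one is positive.
    This turns either alternative into equality.\<close>
  moreover have eq_if: "AE x in M. f x = g x"
    if fg: "in_Lp q M f" "in_Lp q M g" "Lpi q M f = 1" "Lpi q M g = 1" "AE x in M. 0 < f x" "AE x in M. f x \<le> g x" for f g :: "'a \<Rightarrow> real"
  proof -
    have i: "integrable M (\<lambda>x. norm (g x) powr q - norm (f x) powr q)"
      using in_Lp_integrable[OF fg(1)] in_Lp_integrable[OF fg(2)] by simp
    have "(\<integral>x. norm (g x) powr q - norm (f x) powr q \<partial>M) = 0"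
      using in_Lp_integrable[OF fg(1)] in_Lp_integrable[OF fg(2)] fg(3,4) by (simp add: Lpi_def)
    moreover have "AE x in M. 0 \<le> norm (g x) powr q - norm (f x) powr q"
      using fg(5,6) by eventually_elim (use q in \<open>auto intro: powr_mono2\<close>)
    ultimately have "AE x in M. norm (g x) powr q - norm (f x) powr q = 0"
      using integral_nonneg_eq_0_iff_AE[OF i] by blast
    then show ?thesis
      using fg(5,6)
    proof eventually_elim
      fix x assume x: "norm (g x) powr q - norm (f x) powr q = 0" "0 < f x" "f x \<le> g x"
      show "f x = g x"
      proof (rule ccontr)
        assume "f x \<noteq> g x"
        then have "f x powr q < g x powr q" using x(2,3) q by (intro powr_less_mono2) auto
        then show False using x by simp
      qed
    qed
  qed
  ultimately show ev: "AE x in M. e x = v x"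
  proof (elim disjE)
    assume "AE x in M. v x < e x"
    then have "AE x in M. v x \<le> e x" by eventually_elim simp
    then have "AE x in M. v x = e x" by (rule eq_if[OF v_Lq eq v_norm e(2) v_pos])
    then show ?thesis by eventually_elim simp
  next
    assume "AE x in M. \<not> v x < e x"
    then have "AE x in M. e x \<le> v x" by eventually_elim simp
    then show ?thesis by (rule eq_if[OF eq v_Lq e(2) v_norm e(3)])
  qed
  show "AE x in M. E x = H x"
    using ev ratio v_pos by eventually_elim (simp add: a_def)
qed

end

section \<open>Convergence\<close>

text \<open>A bounded \<open>C\<^sup>1\<close> substitute for \<open>min t 0\<close>.\<close>

definition neg_bump :: "real \<Rightarrow> real" where
  "neg_bump t = - flat_exp 0 (- t)"

lemma neg_bump:
  "(neg_bump has_real_derivative flat_exp 2 (- t)) (at t)"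
  "continuous_on UNIV (\<lambda>t. flat_exp 2 (- t))"
  "\<bar>neg_bump t\<bar> \<le> 2" "\<bar>flat_exp 2 (- t)\<bar> \<le> 2"
  "neg_bump t \<le> 0" "0 \<le> flat_exp 2 (- t)" "neg_bump t = 0 \<longleftrightarrow> 0 \<le> t"
proof -
  show "(neg_bump has_real_derivative flat_exp 2 (- t)) (at t)"
    unfolding neg_bump_def[abs_def]
    by (rule DERIV_minus[OF DERIV_chain2[OF flat_exp_deriv[of 0] DERIV_minus[OF DERIV_ident]], THEN DERIV_cong]) (simp add: numeral_2_eq_2)
  have "continuous_on UNIV (flat_exp 2)"
    using flat_exp_deriv by (intro DERIV_continuous_on) (auto intro: has_field_derivative_at_within)
  then show "continuous_on UNIV (\<lambda>t. flat_exp 2 (- t))"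
    by (rule continuous_on_compose2) (auto intro: continuous_intros)
  show "\<bar>neg_bump t\<bar> \<le> 2"
    by (auto simp: neg_bump_def flat_exp_def divide_nonpos_neg intro: order.trans[of _ 1])
  show "0 \<le> flat_exp 2 (- t)" by (simp add: flat_exp_def)
  show "\<bar>flat_exp 2 (- t)\<bar> \<le> 2"
  proof (cases "t < 0")
    case True
    \<comment> \<open>The bound in question is x^2 exp (-x) <= 2 for x = -1 / t > 0, which follows
      from the quadratic Taylor bound of the exponential.\<close>
    define x where "x = - 1 / t"
    have x: "0 < x" "exp (1 / t) = inverse (exp x)" "t\<^sup>2 = 1 / x\<^sup>2"
      using True by (simp_all add: x_def exp_minus[symmetric] divide_neg_neg power_divide)
    have "1 + x + x\<^sup>2 / 2 \<le> exp x" using x(1) by (intro exp_lower_Taylor_quadratic) simp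
    then have "x\<^sup>2 \<le> 2 * exp x" using x(1) by simp
    then have "inverse (exp x) * x\<^sup>2 \<le> 2" by (simp add: field_simps)
    then show ?thesis using True by (simp add: flat_exp_def x)
  qed (simp add: flat_exp_def)
  show "neg_bump t \<le> 0" "neg_bump t = 0 \<longleftrightarrow> 0 \<le> t"
    by (auto simp: neg_bump_def flat_exp_def)
qed

section \<open>One step of the iteration: testing, sign and nontriviality\<close>

context bounded_open
begin

lemma W01p_norm_powr:
  assumes "sobolev0 \<Omega> p u G"
  shows "W01p_norm \<Omega> p u = Lpi p M G powr (1 / p)" "W01p_norm \<Omega> p u powr p = Lpi p M G"
proof -
  note W = sobolev0_imp_W01p[OF assms]
  have "Lpi p M (weak_grad \<Omega> u) = Lpi p M G"
    using W(2) in_Lp_measurable[OF sobolev0_in_Lp(2)[OF W01p_imp_sobolev0[OF W(1)]]] in_Lp_measurable[OF sobolev0_in_Lp(2)[OF assms]]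
    by (rule Lpi_cong_AE)
  then show "W01p_norm \<Omega> p u = Lpi p M G powr (1 / p)" by (simp add: W01p_norm_def Lp_norm_eq)
  then show "W01p_norm \<Omega> p u powr p = Lpi p M G" using p_bounds Lpi_nonneg[of p M G] by (simp add: powr_powr)
qed

lemma Lp_norm_powr: "0 < r \<Longrightarrow> Lp_norm r \<Omega> f powr r = Lpi r M f"
  using Lpi_nonneg[of r M f] by (simp add: Lp_norm_eq powr_powr)

lemma Lp_norm_eq_1_iff: "0 < r \<Longrightarrow> Lp_norm r \<Omega> f = 1 \<longleftrightarrow> Lpi r M f = 1"
  using Lp_norm_powr[of r f] by (auto simp: Lp_norm_eq)

lemma Lp_norm_pos:
  assumes "in_Lp r M f" "0 < r" "\<not> (AE x in M. f x = 0)"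
  shows "0 < Lp_norm r \<Omega> f"
  using assms Lpi_eq_0_iff[OF assms(1)] Lpi_nonneg[of r M f] by (simp add: Lp_norm_eq)

text \<open>Passes from the chosen gradient of the test function to an explicit one and uses f >= 0
  to merge |f|^(q-2) f into |f|^(q-1). The latter is 0 at f = 0 also for q = 1, because
  \<open>0 powr 0 = 0\<close>.\<close>

lemma weak_solution_testing:
  assumes sol: "weak_solution \<Omega> p q f u" and f: "AE x in M. 0 \<le> f x" "f \<in> borel_measurable M"
    and \<phi>: "sobolev0 \<Omega> p \<phi> \<Phi>"
  shows "(\<integral>x. pflow p (weak_grad \<Omega> u x) \<bullet> \<Phi> x \<partial>M)
    = Lp_norm q \<Omega> f powr (p - q) * (\<integral>x. \<bar>f x\<bar> powr (q - 1) * \<phi> x \<partial>M)"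
proof -
  note W = sobolev0_imp_W01p[OF \<phi>]
  have u: "u \<in> W01p \<Omega> p" using sol by (simp add: weak_solution_def)
  note m = in_Lp_measurable[OF sobolev0_in_Lp(2)[OF W01p_imp_sobolev0[OF W(1)]]]
    in_Lp_measurable[OF sobolev0_in_Lp(2)[OF W01p_imp_sobolev0[OF u]]]
  note [measurable] = m pflow_measurable[OF p_gt_1 m(2)] in_Lp_measurable[OF sobolev0_in_Lp(1)[OF \<phi>]] in_Lp_measurable[OF sobolev0_in_Lp(2)[OF \<phi>]] f(2)
  have "(\<integral>x. pflow p (weak_grad \<Omega> u x) \<bullet> \<Phi> x \<partial>M) = (\<integral>x. pflow p (weak_grad \<Omega> u x) \<bullet> weak_grad \<Omega> \<phi> x \<partial>M)"
    by (rule integral_cong_AE; (measurable)?) (use W(2) in eventually_elim, simp)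
  also have "\<dots> = Lp_norm q \<Omega> f powr (p - q) * (\<integral>x. \<bar>f x\<bar> powr (q - 2) * f x * \<phi> x \<partial>M)"
    using sol W(1) by (simp add: weak_solution_def pflow_def)
  also have "(\<integral>x. \<bar>f x\<bar> powr (q - 2) * f x * \<phi> x \<partial>M) = (\<integral>x. \<bar>f x\<bar> powr (q - 1) * \<phi> x \<partial>M)"
  proof (rule integral_cong_AE; (measurable)?)
    show "AE x in M. \<bar>f x\<bar> powr (q - 2) * f x * \<phi> x = \<bar>f x\<bar> powr (q - 1) * \<phi> x"
      using f(1) by eventually_elim (use powr_minus_one_mult[where r = "q - 1"] in simp)
  qed
  finally show ?thesis .
qed

text \<open>Tested with \<open>neg_bump\<close> of u, which is nonpositive and nondecreasing in u,
  the equation has a nonnegative left and a nonpositive right side. Both vanish, so the test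
  function has zero gradient, and by the Poincare inequality it is 0.\<close>

lemma weak_solution_nonneg:
  assumes sol: "weak_solution \<Omega> p q f u" and f: "AE x in M. 0 \<le> f x" "f \<in> borel_measurable M"
  shows "AE x in M. 0 \<le> u x"
proof -
  define G where "G = weak_grad \<Omega> u"
  have u: "sobolev0 \<Omega> p u G" unfolding G_def using sol by (intro W01p_imp_sobolev0) (simp add: weak_solution_def)
  define J where "J x = flat_exp 2 (- u x)" for x
  have B: "sobolev0 \<Omega> p (\<lambda>x. neg_bump (u x)) (\<lambda>x. J x *\<^sub>R G x)"
    unfolding J_def by (rule sobolev0_comp[OF u neg_bump(1,2,3,4)]) (simp add: neg_bump(7))
  have J: "0 \<le> J x" for x by (simp add: J_def neg_bump(6))
  have eq: "pflow p (G x) \<bullet> (J x *\<^sub>R G x) = J x * norm (G x) powr p" for x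
    by (simp add: pflow_inner_self)
  have int: "integrable M (\<lambda>x. J x * norm (G x) powr p)"
    using integrable_pflow_inner[OF p_gt_1 sobolev0_in_Lp(2)[OF u] sobolev0_in_Lp(2)[OF B]] by (simp only: eq)
  have "0 \<le> (\<integral>x. - (\<bar>f x\<bar> powr (q - 1) * neg_bump (u x)) \<partial>M)"
    by (intro integral_nonneg_AE AE_I2) (simp add: mult_nonneg_nonpos neg_bump(5))
  then have "(\<integral>x. \<bar>f x\<bar> powr (q - 1) * neg_bump (u x) \<partial>M) \<le> 0" by simp
  then have "Lp_norm q \<Omega> f powr (p - q) * (\<integral>x. \<bar>f x\<bar> powr (q - 1) * neg_bump (u x) \<partial>M) \<le> 0"
    by (intro mult_nonneg_nonpos) auto
  then have "(\<integral>x. J x * norm (G x) powr p \<partial>M) \<le> 0"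
    using weak_solution_testing[OF sol f B] by (simp only: eq G_def[symmetric])
  moreover have "0 \<le> (\<integral>x. J x * norm (G x) powr p \<partial>M)" by (intro integral_nonneg_AE AE_I2) (simp add: J)
  ultimately have "(\<integral>x. J x * norm (G x) powr p \<partial>M) = 0" by simp
  then have "AE x in M. J x * norm (G x) powr p = 0"
    using integral_nonneg_eq_0_iff_AE[OF int] J by simp
  then have "AE x in M. J x *\<^sub>R G x = 0" by eventually_elim auto
  then have G0: "Lpi p M (\<lambda>x. J x *\<^sub>R G x) = 0" using Lpi_eq_0_iff[OF sobolev0_in_Lp(2)[OF B]] by simp
  obtain D where "\<And>u G. sobolev0 \<Omega> p u G \<Longrightarrow> Lpi p M u \<le> D * Lpi p M G" by (rule poincare) blast
  from this[OF B] have "Lpi p M (\<lambda>x. neg_bump (u x)) = 0"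
    using G0 Lpi_nonneg[of p M "\<lambda>x. neg_bump (u x)"] by simp
  then have "AE x in M. neg_bump (u x) = 0" using Lpi_eq_0_iff[OF sobolev0_in_Lp(1)[OF B]] by simp
  then show ?thesis by (simp only: neg_bump(7))
qed

text \<open>A vanishing solution has vanishing flux, so |f|^(q-1) integrates to 0 against every test
  function and is 0 almost everywhere. This gives f = 0 also for q = 1, since
  \<open>x powr 0\<close> is 1 for nonzero x.\<close>

lemma weak_solution_nonzero:
  assumes sol: "weak_solution \<Omega> p q f u" and f: "AE x in M. 0 \<le> f x" "in_Lp q M f" "\<not> (AE x in M. f x = 0)"
    and q: "1 \<le> q"
  shows "\<not> (AE x in M. u x = 0)"
proof
  assume u0: "AE x in M. u x = 0"
  define G where "G = weak_grad \<Omega> u"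
  have u: "sobolev0 \<Omega> p u G" unfolding G_def using sol by (intro W01p_imp_sobolev0) (simp add: weak_solution_def)
  note fm[measurable] = in_Lp_measurable[OF f(2)]
  note [measurable] = in_Lp_measurable[OF sobolev0_in_Lp(1)[OF u]]
  note T = weak_solution_testing[OF sol f(1) fm, folded G_def]
  have N: "0 < Lp_norm q \<Omega> f" using q by (intro Lp_norm_pos[OF f(2) _ f(3)]) simp
  have "(\<integral>x. \<bar>f x\<bar> powr (q - 1) * u x \<partial>M) = (\<integral>x. 0 \<partial>M)"
    by (rule integral_cong_AE; (measurable)?) (use u0 in eventually_elim, simp)
  then have "Lpi p M G = 0" using T[OF u] by (simp add: integral_pflow_self)
  then have G0: "AE x in M. G x = 0" using Lpi_eq_0_iff[OF sobolev0_in_Lp(2)[OF u]] by simp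
  have "AE x in M. \<bar>f x\<bar> powr (q - 1) = 0"
  proof (rule integral_test_functions_zero_imp_AE_zero[OF open_\<Omega>])
    have fi: "integrable M (\<lambda>x. \<bar>f x\<bar> powr (q - 1))"
      using Holder_integral(1)[OF f(2) in_Lp_const[OF finite_M, of _ "1::real"] q] by simp
    show "locally_integrable \<Omega> (\<lambda>x. \<bar>f x\<bar> powr (q - 1))"
      unfolding locally_integrable_def using integrable_lebesgue_on_subset[OF fi sets_\<Omega>]
      by (auto simp: lmeasurable_compact fmeasurableD)
    fix \<phi> assume \<phi>: "\<phi> \<in> test_functions \<Omega>"
    note S = sobolev0_test[OF \<phi>]
    have "AE x in M. pflow p (G x) \<bullet> grad \<phi> x = 0" using G0 by eventually_elim (simp add: pflow_def)
    then have "(\<integral>x. pflow p (G x) \<bullet> grad \<phi> x \<partial>M) = 0" by (rule integral_eq_zero_AE)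
    then show "(\<integral>x. \<phi> x * \<bar>f x\<bar> powr (q - 1) \<partial>M) = 0"
      using T[OF S] N by (simp add: mult.commute)
  qed
  then have "AE x in M. f x = 0" by eventually_elim (auto split: if_splits)
  with f(3) show False ..
qed

end
theorem mainTheorem3:
  fixes \<Omega> :: "'a::euclidean_space set"
    and p q :: real
    and u :: "nat \<Rightarrow> 'a \<Rightarrow> real"
  assumes "DIM('a) \<ge> 2"
    and "open \<Omega>" and "connected \<Omega>" and "\<Omega> \<noteq> {}" and "bounded \<Omega>"
    and "p > 1" and "1 \<le> q" and "q \<le> p"
    and "u 0 \<in> Lp_space q \<Omega>"
    and "\<not> (AE x in lebesgue_on \<Omega>. u 0 x = 0)"
    and "AE x in lebesgue_on \<Omega>. u 0 x \<ge> 0"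
    and "\<And>n. weak_solution \<Omega> p q (u n) (u (Suc n))"
  shows "(\<lambda>n. (Lp_norm q \<Omega> (u n) / Lp_norm q \<Omega> (u (Suc n))) powr (p - 1))
           \<longlonglongrightarrow> lambda_q \<Omega> p q \<and>
         tendsto_W01p \<Omega> p (\<lambda>n x. u n x / Lp_norm q \<Omega> (u n)) (e_q \<Omega> p q)"
proof -
  interpret bounded_open \<Omega> p using assms(2,5,6) by unfold_locales
  note q = assms(7,8)
  have q0: "0 < q" using q by simp
  note sol = assms(12)
  define N where "N n = Lp_norm q \<Omega> (u n)" for n
  define w where "w n x = u n x / N n" for n x
  define D where "D n = weak_grad \<Omega> (u n)" for n
  define G where "G n x = (1 / N n) *\<^sub>R D n x" for n x
  define lam where "lam n = (N n / N (Suc n)) powr (p - 1)" for n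
  have u_sob: "sobolev0 \<Omega> p (u (Suc n)) (D (Suc n))" for n
    unfolding D_def using sol[of n] by (intro W01p_imp_sobolev0) (simp add: weak_solution_def)
  have uLq: "in_Lp q M (u n)" for n
  proof (cases n)
    case 0
    then show ?thesis using assms(9) by (simp add: Lp_space_iff)
  next
    case (Suc k)
    show ?thesis unfolding Suc
      by (rule in_Lp_exponent_mono[OF finite_M sobolev0_in_Lp(1)[OF u_sob] less_imp_le[OF q0] q(2)])
  qed
  \<comment> \<open>Sign and nontriviality go through the induction together, because both
    properties of the next iterate use the sign of the present one. They make every norm
    \<open>N n\<close> positive, so that the normalisation makes sense.\<close>
  have u_pos: "(AE x in M. 0 \<le> u n x) \<and> \<not> (AE x in M. u n x = 0)" for n
  proof (induction n)
    case 0
    then show ?case using assms(10,11) by simp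
  next
    case (Suc n)
    then show ?case
      using weak_solution_nonneg[OF sol _ in_Lp_measurable[OF uLq]] weak_solution_nonzero[OF sol _ uLq _ q(1)] by blast
  qed
  have N: "0 < N n" for n
    unfolding N_def using u_pos[of n] by (intro Lp_norm_pos[OF uLq q0]) simp
  have w_sob: "sobolev0 \<Omega> p (w (Suc n)) (G (Suc n))" for n
    using sobolev0_scale[OF u_sob, of "1 / N (Suc n)" n] by (simp add: w_def[abs_def] G_def[abs_def])
  interpret inverse_iteration \<Omega> p q w G lam
  proof unfold_locales
    show "1 \<le> q" "q \<le> p" by fact+
    have weq: "w n = (\<lambda>x. (1 / N n) *\<^sub>R u n x)" for n by (simp add: w_def[abs_def])
    show "in_Lp q M (w n)" for n unfolding weq by (rule in_Lp_scaleR(1)[OF uLq])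
    show "AE x in M. 0 \<le> w n x" for n
      using conjunct1[OF u_pos[of n]] by eventually_elim (use N[of n] in \<open>simp add: w_def\<close>)
    have "Lpi q M (u n) = N n powr q" for n by (simp add: N_def Lp_norm_powr[OF q0])
    then show "Lpi q M (w n) = 1" for n
      unfolding weq in_Lp_scaleR(2)[OF uLq] using N[of n] by (simp add: powr_divide)
    show "sobolev0 \<Omega> p (w (Suc n)) (G (Suc n))" for n by (rule w_sob)
    show "0 \<le> lam n" for n by (simp add: lam_def)
    fix n \<phi> \<Phi> assume \<phi>: "sobolev0 \<Omega> p \<phi> \<Phi>"
    have "(\<integral>x. pflow p (G (Suc n) x) \<bullet> \<Phi> x \<partial>M) = (1 / N (Suc n)) powr (p - 1) * (\<integral>x. pflow p (D (Suc n) x) \<bullet> \<Phi> x \<partial>M)"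
      using N[of "Suc n"] by (simp add: G_def pflow_scale)
    also have "\<dots> = (1 / N (Suc n)) powr (p - 1) * (N n powr (p - q) * (\<integral>x. \<bar>u n x\<bar> powr (q - 1) * \<phi> x \<partial>M))"
      using weak_solution_testing[OF sol _ in_Lp_measurable[OF uLq] \<phi>] u_pos[of n] by (simp add: D_def N_def)
    also have "(\<integral>x. \<bar>u n x\<bar> powr (q - 1) * \<phi> x \<partial>M) = (\<integral>x. N n powr (q - 1) * (\<bar>w n x\<bar> powr (q - 1) * \<phi> x) \<partial>M)"
      using N[of n] by (intro Bochner_Integration.integral_cong) (simp_all add: w_def powr_divide)
    also have "\<dots> = N n powr (q - 1) * (\<integral>x. \<bar>w n x\<bar> powr (q - 1) * \<phi> x \<partial>M)" by simp
    \<comment> \<open>The powers of the norm of \<open>u n\<close> add up to (p - q) + (q - 1) = p -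
      1, so that q disappears from the factor and \<open>lam n\<close> remains.\<close>
    also have "(1 / N (Suc n)) powr (p - 1) * (N n powr (p - q) * (N n powr (q - 1) * (\<integral>x. \<bar>w n x\<bar> powr (q - 1) * \<phi> x \<partial>M)))
      = (1 / N (Suc n)) powr (p - 1) * N n powr ((p - q) + (q - 1)) * (\<integral>x. \<bar>w n x\<bar> powr (q - 1) * \<phi> x \<partial>M)"
      by (simp only: powr_add ac_simps)
    also have "(1 / N (Suc n)) powr (p - 1) * N n powr ((p - q) + (q - 1)) = lam n"
      using N[of n] N[of "Suc n"] by (simp add: lam_def powr_divide)
    finally show "(\<integral>x. pflow p (G (Suc n) x) \<bullet> \<Phi> x \<partial>M) = lam n * (\<integral>x. \<bar>w n x\<bar> powr (q - 1) * \<phi> x \<partial>M)" .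
  qed
  \<comment> \<open>Stated for an arbitrary subsequence because it is used twice: for the full
    sequence, to produce a minimizer, and for a hypothetical subsequence that stays away from the
    claimed limit.\<close>
  have lim: "\<exists>s v H. iteration_limit \<Omega> p q w G lam v H (\<lambda>k. Suc (r (s k))) \<and>
      (\<lambda>k. Lpi p M (\<lambda>x. G (Suc (r (s k))) x - H x)) \<longlonglongrightarrow> 0"
    if r: "strict_mono r" for r :: "nat \<Rightarrow> nat"
  proof -
    obtain s v H where s: "strict_mono (s :: nat \<Rightarrow> nat)" "sobolev0 \<Omega> p v H"
      "(\<lambda>k. Lpi p M (\<lambda>x. G (Suc (r (s k))) x - H x)) \<longlonglongrightarrow> 0"
      "AE x in M. (\<lambda>k. w (Suc (r (s k))) x) \<longlonglongrightarrow> v x"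
      "AE x in M. (\<lambda>k. w (Suc (Suc (r (s k)))) x) \<longlonglongrightarrow> v x"
      "AE x in M. (\<lambda>k. G (Suc (Suc (r (s k)))) x) \<longlonglongrightarrow> H x"
      "AE x in M. 0 \<le> v x" "Lpi q M v = 1" "Lpi p M H \<le> lim lam"
      by (rule subsequence_limit[OF r])
    have "strict_mono (\<lambda>k. Suc (r (s k)))" using r s(1) by (simp add: strict_mono_def)
    then have "iteration_limit \<Omega> p q w G lam v H (\<lambda>k. Suc (r (s k)))"
      using s assms(3) by unfold_locales auto
    with s(3) show ?thesis by blast
  qed
  obtain s v H where I: "iteration_limit \<Omega> p q w G lam v H (\<lambda>k. Suc (s k))"
    using lim[OF strict_mono_id] by auto
  interpret L: iteration_limit \<Omega> p q w G lam v H "\<lambda>k. Suc (s k)" by (rule I)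
  have vW: "v \<in> W01p \<Omega> p" "Lp_norm q \<Omega> v = 1" "W01p_norm \<Omega> p v powr p = lim lam"
    using sobolev0_imp_W01p(1)[OF L.v_sobolev] L.v_norm W01p_norm_powr(2)[OF L.v_sobolev] L.energy_limit
    by (simp_all add: Lp_norm_eq_1_iff[OF q0])
  \<comment> \<open>The limit v attains the lower bound given by \<open>lim_lam_minimal\<close>, so
    the minimum exists and \<open>LEAST\<close> is determined by it.\<close>
  have "lambda_q \<Omega> p q = lim lam"
    unfolding lambda_q_def
  proof (rule Least_equality)
    show "lim lam \<in> {W01p_norm \<Omega> p u powr p |u. u \<in> W01p \<Omega> p \<and> Lp_norm q \<Omega> u = 1}"
      using vW by (auto intro!: exI[of _ v])
    fix l assume "l \<in> {W01p_norm \<Omega> p u powr p |u. u \<in> W01p \<Omega> p \<and> Lp_norm q \<Omega> u = 1}"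
    then obtain f where f: "l = W01p_norm \<Omega> p f powr p" "f \<in> W01p \<Omega> p" "Lp_norm q \<Omega> f = 1" by auto
    note S = W01p_imp_sobolev0[OF f(2)]
    show "lim lam \<le> l"
      using L.lim_lam_minimal[OF S] f(3) by (simp add: f(1) W01p_norm_powr(2)[OF S] Lp_norm_eq_1_iff[OF q0])
  qed
  note lambda = this
  define e where "e = e_q \<Omega> p q"
  define E where "E = weak_grad \<Omega> e"
  \<comment> \<open>The limit v is a witness for the choice in the definition of \<open>e_q\<close>,
    so the chosen function has the properties by which it is selected.\<close>
  have "e \<in> W01p \<Omega> p \<and> (AE x in M. e x > 0) \<and> Lp_norm q \<Omega> e = 1 \<and> W01p_norm \<Omega> p e powr p = lambda_q \<Omega> p q"
    unfolding e_def e_q_def by (rule someI[of _ v]) (use vW L.v_pos lambda in auto)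
  then have e: "e \<in> W01p \<Omega> p" "AE x in M. 0 < e x" "Lpi q M e = 1" "W01p_norm \<Omega> p e powr p = lim lam"
    by (simp_all add: lambda Lp_norm_eq_1_iff[OF q0])
  have eE: "sobolev0 \<Omega> p e E" unfolding E_def by (rule W01p_imp_sobolev0[OF e(1)])
  have E_le: "Lpi p M E \<le> lim lam" using e(4) W01p_norm_powr(2)[OF eE] by simp
  define X where "X n = Lpi p M (\<lambda>x. G (Suc n) x - E x)" for n
  \<comment> \<open>Otherwise a subsequence stays at a fixed distance from E; a further subsequence
    converges to some H', and uniqueness of the positive minimizer gives H' = E almost
    everywhere.\<close>
  have "X \<longlonglongrightarrow> 0"
  proof (rule ccontr)
    assume "\<not> X \<longlonglongrightarrow> 0"
    then obtain \<epsilon> where \<epsilon>: "0 < \<epsilon>" "\<exists>\<^sub>F n in sequentially. \<epsilon> \<le> X n"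
      unfolding tendsto_iff frequently_def by (auto simp: dist_real_def X_def Lpi_nonneg not_le)
    then have "infinite {n. \<epsilon> \<le> X n}"
      by (simp add: frequently_cofinite cofinite_eq_sequentially[symmetric])
    from infinite_enumerate[OF this] obtain r :: "nat \<Rightarrow> nat" where r: "strict_mono r" "\<And>n. \<epsilon> \<le> X (r n)"
      by auto
    from lim[OF r(1)] obtain s' v' H' where I': "iteration_limit \<Omega> p q w G lam v' H' (\<lambda>k. Suc (r (s' k)))"
      and conv: "(\<lambda>k. Lpi p M (\<lambda>x. G (Suc (r (s' k))) x - H' x)) \<longlonglongrightarrow> 0" by blast
    interpret L': iteration_limit \<Omega> p q w G lam v' H' "\<lambda>k. Suc (r (s' k))" by (rule I')
    note [measurable] = in_Lp_measurable[OF G_Lp] in_Lp_measurable[OF sobolev0_in_Lp(2)[OF eE]]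
      in_Lp_measurable[OF sobolev0_in_Lp(2)[OF L'.v_sobolev]]
    have EH: "AE x in M. E x = H' x" by (rule L'.positive_minimizer_unique(2)[OF eE e(3,2) E_le])
    have "X (r (s' k)) = Lpi p M (\<lambda>x. G (Suc (r (s' k))) x - H' x)" for k
      unfolding X_def by (rule Lpi_cong_AE; (measurable)?) (use EH in eventually_elim, simp)
    with conv have "(\<lambda>k. X (r (s' k))) \<longlonglongrightarrow> 0" by simp
    then have "\<epsilon> \<le> 0" by (rule LIMSEQ_le_const) (use r(2) in auto)
    with \<epsilon>(1) show False by simp
  qed
  moreover have "W01p_norm \<Omega> p (\<lambda>x. w (Suc n) x - e x) = X n powr (1 / p)" for n
    unfolding X_def by (rule W01p_norm_powr(1)[OF sobolev0_diff[OF w_sob eE]])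
  ultimately have "(\<lambda>n. W01p_norm \<Omega> p (\<lambda>x. w (Suc n) x - e x)) \<longlonglongrightarrow> 0"
    using tendsto_powr_inverse_iff[of X p] p_bounds by (simp add: X_def Lpi_nonneg)
  \<comment> \<open>The term \<open>w 0\<close> may lie outside the Sobolev space; one term affects
    neither the limit nor the eventual membership shown next.\<close>
  then have "(\<lambda>n. W01p_norm \<Omega> p (\<lambda>x. w n x - e x)) \<longlonglongrightarrow> 0" by (rule LIMSEQ_imp_Suc)
  moreover have "\<forall>\<^sub>F n in sequentially. w n \<in> W01p \<Omega> p"
    using sobolev0_imp_W01p(1)[OF w_sob] by (intro eventually_sequentiallyI[of 1]) (metis Suc_le_D One_nat_def)
  ultimately have "tendsto_W01p \<Omega> p w e" using e(1) by (simp add: tendsto_W01p_def)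
  then show ?thesis
    using lam_convergent by (simp add: lambda e_def w_def[abs_def] lam_def[abs_def] N_def)
qed

end
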